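(* Let $d=d_1+d_2$ with $1\le d_1<d$ and $1\le d_2<d$. Let $A'\in\mathbb R^{d_1\times d_1}$ be diagonalizable with $\mathrm{Sp}(A')\subset\mathbb R$, and let $K_{11}\in\mathbb R^{d_1\times d_1}$, $A_{12},K_{12}\in\mathbb R^{d_1\times d_2}$, $K_{21}\in\mathbb R^{d_2\times d_1}$, $K_{22}\in\mathbb R^{d_2\times d_2}$. Let $\omega$ be a nonempty open subset of $\mathbb T=\mathbb R/(2\pi\mathbb Z)$ and consider the control system $$\begin{cases}(\partial_t+A'\partial_x+K_{11})f_1+(A_{12}\partial_x+K_{12})f_2=u_11_\omega&\text{in }(0,T)\times\mathbb T,\\ (\partial_t-\partial_x^2+K_{22})f_2+K_{21}f_1=0&\text{in }(0,T)\times\mathbb T,\end{cases}\qquad f(0,\cdot)=f_0,$$ with state $f=(f_1,f_2)\in\mathbb C^{d_1}\times\mathbb C^{d_2}$. Let $\mu_*=\min\{|\mu|:\mu\in\mathrm{Sp}(A')\}$, $\ell(\omega)=\sup\{|I|: I\text{ connected component of }\mathbb T\setminus\omega\}$ ($|I|$ the Lebesgue measure, $\sup\emptyset=0$), and $T^*=\ell(\omega)/\mu_*$ if $\mu_*>0$, $T^*=+\infty$ if $\mu_*=0$. The following statements are equivalent: - The system is null controllable in any time $T>T^*$. - The couple of matrices $(K_{22},K_{21})$ satisfies the Kalman rank condition $$\mathrm{Span}\{K_{22}^jK_{21}X_1:\ X_1\in\mathbb C^{d_1},\ 0\le j\le d_2-1\}=\mathbb C^{d_2}.$$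
   Context: $\mathrm{Sp}$ denotes the spectrum of a matrix. Solutions: put $A=\begin{pmatrix}A'&A_{12}\\0&0\end{pmatrix}$, $B=\begin{pmatrix}0&0\\0&I_{d_2}\end{pmatrix}$, $K=\begin{pmatrix}K_{11}&K_{12}\\ K_{21}&K_{22}\end{pmatrix}$ and $\mathcal L=-B\partial_x^2+A\partial_x+K$. The solution is the mild solution $f\in C^0([0,T];L^2(\mathbb T)^d)$, $f(t)=e^{-t\mathcal L}f_0+\int_0^te^{-(t-\tau)\mathcal L}(u_1(\tau)1_\omega,0)\,d\tau$, where $e^{-t\mathcal L}$ acts on the $n$-th Fourier coefficient as multiplication by $\exp(-t(n^2B+\mathrm i nA+K))$, $n\in\mathbb Z$. Null-controllability in time $T$: for every $f_0\in L^2(\mathbb T;\mathbb C^d)$ there exists $u_1\in L^2((0,T)\times\mathbb T;\mathbb C^{d_1})$ supported on $[0,T]\times\omega$ such that the solution satisfies $f(T,\cdot)=0$.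
   Formalization: The formal theorem assumes T* finite (μ_*>0): if μ_*=0 then T*=+∞, the first item holds vacuously, and the equivalence fails, e.g. for A'=0, K_21=0, where the Kalman condition is false. *)

theory Defs
  imports "HOL-Analysis.Analysis"
begin

section \<open>Matrices\<close>

abbreviation cmat :: "real^'m^'n \<Rightarrow> complex^'m^'n" where
  "cmat \<equiv> map_matrix complex_of_real"

definition spectrum :: "complex^'n^'n \<Rightarrow> complex set" where
  "spectrum A = {l. \<exists>v. v \<noteq> 0 \<and> A *v v = l *s v}"

definition diagonalizable :: "complex^'n^'n \<Rightarrow> bool" where
  "diagonalizable A \<longleftrightarrow>
     (\<exists>(P :: complex^'n^'n) (D :: complex^'n^'n). invertible P \<and> (\<forall>i j. i \<noteq> j \<longrightarrow> D $ i $ j = 0) \<and> A = P ** D ** matrix_inv P)"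

primrec matpow :: "'a::semiring_1^'n^'n \<Rightarrow> nat \<Rightarrow> 'a^'n^'n" where
  "matpow M 0 = mat 1"
| "matpow M (Suc k) = M ** matpow M k"

definition mat_exp :: "complex^'n^'n \<Rightarrow> complex^'n^'n" where
  "mat_exp M = (\<Sum>k. (1 / fact k) *\<^sub>R matpow M k)"

definition block_matrix ::
    "'a^'m1^'n1 \<Rightarrow> 'a^'m2^'n1 \<Rightarrow> 'a^'m1^'n2 \<Rightarrow> 'a^'m2^'n2 \<Rightarrow> 'a^('m1 + 'm2)^('n1 + 'n2)" where
  "block_matrix M11 M12 M21 M22 = (\<chi> i j.
     case i of
       Inl a \<Rightarrow> (case j of Inl b \<Rightarrow> M11 $ a $ b | Inr b \<Rightarrow> M12 $ a $ b)
     | Inr a \<Rightarrow> (case j of Inl b \<Rightarrow> M21 $ a $ b | Inr b \<Rightarrow> M22 $ a $ b))"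

definition kalman_condition :: "real^'d2^'d2 \<Rightarrow> real^'d1^'d2 \<Rightarrow> bool" where
  "kalman_condition K22 K21 \<longleftrightarrow>
     vec.span {matpow (cmat K22) j *v (cmat K21 *v X1) | j X1. j \<le> CARD('d2) - 1}
       = (UNIV :: (complex^'d2) set)"

section \<open>The torus and its function spaces\<close>

text \<open>
  The torus \<open>\<real>/2\<pi>\<int>\<close> is identified with the unit circle through \<open>x \<mapsto> cis x\<close>. Subsets of the
  torus are subsets of the circle, with the subspace topology. Functions on the torus are given by
  their values on the fundamental domain \<open>{0..<2*pi}\<close>, the values elsewhere being irrelevant.
  Elements of \<open>L\<^sup>2\<close> are represented by Borel functions, and equality in \<open>L\<^sup>2\<close> is equality
  almost everywhere.
\<close>

abbreviation torus :: "complex set" where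
  "torus \<equiv> sphere 0 1"

abbreviation torus_measure :: "real measure" where
  "torus_measure \<equiv> restrict_space lborel {0..<2*pi}"

definition L2 :: "'a measure \<Rightarrow> ('a \<Rightarrow> complex^'n) set" where
  "L2 M = {f. f \<in> borel_measurable M \<and> integrable M (\<lambda>x. (norm (f x))\<^sup>2)}"

definition fourier_coeff :: "(real \<Rightarrow> complex^'n) \<Rightarrow> int \<Rightarrow> complex^'n" where
  "fourier_coeff f n =
     (1 / (2*pi)) *\<^sub>R (LINT x|torus_measure. cis (- (of_int n * x)) *s f x)"

definition L2_continuous_on :: "real set \<Rightarrow> (real \<Rightarrow> real \<Rightarrow> complex^'n) \<Rightarrow> bool" where
  "L2_continuous_on S f \<longleftrightarrow>
     (\<forall>t\<in>S. ((\<lambda>s. LINT x|torus_measure. (norm (f s x - f t x))\<^sup>2) \<longlongrightarrow> 0) (at t within S))"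

section \<open>The critical time\<close>

definition arc_length :: "complex set \<Rightarrow> ennreal" where
  "arc_length I = emeasure lborel {x\<in>{0..<2*pi}. cis x \<in> I}"

definition max_gap :: "complex set \<Rightarrow> ennreal" where
  "max_gap \<omega> = (SUP I\<in>components (torus - \<omega>). arc_length I)"

definition min_speed :: "real^'n^'n \<Rightarrow> real" where
  "min_speed A' = Min (cmod ` spectrum (cmat A'))"

definition critical_time :: "real^'n^'n \<Rightarrow> complex set \<Rightarrow> ennreal" where
  "critical_time A' \<omega> =
     (if min_speed A' > 0 then max_gap \<omega> / ennreal (min_speed A') else \<infinity>)"

text \<open>
  Pitfall: if the critical time is infinite (\<open>min_speed A' = 0\<close>), then no time exceeds it and
  "null controllable in any time exceeding the critical time" is vacuously true, whatever the
  coupling (e.g. \<open>A' = 0\<close>, \<open>K21 = 0\<close>, for which the Kalman condition fails). Statements about all such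
  times are therefore meaningful only for a finite critical time.
\<close>

section \<open>The control system\<close>

definition transport_matrix :: "real^'d1^'d1 \<Rightarrow> real^'d2^'d1 \<Rightarrow> real^('d1 + 'd2)^('d1 + 'd2)" where
  "transport_matrix A' A12 = block_matrix A' A12 0 0"

definition diffusion_matrix :: "real^('d1::finite + 'd2::finite)^('d1 + 'd2)" where
  "diffusion_matrix = block_matrix 0 0 0 (mat 1)"

text \<open>The operator \<open>-B \<partial>\<^sub>x\<^sup>2 + A \<partial>\<^sub>x + K\<close> acts on the \<open>n\<close>-th Fourier mode as the following matrix.\<close>

definition symbol ::
    "real^'d^'d \<Rightarrow> real^'d^'d \<Rightarrow> real^'d^'d \<Rightarrow> int \<Rightarrow> complex^'d^'d" where
  "symbol B A K n = (\<chi> i j.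
     of_int (n\<^sup>2) * cmat B $ i $ j + \<i> * of_int n * cmat A $ i $ j + cmat K $ i $ j)"

definition semigroup_multiplier ::
    "real^'d^'d \<Rightarrow> real^'d^'d \<Rightarrow> real^'d^'d \<Rightarrow> real \<Rightarrow> int \<Rightarrow> complex^'d^'d" where
  "semigroup_multiplier B A K t n = mat_exp ((- t) *\<^sub>R symbol B A K n)"

definition control_term ::
    "complex set \<Rightarrow> (real \<times> real \<Rightarrow> complex^'d1) \<Rightarrow> real \<Rightarrow> real \<Rightarrow>
     complex^('d1::finite + 'd2::finite)" where
  "control_term \<omega> u t x = (\<chi> i.
     case i of Inl a \<Rightarrow> (if cis x \<in> \<omega> then u (t, x) $ a else 0) | Inr b \<Rightarrow> 0)"

text \<open>
  Since a function in \<open>L\<^sup>2\<close> is determined by its Fourier coefficients, and since taking a Fourier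
  coefficient is a bounded linear map and hence commutes with the \<open>L\<^sup>2\<close>-valued integral, the
  identity \<open>f(t) = e\<^bsup>-tL\<^esup> f\<^sub>0 + \<integral>\<^sub>0\<^sup>t e\<^bsup>-(t-\<tau>)L\<^esup> g(\<tau>) d\<tau>\<close> in \<open>L\<^sup>2\<close> is stated coefficient by coefficient.
\<close>

definition mild_solution ::
    "real^('d1::finite + 'd2::finite)^('d1 + 'd2) \<Rightarrow> real^('d1 + 'd2)^('d1 + 'd2) \<Rightarrow>
     real^('d1 + 'd2)^('d1 + 'd2) \<Rightarrow> complex set \<Rightarrow> real \<Rightarrow> (real \<Rightarrow> complex^('d1 + 'd2)) \<Rightarrow>
     (real \<times> real \<Rightarrow> complex^'d1) \<Rightarrow> (real \<Rightarrow> real \<Rightarrow> complex^('d1 + 'd2)) \<Rightarrow> bool" where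
  "mild_solution B A K \<omega> T f0 u f \<longleftrightarrow>
     (\<forall>t\<in>{0..T}. f t \<in> L2 torus_measure) \<and>
     L2_continuous_on {0..T} f \<and>
     (\<forall>t\<in>{0..T}. \<forall>n.
        fourier_coeff (f t) n =
          semigroup_multiplier B A K t n *v fourier_coeff f0 n +
          (LINT \<tau>:{0..t}|lborel.
             semigroup_multiplier B A K (t - \<tau>) n *v fourier_coeff (control_term \<omega> u \<tau>) n))"

definition null_controllable ::
    "real^'d1^'d1 \<Rightarrow> real^'d2^'d1 \<Rightarrow> real^'d1^'d1 \<Rightarrow> real^'d2^'d1 \<Rightarrow> real^'d1^'d2 \<Rightarrow>
     real^'d2^'d2 \<Rightarrow> complex set \<Rightarrow> real \<Rightarrow> bool" where
  "null_controllable A' A12 K11 K12 K21 K22 \<omega> T \<longleftrightarrow>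
     (\<forall>f0 \<in> L2 torus_measure.
        \<exists>u \<in> L2 (restrict_space lborel {0<..<T} \<Otimes>\<^sub>M torus_measure).
          (AE (t, x) in restrict_space lborel {0<..<T} \<Otimes>\<^sub>M torus_measure.
             cis x \<notin> \<omega> \<longrightarrow> u (t, x) = 0) \<and>
          (\<exists>f. mild_solution diffusion_matrix (transport_matrix A' A12)
                 (block_matrix K11 K12 K21 K22) \<omega> T f0 u f \<and>
               (AE x in torus_measure. f T x = 0)))"

end

theory Submission
  imports Defs "HOL-Computational_Algebra.Fundamental_Theorem_Algebra" "HOL-Real_Asymp.Real_Asymp" "HOL-Library.Function_Algebras"
begin

text \<open>
  After diagonalization of \<open>A'\<close> the system becomes, for each frequency \<open>n\<close>, an ODE with a matrix \<open>M\<^sub>n\<close>. For large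
  \<open>|n|\<close> two Riccati equations split \<open>M\<^sub>n\<close> into a hyperbolic block \<open>in\<Lambda> + K\<^sub>1\<^sub>1 + O(1/n)\<close> and a parabolic block
  \<open>n\<^sup>2 + K\<^sub>2\<^sub>2 + O(1/n)\<close>. The hyperbolic block is steered along characteristics in any time exceeding
  \<open>\<ell>(\<omega>)/\<mu>\<^sub>*\<close>, the parabolic block by the method of Lebeau and Robbiano, in which the Kalman condition gives the
  steering of each frequency through the coupling. For high frequencies each of the two controls
  disturbs the other block little, so an iteration controls all but finitely many modes. The remaining
  modes are reached as well: otherwise a functional vanishing on the reachable states would be a common
  eigenvector of all transposed \<open>M\<^sub>n\<close>, which the Kalman condition excludes. Conversely, if the Kalman condition
  fails, a left eigenvector of \<open>K\<^sub>2\<^sub>2\<close> that annihilates \<open>K\<^sub>2\<^sub>1\<close> yields a component of the mode \<open>n = 0\<close> on which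
  no control acts.
\<close>

section \<open>Matrix exponentials\<close>

text \<open>Null control is treated as a moment problem: a control acts on mode \<open>n\<close>
  through a Duhamel integral \<open>mom\<close>, and these moments have to cancel the free evolution
  of all modes at once. No observability inequality for the adjoint system is used; costs are
  bounded linearly in the data, and the constants are carried through the statements. The control
  sits in the hyperbolic equation only. After the splitting it enters the parabolic block through a
  matrix of size \<open>1/n^2\<close>, equal to \<open>K21/n^2\<close> up to smaller terms, so
  steering a parabolic mode costs an extra power of \<open>n\<close>, which the exponential margin
  of the Lebeau-Robbiano scheme absorbs. The time in excess of the critical one is divided:
  transport controls act on \<open>(0, T0)\<close>, parabolic ones at the end, and in the pause
  between them the parabolic response to the former decays. This pause makes the iteration contract.
  For the low modes, the states reachable at a fixed time need not be invariant under the semigroup.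
  Their low-frequency parts increase with time inside a space of finite dimension, hence are
  constant on some \<open>[t0, T)\<close>, which yields the invariance.\<close>

lemma norm_vec_eq: "norm (x :: 'a::real_normed_vector^'n) = L2_set (\<lambda>i. norm (x $ i)) UNIV"
  by (simp add: norm_vec_def)

lemma norm_inner_row: "norm (\<Sum>j\<in>UNIV. (a::complex^'m) $ j * x $ j) \<le> norm a * norm x"
proof -
  have "norm (\<Sum>j\<in>UNIV. a $ j * x $ j) \<le> (\<Sum>j\<in>UNIV. \<bar>norm (a $ j)\<bar> * \<bar>norm (x $ j)\<bar>)"
    by (rule sum_norm_le) (simp add: norm_mult)
  also have "\<dots> \<le> L2_set (\<lambda>j. norm (a$j)) UNIV * L2_set (\<lambda>j. norm (x$j)) UNIV"
    by (rule L2_set_mult_ineq)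
  finally show ?thesis by (simp add: norm_vec_def)
qed

text \<open>The norm of a matrix, read as a vector of rows, is the Frobenius norm; Cauchy-Schwarz in
  each row gives the estimate without passing to operator norms.\<close>

lemma norm_matrix_vector_mult: "norm ((A::complex^'m^'n) *v x) \<le> norm A * norm x"
proof -
  have "norm (A *v x) = L2_set (\<lambda>i. norm (\<Sum>j\<in>UNIV. A $ i $ j * x $ j)) UNIV"
    by (simp add: norm_vec_def matrix_vector_mult_def)
  also have "\<dots> \<le> L2_set (\<lambda>i. norm (A $ i) * norm x) UNIV"
    by (rule L2_set_mono) (auto intro: norm_inner_row)
  also have "\<dots> = norm A * norm x"
    by (simp add: norm_vec_def[of A] L2_set_left_distrib)
  finally show ?thesis .
qed

lemma norm_transpose_matrix: "norm (transpose (A::complex^'m^'n)) = norm A"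
  unfolding norm_vec_def L2_set_def transpose_def
  by (simp add: sum_nonneg) (rule sum.swap)

lemma norm_matrix_matrix_mult: "norm ((A::complex^'m^'n) ** (B::complex^'k^'m)) \<le> norm A * norm B"
proof -
  have col: "transpose (A ** B) $ j = A *v (transpose B $ j)" for j
    by (simp add: vec_eq_iff matrix_matrix_mult_def matrix_vector_mult_def transpose_def)
  have "norm (A ** B) = norm (transpose (A ** B))" by (simp only: norm_transpose_matrix)
  also have "\<dots> = L2_set (\<lambda>j. norm (A *v (transpose B $ j))) UNIV"
    by (subst norm_vec_def) (simp only: col)
  also have "\<dots> \<le> L2_set (\<lambda>j. norm A * norm (transpose B $ j)) UNIV"
    by (rule L2_set_mono) (auto intro: norm_matrix_vector_mult)
  also have "\<dots> = norm A * norm (transpose B)"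
    by (simp add: norm_vec_def[of "transpose B"] L2_set_right_distrib)
  finally show ?thesis by (simp only: norm_transpose_matrix)
qed

lemma bounded_bilinear_matrix_vector: "bounded_bilinear (\<lambda>(A::complex^'m^'n) x. A *v x)"
proof (unfold_locales)
  show "\<exists>K. \<forall>(A::complex^'m^'n) x. norm (A *v x) \<le> norm A * norm x * K"
    by (rule exI[of _ 1]) (simp add: norm_matrix_vector_mult)
qed (simp_all add: matrix_vector_right_distrib matrix_vector_mult_add_rdistrib
      matrix_vector_mult_def vec_eq_iff scaleR_sum_right algebra_simps sum.distrib)

lemma bounded_bilinear_matrix_matrix:
  "bounded_bilinear (\<lambda>(A::complex^'m^'n) (B::complex^'k^'m). A ** B)"
proof (unfold_locales)
  show "\<exists>K. \<forall>(A::complex^'m^'n) (B::complex^'k^'m). norm (A ** B) \<le> norm A * norm B * K"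
    by (rule exI[of _ 1]) (simp add: norm_matrix_matrix_mult)
qed (simp_all add: matrix_matrix_mult_def vec_eq_iff scaleR_sum_right algebra_simps sum.distrib)

lemmas bounded_linear_matrix_vector [simp, intro] =
  bounded_bilinear.bounded_linear_right[OF bounded_bilinear_matrix_vector]

lemma bounded_linear_vector_smult: "bounded_linear (\<lambda>v::complex^'n. c *s v)"
proof -
  have "(\<lambda>v::complex^'n. c *s v) = (\<lambda>v. mat c *v v)"
    by (auto simp: fun_eq_iff vec_eq_iff matrix_vector_mult_def mat_def if_distrib[where f="\<lambda>a. a * b" for b] cong: if_cong)
  then show ?thesis using bounded_linear_matrix_vector[of "mat c"] by simp
qed

lemma norm_vector_smult: "norm (c *s (v::complex^'n)) = cmod c * norm v"
  by (simp add: norm_vec_def norm_mult L2_set_right_distrib)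

lemma matpow_commute: "matpow M k ** M = M ** matpow M k"
  by (induction k) (simp_all add: matrix_mul_assoc [symmetric])

lemma matpow_scaleR: "matpow (t *\<^sub>R (M::complex^'n^'n)) k = t ^ k *\<^sub>R matpow M k"
proof (induction k)
  case (Suc k)
  interpret bounded_bilinear "\<lambda>(A::complex^'n^'n) (B::complex^'n^'n). A ** B"
    by (rule bounded_bilinear_matrix_matrix)
  show ?case by (simp add: Suc scaleR_left scaleR_right)
qed simp

lemma norm_matpow: "norm (matpow (M::complex^'n^'n) k) \<le> norm (mat 1 :: complex^'n^'n) * norm M ^ k"
proof (induction k)
  case (Suc k)
  have "norm (matpow M (Suc k)) \<le> norm M * norm (matpow M k)"
    by (simp add: norm_matrix_matrix_mult)
  also have "\<dots> \<le> norm M * (norm (mat 1 :: complex^'n^'n) * norm M ^ k)"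
    by (intro mult_left_mono Suc) simp
  finally show ?case by (simp add: algebra_simps)
qed simp

lemma summable_mat_exp: "summable (\<lambda>k. (1 / fact k) *\<^sub>R matpow (M::complex^'n^'n) k)"
proof (rule summable_comparison_test)
  show "summable (\<lambda>k. norm (mat 1 :: complex^'n^'n) * (norm M ^ k / fact k))"
    by (intro summable_mult) (use summable_exp_generic[of "norm M"] in \<open>simp add: divide_inverse ac_simps\<close>)
  have "norm ((1 / fact k) *\<^sub>R matpow M k) \<le> norm (mat 1 :: complex^'n^'n) * (norm M ^ k / fact k)" for k
    using divide_right_mono[OF norm_matpow[of M k], of "fact k"] by simp
  then show "\<exists>N. \<forall>n\<ge>N. norm ((1 / fact n) *\<^sub>R matpow M n)
      \<le> norm (mat 1 :: complex^'n^'n) * (norm M ^ n / fact n)" by blast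
qed

lemma has_vector_derivative_vecI:
  fixes f :: "real \<Rightarrow> ('a::real_normed_vector)^'n"
  assumes "\<And>i. ((\<lambda>t. f t $ i) has_vector_derivative f' $ i) (at x)"
  shows "(f has_vector_derivative f') (at x)"
proof -
  have "((\<lambda>h. (1 / norm h) *\<^sub>R (f (x + h) - f x - h *\<^sub>R f')) \<longlongrightarrow> 0) (at 0)"
  proof (rule vec_tendstoI)
    fix i
    show "((\<lambda>h. ((1 / norm h) *\<^sub>R (f (x + h) - f x - h *\<^sub>R f')) $ i) \<longlongrightarrow> (0::'a^'n) $ i) (at 0)"
      using assms[of i] by (simp add: has_vector_derivative_def has_derivative_at mult.commute
          tendsto_norm_zero_iff[symmetric, where f="\<lambda>h. (f (x+h) $ i - f x $ i - h *\<^sub>R f' $ i) /\<^sub>R \<bar>h\<bar>"] divide_inverse)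
  qed
  from tendsto_norm_zero[OF this]
  show ?thesis
    by (simp add: has_vector_derivative_def has_derivative_at bounded_linear_scaleR_left divide_inverse mult.commute)
qed

lemma mat_exp_entry:
  "mat_exp (t *\<^sub>R (M::complex^'n^'n)) $ i $ j = (\<Sum>k. (matpow M k $ i $ j / fact k) * of_real t ^ k)"
proof -
  have bl: "bounded_linear (\<lambda>A::complex^'n^'n. A $ i $ j)"
    using bounded_linear_compose[OF bounded_linear_vec_nth[of j] bounded_linear_vec_nth[of i]] .
  have "mat_exp (t *\<^sub>R M) $ i $ j = (\<Sum>k. ((1 / fact k) *\<^sub>R matpow (t *\<^sub>R M) k) $ i $ j)"
    unfolding mat_exp_def by (rule bounded_linear.suminf[OF bl summable_mat_exp])
  also have "\<dots> = (\<Sum>k. (matpow M k $ i $ j / fact k) * of_real t ^ k)"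
    by (rule suminf_cong) (simp add: matpow_scaleR, simp add: scaleR_conv_of_real)
  finally show ?thesis .
qed

lemma summable_mat_exp_entry:
  "summable (\<lambda>k. (matpow (M::complex^'n^'n) k $ i $ j / fact k) * z ^ k)"
proof (rule summable_comparison_test)
  let ?c = "norm (mat 1 :: complex^'n^'n)"
  show "summable (\<lambda>k. ?c * ((norm M * norm z) ^ k / fact k))"
    by (intro summable_mult) (use summable_exp_generic[of "norm M * norm z"] in \<open>simp add: divide_inverse ac_simps\<close>)
  have "norm ((matpow M k $ i $ j / fact k) * z ^ k) \<le> ?c * ((norm M * norm z) ^ k / fact k)" for k
  proof -
    have "norm (matpow M k $ i $ j) \<le> norm (matpow M k)"
      by (rule order_trans[OF Finite_Cartesian_Product.norm_nth_le Finite_Cartesian_Product.norm_nth_le])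
    also note norm_matpow
    finally have "norm (matpow M k $ i $ j) * (norm z ^ k / fact k) \<le> (?c * norm M ^ k) * (norm z ^ k / fact k)"
      by (intro mult_right_mono) simp_all
    then show ?thesis by (simp add: norm_mult norm_divide norm_power power_mult_distrib)
  qed
  then show "\<exists>N. \<forall>k\<ge>N. norm ((matpow M k $ i $ j / fact k) * z ^ k) \<le> ?c * ((norm M * norm z) ^ k / fact k)"
    by blast
qed

text \<open>Every entry is an entire power series in \<open>t\<close>, so it may be differentiated
  term by term; the shifted coefficients are those of \<open>M\<close> times the
  exponential.\<close>

lemma mat_exp_has_derivative:
  "((\<lambda>t. mat_exp (t *\<^sub>R (M::complex^'n^'n))) has_vector_derivative M ** mat_exp (t *\<^sub>R M)) (at t)"
proof (intro has_vector_derivative_vecI)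
  fix i j
  define c where "c l = (\<lambda>k. matpow M k $ l $ j / fact k)" for l
  have e: "mat_exp (t *\<^sub>R M) $ l $ j = (\<Sum>k. c l k * of_real t ^ k)" for l t
    by (simp add: mat_exp_entry c_def)
  have s: "summable (\<lambda>k. c l k * z ^ k)" for l z
    unfolding c_def by (rule summable_mat_exp_entry)
  have "diffs (c i) k = (\<Sum>l\<in>UNIV. M $ i $ l * c l k)" for k
  proof -
    have "of_nat (Suc k) * (x / fact (Suc k)) = x / (fact k :: complex)" for x
      by (simp del: of_nat_Suc)
    from this[of "matpow M (Suc k) $ i $ j"] show ?thesis
      by (simp add: diffs_def c_def matrix_matrix_mult_def sum_divide_distrib del: of_nat_Suc fact_Suc)
  qed
  then have "(\<Sum>k. diffs (c i) k * of_real t ^ k) = (\<Sum>k. \<Sum>l\<in>UNIV. M $ i $ l * (c l k * of_real t ^ k))"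
    by (simp add: sum_distrib_right mult.assoc)
  also have "\<dots> = (\<Sum>l\<in>UNIV. \<Sum>k. M $ i $ l * (c l k * of_real t ^ k))"
    by (rule suminf_sum) (intro summable_mult s)
  also have "\<dots> = (M ** mat_exp (t *\<^sub>R M)) $ i $ j"
    by (simp add: matrix_matrix_mult_def e suminf_mult[OF s])
  finally have eq: "(\<Sum>k. diffs (c i) k * of_real t ^ k) = (M ** mat_exp (t *\<^sub>R M)) $ i $ j" .
  have "((\<lambda>x. \<Sum>n. c i n * x ^ n) has_field_derivative (\<Sum>n. diffs (c i) n * of_real t ^ n)) (at (of_real t))"
    by (rule termdiffs_strong_converges_everywhere) (rule s)
  then show "((\<lambda>t. mat_exp (t *\<^sub>R M) $ i $ j) has_vector_derivative (M ** mat_exp (t *\<^sub>R M)) $ i $ j) (at t)"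
    unfolding eq e by (rule has_vector_derivative_real_field)
qed

lemma mat_exp_0: "mat_exp (0::complex^'n^'n) = mat 1"
proof -
  have "matpow (0::complex^'n^'n) (Suc k) = 0" for k
    by (simp add: matrix_matrix_mult_def vec_eq_iff)
  then have "(1 / fact k) *\<^sub>R matpow (0::complex^'n^'n) k = (if k = 0 then mat 1 else 0)" for k
    by (cases k) auto
  then show ?thesis unfolding mat_exp_def
    using suminf_finite[of "{0}" "\<lambda>k. if k = 0 then mat 1 else (0::complex^'n^'n)"] by simp
qed

text \<open>Solution operator of \<open>y' = - M y\<close>; the sign is that of the semigroup
  \<open>exp(-t L)\<close>. It is a group, and negative times are used to pull states back.\<close>

definition flow :: "complex^'n^'n \<Rightarrow> real \<Rightarrow> complex^'n \<Rightarrow> complex^'n" where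
  "flow M t v = mat_exp ((- t) *\<^sub>R M) *v v"

lemma flow_0 [simp]: "flow M 0 v = v"
  by (simp add: flow_def mat_exp_0)

lemma flow_has_derivative: "((\<lambda>t. flow M t v) has_vector_derivative - (M *v flow M t v)) (at t)"
proof -
  have "((\<lambda>s. mat_exp (s *\<^sub>R M) *v v) has_vector_derivative M *v flow M t v) (at (- t))"
    using bounded_linear.has_vector_derivative[OF
        bounded_bilinear.bounded_linear_left[OF bounded_bilinear_matrix_vector] mat_exp_has_derivative[of M "- t"]]
    by (simp add: flow_def matrix_vector_mul_assoc)
  have "(uminus has_vector_derivative - 1) (at t)" by (auto intro!: derivative_eq_intros)
  from vector_diff_chain_at[OF this \<open>((\<lambda>s. mat_exp (s *\<^sub>R M) *v v) has_vector_derivative M *v flow M t v) (at (- t))\<close>]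
  have "((\<lambda>s. mat_exp (s *\<^sub>R M) *v v) \<circ> uminus has_vector_derivative (- 1) *\<^sub>R (M *v flow M t v)) (at t)" .
  then show ?thesis by (simp add: flow_def[abs_def] comp_def)
qed

lemma bounded_linear_flow: "bounded_linear (flow M t)"
  unfolding flow_def[abs_def] by (rule bounded_linear_matrix_vector)

lemmas flow_add_right = linear_add[OF bounded_linear.linear[OF bounded_linear_flow]]
  and flow_diff_right = linear_diff[OF bounded_linear.linear[OF bounded_linear_flow]]
  and flow_scaleR_right = linear_scale[OF bounded_linear.linear[OF bounded_linear_flow]]
  and flow_zero_right [simp] = linear_0[OF bounded_linear.linear[OF bounded_linear_flow]]
  and flow_minus_right = linear_neg[OF bounded_linear.linear[OF bounded_linear_flow]]

lemma flow_smult_right: "flow M t (c *s v) = c *s flow M t v"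
  by (simp add: flow_def matrix_vector_mult_def vec_eq_iff sum_distrib_left mult.left_commute)

lemma continuous_on_flow [continuous_intros]: "continuous_on S (\<lambda>t. flow M t v)"
  by (intro continuous_at_imp_continuous_on ballI has_vector_derivative_continuous[OF flow_has_derivative])

text \<open>Energy estimate: \<open>exp(-2 C s) |y(s)|^2\<close> is nonincreasing. The real inner
  product is the real part of the Hermitian one, so skew-adjoint parts of \<open>M\<close> do not
  enter, and bounds uniform in the frequency become possible.\<close>

lemma growth_bound:
  fixes y :: "real \<Rightarrow> complex^'n"
  assumes y: "\<And>t. (y has_vector_derivative - (M *v y t)) (at t)"
    and M: "\<And>v. inner v (M *v v) \<ge> - C * (norm v)\<^sup>2" and t: "0 \<le> t"
  shows "norm (y t) \<le> exp (C * t) * norm (y 0)"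
proof -
  define h where "h s = exp (- 2 * C * s) * inner (y s) (y s)" for s
  have d: "(h has_real_derivative exp (- 2 * C * s) * (- 2 * C * inner (y s) (y s) - 2 * inner (y s) (M *v y s))) (at s)" for s
  proof -
    have "((\<lambda>s. inner (y s) (y s)) has_vector_derivative inner (y s) (- (M *v y s)) + inner (- (M *v y s)) (y s)) (at s)"
      by (rule bounded_bilinear.has_vector_derivative[OF bounded_bilinear_inner y y])
    then have "((\<lambda>s. inner (y s) (y s)) has_real_derivative - 2 * inner (y s) (M *v y s)) (at s)"
      by (simp add: has_real_derivative_iff_has_vector_derivative inner_commute)
    then show ?thesis unfolding h_def
      by (auto intro!: derivative_eq_intros simp: algebra_simps)
  qed
  have "h t \<le> h 0"
  proof (rule DERIV_nonpos_imp_nonincreasing[OF t])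
    fix s
    have "- 2 * C * inner (y s) (y s) - 2 * inner (y s) (M *v y s) \<le> 0"
      using M[of "y s"] by (simp add: power2_norm_eq_inner)
    then show "\<exists>z. (h has_real_derivative z) (at s) \<and> z \<le> 0"
      using d[of s] by (intro exI[of _ "exp (- 2 * C * s) * (- 2 * C * inner (y s) (y s) - 2 * inner (y s) (M *v y s))"] conjI) (auto intro: mult_nonneg_nonpos)
  qed
  then have "(norm (y t))\<^sup>2 \<le> (exp (C * t) * norm (y 0))\<^sup>2"
    by (simp add: h_def power_mult_distrib power2_norm_eq_inner[symmetric] exp_minus field_simps flip: exp_double)
  then show ?thesis by (rule power2_le_imp_le) simp
qed

lemma inner_matrix_vector_bound: "\<bar>inner v ((M::complex^'n^'n) *v v)\<bar> \<le> norm M * (norm v)\<^sup>2"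
proof -
  have "\<bar>inner v (M *v v)\<bar> \<le> norm v * norm (M *v v)" by (rule Cauchy_Schwarz_ineq2)
  also have "\<dots> \<le> norm v * (norm M * norm v)" by (intro mult_left_mono norm_matrix_vector_mult) simp
  finally show ?thesis by (simp add: power2_eq_square mult_ac)
qed

text \<open>The difference with the flow starts at zero; the energy estimate keeps it zero forwards
  and, applied to \<open>- M\<close> with reversed time, also backwards.\<close>

lemma flow_unique:
  fixes y :: "real \<Rightarrow> complex^'n"
  assumes y: "\<And>t. (y has_vector_derivative - (M *v y t)) (at t)"
  shows "y t = flow M t (y 0)"
proof -
  define z where "z s = y s - flow M s (y 0)" for s
  have z: "(z has_vector_derivative - (M *v z t)) (at t)" for t
    unfolding z_def[abs_def]
    using has_vector_derivative_diff[OF y flow_has_derivative] by (simp add: matrix_vector_mult_diff_distrib)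
  have "z t = 0"
  proof (cases "t \<ge> 0")
    case True
    have "norm (z t) \<le> exp (norm M * t) * norm (z 0)"
      using inner_matrix_vector_bound[of _ M] by (intro growth_bound[of z M] z True) (simp add: abs_le_iff minus_le_iff)
    then show ?thesis by (simp add: z_def)
  next
    case False
    have "((z \<circ> uminus) has_vector_derivative (- 1) *\<^sub>R (- (M *v z (- s)))) (at s)" for s
      by (rule vector_diff_chain_at[of uminus "-1" s, OF _ z]) (auto intro!: derivative_eq_intros)
    then have "((\<lambda>s. z (- s)) has_vector_derivative - ((- M) *v z (- s))) (at s)" for s
      by (simp add: comp_def bounded_bilinear.minus_left[OF bounded_bilinear_matrix_vector])
    then have "norm (z (- (- t))) \<le> exp (norm M * (- t)) * norm (z (- 0))"
      by (rule growth_bound) (use False inner_matrix_vector_bound[of _ M] in \<open>simp_all add: abs_le_iff bounded_bilinear.minus_left[OF bounded_bilinear_matrix_vector]\<close>)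
    then show ?thesis by (simp add: z_def)
  qed
  then show ?thesis by (simp add: z_def)
qed

lemma flow_growth:
  assumes "\<And>v. inner v (M *v v) \<ge> - C * (norm v)\<^sup>2" "0 \<le> t"
  shows "norm (flow M t v) \<le> exp (C * t) * norm v"
  using growth_bound[OF flow_has_derivative assms, of v] by simp

lemma flow_norm_bound:
  assumes "norm M \<le> C"
  shows "norm (flow M t v) \<le> exp (C * \<bar>t\<bar>) * norm v"
proof -
  have *: "norm (flow M t v) \<le> exp (norm M * t) * norm v" if "t \<ge> 0" for M t
    using inner_matrix_vector_bound[of _ M] that by (intro flow_growth) (simp_all add: abs_le_iff minus_le_iff)
  have "norm (flow M t v) \<le> exp (norm M * \<bar>t\<bar>) * norm v"
  proof (cases "t \<ge> 0")
    case False
    have "flow M t v = flow (- M) (- t) v" by (simp add: flow_def)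
    then show ?thesis using *[of "-t" "- M"] False by simp
  qed (use * in simp)
  also have "\<dots> \<le> exp (C * \<bar>t\<bar>) * norm v"
    using assms by (intro mult_right_mono) (simp_all add: mult_right_mono)
  finally show ?thesis .
qed

text \<open>Both sides solve the same linear equation with the same initial value. This carries
  changes of unknowns and eigenfunctionals through the exponentials.\<close>

lemma flow_intertwine:
  fixes R :: "complex^'n \<Rightarrow> complex^'m"
  assumes R: "bounded_linear R" and eq: "\<And>v. R (M *v v) = P *v R v"
  shows "R (flow M t v) = flow P t (R v)"
proof -
  have "((\<lambda>t. R (flow M t v)) has_vector_derivative - (P *v R (flow M t v))) (at t)" for t
    using bounded_linear.has_vector_derivative[OF R flow_has_derivative, of M v t]
    by (simp add: eq linear_neg[OF bounded_linear.linear[OF R]])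
  from flow_unique[OF this, of t] show ?thesis by simp
qed

lemma flow_commute: "M *v flow M t v = flow M t (M *v v)"
  by (rule flow_intertwine) simp_all

lemma flow_add_time: "flow M (s + t) v = flow M s (flow M t v)"
proof -
  have "((\<lambda>s. flow M (s + t) v) has_vector_derivative - (M *v flow M (s + t) v)) (at s)" for s
  proof -
    have "((\<lambda>s. s + t) has_vector_derivative 1) (at s)" by (auto intro!: derivative_eq_intros)
    from vector_diff_chain_at[OF this flow_has_derivative[of M v "s + t"]] show ?thesis
      by (simp add: comp_def)
  qed
  from flow_unique[OF this, of s] show ?thesis by simp
qed

lemma flow_has_derivative_comp:
  assumes y: "(y has_vector_derivative y') (at t)"
  shows "((\<lambda>t. flow M t (y t)) has_vector_derivative - (M *v flow M t (y t)) + flow M t y') (at t)"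
proof -
  have "((\<lambda>s. mat_exp (s *\<^sub>R M)) \<circ> uminus has_vector_derivative (- 1) *\<^sub>R (M ** mat_exp ((- t) *\<^sub>R M))) (at t)"
    by (rule vector_diff_chain_at[of uminus "-1" t, OF _ mat_exp_has_derivative]) (auto intro!: derivative_eq_intros)
  then have "((\<lambda>s. mat_exp ((- s) *\<^sub>R M)) has_vector_derivative - (M ** mat_exp ((- t) *\<^sub>R M))) (at t)"
    by (simp add: comp_def)
  from bounded_bilinear.has_vector_derivative[OF bounded_bilinear_matrix_vector this y] show ?thesis
    by (simp add: flow_def[abs_def] bounded_bilinear.minus_left[OF bounded_bilinear_matrix_vector]
        matrix_vector_mul_assoc add.commute)
qed

lemma flow_commuting_sum:
  assumes "\<And>v. A *v (B *v v) = B *v (A *v v)"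
  shows "flow (A + B) t v = flow A t (flow B t v)"
proof -
  have B: "B *v flow A t v = flow A t (B *v v)" for t v
    by (rule flow_intertwine) (simp_all add: assms)
  have "((\<lambda>t. flow A t (flow B t v)) has_vector_derivative - ((A + B) *v flow A t (flow B t v))) (at t)" for t
    using flow_has_derivative_comp[OF flow_has_derivative, of A B v t]
    by (simp add: matrix_vector_mult_add_rdistrib B flow_minus_right)
  from flow_unique[OF this, of t] show ?thesis by simp
qed

lemma mat_mult_vec: "mat c *v v = c *s (v::complex^'n)"
  by (auto simp: vec_eq_iff matrix_vector_mult_def mat_def if_distrib[where f="\<lambda>a. a * b" for b] cong: if_cong)

lemma has_vector_derivative_exp_smult:
  fixes v :: "complex^'n"
  shows
  "((\<lambda>t. exp (c * of_real t) *s v) has_vector_derivative (c *s (exp (c * of_real t) *s v))) (at t)"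
proof (rule has_vector_derivative_vecI)
  fix i
  have "((\<lambda>z. exp (c * z) * v $ i) has_field_derivative c * (exp (c * of_real t) * v $ i)) (at (of_real t))"
    by (auto intro!: derivative_eq_intros)
  from has_vector_derivative_real_field[OF this]
  show "((\<lambda>t. (exp (c * of_real t) *s v) $ i) has_vector_derivative (c *s (exp (c * of_real t) *s v)) $ i) (at t)"
    by (simp add: mult.assoc)
qed

lemma flow_mat: "flow (mat c) t v = exp (- c * of_real t) *s v"
proof -
  have "((\<lambda>t. exp (- c * of_real t) *s v) has_vector_derivative - (mat c *v (exp (- c * of_real t) *s v))) (at t)" for t
    using has_vector_derivative_exp_smult[of "- c" v t] by (simp add: mat_mult_vec vec_eq_iff)
  from flow_unique[OF this, of t] show ?thesis by simp
qed

lemma flow_mat_add: "flow (mat c + B) t v = exp (- c * of_real t) *s flow B t v"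
proof -
  have "mat c *v (B *v v) = B *v (mat c *v v)" for v
    by (simp add: mat_mult_vec vector_scalar_commute)
  then show ?thesis by (simp add: flow_commuting_sum flow_mat)
qed

lemma flow_inverse: "flow M (- t) (flow M t v) = v"
  using flow_add_time[of M "- t" t v] by simp

section \<open>Square integrable functions and Fourier series\<close>

abbreviation sqint :: "'a measure \<Rightarrow> ('a \<Rightarrow> 'b::real_normed_vector) \<Rightarrow> ennreal" where
  "sqint M f \<equiv> \<integral>\<^sup>+x. ennreal ((norm (f x))\<^sup>2) \<partial>M"

text \<open>A bound by a number instead of the norm itself; through the nonnegative integral it can
  be handled before any integrability is known.\<close>

definition L2b :: "'a measure \<Rightarrow> ('a \<Rightarrow> 'b::{real_normed_vector,second_countable_topology}) \<Rightarrow> real \<Rightarrow> bool" where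
  "L2b M f a \<longleftrightarrow> 0 \<le> a \<and> f \<in> borel_measurable M \<and> (sqint M f) \<le> ennreal (a\<^sup>2)"

lemma L2bD:
  assumes "L2b M f a"
  shows "0 \<le> a" "f \<in> borel_measurable M" "sqint M f \<le> ennreal (a\<^sup>2)"
  using assms by (auto simp: L2b_def)

lemma L2b_mono: "L2b M f a \<Longrightarrow> a \<le> b \<Longrightarrow> L2b M f b"
  unfolding L2b_def
  by (elim conjE, intro conjI) (linarith, assumption, erule order_trans, intro ennreal_leI power_mono)

lemma L2b_zero [simp]: "0 \<le> a \<Longrightarrow> L2b M (\<lambda>x. 0) a"
  by (simp add: L2b_def)

lemma L2b_le:
  assumes "L2b M f a" and [measurable]: "g \<in> borel_measurable M"
    and le: "\<And>x. x \<in> space M \<Longrightarrow> norm (g x) \<le> c * norm (f x)" and c: "0 \<le> c"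
  shows "L2b M g (c * a)"
proof -
  have [measurable]: "f \<in> borel_measurable M" and a: "0 \<le> a" using L2bD[OF assms(1)] by auto
  have "sqint M g \<le> (\<integral>\<^sup>+x. ennreal (c\<^sup>2) * ennreal ((norm (f x))\<^sup>2) \<partial>M)"
    using power_mono[OF le, of _ 2]
    by (intro nn_integral_mono) (simp add: power_mult_distrib flip: ennreal_mult)
  also have "\<dots> = ennreal (c\<^sup>2) * (sqint M f)"
    by (rule nn_integral_cmult) measurable
  also have "\<dots> \<le> ennreal (c\<^sup>2) * ennreal (a\<^sup>2)"
    by (intro mult_left_mono L2bD assms(1)) simp
  finally show ?thesis using a c assms(2) by (simp add: L2b_def power_mult_distrib flip: ennreal_mult)
qed

lemma square_add_le:
  fixes x y a b :: real assumes "0 < a" "0 < b"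
  shows "(x + y)\<^sup>2 \<le> (1 + b / a) * x\<^sup>2 + (1 + a / b) * y\<^sup>2"
proof -
  have "0 \<le> (b * x - a * y)\<^sup>2 / (a * b)" using assms by simp
  also have "\<dots> = (1 + b / a) * x\<^sup>2 + (1 + a / b) * y\<^sup>2 - (x + y)\<^sup>2"
    using assms by (simp add: field_simps power2_eq_square)
  finally show ?thesis by simp
qed

text \<open>Minkowski from the weighted inequality \<open>square_add_le\<close>, which is sharp for
  weights proportional to the two norms. Vanishing norms are reached by enlarging both bounds by
  \<open>e\<close> and letting \<open>e\<close> tend to zero.\<close>

lemma L2b_add:
  assumes f: "L2b M f a" and g: "L2b M g b"
  shows "L2b M (\<lambda>x. f x + g x) (a + b)"
proof -
  have [measurable]: "f \<in> borel_measurable M" "g \<in> borel_measurable M" and a: "0 \<le> a" and b: "0 \<le> b"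
    using L2bD[OF f] L2bD[OF g] by auto
  have pos: "sqint M (\<lambda>x. f x + g x) \<le> ennreal ((a' + b')\<^sup>2)"
    if "0 < a'" "0 < b'" "a \<le> a'" "b \<le> b'" for a' b'
  proof -
    have "sqint M (\<lambda>x. f x + g x) \<le>
      (\<integral>\<^sup>+x. ennreal (1 + b'/a') * ennreal ((norm (f x))\<^sup>2) + ennreal (1 + a'/b') * ennreal ((norm (g x))\<^sup>2) \<partial>M)"
    proof (rule nn_integral_mono)
      fix x
      have "(norm (f x + g x))\<^sup>2 \<le> (norm (f x) + norm (g x))\<^sup>2"
        by (intro power_mono norm_triangle_ineq) simp
      also have "\<dots> \<le> (1 + b'/a') * (norm (f x))\<^sup>2 + (1 + a'/b') * (norm (g x))\<^sup>2"
        by (rule square_add_le) (use that in auto)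
      finally show "ennreal ((norm (f x + g x))\<^sup>2) \<le> ennreal (1 + b'/a') * ennreal ((norm (f x))\<^sup>2) + ennreal (1 + a'/b') * ennreal ((norm (g x))\<^sup>2)"
        using that by (simp flip: ennreal_mult ennreal_plus)
    qed
    also have "\<dots> = ennreal (1 + b'/a') * (sqint M f) + ennreal (1 + a'/b') * (sqint M g)"
      by (subst nn_integral_add) (simp_all add: nn_integral_cmult)
    also have "\<dots> \<le> ennreal (1 + b'/a') * ennreal (a'\<^sup>2) + ennreal (1 + a'/b') * ennreal (b'\<^sup>2)"
      using that a b L2bD(3)[OF f] L2bD(3)[OF g]
      by (intro add_mono mult_left_mono) (auto elim!: order_trans intro!: ennreal_leI power_mono)
    also have "\<dots> = ennreal ((1 + b'/a') * a'\<^sup>2 + (1 + a'/b') * b'\<^sup>2)"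
      using that by (simp flip: ennreal_mult ennreal_plus)
    also have "(1 + b'/a') * a'\<^sup>2 + (1 + a'/b') * b'\<^sup>2 = (a' + b')\<^sup>2"
      using that by (simp add: field_simps power2_eq_square)
    finally show ?thesis .
  qed
  let ?I = "sqint M (\<lambda>x. f x + g x)"
  have lim: "((\<lambda>e. ennreal ((a + e + (b + e))\<^sup>2)) \<longlongrightarrow> ennreal ((a + 0 + (b + 0))\<^sup>2)) (at_right 0)"
    by (intro tendsto_intros)
  have "?I \<le> ennreal ((a + e + (b + e))\<^sup>2)" if "e > 0" for e
    by (rule pos) (use a b that in auto)
  then have "\<forall>\<^sub>F e in at_right 0. ?I \<le> ennreal ((a + e + (b + e))\<^sup>2)"
    by (intro eventually_mono[OF eventually_at_right_less[of 0]])
  from tendsto_lowerbound[OF lim this] have "?I \<le> ennreal ((a + 0 + (b + 0))\<^sup>2)" by simp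
  then show ?thesis using a b by (simp add: L2b_def)
qed

lemma L2b_minus: "L2b M f a \<Longrightarrow> L2b M (\<lambda>x. - f x) a"
  by (simp add: L2b_def)

lemma L2b_diff: "L2b M f a \<Longrightarrow> L2b M g b \<Longrightarrow> L2b M (\<lambda>x. f x - g x) (a + b)"
  using L2b_add[of M f a "\<lambda>x. - g x" b] L2b_minus by auto

lemma L2b_sum:
  assumes "finite I" "\<And>i. i \<in> I \<Longrightarrow> L2b M (f i) (a i)"
  shows "L2b M (\<lambda>x. \<Sum>i\<in>I. f i x) (\<Sum>i\<in>I. a i)"
  using assms by (induction I) (auto intro: L2b_add)

lemma L2b_epsilon:
  assumes f: "\<And>e. 0 < e \<Longrightarrow> L2b M f (a + e)" and a: "0 \<le> a"
  shows "L2b M f a"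
proof -
  have lim: "((\<lambda>e. ennreal ((a + e)\<^sup>2)) \<longlongrightarrow> ennreal ((a + 0)\<^sup>2)) (at_right 0)"
    by (intro tendsto_intros)
  have "sqint M f \<le> ennreal ((a + e)\<^sup>2)" if "e > 0" for e
    by (rule L2bD(3)[OF f[OF that]])
  then have "\<forall>\<^sub>F e in at_right 0. (sqint M f) \<le> ennreal ((a + e)\<^sup>2)"
    by (intro eventually_mono[OF eventually_at_right_less[of 0]])
  from tendsto_lowerbound[OF lim this] show ?thesis
    using a L2bD(2)[OF f[of 1]] by (simp add: L2b_def)
qed

lemma L2b_bounded_linear:
  assumes "L2b M f a" "bounded_linear R" "\<And>v. norm (R v) \<le> c * norm v" "0 \<le> c"
  shows "L2b M (\<lambda>x. R (f x)) (c * a)"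
proof (rule L2b_le[OF assms(1)])
  show "(\<lambda>x. R (f x)) \<in> borel_measurable M"
    using measurable_compose[OF L2bD(2)[OF assms(1)] borel_measurable_continuous_onI[OF linear_continuous_on[OF assms(2)]]] .
qed (use assms in auto)

lemma L2b_limit:
  assumes f: "\<And>l. L2b M (F l) a" and [measurable]: "f \<in> borel_measurable M"
    and lim: "AE x in M. (\<lambda>l. F l x) \<longlonglongrightarrow> f x"
  shows "L2b M f a"
proof -
  have [measurable]: "\<And>l. F l \<in> borel_measurable M" using L2bD(2)[OF f] .
  have "sqint M f = (\<integral>\<^sup>+x. liminf (\<lambda>l. ennreal ((norm (F l x))\<^sup>2)) \<partial>M)"
  proof (rule nn_integral_cong_AE, use lim in eventually_elim)
    fix x assume "(\<lambda>l. F l x) \<longlonglongrightarrow> f x"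
    then have "(\<lambda>l. ennreal ((norm (F l x))\<^sup>2)) \<longlonglongrightarrow> ennreal ((norm (f x))\<^sup>2)"
      by (intro tendsto_intros)
    then show "ennreal ((norm (f x))\<^sup>2) = liminf (\<lambda>l. ennreal ((norm (F l x))\<^sup>2))"
      by (intro lim_imp_Liminf[symmetric]) auto
  qed
  also have "\<dots> \<le> liminf (\<lambda>l. sqint M (F l))"
    by (rule nn_integral_liminf) measurable
  also have "\<dots> \<le> liminf (\<lambda>l::nat. ennreal (a\<^sup>2))"
    using L2bD(3)[OF f] by (intro Liminf_mono always_eventually allI)
  also have "\<dots> = ennreal (a\<^sup>2)" by (simp add: Liminf_const)
  finally show ?thesis using L2bD(1)[OF f] by (simp add: L2b_def)
qed

text \<open>Completeness with rates: monotone convergence for the partial sums of norms gives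
  absolute convergence almost everywhere, and Fatou bounds the tails. The last conclusion holds at
  every point, so a common support of the terms is inherited exactly.\<close>

lemma L2b_series:
  fixes u :: "nat \<Rightarrow> 'a \<Rightarrow> 'b::{banach,second_countable_topology}"
  assumes u: "\<And>k. L2b M (u k) (B k)" and B: "summable B"
  obtains v where "L2b M v (suminf B)"
    and "\<And>m. L2b M (\<lambda>x. v x - (\<Sum>k<m. u k x)) (\<Sum>k. B (k + m))"
    and "\<forall>x. (\<forall>k. u k x = 0) \<longrightarrow> v x = 0"
proof -
  have [measurable]: "\<And>l. u l \<in> borel_measurable M" using L2bD(2)[OF u] .
  have B0: "B k \<ge> 0" for k using L2bD(1)[OF u] .
  define S where "S m x = (\<Sum>k<m. norm (u k x))" for m x
  have [measurable]: "S m \<in> borel_measurable M" for m unfolding S_def by measurable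
  have S0: "S m x \<ge> 0" for m x by (simp add: S_def sum_nonneg)
  have "L2b M (S m) (\<Sum>k<m. B k)" for m
    unfolding S_def using u by (intro L2b_sum) (auto simp: L2b_def)
  then have S: "L2b M (S m) (suminf B)" for m
    by (rule L2b_mono) (intro sum_le_suminf B, auto simp: B0)
  have "(\<integral>\<^sup>+x. (SUP m. ennreal ((S m x)\<^sup>2)) \<partial>M) = (SUP m. \<integral>\<^sup>+x. ennreal ((S m x)\<^sup>2) \<partial>M)"
  proof (rule nn_integral_monotone_convergence_SUP)
    show "incseq (\<lambda>m x. ennreal ((S m x)\<^sup>2))"
    proof (rule incseq_SucI, rule le_funI)
      fix m x
      have "S m x \<le> S (Suc m) x" by (simp add: S_def)
      then show "ennreal ((S m x)\<^sup>2) \<le> ennreal ((S (Suc m) x)\<^sup>2)"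
        using S0 by (intro ennreal_leI power_mono) auto
    qed
  qed measurable
  also have "\<dots> \<le> ennreal ((suminf B)\<^sup>2)"
    using L2bD(3)[OF S] S0 by (intro SUP_least) simp
  also have "\<dots> < \<infinity>" by simp
  finally have "AE x in M. (SUP m. ennreal ((S m x)\<^sup>2)) \<noteq> \<infinity>"
    by (intro nn_integral_noteq_infinite) auto
  then have sm: "AE x in M. summable (\<lambda>k. norm (u k x))"
  proof eventually_elim
    fix x assume "(SUP m. ennreal ((S m x)\<^sup>2)) \<noteq> \<infinity>"
    then obtain r where r: "(SUP m. ennreal ((S m x)\<^sup>2)) = ennreal r" "0 \<le> r" by (cases "(SUP m. ennreal ((S m x)\<^sup>2))") auto
    have "S m x \<le> sqrt r" for m
    proof -
      have "ennreal ((S m x)\<^sup>2) \<le> ennreal r" unfolding r(1)[symmetric] by (rule SUP_upper) simp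
      then show ?thesis using r(2) by (simp add: real_le_rsqrt)
    qed
    then show "summable (\<lambda>k. norm (u k x))"
      by (intro bounded_imp_summable[where B="sqrt r"]) (auto simp: lessThan_Suc_atMost[symmetric] S_def simp del: sum.lessThan_Suc)
  qed
  define v where "v x = (if summable (\<lambda>k. norm (u k x)) then (\<Sum>k. u k x) else 0)" for x
  have "v = (\<lambda>x. if (\<Sum>k. ennreal (norm (u k x))) \<noteq> top then (\<Sum>k. u k x) else 0)"
  proof
    fix x
    have "summable (\<lambda>k. norm (u k x)) \<longleftrightarrow> (\<Sum>k. ennreal (norm (u k x))) \<noteq> top"
      by (rule iffI) (erule ennreal_suminf_neq_top, simp, rule summable_suminf_not_top, simp_all)
    then show "v x = (if (\<Sum>k. ennreal (norm (u k x))) \<noteq> top then (\<Sum>k. u k x) else 0)"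
      by (simp only: v_def)
  qed
  moreover have "(\<lambda>x. if (\<Sum>k. ennreal (norm (u k x))) \<noteq> top then (\<Sum>k. u k x) else 0) \<in> borel_measurable M"
    by measurable
  ultimately have [measurable]: "v \<in> borel_measurable M" by (simp only:)
  have tail: "L2b M (\<lambda>x. v x - (\<Sum>k<m. u k x)) (\<Sum>k. B (k + m))" for m
  proof (rule L2b_limit[where F="\<lambda>l x. (\<Sum>k<l. u (k + m) x)"])
    have Bm: "summable (\<lambda>k. B (k + m))" using B by (simp add: summable_iff_shift)
    show "L2b M (\<lambda>x. \<Sum>k<l. u (k + m) x) (\<Sum>k. B (k + m))" for l
      by (rule L2b_mono[OF L2b_sum[where a="\<lambda>k. B (k + m)"]]) (use u Bm B0 in \<open>auto intro!: sum_le_suminf\<close>)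
    show "AE x in M. (\<lambda>l. \<Sum>k<l. u (k + m) x) \<longlonglongrightarrow> v x - (\<Sum>k<m. u k x)"
      using sm
    proof eventually_elim
      fix x assume s: "summable (\<lambda>k. norm (u k x))"
      then have s': "summable (\<lambda>k. u k x)" by (rule summable_norm_cancel)
      then have "(\<lambda>k. u (k + m) x) sums (v x - (\<Sum>k<m. u k x))"
        using sums_split_initial_segment[OF summable_sums[OF s'], of m] s by (simp add: v_def)
      then show "(\<lambda>l. \<Sum>k<l. u (k + m) x) \<longlonglongrightarrow> v x - (\<Sum>k<m. u k x)" by (simp add: sums_def)
    qed
  qed measurable
  show thesis
  proof (rule that[of v])
    show "L2b M v (suminf B)" using tail[of 0] by simp
    show "\<forall>x. (\<forall>k. u k x = 0) \<longrightarrow> v x = 0" by (simp add: v_def)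
  qed (rule tail)
qed

text \<open>Integrates \<open>|g| <= s/2 + |g|^2/(2 s)\<close> with the optimal \<open>s\<close>,
  the ratio of the two bounds; degenerate bounds are again reached by a limit.\<close>

lemma L2b_cauchy_schwarz:
  fixes g :: "'a \<Rightarrow> 'b::{banach,second_countable_topology}"
  assumes g: "L2b M g c" and fin: "emeasure M (space M) \<le> ennreal m" and m: "0 \<le> m"
  shows "integrable M g" "norm (\<integral>x. g x \<partial>M) \<le> sqrt m * c"
proof -
  have [measurable]: "g \<in> borel_measurable M" and c: "0 \<le> c" using L2bD[OF g] by auto
  have pos: "(\<integral>\<^sup>+x. ennreal (norm (g x)) \<partial>M) \<le> ennreal (m' * c')"
    if "0 < c'" "0 < m'" "c \<le> c'" "m \<le> m'\<^sup>2" for c' m'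
  proof -
    let ?s = "c' / m'"
    have "(\<integral>\<^sup>+x. ennreal (norm (g x)) \<partial>M) \<le> (\<integral>\<^sup>+x. ennreal (?s / 2) + ennreal (1 / (2 * ?s)) * ennreal ((norm (g x))\<^sup>2) \<partial>M)"
    proof (rule nn_integral_mono)
      fix x
      have "0 \<le> (norm (g x) - ?s)\<^sup>2 / (2 * ?s)" using that by simp
      also have "\<dots> = ?s / 2 + 1 / (2 * ?s) * (norm (g x))\<^sup>2 - norm (g x)"
        using that by (simp add: field_simps power2_eq_square)
      finally show "ennreal (norm (g x)) \<le> ennreal (?s / 2) + ennreal (1 / (2 * ?s)) * ennreal ((norm (g x))\<^sup>2)"
        using that by (simp flip: ennreal_mult ennreal_plus)
    qed
    also have "\<dots> = ennreal (?s / 2) * emeasure M (space M) + ennreal (1 / (2 * ?s)) * (sqint M g)"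
      by (subst nn_integral_add) (simp_all add: nn_integral_cmult)
    also have "\<dots> \<le> ennreal (?s / 2) * ennreal (m'\<^sup>2) + ennreal (1 / (2 * ?s)) * ennreal (c'\<^sup>2)"
      using that c L2bD(3)[OF g] fin m
      by (intro add_mono mult_left_mono) (auto elim!: order_trans intro!: ennreal_leI power_mono)
    also have "\<dots> = ennreal (?s / 2 * m'\<^sup>2 + 1 / (2 * ?s) * c'\<^sup>2)"
      using that by (simp flip: ennreal_mult ennreal_plus)
    also have "?s / 2 * m'\<^sup>2 + 1 / (2 * ?s) * c'\<^sup>2 = m' * c'"
      using that by (simp add: field_simps power2_eq_square)
    finally show ?thesis .
  qed
  have "(\<integral>\<^sup>+x. ennreal (norm (g x)) \<partial>M) \<le> ennreal ((sqrt m + 1) * (c + 1))"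
    by (rule pos) (use c m in \<open>auto simp: add_nonneg_pos power2_sum\<close>)
  also have "\<dots> < \<infinity>" by simp
  finally show "integrable M g" by (intro integrableI_bounded) auto
  have lim: "((\<lambda>e. ennreal ((sqrt m + e) * (c + e))) \<longlongrightarrow> ennreal ((sqrt m + 0) * (c + 0))) (at_right 0)"
    by (intro tendsto_intros)
  have "(\<integral>\<^sup>+x. ennreal (norm (g x)) \<partial>M) \<le> ennreal ((sqrt m + 0) * (c + 0))"
  proof (rule tendsto_lowerbound[OF lim])
    have "(\<integral>\<^sup>+x. ennreal (norm (g x)) \<partial>M) \<le> ennreal ((sqrt m + e) * (c + e))" if "e > 0" for e
      by (rule pos) (use c m that in \<open>auto simp: add_nonneg_pos power2_sum\<close>)
    then show "\<forall>\<^sub>F e in at_right 0. (\<integral>\<^sup>+x. ennreal (norm (g x)) \<partial>M) \<le> ennreal ((sqrt m + e) * (c + e))"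
      by (intro eventually_mono[OF eventually_at_right_less[of 0]])
  qed simp
  moreover have "ennreal (norm (\<integral>x. g x \<partial>M)) \<le> (\<integral>\<^sup>+x. ennreal (norm (g x)) \<partial>M)"
    by (rule integral_norm_bound_ennreal) fact
  ultimately have "ennreal (norm (\<integral>x. g x \<partial>M)) \<le> ennreal (sqrt m * c)" by simp
  then show "norm (\<integral>x. g x \<partial>M) \<le> sqrt m * c"
    using m c by (subst (asm) ennreal_le_iff) auto
qed

lemma L2_iff_L2b: "f \<in> L2 M \<longleftrightarrow> (\<exists>a. L2b M f a)"
proof
  assume f: "f \<in> L2 M"
  then have "sqint M f = ennreal (LINT x|M. (norm (f x))\<^sup>2)"
    by (intro nn_integral_eq_integral) (auto simp: L2_def)
  then show "\<exists>a. L2b M f a" using f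
    by (intro exI[of _ "sqrt (LINT x|M. (norm (f x))\<^sup>2)"]) (simp add: L2b_def L2_def)
next
  assume "\<exists>a. L2b M f a"
  then obtain a where f: "L2b M f a" by auto
  then have [measurable]: "f \<in> borel_measurable M" by (rule L2bD)
  have "sqint M f < \<infinity>"
    using L2bD(3)[OF f] by (rule order_le_less_trans) simp
  then show "f \<in> L2 M" by (auto simp: L2_def intro!: integrableI_bounded)
qed

lemma L2b_integral_le:
  assumes "L2b M f a"
  shows "(LINT x|M. (norm (f x))\<^sup>2) \<le> a\<^sup>2"
  using L2bD[OF assms] by (intro integral_real_bounded) auto

section \<open>Square summable families, through their finite subfamilies\<close>

definition l2b :: "('i \<Rightarrow> 'a::real_normed_vector) \<Rightarrow> real \<Rightarrow> bool" where
  "l2b a B \<longleftrightarrow> (\<forall>F. finite F \<longrightarrow> L2_set (\<lambda>n. norm (a n)) F \<le> B)"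

lemma l2bD: "l2b a B \<Longrightarrow> finite F \<Longrightarrow> L2_set (\<lambda>n. norm (a n)) F \<le> B"
  by (simp add: l2b_def)

lemma l2b_nonneg: "l2b a B \<Longrightarrow> 0 \<le> B"
  using l2bD[of a B "{}"] by simp

lemma l2b_mono: "l2b a B \<Longrightarrow> B \<le> C \<Longrightarrow> l2b a C"
  unfolding l2b_def using order_trans by blast

lemma l2b_component: "l2b a B \<Longrightarrow> norm (a n) \<le> B"
  using l2bD[of a B "{n}"] by simp

lemma l2b_add: "l2b a A \<Longrightarrow> l2b b B \<Longrightarrow> l2b (\<lambda>n. a n + b n) (A + B)"
proof (unfold l2b_def, intro allI impI)
  fix F :: "'a set"
  assume a: "\<forall>F. finite F \<longrightarrow> L2_set (\<lambda>n. norm (a n)) F \<le> A"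
    and b: "\<forall>F. finite F \<longrightarrow> L2_set (\<lambda>n. norm (b n)) F \<le> B" and F: "finite F"
  have "L2_set (\<lambda>n. norm (a n + b n)) F \<le> L2_set (\<lambda>n. norm (a n) + norm (b n)) F"
    by (rule L2_set_mono) (auto intro: norm_triangle_ineq)
  also have "\<dots> \<le> L2_set (\<lambda>n. norm (a n)) F + L2_set (\<lambda>n. norm (b n)) F"
    by (rule L2_set_triangle_ineq)
  also have "\<dots> \<le> A + B" using a b F by (intro add_mono) auto
  finally show "L2_set (\<lambda>n. norm (a n + b n)) F \<le> A + B" .
qed

lemma l2b_le:
  assumes "l2b a A" "\<And>n. norm (b n) \<le> c * norm (a n)" "0 \<le> c"
  shows "l2b b (c * A)"
proof (unfold l2b_def, intro allI impI)
  fix F :: "'a set" assume F: "finite F"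
  have "L2_set (\<lambda>n. norm (b n)) F \<le> L2_set (\<lambda>n. c * norm (a n)) F"
    by (rule L2_set_mono) (use assms in auto)
  also have "\<dots> = c * L2_set (\<lambda>n. norm (a n)) F" using assms by (simp add: L2_set_right_distrib)
  also have "\<dots> \<le> c * A" using assms F by (intro mult_left_mono l2bD) auto
  finally show "L2_set (\<lambda>n. norm (b n)) F \<le> c * A" .
qed

lemma l2b_minus: "l2b a A \<Longrightarrow> l2b (\<lambda>n. - a n) A"
  by (simp add: l2b_def)

lemma l2b_iff_sum:
  assumes "0 \<le> B"
  shows "l2b a B \<longleftrightarrow> (\<forall>F. finite F \<longrightarrow> (\<Sum>n\<in>F. (norm (a n))\<^sup>2) \<le> B\<^sup>2)"
proof -
  have "sqrt x \<le> B \<longleftrightarrow> x \<le> B\<^sup>2" if "0 \<le> x" for x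
    using assms that real_sqrt_le_iff[of x "B\<^sup>2"] by simp
  then show ?thesis by (simp add: l2b_def L2_set_def sum_nonneg)
qed

text \<open>A finite set that nearly exhausts the supremum of the finite square sums leaves at most
  \<open>e^2\<close> for every finite set disjoint from it.\<close>

lemma l2b_tail:
  fixes a :: "int \<Rightarrow> 'a::real_normed_vector"
  assumes a: "l2b a A" and e: "0 < e"
  obtains m :: nat where "l2b (\<lambda>n. if \<bar>n\<bar> \<le> int m then 0 else a n) e"
proof -
  let ?s = "\<lambda>F. \<Sum>n\<in>F. (norm (a n))\<^sup>2"
  let ?X = "?s ` {F. finite F}"
  have A: "0 \<le> A" using l2b_nonneg[OF a] .
  have bdd: "bdd_above ?X"
    using a A by (intro bdd_aboveI[of _ "A\<^sup>2"]) (auto simp: l2b_iff_sum)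
  obtain F0 where F0: "finite F0" "Sup ?X - e\<^sup>2 < ?s F0"
  proof -
    have "Sup ?X - e\<^sup>2 < Sup ?X" using e by simp
    then obtain y where "y \<in> ?X" "Sup ?X - e\<^sup>2 < y" by (rule less_cSupE) auto
    then show thesis using that by auto
  qed
  obtain m :: nat where m: "\<And>n. n \<in> F0 \<Longrightarrow> \<bar>n\<bar> \<le> int m"
  proof -
    have "finite ((\<lambda>n. nat \<bar>n\<bar>) ` F0)" using F0 by simp
    then obtain m where "\<forall>k\<in>(\<lambda>n. nat \<bar>n\<bar>) ` F0. k \<le> m" using finite_nat_set_iff_bounded_le by blast
    then show thesis by (intro that[of m]) force
  qed
  show thesis
  proof (rule that[of m])
    have "(\<Sum>n\<in>F. (norm (if \<bar>n\<bar> \<le> int m then 0 else a n))\<^sup>2) \<le> e\<^sup>2" if F: "finite F" for F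
    proof -
      let ?G = "{n\<in>F. \<not> \<bar>n\<bar> \<le> int m}"
      have "(\<Sum>n\<in>F. (norm (if \<bar>n\<bar> \<le> int m then 0 else a n))\<^sup>2) = ?s ?G"
        using F by (intro sum.mono_neutral_cong_right) auto
      moreover have "?s (F0 \<union> ?G) = ?s F0 + ?s ?G"
        using F F0 m by (intro sum.union_disjoint) auto
      moreover have "?s (F0 \<union> ?G) \<le> Sup ?X"
        by (intro cSup_upper bdd imageI) (use F F0 in auto)
      ultimately show ?thesis using F0 by linarith
    qed
    then show "l2b (\<lambda>n. if \<bar>n\<bar> \<le> int m then 0 else a n) e" using e by (simp add: l2b_iff_sum)
  qed
qed

section \<open>Fourier coefficients on the circle\<close>

abbreviation ee :: "int \<Rightarrow> real \<Rightarrow> complex" where "ee n x \<equiv> cis (of_int n * x)"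

lemma torus_measure_finite: "emeasure torus_measure (space torus_measure) \<le> ennreal (2 * pi)"
  by (simp add: emeasure_restrict_space space_restrict_space)

lemma sigma_finite_torus: "sigma_finite_measure torus_measure"
  by (intro sigma_finite_measure_restrict_space sigma_finite_lborel) simp

lemma finite_measure_torus: "finite_measure torus_measure"
  using torus_measure_finite by (intro finite_measureI) (auto simp: top_unique)

lemma integral_torus: "(LINT x|torus_measure. f x) = (LINT x:{0..<2*pi}|lborel. f x)"
  for f :: "real \<Rightarrow> 'a::{banach,second_countable_topology}"
  by (simp add: integral_restrict_space set_lebesgue_integral_def)

lemma integrable_torus_continuous:
  fixes f :: "real \<Rightarrow> 'a::{banach,second_countable_topology}"
  assumes "continuous_on UNIV f"
  shows "integrable torus_measure f"
proof -
  have c: "continuous_on {0..2*pi} f" using assms continuous_on_subset by blast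
  have "set_integrable lborel {0..2*pi} f"
    unfolding set_integrable_def by (rule borel_integrable_compact) (use c in auto)
  then have "set_integrable lborel {0..<2*pi} f"
    by (rule set_integrable_subset) auto
  then show ?thesis by (simp add: integrable_restrict_space set_integrable_def)
qed

lemma integral_ee: "(LINT x|torus_measure. ee n x) = (if n = 0 then 2 * pi else 0)"
proof -
  have "(LINT x:{0..<2*pi}|lborel. ee n x) = (LINT x:{0..2*pi}|lborel. ee n x)"
    by (rule set_integral_discrete_difference[where X="{2*pi}"]) auto
  also have "\<dots> = (if n = 0 then 2 * pi else 0)"
  proof (cases "n = 0")
    case False
    define F where "F x = (1 / (\<i> * of_int n)) * ee n x" for x
    have F: "(F has_vector_derivative ee n x) (at x within {0..2*pi})" for x
    proof -
      have "((\<lambda>z. (1 / (\<i> * of_int n)) * exp (\<i> * of_int n * z)) has_field_derivative exp (\<i> * of_int n * of_real x)) (at (of_real x))"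
        using False by (auto intro!: derivative_eq_intros)
      from has_vector_derivative_real_field[OF this]
      show ?thesis unfolding F_def by (simp add: cis_conv_exp mult.assoc)
    qed
    have "(LBINT x:{0..2*pi}. ee n x) = F (2*pi) - F 0"
      unfolding set_lebesgue_integral_def by (rule integral_FTC_atLeastAtMost) (use F in \<open>auto intro!: continuous_intros\<close>)
    also have "\<dots> = 0"
      using cis_multiple_2pi[of "of_int n"] by (simp add: F_def mult.commute mult.left_commute)
    finally show ?thesis using False by simp
  qed (simp add: set_lebesgue_integral_def scaleR_conv_of_real)
  finally show ?thesis by (simp add: integral_torus)
qed

lemma measurable_torus_cont: "continuous_on UNIV f \<Longrightarrow> f \<in> borel_measurable torus_measure"
  by (intro measurable_restrict_space1) (simp add: borel_measurable_continuous_onI)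

lemma continuous_on_ee [continuous_intros]: "continuous_on S (\<lambda>x. ee n x)"
  by (intro continuous_intros)

lemma borel_measurable_ee [measurable]: "(\<lambda>x. ee n x) \<in> borel_measurable torus_measure"
  by (intro measurable_torus_cont continuous_intros)

lemma borel_measurable_vector_smult:
  fixes f :: "'a \<Rightarrow> complex^'n"
  assumes [measurable]: "c \<in> borel_measurable M" "f \<in> borel_measurable M"
  shows "(\<lambda>x. c x *s f x) \<in> borel_measurable M"
proof (rule borel_measurable_continuous_Pair[OF assms])
  have "continuous_on UNIV (\<lambda>x::complex \<times> (complex^'n). \<chi> i. fst x * snd x $ i)"
    by (intro continuous_on_vec_lambda continuous_intros)
  then show "continuous_on UNIV (\<lambda>x::complex \<times> (complex^'n). fst x *s snd x)"
    by (simp add: vector_scalar_mult_def)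
qed

lemma inner_smult_right: "inner (v::complex^'n) (c *s w) = inner (cnj c *s v) w"
  by (simp add: inner_vec_def inner_complex_def algebra_simps)

lemma L2b_torus_integrable:
  fixes f :: "real \<Rightarrow> complex^'n"
  assumes "L2b torus_measure f a"
  shows "integrable torus_measure f" "integrable torus_measure (\<lambda>x. ee n x *s f x)"
proof -
  show "integrable torus_measure f"
    using L2b_cauchy_schwarz(1)[OF assms torus_measure_finite] by simp
  have "L2b torus_measure (\<lambda>x. ee n x *s f x) (1 * a)"
    using L2bD(2)[OF assms] by (intro L2b_le[OF assms] borel_measurable_vector_smult) (auto simp: norm_vector_smult)
  then show "integrable torus_measure (\<lambda>x. ee n x *s f x)"
    using L2b_cauchy_schwarz(1)[OF _ torus_measure_finite] by simp
qed

lemma fourier_coeff_add: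
  assumes "L2b torus_measure f a" "L2b torus_measure g b"
  shows "fourier_coeff (\<lambda>x. f x + g x) n = fourier_coeff f n + fourier_coeff g n"
  using L2b_torus_integrable(2)[OF assms(1), of "-n"] L2b_torus_integrable(2)[OF assms(2), of "-n"]
  by (simp add: fourier_coeff_def vector_add_ldistrib scaleR_add_right)

lemma fourier_coeff_bounded_linear:
  assumes "L2b torus_measure f a" "bounded_linear R" "\<And>c v. R (c *s v) = c *s R v"
  shows "fourier_coeff (\<lambda>x. R (f x)) n = R (fourier_coeff f n)"
  using integral_bounded_linear[OF assms(2) L2b_torus_integrable(2)[OF assms(1), of "-n"]]
  by (simp add: fourier_coeff_def assms(3) linear_scale[OF bounded_linear.linear[OF assms(2)]])

definition trig :: "int set \<Rightarrow> (int \<Rightarrow> complex^'n) \<Rightarrow> real \<Rightarrow> complex^'n" where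
  "trig F c x = (\<Sum>n\<in>F. ee n x *s c n)"

lemma continuous_on_trig: "continuous_on S (trig F c)"
proof -
  have "continuous_on S (\<lambda>x. \<Sum>n\<in>F. (\<chi> i. ee n x * c n $ i))"
    by (intro continuous_on_sum continuous_on_vec_lambda continuous_intros)
  then show ?thesis by (simp add: trig_def[abs_def] vector_scalar_mult_def)
qed

lemma inner_trig_integral:
  fixes f :: "real \<Rightarrow> complex^'n"
  assumes "L2b torus_measure f a" "finite F"
  shows "integrable torus_measure (\<lambda>x. inner (f x) (trig F c x))"
    and "(LINT x|torus_measure. inner (f x) (trig F c x)) = 2 * pi * (\<Sum>n\<in>F. inner (fourier_coeff f n) (c n))"
proof -
  have eq: "inner (f x) (trig F c x) = (\<Sum>n\<in>F. inner (ee (- n) x *s f x) (c n))" for x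
    by (simp add: trig_def inner_sum_right inner_smult_right cis_cnj)
  have i: "integrable torus_measure (\<lambda>x. inner (ee (- n) x *s f x) (c n))" for n
    by (intro integrable_inner_left L2b_torus_integrable(2)[OF assms(1)])
  show "integrable torus_measure (\<lambda>x. inner (f x) (trig F c x))"
    unfolding eq by (intro Bochner_Integration.integrable_sum i)
  have "(LINT x|torus_measure. inner (f x) (trig F c x)) = (\<Sum>n\<in>F. LINT x|torus_measure. inner (ee (- n) x *s f x) (c n))"
    unfolding eq by (intro Bochner_Integration.integral_sum i)
  also have "\<dots> = (\<Sum>n\<in>F. inner (LINT x|torus_measure. ee (- n) x *s f x) (c n))"
    by (intro sum.cong refl integral_inner_left) (use L2b_torus_integrable(2)[OF assms(1)] in blast)
  also have "\<dots> = 2 * pi * (\<Sum>n\<in>F. inner (fourier_coeff f n) (c n))"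
    by (simp add: fourier_coeff_def sum_distrib_left)
  finally show "(LINT x|torus_measure. inner (f x) (trig F c x)) = 2 * pi * (\<Sum>n\<in>F. inner (fourier_coeff f n) (c n))" .
qed

lemma L2b_trig_ex: "\<exists>a. L2b torus_measure (trig F c) a"
proof -
  have "trig F c \<in> L2 torus_measure"
    unfolding L2_def
    by (auto intro!: measurable_torus_cont integrable_torus_continuous continuous_intros continuous_on_trig)
  then show ?thesis by (simp add: L2_iff_L2b)
qed

lemma fourier_coeff_trig:
  assumes "finite F"
  shows "fourier_coeff (trig F c) n = (if n \<in> F then c n else 0)"
proof -
  have i: "integrable torus_measure (\<lambda>x. ee (- n) x *s (ee m x *s c m))" for m
  proof -
    have "continuous_on UNIV (\<lambda>x. \<chi> i. ee (- n) x * (ee m x * c m $ i))"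
      by (intro continuous_on_vec_lambda continuous_intros)
    then show ?thesis by (intro integrable_torus_continuous) (simp add: vector_scalar_mult_def)
  qed
  have "(LINT x|torus_measure. ee (- n) x *s trig F c x) = (\<Sum>m\<in>F. LINT x|torus_measure. ee (- n) x *s (ee m x *s c m))"
    unfolding trig_def using i by (simp add: vec.scale_sum_right)
  also have "\<dots> = (\<Sum>m\<in>F. (if m = n then 2 * pi else 0) *\<^sub>R c m)"
  proof (rule sum.cong[OF refl])
    fix m
    have eq: "ee (- n) x *s (ee m x *s c m) = ee (m - n) x *s c m" for x
      by (simp add: cis_mult vector_smult_assoc algebra_simps)
    have bl: "bounded_linear (\<lambda>z::complex. z *s c m)"
    proof -
      have "bounded_linear (\<lambda>z::complex. mat z *v c m)"
        by (intro bounded_linear_compose[OF bounded_bilinear.bounded_linear_left[OF bounded_bilinear_matrix_vector]]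
           linear_conv_bounded_linear[THEN iffD1])
          (auto intro!: linearI simp: mat_def vec_eq_iff)
      then show ?thesis by (simp add: mat_mult_vec)
    qed
    have "(LINT x|torus_measure. ee (m - n) x *s c m) = (LINT x|torus_measure. ee (m - n) x) *s c m"
      by (rule integral_bounded_linear[OF bl]) (intro integrable_torus_continuous continuous_intros)
    also have "\<dots> = (if m = n then 2 * pi else 0) *\<^sub>R c m"
      unfolding integral_ee by (simp add: vec_eq_iff) (simp add: scaleR_conv_of_real)
    finally show "(LINT x|torus_measure. ee (- n) x *s (ee m x *s c m)) = (if m = n then 2 * pi else 0) *\<^sub>R c m"
      by (simp only: eq)
  qed
  also have "\<dots> = (\<Sum>m\<in>F. if m = n then (2 * pi) *\<^sub>R c n else 0)" by (intro sum.cong) auto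
  also have "\<dots> = (if n \<in> F then (2 * pi) *\<^sub>R c n else 0)" using assms by (rule sum.delta)
  finally show ?thesis by (simp add: fourier_coeff_def)
qed

lemma norm_trig_integral:
  assumes "finite F"
  shows "(LINT x|torus_measure. (norm (trig F c x))\<^sup>2) = 2 * pi * (\<Sum>n\<in>F. (norm (c n))\<^sup>2)"
proof -
  obtain a where "L2b torus_measure (trig F c) a" using L2b_trig_ex by blast
  from inner_trig_integral(2)[OF this assms, of c] show ?thesis
    by (simp add: power2_norm_eq_inner fourier_coeff_trig[OF assms] cong: sum.cong)
qed

lemma L2b_trig:
  assumes "finite F" "L2_set (\<lambda>n. norm (c n)) F \<le> B"
  shows "L2b torus_measure (trig F c) (sqrt (2 * pi) * B)"
proof -
  have B: "0 \<le> B" using assms(2) L2_set_nonneg[of "\<lambda>n. norm (c n)" F] by linarith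
  have i: "integrable torus_measure (\<lambda>x. (norm (trig F c x))\<^sup>2)"
    by (intro integrable_torus_continuous continuous_intros continuous_on_trig)
  have "(\<Sum>n\<in>F. (norm (c n))\<^sup>2) = (L2_set (\<lambda>n. norm (c n)) F)\<^sup>2"
    by (simp add: L2_set_def sum_nonneg)
  also have "\<dots> \<le> B\<^sup>2" using assms(2) by (intro power_mono) auto
  finally have "(LINT x|torus_measure. (norm (trig F c x))\<^sup>2) \<le> (sqrt (2 * pi) * B)\<^sup>2"
    by (simp add: norm_trig_integral[OF assms(1)] power_mult_distrib)
  then show ?thesis
    using B nn_integral_eq_integral[OF i] by (auto simp: L2b_def intro!: measurable_torus_cont continuous_on_trig)
qed

lemma bessel:
  fixes f :: "real \<Rightarrow> complex^'n"
  assumes f: "L2b torus_measure f a"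
  shows "l2b (fourier_coeff f) (a / sqrt (2 * pi))"
proof -
  have a: "0 \<le> a" using L2bD[OF f] by simp
  have [measurable]: "f \<in> borel_measurable torus_measure" using L2bD[OF f] by simp
  have "(\<Sum>n\<in>F. (norm (fourier_coeff f n))\<^sup>2) \<le> (a / sqrt (2 * pi))\<^sup>2" if F: "finite F" for F
  proof -
    let ?g = "trig F (fourier_coeff f)" and ?S = "\<Sum>n\<in>F. (norm (fourier_coeff f n))\<^sup>2"
    have i1: "integrable torus_measure (\<lambda>x. (norm (f x))\<^sup>2)"
      using f L2_iff_L2b[of f torus_measure] by (auto simp: L2_def)
    have i2: "integrable torus_measure (\<lambda>x. inner (f x) (?g x))"
      by (rule inner_trig_integral(1)[OF f F])
    have i3: "integrable torus_measure (\<lambda>x. (norm (?g x))\<^sup>2)"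
      by (intro integrable_torus_continuous continuous_intros continuous_on_trig)
    have sq: "(norm (u - v))\<^sup>2 = (norm u)\<^sup>2 - 2 * inner u v + (norm v)\<^sup>2" for u v :: "complex^'n"
      unfolding power2_norm_eq_inner inner_diff_left inner_diff_right by (simp add: inner_commute[of v u])
    have "0 \<le> (LINT x|torus_measure. (norm (f x - ?g x))\<^sup>2)" by simp
    also have "\<dots> = (LINT x|torus_measure. (norm (f x))\<^sup>2 - 2 * inner (f x) (?g x) + (norm (?g x))\<^sup>2)"
      by (simp only: sq)
    also have "\<dots> = (LINT x|torus_measure. (norm (f x))\<^sup>2) - 2 * (2 * pi * ?S) + 2 * pi * ?S"
      using i1 i2 i3 by (simp add: inner_trig_integral(2)[OF f F] norm_trig_integral[OF F] flip: power2_norm_eq_inner)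
    finally have "2 * pi * ?S \<le> a\<^sup>2" using L2b_integral_le[OF f] by simp
    then show ?thesis by (simp add: power_divide field_simps)
  qed
  then show ?thesis using a by (simp add: l2b_iff_sum)
qed

lemma trig_diff: "trig F c x - trig F d x = trig F (\<lambda>n. c n - d n) x"
  by (simp add: trig_def sum_subtractf[symmetric] vector_ssub_ldistrib)

text \<open>The symmetric partial sums are Cauchy; a subsequence with geometric increments is summed
  as a series. Convergence of all symmetric partial sums is kept as a conclusion, because two
  realisations are later compared through it.\<close>

lemma riesz_fischer:
  fixes a :: "int \<Rightarrow> complex^'n"
  assumes a: "l2b a A"
  obtains f where "L2b torus_measure f (sqrt (2 * pi) * A)"
    and "\<And>n. fourier_coeff f n = a n"
    and "\<And>e. 0 < e \<Longrightarrow> \<exists>m0. \<forall>m\<ge>m0. L2b torus_measure (\<lambda>x. f x - trig {-int m..int m} a x) e"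
proof -
  have A: "0 \<le> A" using l2b_nonneg[OF a] .
  define S where "S m = trig {-int m..int m} a" for m
  have "\<exists>m. \<forall>l\<ge>m. L2b torus_measure (\<lambda>x. S l x - S m x) e" if e: "0 < e" for e
  proof -
    obtain m where m: "l2b (\<lambda>n. if \<bar>n\<bar> \<le> int m then 0 else a n) (e / sqrt (2 * pi))"
      using l2b_tail[OF a, of "e / sqrt (2 * pi)"] e by auto
    have "L2b torus_measure (\<lambda>x. S l x - S m x) e" if "l \<ge> m" for l
    proof -
      have sub: "{-int m..int m} \<subseteq> {-int l..int l}" using that by auto
      have "S l x - S m x = trig {-int l..int l} (\<lambda>n. if \<bar>n\<bar> \<le> int m then 0 else a n) x" for x
      proof -
        have "trig {-int l..int l} (\<lambda>n. if \<bar>n\<bar> \<le> int m then 0 else a n) x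
          = (\<Sum>n\<in>{-int l..int l} - {-int m..int m}. ee n x *s a n)"
          unfolding trig_def by (intro sum.mono_neutral_cong_right) auto
        then show ?thesis using sum_diff[OF _ sub, of "\<lambda>n. ee n x *s a n"] by (simp add: S_def trig_def)
      qed
      moreover have "L2b torus_measure (trig {-int l..int l} (\<lambda>n. if \<bar>n\<bar> \<le> int m then 0 else a n)) (sqrt (2 * pi) * (e / sqrt (2 * pi)))"
        by (intro L2b_trig l2bD[OF m]) auto
      ultimately show ?thesis by simp
    qed
    then show ?thesis by blast
  qed
  then have "\<exists>m. \<forall>l\<ge>m. L2b torus_measure (\<lambda>x. S l x - S m x) ((1/2)^k)" for k by simp
  then obtain M where M: "\<And>k l. l \<ge> M k \<Longrightarrow> L2b torus_measure (\<lambda>x. S l x - S (M k) x) ((1/2)^k)"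
    by metis
  \<comment> \<open>Adding all \<open>M i\<close> and \<open>k\<close> makes both \<open>N k\<close>
    and \<open>N (Suc k)\<close> at least \<open>M k\<close>, so that consecutive terms can be
    compared through \<open>S (M k)\<close>.\<close>
  define N where "N k = (\<Sum>i\<le>k. M i) + k" for k
  have N: "N k \<ge> M k" "N (Suc k) \<ge> M k" "N k \<ge> k" for k
    using member_le_sum[of k "{..k}" M] member_le_sum[of k "{..Suc k}" M] by (auto simp: N_def)
  have B: "L2b torus_measure (\<lambda>x. S (N (Suc k)) x - S (N k) x) (2 * (1/2)^k)" for k
    using L2b_diff[OF M[OF N(2)[of k]] M[OF N(1)[of k]]] by simp
  have sumB: "summable (\<lambda>k. 2 * (1/2::real)^k)" by (intro summable_mult summable_geometric) simp
  obtain v where "L2b torus_measure v (\<Sum>k. 2 * (1/2)^k)"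
    and v: "\<And>m. L2b torus_measure (\<lambda>x. v x - (\<Sum>k<m. S (N (Suc k)) x - S (N k) x)) (\<Sum>k. 2 * (1/2)^(k + m))"
    and "\<forall>x. (\<forall>k. S (N (Suc k)) x - S (N k) x = 0) \<longrightarrow> v x = 0"
    by (rule L2b_series[OF B sumB]) blast
  define f where "f x = v x + S (N 0) x" for x
  have tail: "L2b torus_measure (\<lambda>x. f x - S (N m) x) (4 * (1/2)^m)" for m
  proof -
    have "f x - S (N m) x = v x - (\<Sum>k<m. S (N (Suc k)) x - S (N k) x)" for x
      unfolding f_def sum_lessThan_telescope[of "\<lambda>k. S (N k) x"] by simp
    moreover have "(\<Sum>k. 2 * (1/2::real)^(k + m)) = 4 * (1/2)^m"
      using suminf_mult[OF summable_geometric[of "1/2::real"], of "2 * (1/2)^m"] suminf_geometric[of "1/2::real"]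
      by (simp add: power_add mult_ac)
    ultimately show ?thesis using v[of m] by (simp only:)
  qed
  have conv: "\<exists>m0. \<forall>m\<ge>m0. L2b torus_measure (\<lambda>x. f x - S m x) e" if e: "0 < e" for e
  proof -
    obtain k where k: "(1/2::real) ^ k < e / 6" using real_arch_pow_inv[of "e/6" "1/2::real"] e by auto
    have "L2b torus_measure (\<lambda>x. f x - S m x) e" if m: "m \<ge> N k" for m
    proof -
      have "L2b torus_measure (\<lambda>x. (f x - S (N k) x) - ((S m x - S (M k) x) - (S (N k) x - S (M k) x))) (4 * (1/2)^k + ((1/2)^k + (1/2)^k))"
        by (intro L2b_diff tail M) (use m N(1)[of k] in auto)
      then show ?thesis using k by (auto intro: L2b_mono)
    qed
    then show ?thesis by blast
  qed
  have S: "L2b torus_measure (S m) (sqrt (2 * pi) * A)" for m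
    unfolding S_def by (intro L2b_trig l2bD[OF a]) auto
  have fa: "fourier_coeff f n = a n" for n
  proof -
    have "norm (fourier_coeff f n - a n) \<le> e" if e: "0 < e" for e
    proof -
      obtain m0 where m0: "\<And>m. m \<ge> m0 \<Longrightarrow> L2b torus_measure (\<lambda>x. f x - S m x) e" using conv[OF e] by auto
      define m where "m = max m0 (nat \<bar>n\<bar>)"
      have L: "L2b torus_measure (\<lambda>x. f x - S m x) e" by (rule m0) (simp add: m_def)
      have "fourier_coeff (\<lambda>x. (f x - S m x) + S m x) n = fourier_coeff (\<lambda>x. f x - S m x) n + fourier_coeff (S m) n"
        by (rule fourier_coeff_add[OF L S])
      moreover have "fourier_coeff (S m) n = a n"
        by (auto simp: S_def fourier_coeff_trig m_def)
      ultimately have "norm (fourier_coeff f n - a n) \<le> e / sqrt (2 * pi)"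
        using l2b_component[OF bessel[OF L], of n] by simp
      also have "\<dots> \<le> e / 1"
      proof (intro divide_left_mono)
        have "1 \<le> 2 * pi" using pi_ge_two by linarith
        then show "1 \<le> sqrt (2 * pi)" by simp
      qed (use e in auto)
      finally show ?thesis by simp
    qed
    then have "norm (fourier_coeff f n - a n) \<le> 0" by (rule field_le_epsilon) simp
    then show ?thesis by simp
  qed
  have "L2b torus_measure f (sqrt (2 * pi) * A)"
  proof -
    have "L2b torus_measure f (sqrt (2 * pi) * A + e)" if e: "0 < e" for e
    proof -
      obtain m where "L2b torus_measure (\<lambda>x. f x - S m x) e" using conv[OF e] by auto
      from L2b_add[OF S[of m] this] show ?thesis by (simp add: add.commute)
    qed
    then show ?thesis by (rule L2b_epsilon) (use A in auto)
  qed
  then show thesis using that[of f] fa conv unfolding S_def by blast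
qed

section \<open>Controls and their moments\<close>

abbreviation QM :: "(real \<times> real) measure" where "QM \<equiv> lborel \<Otimes>\<^sub>M torus_measure"

definition uhat :: "(real \<times> real \<Rightarrow> complex^'n) \<Rightarrow> real \<Rightarrow> int \<Rightarrow> complex^'n" where
  "uhat u t n = fourier_coeff (\<lambda>x. u (t, x)) n"

text \<open>The support condition holds at every point and the bound on the whole time axis, so
  controls on different time intervals are concatenated by addition, without restricting
  domains.\<close>

definition ctl :: "complex set \<Rightarrow> real \<Rightarrow> real \<Rightarrow> real \<Rightarrow> (real \<times> real \<Rightarrow> complex^'n) \<Rightarrow> bool" where
  "ctl \<omega> a b A u \<longleftrightarrow> L2b QM u A \<and> (\<forall>t x. u (t, x) \<noteq> 0 \<longrightarrow> a < t \<and> t < b \<and> cis x \<in> \<omega>)"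

text \<open>For a control that acts between times 0 and \<open>T\<close>, this is mode
  \<open>n\<close> at time \<open>T\<close> of the solution started from zero and driven through
  \<open>S n\<close>. The integral runs over all times and is truncated by the support of the
  control; since \<open>T\<close> may be any real number, a moment can be pulled back to an earlier
  time.\<close>

definition mom :: "(int \<Rightarrow> complex^'k^'k) \<Rightarrow> (int \<Rightarrow> complex^'n^'k) \<Rightarrow> real \<Rightarrow> (real \<times> real \<Rightarrow> complex^'n) \<Rightarrow> int \<Rightarrow> complex^'k" where
  "mom G S T u n = (LINT t|lborel. flow (G n) (T - t) (S n *v uhat u t n))"

lemma ctlD:
  assumes "ctl \<omega> a b A u"
  shows "L2b QM u A" "u \<in> borel_measurable QM" "0 \<le> A" "\<And>t x. \<not> (a < t \<and> t < b) \<Longrightarrow> u (t, x) = 0"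
    "\<And>t x. cis x \<notin> \<omega> \<Longrightarrow> u (t, x) = 0"
  using assms by (auto simp: ctl_def L2b_def)

lemma ctl_mono: "ctl \<omega> a b A u \<Longrightarrow> a' \<le> a \<Longrightarrow> b \<le> b' \<Longrightarrow> A \<le> A' \<Longrightarrow> ctl \<omega> a' b' A' u"
  unfolding ctl_def using L2b_mono by force

lemma ctl_zero: "0 \<le> A \<Longrightarrow> ctl \<omega> a b A (\<lambda>_. 0)"
  by (simp add: ctl_def)

lemma ctl_add: "ctl \<omega> a b A u \<Longrightarrow> ctl \<omega> a b B v \<Longrightarrow> ctl \<omega> a b (A + B) (\<lambda>z. u z + v z)"
  unfolding ctl_def by (auto intro!: L2b_add) (metis add_0)+

lemma ctl_minus: "ctl \<omega> a b A u \<Longrightarrow> ctl \<omega> a b A (\<lambda>z. - u z)"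
  by (auto simp: ctl_def L2b_minus)

lemma ctl_diff: "ctl \<omega> a b A u \<Longrightarrow> ctl \<omega> a b B v \<Longrightarrow> ctl \<omega> a b (A + B) (\<lambda>z. u z - v z)"
  using ctl_add[OF _ ctl_minus, of \<omega> a b A u B v] by simp

lemma section_measurable:
  assumes "u \<in> borel_measurable QM"
  shows "(\<lambda>x. u (t, x)) \<in> borel_measurable torus_measure"
  by (rule measurable_compose[OF _ assms]) simp

lemma uhat_measurable:
  assumes [measurable]: "u \<in> borel_measurable QM"
  shows "(\<lambda>t. uhat u t n) \<in> borel_measurable lborel"
proof -
  interpret sigma_finite_measure torus_measure by (rule sigma_finite_torus)
  have "(\<lambda>z. ee (- n) (snd z) *s u z) \<in> borel_measurable QM"
    by (intro borel_measurable_vector_smult assms measurable_compose[OF measurable_snd borel_measurable_ee])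
  then have "(\<lambda>t. LINT x|torus_measure. ee (- n) x *s u (t, x)) \<in> borel_measurable lborel"
    by (intro borel_measurable_lebesgue_integral) (simp add: split_beta')
  then show ?thesis unfolding uhat_def fourier_coeff_def by simp
qed

lemma uhat_eq_0: "(\<And>x. u (t, x) = 0) \<Longrightarrow> uhat u t n = 0"
  by (simp add: uhat_def fourier_coeff_def)

lemma bessel_nn:
  fixes f :: "real \<Rightarrow> complex^'n"
  assumes [measurable]: "f \<in> borel_measurable torus_measure" and F: "finite F"
  shows "(\<Sum>n\<in>F. ennreal ((norm (fourier_coeff f n))\<^sup>2)) \<le> sqint torus_measure f"
proof (cases "sqint torus_measure f")
  case (real r)
  have "L2b torus_measure f (sqrt r)" using real by (simp add: L2b_def)
  from bessel[OF this] have "(\<Sum>n\<in>F. (norm (fourier_coeff f n))\<^sup>2) \<le> (sqrt r / sqrt (2 * pi))\<^sup>2"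
    using real F by (subst (asm) l2b_iff_sum) auto
  also have "\<dots> = r / (2 * pi)" using real by (simp add: power_divide)
  also have "\<dots> \<le> r / 1" using real pi_ge_two by (intro divide_left_mono) auto
  finally show ?thesis using real by (simp add: sum_nonneg)
qed simp

lemma uhat_bessel:
  assumes u: "L2b QM u A" and F: "finite F"
  shows "(\<integral>\<^sup>+t. (\<Sum>n\<in>F. ennreal ((norm (uhat u t n))\<^sup>2)) \<partial>lborel) \<le> ennreal (A\<^sup>2)"
proof -
  interpret sigma_finite_measure torus_measure by (rule sigma_finite_torus)
  have [measurable]: "u \<in> borel_measurable QM" using L2bD[OF u] by simp
  have "(\<integral>\<^sup>+t. (\<Sum>n\<in>F. ennreal ((norm (uhat u t n))\<^sup>2)) \<partial>lborel) \<le>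
    (\<integral>\<^sup>+t. (sqint torus_measure (\<lambda>x. u (t, x))) \<partial>lborel)"
    unfolding uhat_def by (intro nn_integral_mono bessel_nn section_measurable F L2bD(2)[OF u])
  also have "\<dots> = sqint QM u"
    by (rule nn_integral_fst) measurable
  finally show ?thesis using L2bD(3)[OF u] by simp
qed

text \<open>Cauchy-Schwarz in time for each mode, then Bessel in space summed over the modes: an
  operator on controls is bounded into square summable sequences as soon as its kernels are bounded
  uniformly in \<open>n\<close>.\<close>

lemma kernel_bound:
  fixes g :: "int \<Rightarrow> real \<Rightarrow> 'b::{banach,second_countable_topology}"
  assumes u: "L2b QM u A" and ab: "a \<le> b" and k: "0 \<le> k"
    and g [measurable]: "\<And>n. g n \<in> borel_measurable lborel"
    and le: "\<And>n t. a < t \<Longrightarrow> t < b \<Longrightarrow> norm (g n t) \<le> k * norm (uhat u t n)"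
    and z: "\<And>n t. \<not> (a < t \<and> t < b) \<Longrightarrow> g n t = 0"
  shows "integrable lborel (g n)" and "l2b (\<lambda>n. LINT t|lborel. g n t) (k * sqrt (b - a) * A)"
proof -
  have A: "0 \<le> A" using L2bD[OF u] by simp
  have [measurable]: "u \<in> borel_measurable QM" using L2bD[OF u] by simp
  let ?M = "restrict_space lborel {a<..<b}"
  have gR: "(LINT t|lborel. g n t) = (LINT t|?M. g n t)" for n
    unfolding integral_restrict_space[of "{a<..<b}" lborel, simplified]
    by (intro Bochner_Integration.integral_cong) (auto simp: indicator_def z)
  have mass: "emeasure ?M (space ?M) \<le> ennreal (b - a)"
    using ab by (simp add: emeasure_restrict_space)
  \<comment> \<open>Norm in time of the \<open>n\<close>-th Fourier coefficient of the control; by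
    Bessel these numbers are square summable with bound \<open>A\<close>.\<close>
  define c where "c n = sqrt (enn2real (sqint lborel (\<lambda>t. uhat u t n)))" for n
  have fin: "sqint lborel (\<lambda>t. uhat u t n) = ennreal ((c n)\<^sup>2)" for n
  proof -
    have "sqint lborel (\<lambda>t. uhat u t n) \<le> ennreal (A\<^sup>2)"
      using uhat_bessel[OF u, of "{n}"] by simp
    then have "sqint lborel (\<lambda>t. uhat u t n) < top" by (rule order_le_less_trans) simp
    then show ?thesis by (simp add: c_def)
  qed
  have L: "L2b ?M (g n) (k * c n)" for n
  proof -
    have "L2b ?M (\<lambda>t. uhat u t n) (c n)"
      unfolding L2b_def
    proof (intro conjI)
      show "0 \<le> c n" by (simp add: c_def)
      show "(\<lambda>t. uhat u t n) \<in> borel_measurable ?M"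
        by (intro measurable_restrict_space1 uhat_measurable) measurable
      have "sqint ?M (\<lambda>t. uhat u t n) \<le> sqint lborel (\<lambda>t. uhat u t n)"
        by (subst nn_integral_restrict_space) (auto intro!: nn_integral_mono simp: indicator_def)
      then show "sqint ?M (\<lambda>t. uhat u t n) \<le> ennreal ((c n)\<^sup>2)" by (simp add: fin)
    qed
    then show ?thesis
      by (rule L2b_le) (use k le in \<open>auto intro!: measurable_restrict_space1 simp: space_restrict_space\<close>)
  qed
  have "integrable ?M (g n)" by (rule L2b_cauchy_schwarz(1)[OF L mass]) (use ab in simp)
  then have "integrable lborel (\<lambda>t. indicator {a<..<b} t *\<^sub>R g n t)"
    by (simp add: integrable_restrict_space)
  moreover have "(\<lambda>t. indicator {a<..<b} t *\<^sub>R g n t) = g n" for n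
    by (rule ext) (auto simp: indicator_def z)
  ultimately show "integrable lborel (g n)" by simp
  have le: "norm (LINT t|lborel. g n t) \<le> (k * sqrt (b - a)) * norm (c n)" for n
    using L2b_cauchy_schwarz(2)[OF L mass, of n] ab L2bD(1)[OF L, of n]
    by (auto simp: gR c_def mult_ac)
  have "l2b c A"
  proof -
    have "(\<Sum>n\<in>F. (norm (c n))\<^sup>2) \<le> A\<^sup>2" if F: "finite F" for F
    proof -
      have "ennreal (\<Sum>n\<in>F. (c n)\<^sup>2) = (\<Sum>n\<in>F. sqint lborel (\<lambda>t. uhat u t n))"
        by (simp add: fin)
      also have "\<dots> = (\<integral>\<^sup>+t. (\<Sum>n\<in>F. ennreal ((norm (uhat u t n))\<^sup>2)) \<partial>lborel)"
        using uhat_measurable[of u] by (subst nn_integral_sum) auto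
      also have "\<dots> \<le> ennreal (A\<^sup>2)" by (rule uhat_bessel[OF u F])
      finally show ?thesis by (simp add: A)
    qed
    then show ?thesis by (simp add: l2b_iff_sum A)
  qed
  from l2b_le[OF this le] show "l2b (\<lambda>n. LINT t|lborel. g n t) (k * sqrt (b - a) * A)"
    using k ab by (simp add: mult_ac)
qed

lemma borel_measurable_matrix_vector:
  fixes f :: "'a \<Rightarrow> complex^'n" and C :: "'a \<Rightarrow> complex^'n^'k"
  assumes "C \<in> borel_measurable M" "f \<in> borel_measurable M"
  shows "(\<lambda>x. C x *v f x) \<in> borel_measurable M"
proof (rule borel_measurable_continuous_Pair[OF assms])
  show "continuous_on UNIV (\<lambda>x::(complex^'n^'k) \<times> (complex^'n). fst x *v snd x)"
    by (intro bounded_bilinear.continuous_on[OF bounded_bilinear_matrix_vector] continuous_intros)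
qed

lemma continuous_on_mat_exp: "continuous_on UNIV (\<lambda>t::real. mat_exp (t *\<^sub>R M))"
  by (intro continuous_at_imp_continuous_on ballI has_vector_derivative_continuous[OF mat_exp_has_derivative])

lemma borel_measurable_flow:
  fixes f :: "real \<Rightarrow> complex^'k"
  assumes f: "f \<in> borel_measurable lborel"
  shows "(\<lambda>t. flow G (T - t) (f t)) \<in> borel_measurable lborel"
proof -
  have "continuous_on UNIV (\<lambda>t. mat_exp ((t - T) *\<^sub>R G))"
    by (rule continuous_on_compose2[OF continuous_on_mat_exp[of G]]) (auto intro!: continuous_intros)
  then show ?thesis
    unfolding flow_def using f
    by (intro borel_measurable_matrix_vector) (auto simp: borel_measurable_continuous_onI)
qed

lemma mom_integrand:
  assumes u: "ctl \<omega> a b A u" and ab: "a \<le> b"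
  shows "integrable lborel (\<lambda>t. flow (G n) (T - t) (S n *v uhat u t n))"
proof -
  note uD = ctlD[OF u]
  define k where "k = exp (norm (G n) * (\<bar>T\<bar> + \<bar>a\<bar> + \<bar>b\<bar>)) * norm (S n)"
  have k: "0 \<le> k" by (simp add: k_def)
  have le: "norm (flow (G n) (T - t) (S n *v w)) \<le> k * norm w" if "a < t" "t < b" for t w
  proof -
    have "norm (flow (G n) (T - t) (S n *v w)) \<le> exp (norm (G n) * \<bar>T - t\<bar>) * norm (S n *v w)"
      by (rule flow_norm_bound) simp
    also have "\<dots> \<le> exp (norm (G n) * (\<bar>T\<bar> + \<bar>a\<bar> + \<bar>b\<bar>)) * (norm (S n) * norm w)"
      using that by (intro mult_mono norm_matrix_vector_mult) (auto intro!: mult_left_mono)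
    finally show ?thesis by (simp add: k_def mult_ac)
  qed
  let ?g = "\<lambda>m t. if m = n then flow (G n) (T - t) (S n *v uhat u t n) else 0"
  have "integrable lborel (?g n)"
  proof (rule kernel_bound(1)[OF uD(1) ab k, of ?g])
    fix m
    have "(\<lambda>t. S n *v uhat u t n) \<in> borel_measurable lborel"
      by (intro borel_measurable_matrix_vector uhat_measurable uD) simp
    from borel_measurable_flow[OF this] show "?g m \<in> borel_measurable lborel" by (cases "m = n") auto
    show "norm (?g m t) \<le> k * norm (uhat u t m)" if "a < t" "t < b" for t
      using le[OF that] k by auto
    show "?g m t = 0" if "\<not> (a < t \<and> t < b)" for t
      using uD(4)[OF that] by (simp add: uhat_eq_0)
  qed
  then show ?thesis by simp
qed

lemma mom_bound_gen:
  assumes u: "ctl \<omega> a b A u" and ab: "a \<le> b" and k: "0 \<le> k" and I: "\<And>n. n \<notin> I \<Longrightarrow> c n = 0" "\<And>n. 0 \<le> c n"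
    and le: "\<And>n t w. n \<in> I \<Longrightarrow> a < t \<Longrightarrow> t < b \<Longrightarrow> c n * norm (flow (G n) (T - t) (S n *v w)) \<le> k * norm w"
  shows "l2b (\<lambda>n. c n *\<^sub>R mom G S T u n) (k * sqrt (b - a) * A)"
proof -
  note uD = ctlD[OF u]
  have "l2b (\<lambda>n. LINT t|lborel. c n *\<^sub>R flow (G n) (T - t) (S n *v uhat u t n)) (k * sqrt (b - a) * A)"
  proof (rule kernel_bound(2)[OF uD(1) ab k])
    fix n
    have "(\<lambda>t. S n *v uhat u t n) \<in> borel_measurable lborel"
      by (intro borel_measurable_matrix_vector uhat_measurable uD) simp
    from borel_measurable_flow[OF this]
    show "(\<lambda>t. c n *\<^sub>R flow (G n) (T - t) (S n *v uhat u t n)) \<in> borel_measurable lborel" by simp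
    show "norm (c n *\<^sub>R flow (G n) (T - t) (S n *v uhat u t n)) \<le> k * norm (uhat u t n)" if "a < t" "t < b" for t
      using le[OF _ that, of n] k I(1)[of n] I(2)[of n] by (cases "n \<in> I") auto
    show "c n *\<^sub>R flow (G n) (T - t) (S n *v uhat u t n) = 0" if "\<not> (a < t \<and> t < b)" for t
      using uD(4)[OF that] by (simp add: uhat_eq_0)
  qed
  then show ?thesis by (simp add: mom_def)
qed

lemma mom_bound:
  assumes u: "ctl \<omega> a b A u" and ab: "a \<le> b" and k: "0 \<le> k"
    and le: "\<And>n t w. n \<in> I \<Longrightarrow> a < t \<Longrightarrow> t < b \<Longrightarrow> norm (flow (G n) (T - t) (S n *v w)) \<le> k * norm w"
  shows "l2b (\<lambda>n. if n \<in> I then mom G S T u n else 0) (k * sqrt (b - a) * A)"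
proof -
  have "l2b (\<lambda>n. (if n \<in> I then 1 else 0) *\<^sub>R mom G S T u n) (k * sqrt (b - a) * A)"
    by (rule mom_bound_gen[OF u ab k, of I]) (use le in auto)
  moreover have "(\<lambda>n. (if n \<in> I then 1 else 0) *\<^sub>R mom G S T u n) = (\<lambda>n. if n \<in> I then mom G S T u n else 0)"
    by auto
  ultimately show ?thesis by simp
qed

lemma L2b_section_AE:
  assumes w: "L2b QM w C"
  shows "AE t in lborel. \<exists>c. L2b torus_measure (\<lambda>x. w (t, x)) c"
proof -
  interpret sigma_finite_measure torus_measure by (rule sigma_finite_torus)
  have [measurable]: "w \<in> borel_measurable QM" using L2bD[OF w] by simp
  have "(\<integral>\<^sup>+t. (sqint torus_measure (\<lambda>x. w (t, x))) \<partial>lborel) = sqint QM w"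
    by (rule nn_integral_fst) measurable
  also have "\<dots> < \<infinity>" using L2bD(3)[OF w] by (rule order_le_less_trans) simp
  finally have "AE t in lborel. (sqint torus_measure (\<lambda>x. w (t, x))) \<noteq> \<infinity>"
    by (intro nn_integral_noteq_infinite borel_measurable_nn_integral) (auto simp: split_beta')
  then show ?thesis
  proof eventually_elim
    fix t assume "sqint torus_measure (\<lambda>x. w (t, x)) \<noteq> \<infinity>"
    then obtain r where "sqint torus_measure (\<lambda>x. w (t, x)) = ennreal r" "0 \<le> r"
      by (cases "sqint torus_measure (\<lambda>x. w (t, x))") auto
    then have "L2b torus_measure (\<lambda>x. w (t, x)) (sqrt r)"
      using section_measurable[of w t] by (simp add: L2b_def)
    then show "\<exists>c. L2b torus_measure (\<lambda>x. w (t, x)) c" ..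
  qed
qed

text \<open>Only for almost every time are the sections known to be square integrable in space,
  which additivity of Fourier coefficients uses.\<close>

lemma uhat_add_AE:
  assumes u: "L2b QM u A" and v: "L2b QM v B"
  shows "AE t in lborel. uhat (\<lambda>z. u z + v z) t n = uhat u t n + uhat v t n"
proof -
  show ?thesis using L2b_section_AE[OF u] L2b_section_AE[OF v]
    by eventually_elim (auto simp: uhat_def fourier_coeff_add)
qed

lemma mom_add:
  assumes u: "ctl \<omega> a b A u" and v: "ctl \<omega> a b B v" and ab: "a \<le> b"
  shows "mom G S T (\<lambda>z. u z + v z) n = mom G S T u n + mom G S T v n"
proof -
  have m: "w \<in> borel_measurable QM \<Longrightarrow> (\<lambda>t. flow (G n) (T - t) (S n *v uhat w t n)) \<in> borel_measurable lborel" for w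
    by (intro borel_measurable_flow borel_measurable_matrix_vector uhat_measurable) simp_all
  have "mom G S T (\<lambda>z. u z + v z) n = (LINT t|lborel. flow (G n) (T - t) (S n *v uhat u t n) + flow (G n) (T - t) (S n *v uhat v t n))"
    unfolding mom_def
  proof (rule integral_cong_AE)
    show "AE t in lborel. flow (G n) (T - t) (S n *v uhat (\<lambda>z. u z + v z) t n) =
        flow (G n) (T - t) (S n *v uhat u t n) + flow (G n) (T - t) (S n *v uhat v t n)"
      using uhat_add_AE[OF ctlD(1)[OF u] ctlD(1)[OF v], of n]
      by eventually_elim (simp add: matrix_vector_right_distrib flow_add_right)
  qed (use m ctlD(2)[OF u] ctlD(2)[OF v] in auto)
  also have "\<dots> = mom G S T u n + mom G S T v n"
    unfolding mom_def by (intro Bochner_Integration.integral_add mom_integrand[OF u ab] mom_integrand[OF v ab])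
  finally show ?thesis .
qed

lemma uhat_minus: "uhat (\<lambda>z. - u z) t n = - uhat u t n"
proof -
  have "ee (- n) x *s (- u (t, x)) = - (ee (- n) x *s u (t, x))" for x by (simp add: vec_eq_iff)
  then show ?thesis by (simp add: uhat_def fourier_coeff_def)
qed

lemma mom_minus: "mom G S T (\<lambda>z. - u z) n = - mom G S T u n"
  by (simp add: mom_def uhat_minus flow_minus_right linear_neg[OF bounded_linear.linear[OF bounded_linear_matrix_vector]])

lemma mom_zero: "mom G S T (\<lambda>z. 0) n = 0"
  by (simp add: mom_def uhat_eq_0)

lemma mom_diff:
  assumes u: "ctl \<omega> a b A u" and v: "ctl \<omega> a b B v" and ab: "a \<le> b"
  shows "mom G S T (\<lambda>z. u z - v z) n = mom G S T u n - mom G S T v n"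
  using mom_add[OF u ctl_minus[OF v] ab] by (simp add: mom_minus)

lemma mom_time:
  assumes u: "ctl \<omega> a b A u" and ab: "a \<le> b"
  shows "mom G S T' u n = flow (G n) (T' - T) (mom G S T u n)"
proof -
  have eq: "flow (G n) (T' - t) w = flow (G n) (T' - T) (flow (G n) (T - t) w)" for t w
    by (simp flip: flow_add_time)
  show ?thesis
    unfolding mom_def eq[of _ "S n *v uhat u _ n"]
    by (rule integral_bounded_linear[OF bounded_linear_flow mom_integrand[OF u ab]])
qed

lemma mom_intertwine:
  assumes u: "ctl \<omega> a b A u" and ab: "a \<le> b"
    and R: "bounded_linear R" and eq: "\<And>v. R (G n *v v) = P n *v R v" "\<And>w. R (S n *v w) = S' n *v w"
  shows "R (mom G S T u n) = mom P S' T u n"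
  unfolding mom_def
  by (simp add: integral_bounded_linear[OF R mom_integrand[OF u ab], symmetric] flow_intertwine[OF R eq(1)] eq(2))

lemma ctl_series:
  fixes u :: "nat \<Rightarrow> real \<times> real \<Rightarrow> complex^'n"
  assumes u: "\<And>k. ctl \<omega> a b (B k) (u k)" and B: "summable B"
  obtains v where "ctl \<omega> a b (suminf B) v"
    and "\<forall>m. ctl \<omega> a b (\<Sum>k. B (k + m)) (\<lambda>z. v z - (\<Sum>k<m. u k z))"
proof -
  obtain v where v: "L2b QM v (suminf B)"
      "\<And>m. L2b QM (\<lambda>x. v x - (\<Sum>k<m. u k x)) (\<Sum>k. B (k + m))"
      "\<forall>x. (\<forall>k. u k x = 0) \<longrightarrow> v x = 0"
    by (rule L2b_series[OF ctlD(1)[OF u] B]) blast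
  have cv: "ctl \<omega> a b (suminf B) v"
    unfolding ctl_def
  proof (intro conjI v(1) allI impI)
    fix t x assume "v (t, x) \<noteq> 0"
    then obtain k where "u k (t, x) \<noteq> 0" using v(3) by blast
    then have "a < t \<and> t < b \<and> cis x \<in> \<omega>" using u[of k] by (simp add: ctl_def)
    then show "a < t" "t < b" "cis x \<in> \<omega>" by auto
  qed
  have part: "ctl \<omega> a b (\<Sum>k<m. B k) (\<lambda>z. \<Sum>k<m. u k z)" for m
    by (induction m) (auto intro: ctl_add u ctl_zero)
  have diff: "ctl \<omega> a b (\<Sum>k. B (k + m)) (\<lambda>z. v z - (\<Sum>k<m. u k z))" for m
    using ctl_diff[OF cv part[of m]] v(2)[of m] by (simp add: ctl_def)
  show thesis using that[OF cv] diff by blast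
qed

text \<open>A fixed moment is continuous in the control, so the tail bounds of the series pass to
  the moments.\<close>

lemma mom_series:
  fixes u :: "nat \<Rightarrow> real \<times> real \<Rightarrow> complex^'n"
  assumes u: "\<And>k. ctl \<omega> a b (B k) (u k)" and B: "summable B" and ab: "a \<le> b"
    and cv: "ctl \<omega> a b (suminf B) v"
    and diff: "\<forall>m. ctl \<omega> a b (\<Sum>k. B (k + m)) (\<lambda>z. v z - (\<Sum>k<m. u k z))"
  shows "(\<lambda>k. mom G S T (u k) n) sums mom G S T v n"
proof -
  have part: "ctl \<omega> a b (\<Sum>k<m. B k) (\<lambda>z. \<Sum>k<m. u k z)" for m
    by (induction m) (auto intro: ctl_add u ctl_zero)
  have msum: "mom G S T (\<lambda>z. \<Sum>k<m. u k z) n = (\<Sum>k<m. mom G S T (u k) n)" for m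
  proof (induction m)
    case (Suc m)
    then show ?case using mom_add[OF part[of m] u[of m] ab, of G S T n] by simp
  qed (simp add: mom_zero)
  define k where "k = exp (norm (G n) * (\<bar>T\<bar> + \<bar>a\<bar> + \<bar>b\<bar>)) * norm (S n)"
  have le: "norm (flow (G n) (T - t) (S n *v w)) \<le> k * norm w" if "a < t" "t < b" for t w
  proof -
    have "norm (flow (G n) (T - t) (S n *v w)) \<le> exp (norm (G n) * \<bar>T - t\<bar>) * norm (S n *v w)"
      by (rule flow_norm_bound) simp
    also have "\<dots> \<le> exp (norm (G n) * (\<bar>T\<bar> + \<bar>a\<bar> + \<bar>b\<bar>)) * (norm (S n) * norm w)"
      using that by (intro mult_mono norm_matrix_vector_mult) (auto intro!: mult_left_mono)
    finally show ?thesis by (simp add: k_def mult_ac)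
  qed
  have "norm ((\<Sum>k<m. mom G S T (u k) n) - mom G S T v n) \<le> k * sqrt (b - a) * (\<Sum>k. B (k + m))" for m
  proof -
    have "l2b (\<lambda>l. if l \<in> {n} then mom G S T (\<lambda>z. v z - (\<Sum>k<m. u k z)) l else 0) (k * sqrt (b - a) * (\<Sum>k. B (k + m)))"
      by (rule mom_bound[OF diff[rule_format] ab]) (use le in \<open>auto simp: k_def\<close>)
    from l2b_component[OF this, of n] show ?thesis
      using mom_diff[OF cv part[of m] ab, of G S T n] by (simp add: msum norm_minus_commute)
  qed
  then have "\<forall>\<^sub>F m in sequentially. norm ((\<Sum>k<m. mom G S T (u k) n) - mom G S T v n) \<le> k * sqrt (b - a) * (\<Sum>k. B (k + m))"
    by (rule always_eventually[OF allI])
  moreover have "(\<lambda>m. k * sqrt (b - a) * (\<Sum>k. B (k + m))) \<longlonglongrightarrow> 0"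
    by (rule tendsto_mult_right_zero) (rule suminf_exist_split2[OF B])
  ultimately have "(\<lambda>m. (\<Sum>k<m. mom G S T (u k) n) - mom G S T v n) \<longlonglongrightarrow> 0"
    by (rule Lim_null_comparison)
  then show ?thesis unfolding sums_def by (rule LIM_zero_cancel)
qed

lemma ctl_shift:
  assumes u: "ctl \<omega> a b A u"
  shows "ctl \<omega> (a + s) (b + s) A (\<lambda>z. u (fst z - s, snd z))"
    and "mom G S (T + s) (\<lambda>z. u (fst z - s, snd z)) n = mom G S T u n"
proof -
  interpret sigma_finite_measure torus_measure by (rule sigma_finite_torus)
  have [measurable]: "u \<in> borel_measurable QM" using ctlD[OF u] by simp
  have m: "(\<lambda>z. u (fst z - s, snd z)) \<in> borel_measurable QM" by measurable
  have [measurable]: "(\<lambda>t. sqint torus_measure (\<lambda>x. u (t, x))) \<in> borel_measurable lborel"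
    by (intro borel_measurable_nn_integral) (simp add: split_beta')
  have "sqint QM (\<lambda>z. u (fst z - s, snd z)) = (\<integral>\<^sup>+t. (sqint torus_measure (\<lambda>x. u (t - s, x))) \<partial>lborel)"
    by (subst nn_integral_fst[symmetric]) (use m in auto)
  also have "\<dots> = (\<integral>\<^sup>+t. (sqint torus_measure (\<lambda>x. u (t, x))) \<partial>lborel)"
    using nn_integral_real_affine[of "\<lambda>t. sqint torus_measure (\<lambda>x. u (t, x))" 1 "- s"] by simp
  also have "\<dots> = sqint QM u"
    by (rule nn_integral_fst) measurable
  finally have "L2b QM (\<lambda>z. u (fst z - s, snd z)) A"
    using ctlD(1)[OF u] m by (simp add: L2b_def)
  moreover have "a + s < t \<and> t < b + s \<and> cis x \<in> \<omega>" if "u (t - s, x) \<noteq> 0" for t x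
  proof -
    have "a < t - s \<and> t - s < b \<and> cis x \<in> \<omega>" using u that unfolding ctl_def by blast
    then show ?thesis by linarith
  qed
  ultimately show "ctl \<omega> (a + s) (b + s) A (\<lambda>z. u (fst z - s, snd z))"
    by (simp add: ctl_def)
  have "mom G S (T + s) (\<lambda>z. u (fst z - s, snd z)) n = (LINT t|lborel. flow (G n) (T + s - t) (S n *v uhat u (t - s) n))"
    by (simp add: mom_def uhat_def)
  also have "\<dots> = mom G S T u n"
    using lborel_integral_real_affine[of 1 "\<lambda>t. flow (G n) (T + s - t) (S n *v uhat u (t - s) n)" s]
    by (simp add: mom_def add.commute)
  finally show "mom G S (T + s) (\<lambda>z. u (fst z - s, snd z)) n = mom G S T u n" .
qed

section \<open>Transport on the circle\<close>

definition fold2pi :: "real \<Rightarrow> real" where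
  "fold2pi y = y - 2 * pi * of_int \<lfloor>y / (2 * pi)\<rfloor>"

lemma fold2pi_bounds: "0 \<le> fold2pi y" "fold2pi y < 2 * pi"
  using floor_divide_lower[of "2 * pi" y] floor_divide_upper[of "2 * pi" y]
  by (auto simp: fold2pi_def algebra_simps)

lemma fold2pi_eq: "0 \<le> y - 2 * pi * of_int k \<Longrightarrow> y - 2 * pi * of_int k < 2 * pi \<Longrightarrow> fold2pi y = y - 2 * pi * of_int k"
proof -
  assume "0 \<le> y - 2 * pi * of_int k" "y - 2 * pi * of_int k < 2 * pi"
  then have "\<lfloor>y / (2 * pi)\<rfloor> = k" by (intro floor_unique) (auto simp: field_simps)
  then show ?thesis by (simp add: fold2pi_def)
qed

lemma fold2pi_id: "0 \<le> y \<Longrightarrow> y < 2 * pi \<Longrightarrow> fold2pi y = y"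
  using fold2pi_eq[of y 0] by simp

lemma cis_fold2pi [simp]: "cis (fold2pi y) = cis y"
  by (simp add: fold2pi_def flip: cis_divide)

lemma ee_fold2pi [simp]: "ee n (fold2pi y) = ee n y"
proof -
  have "ee n (fold2pi y) = ee n y / cis (2 * pi * of_int (n * \<lfloor>y / (2 * pi)\<rfloor>))"
    by (simp add: fold2pi_def cis_divide algebra_simps)
  then show ?thesis by (simp add: cis_multiple_2pi)
qed

lemma fold2pi_add_fold2pi: "fold2pi (x + fold2pi c) = fold2pi (x + c)"
proof -
  let ?k = "\<lfloor>c / (2 * pi)\<rfloor>" and ?m = "\<lfloor>(x + c) / (2 * pi)\<rfloor>"
  have "x + fold2pi c - 2 * pi * of_int (?m - ?k) = fold2pi (x + c)"
    by (simp add: fold2pi_def algebra_simps)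
  then show ?thesis
    using fold2pi_eq[of "x + fold2pi c" "?m - ?k"] fold2pi_bounds[of "x + c"] by simp
qed

lemma fold2pi_measurable [measurable]: "fold2pi \<in> borel_measurable borel"
  unfolding fold2pi_def[abs_def] by measurable

lemma sets_torus_iff: "A \<in> sets torus_measure \<longleftrightarrow> A \<in> sets borel \<and> A \<subseteq> {0..<2*pi}"
  by (auto simp: sets_restrict_space_iff)

lemma fold2pi_shift_torus: "(\<lambda>x. fold2pi (x + c)) \<in> measurable torus_measure torus_measure"
  by (rule measurable_restrict_space3) (auto simp: fold2pi_bounds)

text \<open>A rotation by \<open>d\<close> in \<open>[0, 2 pi)\<close> consists of two translations:
  the part of \<open>A\<close> above \<open>d\<close> comes from points that do not wrap around, the
  part below \<open>d\<close> from points that do.\<close>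

lemma distr_rotation: "distr torus_measure torus_measure (\<lambda>x. fold2pi (x + c)) = torus_measure"
proof (rule measure_eqI)
  fix A assume "A \<in> sets (distr torus_measure torus_measure (\<lambda>x. fold2pi (x + c)))"
  then have A: "A \<in> sets torus_measure" by simp
  then have Ab [measurable]: "A \<in> sets borel" and A2: "A \<subseteq> {0..<2*pi}" by (auto simp: sets_torus_iff)
  define d where "d = fold2pi c"
  have d: "0 \<le> d" "d < 2 * pi" using fold2pi_bounds[of c] by (auto simp: d_def)
  have pre: "{x\<in>{0..<2*pi}. fold2pi (x + c) \<in> A} = (\<lambda>x. x + d) -` (A \<inter> {d..}) \<union> (\<lambda>x. x + (d - 2 * pi)) -` (A \<inter> {..<d})"
  proof (intro equalityI subsetI)
    fix x assume x: "x \<in> {x\<in>{0..<2*pi}. fold2pi (x + c) \<in> A}"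
    have f: "fold2pi (x + c) = fold2pi (x + d)" by (simp add: d_def fold2pi_add_fold2pi)
    show "x \<in> (\<lambda>x. x + d) -` (A \<inter> {d..}) \<union> (\<lambda>x. x + (d - 2 * pi)) -` (A \<inter> {..<d})"
    proof (cases "x + d < 2 * pi")
      case True
      then have "fold2pi (x + d) = x + d" using x d by (intro fold2pi_id) auto
      then show ?thesis using x f by auto
    next
      case False
      then have "fold2pi (x + d) = x + d - 2 * pi" using x d fold2pi_eq[of "x + d" 1] by auto
      then have "fold2pi (x + c) = x + (d - 2 * pi)" using f by simp
      then show ?thesis using x by auto
    qed
  next
    fix x assume "x \<in> (\<lambda>x. x + d) -` (A \<inter> {d..}) \<union> (\<lambda>x. x + (d - 2 * pi)) -` (A \<inter> {..<d})"
    then consider "x + d \<in> A" "0 \<le> x" | "x + d - 2 * pi \<in> A" "x < 2 * pi" by (auto simp: algebra_simps)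
    then show "x \<in> {x\<in>{0..<2*pi}. fold2pi (x + c) \<in> A}"
    proof cases
      case 1
      then have "0 \<le> x + d" "x + d < 2 * pi" using A2 by auto
      then show ?thesis using 1 d fold2pi_id[of "x + d"] fold2pi_add_fold2pi[of x c] by (auto simp: d_def)
    next
      case 2
      then have "0 \<le> x + d - 2 * pi" "x + d - 2 * pi < 2 * pi" using A2 by auto
      then show ?thesis using 2 d fold2pi_eq[of "x + d" 1] fold2pi_add_fold2pi[of x c] by (auto simp: d_def)
    qed
  qed
  have tr: "emeasure lborel ((\<lambda>x. x + e) -` B) = emeasure lborel B" if B: "B \<in> sets borel" for e :: real and B
  proof -
    have "emeasure lborel B = emeasure (distr lborel borel (\<lambda>x. x + e)) B"
      using lborel_distr_plus[of e] by (simp add: add.commute[of _ e])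
    also have "\<dots> = emeasure lborel ((\<lambda>x. x + e) -` B)" using B by (subst emeasure_distr) auto
    finally show ?thesis ..
  qed
  have "emeasure (distr torus_measure torus_measure (\<lambda>x. fold2pi (x + c))) A = emeasure torus_measure ((\<lambda>x. fold2pi (x + c)) -` A \<inter> space torus_measure)"
    by (rule emeasure_distr[OF fold2pi_shift_torus A])
  also have "(\<lambda>x. fold2pi (x + c)) -` A \<inter> space torus_measure = {x\<in>{0..<2*pi}. fold2pi (x + c) \<in> A}"
    by (auto simp: space_restrict_space)
  also have "emeasure torus_measure \<dots> = emeasure lborel \<dots>"
    by (rule emeasure_restrict_space) auto
  also have "\<dots> = emeasure lborel ((\<lambda>x. x + d) -` (A \<inter> {d..})) + emeasure lborel ((\<lambda>x. x + (d - 2 * pi)) -` (A \<inter> {..<d}))"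
  proof -
    have m: "(\<lambda>x. x + e) -` B \<in> sets lborel" if "B \<in> sets borel" for e :: real and B
      using measurable_sets[of "\<lambda>x. x + e" borel borel B] that by simp
    have "(\<lambda>x. x + d) -` (A \<inter> {d..}) \<inter> (\<lambda>x. x + (d - 2 * pi)) -` (A \<inter> {..<d}) = {}"
    proof (intro equals0I)
      fix x assume "x \<in> (\<lambda>x. x + d) -` (A \<inter> {d..}) \<inter> (\<lambda>x. x + (d - 2 * pi)) -` (A \<inter> {..<d})"
      then have "x + d \<in> A" "x + (d - 2 * pi) \<in> A" by auto
      then have "x + d \<in> {0..<2*pi}" "x + (d - 2 * pi) \<in> {0..<2*pi}" using A2 by blast+
      then show False by simp
    qed
    then show ?thesis unfolding pre by (intro plus_emeasure[symmetric] m) auto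
  qed
  also have "\<dots> = emeasure lborel (A \<inter> {d..}) + emeasure lborel (A \<inter> {..<d})"
    by (subst (1 2) tr) auto
  also have "\<dots> = emeasure lborel (A \<inter> {d..} \<union> A \<inter> {..<d})"
    by (intro plus_emeasure) auto
  also have "A \<inter> {d..} \<union> A \<inter> {..<d} = A" by auto
  also have "emeasure lborel A = emeasure torus_measure A"
    using A2 by (subst emeasure_restrict_space) auto
  finally show "emeasure (distr torus_measure torus_measure (\<lambda>x. fold2pi (x + c))) A = emeasure torus_measure A" .
qed simp

lemma nn_integral_rotation:
  assumes "f \<in> borel_measurable torus_measure"
  shows "(\<integral>\<^sup>+x. f (fold2pi (x + c)) \<partial>torus_measure) = (\<integral>\<^sup>+x. f x \<partial>torus_measure)"
  using nn_integral_distr[OF fold2pi_shift_torus, of f c] assms by (simp add: distr_rotation)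

lemma integral_rotation:
  fixes f :: "real \<Rightarrow> 'a::{banach,second_countable_topology}"
  assumes "f \<in> borel_measurable torus_measure"
  shows "(LINT x|torus_measure. f (fold2pi (x + c))) = (LINT x|torus_measure. f x)"
  using integral_distr[OF fold2pi_shift_torus, of f c] assms by (simp add: distr_rotation)

section \<open>Characteristics and the control region\<close>

lemma openin_torus_open:
  assumes "openin (top_of_set torus) \<omega>"
  obtains U where "open U" "\<And>x. cis x \<in> \<omega> \<longleftrightarrow> cis x \<in> U"
proof -
  obtain U where "open U" "\<omega> = torus \<inter> U" using assms unfolding openin_open by auto
  then show thesis by (intro that[of U]) auto
qed

lemma open_cis_preimage:
  assumes "openin (top_of_set torus) \<omega>"
  shows "open {x. cis x \<in> \<omega>}"
proof -
  obtain U where U: "open U" "\<And>x. cis x \<in> \<omega> \<longleftrightarrow> cis x \<in> U" using openin_torus_open[OF assms] by blast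
  have "open (cis -` U)" by (rule open_vimage[OF U(1)]) (intro continuous_intros)
  then show ?thesis by (simp add: U(2) vimage_def)
qed

text \<open>An arc avoiding \<omega> is connected, hence lies in one component of the complement,
  whose length is at most the maximal gap.\<close>

lemma arc_meets_open:
  assumes om: "openin (top_of_set torus) \<omega>" and ne: "\<omega> \<noteq> {}" and L: "max_gap \<omega> < ennreal L"
  shows "\<exists>s\<in>{0<..<L}. cis (c + s) \<in> \<omega>"
proof (rule ccontr)
  assume neg: "\<not> (\<exists>s\<in>{0<..<L}. cis (c + s) \<in> \<omega>)"
  have L0: "0 < L"
  proof (rule ccontr)
    assume "\<not> 0 < L"
    then have "ennreal L = 0" by (simp add: ennreal_neg)
    then show False using L by simp
  qed
  define J where "J = (\<lambda>s. cis (c + s)) ` {0<..<L}"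
  have J: "J \<subseteq> torus - \<omega>" using neg by (auto simp: J_def)
  have "connected J" unfolding J_def by (intro connected_continuous_image continuous_intros) auto
  moreover have "J \<noteq> {}" using L0 by (simp add: J_def)
  ultimately obtain I where I: "I \<in> components (torus - \<omega>)" "J \<subseteq> I"
    using exists_component_superset[OF J] J by blast
  \<comment> \<open>An arc longer than the circle covers every point of the nonempty \<omega>. Up to
    \<open>2 pi\<close> the parametrisation is injective, so the arc really has length
    \<open>L\<close>.\<close>
  have "L \<le> 2 * pi"
  proof (rule ccontr)
    assume "\<not> L \<le> 2 * pi"
    obtain z where z: "z \<in> \<omega>" using ne by auto
    moreover have "\<omega> \<subseteq> torus" using om openin_imp_subset by blast
    ultimately have "cmod z = 1" "z \<noteq> 0" by auto
    then have "z = cis (Arg z)" using cis_Arg[of z] by (auto simp: sgn_eq)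
    define s where "s = (let r = fold2pi (Arg z - c) in if r = 0 then 2 * pi else r)"
    have s: "0 < s" "s < L" using \<open>\<not> L \<le> 2 * pi\<close> fold2pi_bounds[of "Arg z - c"] by (auto simp: s_def Let_def)
    have "cis s = cis (Arg z - c)"
      unfolding cis_fold2pi[of "Arg z - c", symmetric] by (auto simp: s_def Let_def simp del: cis_fold2pi)
    then have "cis (c + s) = cis (Arg z)" by (simp add: cis_divide[symmetric] cis_mult[symmetric])
    then have "cis (c + s) \<in> \<omega>" using z \<open>z = cis (Arg z)\<close> by simp
    then show False using neg s by auto
  qed
  have "closedin (top_of_set torus) (torus - \<omega>)"
    using closedin_diff[OF closedin_topspace om] by simp
  then have "closed (torus - \<omega>)" by (rule closedin_closed_trans) simp
  then have "closed I" using I(1) closed_components by blast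
  then have Im: "{x. cis x \<in> I} \<in> sets borel"
  proof -
    have "closed (cis -` I)" by (rule closed_vimage[OF \<open>closed I\<close>]) (intro continuous_intros)
    then show ?thesis by (simp add: vimage_def)
  qed
  let ?B = "{x\<in>{0..<2*pi}. cis x \<in> I}"
  have B: "?B \<in> sets torus_measure"
  proof -
    have "?B = {0..<2*pi} \<inter> {x. cis x \<in> I}" by auto
    then show ?thesis using sets.Int[OF _ Im, of "{0..<2*pi}"] by (auto simp: sets_torus_iff)
  qed
  have "emeasure torus_measure {0<..<L} \<le> emeasure torus_measure ((\<lambda>x. fold2pi (x + c)) -` ?B \<inter> space torus_measure)"
  proof (rule emeasure_mono)
    show "{0<..<L} \<subseteq> (\<lambda>x. fold2pi (x + c)) -` ?B \<inter> space torus_measure"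
    proof
      fix x assume x: "x \<in> {0<..<L}"
      then have "cis (c + x) \<in> I" using I(2) by (auto simp: J_def)
      then show "x \<in> (\<lambda>x. fold2pi (x + c)) -` ?B \<inter> space torus_measure"
        using x \<open>L \<le> 2 * pi\<close> by (simp add: fold2pi_bounds space_restrict_space add.commute)
    qed
    show "(\<lambda>x. fold2pi (x + c)) -` ?B \<inter> space torus_measure \<in> sets torus_measure"
      by (rule measurable_sets[OF fold2pi_shift_torus B])
  qed
  also have "\<dots> = emeasure torus_measure ?B"
    using emeasure_distr[OF fold2pi_shift_torus B, of c] by (simp add: distr_rotation)
  also have "\<dots> = arc_length I"
    unfolding arc_length_def by (rule emeasure_restrict_space) auto
  also have "\<dots> \<le> max_gap \<omega>" unfolding max_gap_def by (rule SUP_upper[OF I(1)])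
  also have "emeasure torus_measure {0<..<L} = ennreal L"
    using L0 \<open>L \<le> 2 * pi\<close> by (subst emeasure_restrict_space) auto
  finally show False using L by simp
qed

text \<open>Every characteristic meets \<omega> before \<open>T1\<close>, because it sweeps an arc
  longer than the maximal gap. By openness nearby characteristics spend a time bounded below in
  \<omega>, and compactness of the circle makes the bound uniform.\<close>

lemma hitting_time_bound:
  assumes om: "openin (top_of_set torus) \<omega>" and ne: "\<omega> \<noteq> {}" and mu: "mu \<noteq> 0"
    and L: "max_gap \<omega> < ennreal (\<bar>mu\<bar> * T1)"
  obtains c where "0 < c" "\<And>y. c \<le> measure lborel {t\<in>{0<..<T1}. cis (y - mu * (T - t)) \<in> \<omega>}"
proof -
  define S where "S y = {t\<in>{0<..<T1}. cis (y - mu * (T - t)) \<in> \<omega>}" for y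
  define O' where "O' = {x. cis x \<in> \<omega>}"
  have oO: "open O'" unfolding O'_def by (rule open_cis_preimage[OF om])
  have oS: "open (S y)" for y
  proof -
    have "S y = {0<..<T1} \<inter> (\<lambda>t. y - mu * (T - t)) -` O'" by (auto simp: S_def O'_def)
    moreover have "open ((\<lambda>t. y - mu * (T - t)) -` O')" by (rule open_vimage[OF oO]) (intro continuous_intros)
    ultimately show ?thesis by auto
  qed
  have ex: "\<exists>t\<in>{0<..<T1}. y - mu * (T - t) \<in> O'" for y
  proof (cases "mu > 0")
    case True
    then obtain s where s: "0 < s" "s < mu * T1" "cis (y - mu * T + s) \<in> \<omega>"
      using arc_meets_open[OF om ne L, of "y - mu * T"] by auto
    have "y - mu * (T - s / mu) = y - mu * T + s" using mu by (simp add: field_simps)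
    moreover have "s / mu \<in> {0<..<T1}" using True s by (auto simp: field_simps)
    ultimately show ?thesis using s by (metis O'_def mem_Collect_eq)
  next
    \<comment> \<open>For negative speed the swept arc is traversed backwards, so it is parametrised
      from its other end \<open>y - mu * T + mu * T1\<close>.\<close>
    case False
    then have m: "mu < 0" using mu by simp
    then obtain s where s: "0 < s" "s < - mu * T1" "cis (y - mu * T + mu * T1 + s) \<in> \<omega>"
      using arc_meets_open[OF om ne L, of "y - mu * T + mu * T1"] by auto
    have "y - mu * (T - (T1 + s / mu)) = y - mu * T + mu * T1 + s" using mu by (simp add: field_simps)
    moreover have "T1 + s / mu \<in> {0<..<T1}" using m s by (auto simp: field_simps)
    ultimately show ?thesis using s by (metis O'_def mem_Collect_eq)
  qed
  have "\<exists>r>0. \<forall>y. \<bar>y - y0\<bar> < r \<longrightarrow> 2 * r \<le> measure lborel (S y)" for y0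
  proof -
    obtain t0 where t0: "0 < t0" "t0 < T1" "y0 - mu * (T - t0) \<in> O'" using ex[of y0] by auto
    obtain e where e: "0 < e" "\<And>x. \<bar>x - (y0 - mu * (T - t0))\<bar> < e \<Longrightarrow> x \<in> O'"
      using oO t0(3) unfolding open_dist by (force simp: dist_real_def)
    \<comment> \<open>The first two bounds keep the times within \<open>r\<close> of
      \<open>t0\<close> inside \<open>(0, T1)\<close>; the other two split the distance
      \<open>e\<close> evenly between the change of \<open>y\<close> and that of
      \<open>t\<close>.\<close>
    define r where "r = Min {t0, T1 - t0, e / 2, e / (2 * \<bar>mu\<bar>)}"
    have r: "0 < r" using t0 e mu by (simp add: r_def)
    have r': "r \<le> t0" "r \<le> T1 - t0" "r \<le> e / 2" "r \<le> e / (2 * \<bar>mu\<bar>)"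
      unfolding r_def by (rule Min.coboundedI; simp)+
    note r = r r'
    have "2 * r \<le> measure lborel (S y)" if y: "\<bar>y - y0\<bar> < r" for y
    proof -
      have sub: "{t0 - r<..<t0 + r} \<subseteq> S y"
      proof
        fix t assume t: "t \<in> {t0 - r<..<t0 + r}"
        then have "\<bar>t - t0\<bar> < r" by auto
        then have "\<bar>mu\<bar> * \<bar>t - t0\<bar> < \<bar>mu\<bar> * (e / (2 * \<bar>mu\<bar>))" using r mu by (intro mult_strict_left_mono) auto
        also have "\<dots> = e / 2" using mu by simp
        finally have "\<bar>mu * (t - t0)\<bar> < e / 2" by (simp add: abs_mult)
        moreover have "y - mu * (T - t) - (y0 - mu * (T - t0)) = (y - y0) + mu * (t - t0)" by (simp add: algebra_simps)
        ultimately have "y - mu * (T - t) \<in> O'" using y r by (intro e(2)) linarith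
        then show "t \<in> S y" using t r by (auto simp: S_def O'_def)
      qed
      have "measure lborel {t0 - r<..<t0 + r} \<le> measure lborel (S y)"
      proof (rule measure_mono_fmeasurable[OF sub])
        have "emeasure lborel (S y) \<le> emeasure lborel {0<..<T1}" by (intro emeasure_mono) (auto simp: S_def)
        also have "\<dots> < \<infinity>" using t0 by simp
        finally show "S y \<in> fmeasurable lborel" using oS[of y] by (intro fmeasurableI) auto
      qed auto
      then show ?thesis using r by simp
    qed
    then show ?thesis using r by blast
  qed
  then obtain r where r: "\<And>y0. 0 < r y0" "\<And>y0 y. \<bar>y - y0\<bar> < r y0 \<Longrightarrow> 2 * r y0 \<le> measure lborel (S y)" by metis
  obtain D where D: "D \<subseteq> {0..2*pi}" "finite D" "{0..2*pi} \<subseteq> (\<Union>y\<in>D. ball y (r y))"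
    by (rule compactE_image[of "{0..2*pi}" "{0..2*pi}" "\<lambda>y. ball y (r y)"]) (use r(1) in auto)
  have Dne: "D \<noteq> {}" using D(3) by (auto simp: subset_eq dest: bspec[of _ _ 0])
  define c where "c = Min ((\<lambda>y. 2 * r y) ` D)"
  have "c \<le> measure lborel (S y)" for y
  proof -
    have "fold2pi y \<in> {0..2*pi}" using fold2pi_bounds[of y] by auto
    then obtain d where d: "d \<in> D" "fold2pi y \<in> ball d (r d)" using D(3) by auto
    then have "2 * r d \<le> measure lborel (S (fold2pi y))" by (intro r(2)) (auto simp: dist_real_def)
    moreover have "S (fold2pi y) = S y" by (simp add: S_def cis_divide[symmetric])
    moreover have "c \<le> 2 * r d" using D(2) d(1) by (auto simp: c_def)
    ultimately show ?thesis by simp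
  qed
  moreover have "0 < c" using D(2) Dne r(1) by (simp add: c_def)
  ultimately show thesis using that by (auto simp: S_def)
qed

section \<open>Exact steering of transport equations\<close>

abbreviation tcoeff :: "int \<Rightarrow> (real \<Rightarrow> complex) \<Rightarrow> complex" where
  "tcoeff n f \<equiv> LINT x|torus_measure. ee (- n) x * f x"

text \<open>The moment identity is the Fourier form of: the integral of
  \<open>v(t, y - mu (T - t))\<close> over \<open>t\<close> equals \<open>z(y)\<close>. Integrated
  along the characteristic that arrives at \<open>y\<close> at time \<open>T\<close>, the control
  produces \<open>z\<close>.\<close>

definition transport_steers :: "complex set \<Rightarrow> real \<Rightarrow> real \<Rightarrow> real \<Rightarrow> (real \<Rightarrow> complex) \<Rightarrow> (real \<times> real \<Rightarrow> complex) \<Rightarrow> bool" where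
  "transport_steers \<omega> T1 T mu z v \<longleftrightarrow>
    (\<forall>t x. v (t, x) \<noteq> 0 \<longrightarrow> 0 < t \<and> t < T1 \<and> cis x \<in> \<omega>) \<and>
    (\<forall>n. (LINT t|lborel. cis (- (of_int n * mu * (T - t))) * tcoeff n (\<lambda>x. v (t, x)))
       = tcoeff n z)"

text \<open>The value \<open>z y\<close> is spread evenly over the times which the characteristic
  arriving at \<open>y\<close> spends in \<omega>. The duration \<open>m y\<close> is at least
  \<open>c\<close>, so dividing by it costs at most the factor \<open>1 / c\<close>.\<close>

lemma transport_control_scalar:
  assumes om: "openin (top_of_set torus) \<omega>" and ne: "\<omega> \<noteq> {}" and mu: "mu \<noteq> 0" and T1: "0 \<le> T1"
    and L: "max_gap \<omega> < ennreal (\<bar>mu\<bar> * T1)"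
  shows "\<exists>C\<ge>0. \<forall>(z :: real \<Rightarrow> complex) a. L2b torus_measure z a \<longrightarrow>
    (\<exists>v. L2b QM v (C * a) \<and> transport_steers \<omega> T1 T mu z v)"
proof -
  obtain c where c: "0 < c" "\<And>y. c \<le> measure lborel {t\<in>{0<..<T1}. cis (y - mu * (T - t)) \<in> \<omega>}"
    using hitting_time_bound[OF om ne mu L, of T] by blast
  define O' where "O' = {x. cis x \<in> \<omega>}"
  have [measurable]: "O' \<in> sets borel" unfolding O'_def using open_cis_preimage[OF om] by simp
  define m where "m y = measure lborel {t\<in>{0<..<T1}. y - mu * (T - t) \<in> O'}" for y
  have mc: "c \<le> m y" for y using c(2)[of y] by (simp add: m_def O'_def)
  have [measurable]: "{t. y - mu * (T - t) \<in> O'} \<in> sets borel" for y by measurable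
  have m_int: "(LINT t|lborel. indicator {0<..<T1} t * indicator O' (y - mu * (T - t)) :: real) = m y" for y
  proof -
    have "(LINT t|lborel. indicator {0<..<T1} t * indicator O' (y - mu * (T - t)) :: real) = (LINT t|lborel. indicator {t\<in>{0<..<T1}. y - mu * (T - t) \<in> O'} t)"
      by (intro Bochner_Integration.integral_cong) (auto simp: indicator_def)
    then show ?thesis by (simp add: m_def)
  qed
  have m_integrable: "integrable lborel (\<lambda>t. indicator {0<..<T1} t * indicator O' (y - mu * (T - t)) :: real)" for y
    by (rule Bochner_Integration.integrable_bound[of lborel "indicator {0<..<T1} :: real \<Rightarrow> real"])
      (use T1 in \<open>auto simp: indicator_def intro!: integrable_real_indicator\<close>)
  have m_meas [measurable]: "m \<in> borel_measurable borel"
  proof -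
    have "(\<lambda>y. LINT t|lborel. indicator {0<..<T1} t * indicator O' (y - mu * (T - t)) :: real) \<in> borel_measurable borel"
      by (rule lborel.borel_measurable_lebesgue_integral) measurable
    then show ?thesis by (simp add: m_int)
  qed
  show ?thesis
    unfolding transport_steers_def
  proof (intro exI[of _ "sqrt T1 / c"] conjI allI impI)
    show "0 \<le> sqrt T1 / c" using T1 c by simp
    fix z :: "real \<Rightarrow> complex" and a
    assume z: "L2b torus_measure z a"
    have [measurable]: "z \<in> borel_measurable torus_measure" and a: "0 \<le> a" using L2bD[OF z] by auto
    define w where "w y = z y / of_real (m y)" for y
    have [measurable]: "w \<in> borel_measurable torus_measure"
      unfolding w_def by (intro borel_measurable_divide) (auto intro!: measurable_restrict_space1)
    have w: "L2b torus_measure w (1 / c * a)"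
    proof (rule L2b_le[OF z])
      fix x show "norm (w x) \<le> 1 / c * norm (z x)"
        using mc[of x] c(1) by (auto simp: w_def norm_divide intro!: divide_left_mono)
    qed (use c in auto)
    define v where "v p = (if fst p \<in> {0<..<T1} \<and> snd p \<in> O' then w (fold2pi (snd p + mu * (T - fst p))) else 0)" for p
    have sm [measurable]: "snd \<in> borel_measurable QM"
      by (rule measurable_compose[OF measurable_snd]) (intro measurable_restrict_space1, simp)
    have fstm [measurable]: "fst \<in> borel_measurable QM"
      using measurable_fst[of lborel torus_measure] by simp
    have fm: "(\<lambda>p. fold2pi (snd p + mu * (T - fst p))) \<in> measurable QM torus_measure"
    proof (rule measurable_restrict_space2)
      have "(\<lambda>p. fold2pi (snd p + mu * (T - fst p))) \<in> borel_measurable QM"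
        by (rule measurable_compose[OF _ fold2pi_measurable])
          (intro borel_measurable_add borel_measurable_times borel_measurable_diff sm fstm borel_measurable_const)
      then show "(\<lambda>p. fold2pi (snd p + mu * (T - fst p))) \<in> measurable QM lborel" by simp
    qed (simp add: fold2pi_bounds)
    have wm: "(\<lambda>p. w (fold2pi (snd p + mu * (T - fst p)))) \<in> borel_measurable QM"
      by (rule measurable_compose[OF fm]) measurable
    have vm: "v \<in> borel_measurable QM"
    proof -
      have 1: "{p\<in>space QM. fst p \<in> {0<..<T1}} \<in> sets QM"
        using measurable_sets[OF fstm, of "{0<..<T1}"] by (simp add: vimage_def Int_def conj_commute)
      have 2: "{p\<in>space QM. snd p \<in> O'} \<in> sets QM"
        using measurable_sets[OF sm, of O'] by (simp add: vimage_def Int_def conj_commute)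
      have "{p\<in>space QM. fst p \<in> {0<..<T1} \<and> snd p \<in> O'} \<in> sets QM"
      proof -
        have "{p\<in>space QM. fst p \<in> {0<..<T1} \<and> snd p \<in> O'} =
          {p\<in>space QM. fst p \<in> {0<..<T1}} \<inter> {p\<in>space QM. snd p \<in> O'}" by blast
        then show ?thesis using sets.Int[OF 1 2] by (simp only:)
      qed
      then show ?thesis unfolding v_def using wm by (intro measurable_If) simp_all
    qed
    interpret tm: sigma_finite_measure torus_measure by (rule sigma_finite_torus)
    interpret pr: pair_sigma_finite lborel torus_measure by unfold_locales
    have rot: "sqint torus_measure (\<lambda>x. w (fold2pi (x + d))) \<le> ennreal ((1 / c * a)\<^sup>2)" for d
      using L2bD(3)[OF w] by (subst nn_integral_rotation) auto
    have vb: "L2b QM v (sqrt T1 / c * a)"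
    proof -
      have "sqint QM v = (\<integral>\<^sup>+t. (sqint torus_measure (\<lambda>x. v (t, x))) \<partial>lborel)"
        by (rule tm.nn_integral_fst[symmetric]) (use vm in measurable)
      also have "\<dots> \<le> (\<integral>\<^sup>+t. ennreal ((1 / c * a)\<^sup>2) * indicator {0<..<T1} t \<partial>lborel)"
      proof (rule nn_integral_mono)
        fix t
        show "sqint torus_measure (\<lambda>x. v (t, x)) \<le> ennreal ((1 / c * a)\<^sup>2) * indicator {0<..<T1} t"
        proof (cases "t \<in> {0<..<T1}")
          case True
          have "sqint torus_measure (\<lambda>x. v (t, x)) \<le> sqint torus_measure (\<lambda>x. w (fold2pi (x + mu * (T - t))))"
            by (rule nn_integral_mono) (auto simp: v_def)
          then show ?thesis using rot[of "mu * (T - t)"] True by simp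
        next
          case False
          then have "v (t, x) = 0" for x unfolding v_def by auto
          then show ?thesis by simp
        qed
      qed
      also have "\<dots> = ennreal ((1 / c * a)\<^sup>2) * ennreal T1"
        using T1 by (subst nn_integral_cmult_indicator) auto
      also have "\<dots> = ennreal ((sqrt T1 / c * a)\<^sup>2)"
        using T1 by (simp add: ennreal_mult[symmetric] power_mult_distrib power_divide)
      finally show ?thesis using vm T1 c(1) a by (simp add: L2b_def)
    qed
    show "\<exists>v. L2b QM v (sqrt T1 / c * a) \<and>
      (\<forall>t x. v (t, x) \<noteq> 0 \<longrightarrow> 0 < t \<and> t < T1 \<and> cis x \<in> \<omega>) \<and>
      (\<forall>n. (LINT t|lborel. cis (- (of_int n * mu * (T - t))) * tcoeff n (\<lambda>x. v (t, x)))
       = tcoeff n z)"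
    proof (intro exI[of _ v] conjI allI vb impI)
      fix t x assume "v (t, x) \<noteq> 0"
      then show "0 < t" "t < T1" "cis x \<in> \<omega>" by (auto simp: v_def O'_def split: if_splits)
    next
      fix n
      \<comment> \<open>Integrand in the variable \<open>x + mu * (T - t)\<close>, the end point of
        the characteristic. In it the moment is a double integral, whose inner integral over time
        gives \<open>m x * w x\<close>, that is \<open>z x\<close>.\<close>
      define g where "g p = indicator {0<..<T1} (fst p) *\<^sub>R (indicator O' (snd p - mu * (T - fst p)) *\<^sub>R (ee (- n) (snd p) * w (snd p)))" for p
      have w_int: "integrable torus_measure w"
        by (rule L2b_cauchy_schwarz(1)[OF w torus_measure_finite]) simp
      have gm: "g \<in> borel_measurable QM"
      proof -
        have 1: "(\<lambda>p. snd p - mu * (T - fst p)) \<in> borel_measurable QM"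
          using sm measurable_fst[of lborel torus_measure] by (intro borel_measurable_diff borel_measurable_times) auto
        have 2: "(\<lambda>p. indicator O' (snd p - mu * (T - fst p)) :: real) \<in> borel_measurable QM"
          by (rule measurable_compose[OF 1]) measurable
        have 3: "(\<lambda>p. indicator {0<..<T1} (fst p) :: real) \<in> borel_measurable QM"
          by (rule measurable_compose[OF measurable_fst]) measurable
        have 4: "(\<lambda>p. ee (- n) (snd p) * w (snd p)) \<in> borel_measurable QM"
          by (rule measurable_compose[OF measurable_snd, of "\<lambda>x. ee (- n) x * w x"]) measurable
        show ?thesis unfolding g_def using 2 3 4 by simp
      qed
      have g_int: "integrable QM g"
      proof (rule pr.Fubini_integrable)
        show "AE t in lborel. integrable torus_measure (\<lambda>x. g (t, x))"
        proof (rule AE_I2)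
          fix t
          show "integrable torus_measure (\<lambda>x. g (t, x))"
          proof (rule Bochner_Integration.integrable_bound[OF w_int section_measurable[OF gm]], rule AE_I2)
            show "norm (g (t, x)) \<le> norm (w x)" for x by (simp add: g_def indicator_def norm_mult)
          qed
        qed
        show "integrable lborel (\<lambda>t. LINT x|torus_measure. norm (g (t, x)))"
        proof (rule Bochner_Integration.integrable_bound[of lborel "\<lambda>t. indicator {0<..<T1} t * (LINT x|torus_measure. norm (w x))"])
          show "integrable lborel (\<lambda>t. indicator {0<..<T1} t * (LINT x|torus_measure. norm (w x)))"
            by (intro integrable_mult_left integrable_real_indicator) (use T1 in auto)
          show "(\<lambda>t. LINT x|torus_measure. norm (g (t, x))) \<in> borel_measurable lborel"
            by (rule tm.borel_measurable_lebesgue_integral) (use gm in \<open>simp add: split_beta'\<close>)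
          have "(LINT x|torus_measure. norm (g (t, x))) \<le> indicator {0<..<T1} t * (LINT x|torus_measure. norm (w x))" for t
          proof (cases "t \<in> {0<..<T1}")
            case True
            have "(LINT x|torus_measure. norm (g (t, x))) \<le> (LINT x|torus_measure. norm (w x))"
            proof (rule integral_mono')
              show "integrable torus_measure (\<lambda>x. norm (w x))" using w_int by simp
              show "norm (g (t, x)) \<le> norm (w x)" for x by (simp add: g_def indicator_def norm_mult)
            qed simp
            then show ?thesis using True by simp
          qed (simp add: g_def)
          moreover have "\<bar>p\<bar> \<le> \<bar>q\<bar>" if "0 \<le> p" "p \<le> q" for p q :: real using that by simp
          ultimately show "AE t in lborel. norm (LINT x|torus_measure. norm (g (t, x))) \<le> norm (indicator {0<..<T1} t * (LINT x|torus_measure. norm (w x)))"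
            unfolding real_norm_def by (intro AE_I2) simp
        qed
      qed (rule gm)
      have "cis (- (of_int n * mu * (T - t))) * tcoeff n (\<lambda>x. v (t, x)) = (LINT x|torus_measure. g (t, x))" for t
      proof -
        have "cis (- (of_int n * mu * (T - t))) * (ee (- n) x * v (t, x)) = g (t, fold2pi (x + mu * (T - t)))"
          if x: "x \<in> space torus_measure" for x
        proof -
          have xO: "fold2pi (x + mu * (T - t)) - mu * (T - t) \<in> O' \<longleftrightarrow> x \<in> O'"
            by (simp add: O'_def cis_divide[symmetric] cis_mult[symmetric])
          have "cis (- (of_int n * mu * (T - t))) * ee (- n) x = ee (- n) (fold2pi (x + mu * (T - t)))"
            unfolding ee_fold2pi by (simp add: cis_mult algebra_simps)
          then show ?thesis by (auto simp: g_def v_def xO indicator_def mult.assoc[symmetric])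
        qed
        then have "(LINT x|torus_measure. cis (- (of_int n * mu * (T - t))) * (ee (- n) x * v (t, x))) = (LINT x|torus_measure. g (t, fold2pi (x + mu * (T - t))))"
          by (intro Bochner_Integration.integral_cong) auto
        also have "\<dots> = (LINT x|torus_measure. g (t, x))"
          by (rule integral_rotation) (rule section_measurable[OF gm])
        finally show ?thesis by simp
      qed
      then have "(LINT t|lborel. cis (- (of_int n * mu * (T - t))) * tcoeff n (\<lambda>x. v (t, x))) = (LINT t|lborel. LINT x|torus_measure. g (t, x))"
        by simp
      also have "\<dots> = (LINT x|torus_measure. LINT t|lborel. g (t, x))"
        using pr.Fubini_integral[of "\<lambda>t x. g (t, x)"] g_int by (simp add: split_beta')
      also have "\<dots> = tcoeff n z"
      proof (intro Bochner_Integration.integral_cong refl)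
        fix x
        have "g (t, x) = (indicator {0<..<T1} t * indicator O' (x - mu * (T - t))) *\<^sub>R (ee (- n) x * w x)" for t
          by (simp add: g_def)
        then have "(LINT t|lborel. g (t, x)) = m x *\<^sub>R (ee (- n) x * w x)"
          using m_int[of x] m_integrable[of x] by simp
        also have "\<dots> = ee (- n) x * z x"
          using mc[of x] c(1) by (simp add: w_def scaleR_conv_of_real)
        finally show "(LINT t|lborel. g (t, x)) = ee (- n) x * z x" .
      qed
      finally show "(LINT t|lborel. cis (- (of_int n * mu * (T - t))) * tcoeff n (\<lambda>x. v (t, x)))
       = tcoeff n z" .
    qed
  qed
qed

definition diagm :: "('n \<Rightarrow> complex) \<Rightarrow> complex^'n^'n" where
  "diagm d = (\<chi> i j. if i = j then d i else 0)"

lemma diagm_mult [simp]: "(diagm d *v v) $ i = d i * v $ i"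
  by (simp add: diagm_def matrix_vector_mult_def if_distrib[where f="\<lambda>a. a * b" for b] cong: if_cong)

lemma flow_diagm: "flow (diagm d) t v $ i = exp (- d i * of_real t) * v $ i"
proof -
  have "((\<lambda>t. \<chi> i. exp (- d i * of_real t) * v $ i) has_vector_derivative - (diagm d *v (\<chi> i. exp (- d i * of_real t) * v $ i))) (at t)" for t
  proof (rule has_vector_derivative_vecI)
    fix i
    have "((\<lambda>z. exp (- d i * z) * v $ i) has_field_derivative - d i * (exp (- d i * of_real t) * v $ i)) (at (of_real t))"
      by (auto intro!: derivative_eq_intros)
    from has_vector_derivative_real_field[OF this]
    show "((\<lambda>t. (\<chi> i. exp (- d i * of_real t) * v $ i) $ i) has_vector_derivative (- (diagm d *v (\<chi> i. exp (- d i * of_real t) * v $ i))) $ i) (at t)"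
      by simp
  qed
  from flow_unique[OF this, of t] have "flow (diagm d) t (\<chi> i. exp (- d i * of_real 0) * v $ i) = (\<chi> i. exp (- d i * of_real t) * v $ i)"
    by simp
  then show ?thesis by (simp add: vec_eq_iff)
qed

lemma fourier_coeff_nth:
  assumes "L2b torus_measure f a"
  shows "fourier_coeff f n $ j = tcoeff n (\<lambda>x. f x $ j) / of_real (2 * pi)"
proof -
  have "(LINT x|torus_measure. ee (- n) x *s f x) $ j = (LINT x|torus_measure. (ee (- n) x *s f x) $ j)"
    by (rule integral_bounded_linear[OF bounded_linear_vec_nth L2b_torus_integrable(2)[OF assms], symmetric])
  then show ?thesis unfolding fourier_coeff_def vector_scaleR_component by (simp add: scaleR_conv_of_real)
qed

lemma norm_axis_eq: "norm (axis j (x::complex)) = norm x"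
proof -
  have "(norm (axis j x))\<^sup>2 = (\<Sum>i\<in>UNIV. (cmod (if i = j then x else 0))\<^sup>2)"
    unfolding norm_vec_def L2_set_def axis_def by (simp add: sum_nonneg)
  also have "\<dots> = (\<Sum>i\<in>UNIV. if i = j then (norm x)\<^sup>2 else 0)" by (rule sum.cong) auto
  finally have "(norm (axis j x))\<^sup>2 = (\<Sum>i\<in>UNIV. if i = j then (norm x)\<^sup>2 else 0)" .
  then show ?thesis by simp
qed

text \<open>Riesz-Fischer turns the target moments into a function on the circle, whose components
  are steered independently, each with its own speed.\<close>

lemma transport_control:
  fixes mu :: "'n::finite \<Rightarrow> real"
  assumes om: "openin (top_of_set torus) \<omega>" and ne: "\<omega> \<noteq> {}" and mu: "\<And>i. mu i \<noteq> 0" and T1: "0 \<le> T1"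
    and L: "\<And>i. max_gap \<omega> < ennreal (\<bar>mu i\<bar> * T1)"
  shows "\<exists>C\<ge>0. \<forall>(a :: int \<Rightarrow> complex^'n) A. l2b a A \<longrightarrow>
    (\<exists>v. ctl \<omega> 0 T1 (C * A) v \<and> (\<forall>n. mom (\<lambda>n. diagm (\<lambda>i. \<i> * of_int n * mu i)) (\<lambda>n. mat 1) T v n = a n))"
proof -
  have "\<forall>i. \<exists>C\<ge>0. \<forall>(z :: real \<Rightarrow> complex) a. L2b torus_measure z a \<longrightarrow>
    (\<exists>v. L2b QM v (C * a) \<and> transport_steers \<omega> T1 T (mu i) z v)"
    by (intro allI transport_control_scalar[OF om ne mu T1 L])
  then obtain C where C: "\<And>i. 0 \<le> C i" and ex: "\<And>i (z :: real \<Rightarrow> complex) a. L2b torus_measure z a \<Longrightarrow>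
      \<exists>v. L2b QM v (C i * a) \<and> transport_steers \<omega> T1 T (mu i) z v"
    by metis
  show ?thesis
  proof (intro exI[of _ "(\<Sum>i\<in>UNIV. C i) * sqrt (2 * pi)"] conjI allI impI)
    show "0 \<le> (\<Sum>i\<in>UNIV. C i) * sqrt (2 * pi)" by (simp add: C sum_nonneg)
    fix a :: "int \<Rightarrow> complex^'n" and A
    assume a: "l2b a A"
    obtain z where z: "L2b torus_measure z (sqrt (2 * pi) * A)" "\<And>n. fourier_coeff z n = a n"
      by (rule riesz_fischer[OF a]) blast
    have zj: "L2b torus_measure (\<lambda>x. z x $ j) (sqrt (2 * pi) * A)" for j
      using L2b_bounded_linear[OF z(1) bounded_linear_vec_nth, of j 1] by (simp add: Finite_Cartesian_Product.norm_nth_le)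
    have "\<forall>j. \<exists>w. L2b QM w (C j * (sqrt (2 * pi) * A)) \<and> transport_steers \<omega> T1 T (mu j) (\<lambda>x. z x $ j) w"
      using ex[OF zj] by blast
    then obtain w where ww: "\<And>j. L2b QM (w j) (C j * (sqrt (2 * pi) * A))" "\<And>j. transport_steers \<omega> T1 T (mu j) (\<lambda>x. z x $ j) (w j)"
      by metis
    have w: "L2b QM (w j) (C j * (sqrt (2 * pi) * A))"
      "w j (t, x) \<noteq> 0 \<Longrightarrow> 0 < t \<and> t < T1 \<and> cis x \<in> \<omega>"
      "(LINT t|lborel. cis (- (of_int n * mu j * (T - t))) * tcoeff n (\<lambda>x. w j (t, x)))
       = tcoeff n (\<lambda>x. z x $ j)" for j n t x
      using ww(1)[of j] ww(2)[of j] unfolding transport_steers_def by blast+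
    define v where "v p = (\<chi> j. w j p)" for p
    have v_eq: "v p = (\<Sum>j\<in>UNIV. axis j (w j p))" for p
      by (auto simp: v_def vec_eq_iff axis_def if_distrib cong: if_cong)
    have "L2b QM v (\<Sum>j\<in>UNIV. 1 * (C j * (sqrt (2 * pi) * A)))"
      unfolding v_eq
    proof (rule L2b_sum)
      fix j
      have "bounded_linear (axis j :: complex \<Rightarrow> complex^'n)"
        by (intro linear_conv_bounded_linear[THEN iffD1] linearI) (auto simp: axis_def vec_eq_iff)
      then show "L2b QM (\<lambda>p. axis j (w j p)) (1 * (C j * (sqrt (2 * pi) * A)))"
        by (intro L2b_bounded_linear[OF w(1)]) (auto simp: norm_axis_eq)
    qed simp
    then have vL: "L2b QM v ((\<Sum>i\<in>UNIV. C i) * sqrt (2 * pi) * A)"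
      by (simp add: sum_distrib_right mult.assoc)
    have vc: "ctl \<omega> 0 T1 ((\<Sum>i\<in>UNIV. C i) * sqrt (2 * pi) * A) v"
      unfolding ctl_def
    proof (intro conjI vL allI impI)
      fix t x assume "v (t, x) \<noteq> 0"
      then obtain j where "w j (t, x) \<noteq> 0" by (auto simp: v_def vec_eq_iff)
      from w(2)[OF this] show "0 < t" "t < T1" "cis x \<in> \<omega>" by auto
    qed
    show "\<exists>v. ctl \<omega> 0 T1 ((\<Sum>i\<in>UNIV. C i) * sqrt (2 * pi) * A) v \<and>
      (\<forall>n. mom (\<lambda>n. diagm (\<lambda>i. \<i> * of_int n * mu i)) (\<lambda>n. mat 1) T v n = a n)"
    proof (intro exI[of _ v] conjI vc allI)
      fix n
      let ?G = "\<lambda>n. diagm (\<lambda>i. \<i> * of_int n * mu i)"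
      have "mom ?G (\<lambda>n. mat 1) T v n $ j = a n $ j" for j
      proof -
        note int = mom_integrand[OF vc T1, of ?G n T "\<lambda>n. mat 1"]
        have fm: "(\<lambda>t. uhat v t n $ j) \<in> borel_measurable lborel"
          by (intro measurable_compose[OF uhat_measurable[OF ctlD(2)[OF vc]]] borel_measurable_continuous_onI continuous_on_component continuous_on_id)
        have wm: "(\<lambda>t. LINT x|torus_measure. ee (- n) x * w j (t, x)) \<in> borel_measurable lborel"
        proof -
          interpret sigma_finite_measure torus_measure by (rule sigma_finite_torus)
          have "(\<lambda>z. ee (- n) (snd z) * w j z) \<in> borel_measurable QM"
            by (intro borel_measurable_times L2bD(2)[OF w(1)] measurable_compose[OF measurable_snd borel_measurable_ee])
          then show ?thesis by (intro borel_measurable_lebesgue_integral) (simp add: split_beta')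
        qed
        have cm: "(\<lambda>t. cis (- (of_int n * mu j * (T - t)))) \<in> borel_measurable lborel"
          by (simp, intro borel_measurable_continuous_onI continuous_intros)
        have "mom ?G (\<lambda>n. mat 1) T v n $ j = (LINT t|lborel. flow (?G n) (T - t) (mat 1 *v uhat v t n) $ j)"
          unfolding mom_def by (rule integral_bounded_linear[OF bounded_linear_vec_nth int, symmetric])
        also have "\<dots> = (LINT t|lborel. cis (- (of_int n * mu j * (T - t))) * uhat v t n $ j)"
          by (simp add: flow_diagm cis_conv_exp algebra_simps)
        also have "\<dots> = (LINT t|lborel. (cis (- (of_int n * mu j * (T - t))) * tcoeff n (\<lambda>x. w j (t, x))) / of_real (2 * pi))"
        proof (rule integral_cong_AE)
          show "AE t in lborel. cis (- (of_int n * mu j * (T - t))) * uhat v t n $ j =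
            (cis (- (of_int n * mu j * (T - t))) * tcoeff n (\<lambda>x. w j (t, x))) / of_real (2 * pi)"
            using L2b_section_AE[OF vL]
            by eventually_elim (auto simp: uhat_def fourier_coeff_nth, simp add: v_def)
        qed (intro borel_measurable_times borel_measurable_divide cm fm wm borel_measurable_const)+
        also have "\<dots> = tcoeff n (\<lambda>x. z x $ j) / of_real (2 * pi)"
          using w(3)[of n j] by simp
        also have "\<dots> = a n $ j" using fourier_coeff_nth[OF z(1), of n j] z(2) by simp
        finally show ?thesis .
      qed
      then show "mom ?G (\<lambda>n. mat 1) T v n = a n" by (simp add: vec_eq_iff)
    qed
  qed
qed

lemma uhat_matrix_AE:
  fixes u :: "real \<times> real \<Rightarrow> complex^'n"
  assumes u: "L2b QM u A"
  shows "AE t in lborel. uhat (\<lambda>z. R (fst z) *v u z) t n = R t *v uhat u t n"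
  using L2b_section_AE[OF u]
proof eventually_elim
  fix t assume "\<exists>c. L2b torus_measure (\<lambda>x. u (t, x)) c"
  then obtain c where "L2b torus_measure (\<lambda>x. u (t, x)) c" ..
  from fourier_coeff_bounded_linear[OF this, of "\<lambda>v. R t *v v" n]
  show "uhat (\<lambda>z. R (fst z) *v u z) t n = R t *v uhat u t n"
    by (simp add: uhat_def vector_scalar_commute)
qed

lemma ctl_matrix:
  fixes u :: "real \<times> real \<Rightarrow> complex^'n" and R :: "real \<Rightarrow> complex^'n^'k"
  assumes u: "ctl \<omega> a b A u" and R: "R \<in> borel_measurable lborel" "\<And>t v. a < t \<Longrightarrow> t < b \<Longrightarrow> norm (R t *v v) \<le> k * norm v"
    and k: "0 \<le> k"
  shows "ctl \<omega> a b (k * A) (\<lambda>z. R (fst z) *v u z)"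
  unfolding ctl_def
proof (intro conjI allI impI)
  note uD = ctlD[OF u]
  have "L2b QM (\<lambda>z. R (fst z) *v u z) (k * A)"
  proof (rule L2b_le[OF uD(1)])
    show "(\<lambda>z. R (fst z) *v u z) \<in> borel_measurable QM"
      using R(1) by (intro borel_measurable_matrix_vector uD measurable_compose[OF measurable_fst])
    fix z :: "real \<times> real"
    show "norm (R (fst z) *v u z) \<le> k * norm (u z)"
      using uD(4)[of "fst z" "snd z"] R(2)[of "fst z" "u z"] by (cases "a < fst z \<and> fst z < b") auto
  qed (rule k)
  then show "L2b QM (\<lambda>z. R (fst z) *v u z) (k * A)" .
  fix t x assume "R (fst (t, x)) *v u (t, x) \<noteq> 0"
  then have "u (t, x) \<noteq> 0" by auto
  then show "a < t" "t < b" "cis x \<in> \<omega>" using u by (auto simp: ctl_def)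
qed

text \<open>Zero order terms that commute with the transport part are absorbed by conjugation.\<close>

lemma transport_control_commuting:
  fixes mu :: "'n::finite \<Rightarrow> real" and D :: "complex^'n^'n"
  assumes om: "openin (top_of_set torus) \<omega>" and ne: "\<omega> \<noteq> {}" and mu: "\<And>i. mu i \<noteq> 0" and T1: "0 \<le> T1"
    and L: "\<And>i. max_gap \<omega> < ennreal (\<bar>mu i\<bar> * T1)"
    and D: "\<And>i j. mu i \<noteq> mu j \<Longrightarrow> D $ i $ j = 0"
  shows "\<exists>C\<ge>0. \<forall>(a :: int \<Rightarrow> complex^'n) A. l2b a A \<longrightarrow>
    (\<exists>v. ctl \<omega> 0 T1 (C * A) v \<and> (\<forall>n. mom (\<lambda>n. diagm (\<lambda>i. \<i> * of_int n * mu i) + D) (\<lambda>n. mat 1) T v n = a n))"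
proof -
  let ?G = "\<lambda>n. diagm (\<lambda>i. \<i> * of_int n * mu i)"
  obtain C where C: "0 \<le> C" "\<And>(a :: int \<Rightarrow> complex^'n) A. l2b a A \<Longrightarrow>
    (\<exists>v. ctl \<omega> 0 T1 (C * A) v \<and> (\<forall>n. mom ?G (\<lambda>n. mat 1) T v n = a n))"
    using transport_control[of \<omega> mu T1 T, OF om ne mu T1 L] by blast
  define k where "k = exp (norm D * (\<bar>T\<bar> + T1))"
  show ?thesis
  proof (intro exI[of _ "k * C"] conjI allI impI)
    show "0 \<le> k * C" using C by (simp add: k_def)
    fix a :: "int \<Rightarrow> complex^'n" and A
    assume "l2b a A"
    then obtain v where v: "ctl \<omega> 0 T1 (C * A) v" "\<And>n. mom ?G (\<lambda>n. mat 1) T v n = a n" using C by blast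
    \<comment> \<open>\<open>R t\<close> inverts the flow of \<open>D\<close> over
      \<open>T - t\<close>. Applied to the control it removes this factor from the moment, because
      \<open>D\<close> commutes with the transport part.\<close>
    define R where "R t = mat_exp ((T - t) *\<^sub>R D)" for t
    have Rv: "R t *v w = flow D (- (T - t)) w" for t w by (simp add: R_def flow_def)
    have Rm: "R \<in> borel_measurable lborel"
      unfolding R_def by (simp, intro borel_measurable_continuous_onI continuous_on_compose2[OF continuous_on_mat_exp[of D]])
        (auto intro!: continuous_intros)
    have u: "ctl \<omega> 0 T1 (k * (C * A)) (\<lambda>z. R (fst z) *v v z)"
    proof (rule ctl_matrix[OF v(1) Rm])
      fix t w assume t: "0 < t" "t < T1"
      have "norm (R t *v w) \<le> exp (norm D * \<bar>- (T - t)\<bar>) * norm w"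
        unfolding Rv by (rule flow_norm_bound) simp
      also have "\<dots> \<le> k * norm w" unfolding k_def using t
        by (intro mult_right_mono) (auto intro!: mult_left_mono)
      finally show "norm (R t *v w) \<le> k * norm w" .
    qed (simp add: k_def)
    show "\<exists>v. ctl \<omega> 0 T1 (k * C * A) v \<and> (\<forall>n. mom (\<lambda>n. ?G n + D) (\<lambda>n. mat 1) T v n = a n)"
    proof (intro exI[of _ "\<lambda>z. R (fst z) *v v z"] conjI allI)
      show "ctl \<omega> 0 T1 (k * C * A) (\<lambda>z. R (fst z) *v v z)" using u by (simp add: mult.assoc)
      fix n
      have "?G n *v (D *v w) = D *v (?G n *v w)" for w
      proof -
        have "of_real (mu i) * (D $ i $ j * w $ j) = D $ i $ j * (of_real (mu j) * w $ j)" for i j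
          using D[of i j] by (cases "mu i = mu j") auto
        then have *: "\<i> * of_int n * of_real (mu i) * (D $ i $ j * w $ j) = D $ i $ j * (\<i> * of_int n * of_real (mu j) * w $ j)" for i j
          by (metis (no_types, opaque_lifting) mult.assoc mult.left_commute)
        have Dx: "(D *v x) $ i = (\<Sum>j\<in>UNIV. D $ i $ j * x $ j)" for x i
          by (simp add: matrix_vector_mult_def)
        show ?thesis
          unfolding vec_eq_iff diagm_mult Dx sum_distrib_left * by simp
      qed
      then have split: "flow (?G n + D) t w = flow (?G n) t (flow D t w)" for t w
        by (rule flow_commuting_sum)
      have "mom (\<lambda>n. ?G n + D) (\<lambda>n. mat 1) T (\<lambda>z. R (fst z) *v v z) n = (LINT t|lborel. flow (?G n) (T - t) (mat 1 *v uhat v t n))"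
        unfolding mom_def
      proof (rule integral_cong_AE)
        show "AE t in lborel. flow (?G n + D) (T - t) (mat 1 *v uhat (\<lambda>z. R (fst z) *v v z) t n) = flow (?G n) (T - t) (mat 1 *v uhat v t n)"
          using uhat_matrix_AE[OF ctlD(1)[OF v(1)], of R n]
        proof eventually_elim
          fix t assume "uhat (\<lambda>z. R (fst z) *v v z) t n = R t *v uhat v t n"
          then show "flow (?G n + D) (T - t) (mat 1 *v uhat (\<lambda>z. R (fst z) *v v z) t n) = flow (?G n) (T - t) (mat 1 *v uhat v t n)"
            using flow_add_time[of D "T - t" "- (T - t)"] by (simp add: split Rv)
        qed
      qed (intro borel_measurable_flow borel_measurable_matrix_vector uhat_measurable ctlD(2)[OF u] ctlD(2)[OF v(1)] borel_measurable_const)+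
      then show "mom (\<lambda>n. ?G n + D) (\<lambda>n. mat 1) T (\<lambda>z. R (fst z) *v v z) n = a n"
        using v(2)[of n] by (simp add: mom_def)
    qed
  qed
qed

section \<open>Controls with prescribed low frequencies\<close>

text \<open>A linear factor with root in the unit disc at most doubles the bound on the
  coefficients.\<close>

lemma coeff_prod_linear_bound:
  fixes z :: "'i \<Rightarrow> complex"
  assumes "finite K" "\<And>k. k \<in> K \<Longrightarrow> cmod (z k) \<le> 1"
  shows "cmod (coeff (\<Prod>k\<in>K. [:- z k, 1:]) i) \<le> 2 ^ card K"
  using assms
proof (induction K arbitrary: i)
  case (insert k K)
  let ?p = "\<Prod>k\<in>K. [:- z k, 1:]"
  have IH: "cmod (coeff ?p i) \<le> 2 ^ card K" for i using insert by auto
  have "coeff ([:- z k, 1:] * ?p) i = - z k * coeff ?p i + (case i of 0 \<Rightarrow> 0 | Suc j \<Rightarrow> coeff ?p j)"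
    by (simp add: mult_pCons_left coeff_pCons split: nat.splits)
  also have "cmod \<dots> \<le> cmod (- z k * coeff ?p i) + cmod (case i of 0 \<Rightarrow> 0 | Suc j \<Rightarrow> coeff ?p j)"
    by (rule norm_triangle_ineq)
  also have "\<dots> \<le> 2 ^ card K + 2 ^ card K"
  proof (rule add_mono)
    have "cmod (z k) * cmod (coeff ?p i) \<le> 1 * 2 ^ card K"
      using insert.prems[of k] IH[of i] by (intro mult_mono) auto
    then show "cmod (- z k * coeff ?p i) \<le> 2 ^ card K" by (simp add: norm_mult)
    show "cmod (case i of 0 \<Rightarrow> 0 | Suc j \<Rightarrow> coeff ?p j) \<le> 2 ^ card K"
      using IH by (cases i) auto
  qed
  finally show ?case using insert by simp
qed (simp add: coeff_1)

text \<open>Inverse of a Vandermonde matrix: \<open>l j i\<close> is the \<open>i\<close>-th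
  coefficient of the Lagrange polynomial of the node \<open>Z j\<close>, and interpolation
  reproduces the monomials up to degree \<open>M\<close>. The bound is \<open>2^M\<close> from the
  numerator over \<open>d^M\<close> from the denominator.\<close>

lemma lagrange_basis:
  fixes Z :: "nat \<Rightarrow> complex"
  assumes inj: "\<And>j k. j \<le> M \<Longrightarrow> k \<le> M \<Longrightarrow> j \<noteq> k \<Longrightarrow> cmod (Z j - Z k) \<ge> d" and d: "0 < d"
    and Z: "\<And>j. j \<le> M \<Longrightarrow> cmod (Z j) \<le> 1"
  obtains l :: "nat \<Rightarrow> nat \<Rightarrow> complex" where "\<forall>j i. j \<le> M \<longrightarrow> cmod (l j i) \<le> (2 / d) ^ M"
    and "\<forall>m i. m \<le> M \<longrightarrow> (\<Sum>j\<le>M. Z j ^ m * l j i) = (if i = m then 1 else 0)"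
proof -
  define q where "q j = (\<Prod>k\<in>{..M}-{j}. [:- Z k, 1:])" for j
  define D where "D j = (\<Prod>k\<in>{..M}-{j}. Z j - Z k)" for j
  have D: "cmod (D j) \<ge> d ^ M" if "j \<le> M" for j
  proof -
    have "(\<Prod>k\<in>{..M}-{j}. d) \<le> (\<Prod>k\<in>{..M}-{j}. cmod (Z j - Z k))"
      using that d by (intro prod_mono) (auto intro!: inj)
    then show ?thesis using that by (simp add: D_def prod_norm)
  qed
  have ne: "D j \<noteq> 0" if "j \<le> M" for j
    using D[OF that] d by (metis norm_zero not_le zero_less_power)
  define L where "L j = smult (1 / D j) (q j)" for j
  define l where "l j i = coeff (L j) i" for j i
  have deg: "degree (L j) \<le> M" if "j \<le> M" for j
  proof -
    have "degree (q j) \<le> (\<Sum>k\<in>{..M}-{j}. degree [:- Z k, 1:])" unfolding q_def using degree_prod_sum_le[of "{..M}-{j}" "\<lambda>k. [:- Z k, 1:]"] by (simp add: comp_def)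
    then show ?thesis using that unfolding L_def by (intro order_trans[OF degree_smult_le]) simp
  qed
  have Lval: "poly (L j) (Z k) = (if j = k then 1 else 0)" if "j \<le> M" "k \<le> M" for j k
  proof (cases "j = k")
    case True
    then show ?thesis using ne[OF that(1)] by (simp add: L_def q_def D_def poly_prod)
  next
    case False
    then have "poly (q j) (Z k) = 0" using that by (auto simp: q_def poly_prod intro!: bexI[of _ k])
    then show ?thesis using False by (simp add: L_def)
  qed
  show thesis
  proof (rule that[of l]; intro allI impI)
    fix j i assume j: "j \<le> M"
    have "cmod (coeff (q j) i) \<le> 2 ^ card ({..M} - {j})"
      unfolding q_def using Z by (intro coeff_prod_linear_bound) auto
    then have c: "cmod (coeff (q j) i) \<le> 2 ^ M" using j by simp
    have "cmod (l j i) = cmod (coeff (q j) i) / cmod (D j)" by (simp add: l_def L_def norm_divide)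
    also have "\<dots> \<le> 2 ^ M / d ^ M" using c D[OF j] d by (intro frac_le) auto
    finally show "cmod (l j i) \<le> (2 / d) ^ M" by (simp add: power_divide)
  next
    fix m i assume m: "m \<le> M"
    have "(\<Sum>j\<le>M. smult (Z j ^ m) (L j)) = monom 1 m"
    proof (rule poly_eqI_degree[of "Z ` {..M}"])
      have "inj_on Z {..M}"
      proof (rule inj_onI, rule ccontr)
        fix j k assume "j \<in> {..M}" "k \<in> {..M}" "Z j = Z k" "j \<noteq> k"
        then show False using inj[of j k] d by auto
      qed
      then have card: "card (Z ` {..M}) = Suc M" by (simp add: card_image)
      have "degree (\<Sum>j\<le>M. smult (Z j ^ m) (L j)) \<le> M"
      proof (intro degree_sum_le)
        fix j assume "j \<in> {..M}"
        then show "degree (smult (Z j ^ m) (L j)) \<le> M" using deg[of j] by (auto intro: order_trans[OF degree_smult_le])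
      qed simp
      then show "degree (\<Sum>j\<le>M. smult (Z j ^ m) (L j)) < card (Z ` {..M})" by (simp add: card)
      show "degree (monom (1::complex) m) < card (Z ` {..M})"
        using m by (simp add: card degree_monom_eq)
      fix x assume "x \<in> Z ` {..M}"
      then obtain k where k: "k \<le> M" "x = Z k" by auto
      have "poly (\<Sum>j\<le>M. smult (Z j ^ m) (L j)) x = (\<Sum>j\<le>M. if j = k then Z j ^ m else 0)"
        unfolding k(2) poly_sum by (intro sum.cong) (use Lval k in auto)
      also have "\<dots> = x ^ m" using k by simp
      finally show "poly (\<Sum>j\<le>M. smult (Z j ^ m) (L j)) x = poly (monom 1 m) x" by (simp add: poly_monom)
    qed
    then have "coeff (\<Sum>j\<le>M. smult (Z j ^ m) (L j)) i = coeff (monom 1 m) i" by simp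
    then show "(\<Sum>j\<le>M. Z j ^ m * l j i) = (if i = m then 1 else 0)"
      by (simp add: coeff_sum l_def eq_commute)
  qed
qed

lemma sin_ge_half:
  fixes x :: real assumes "0 \<le> x" "x \<le> 1"
  shows "x / 2 \<le> sin x"
proof -
  define f where "f t = sin t - t / 2" for t :: real
  have cosg: "cos t \<ge> 1 / 2" if "0 \<le> t" "t \<le> 1" for t :: real
  proof -
    have "cos t \<ge> cos (pi / 3)" using that pi_gt3 by (intro cos_monotone_0_pi_le) auto
    then show ?thesis by (simp add: cos_60)
  qed
  have "f 0 \<le> f x"
  proof (rule DERIV_nonneg_imp_nondecreasing[OF assms(1)])
    fix t assume t: "0 \<le> t" "t \<le> x"
    have "(f has_real_derivative (cos t - 1 / 2)) (at t)" unfolding f_def by (auto intro!: derivative_eq_intros)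
    then show "\<exists>y. (f has_real_derivative y) (at t) \<and> 0 \<le> y" using cosg[of t] t assms by auto
  qed
  then show ?thesis by (simp add: f_def)
qed

lemma cos_ge_half:
  fixes t :: real assumes "\<bar>t\<bar> \<le> 1"
  shows "1 / 2 \<le> cos t"
proof -
  have "cos \<bar>t\<bar> \<ge> cos (pi / 3)" using assms pi_gt3 by (intro cos_monotone_0_pi_le) auto
  then show ?thesis by (simp add: cos_60)
qed

lemma cis_dist_lower:
  assumes "\<bar>a - b\<bar> \<le> 1"
  shows "\<bar>a - b\<bar> / 2 \<le> cmod (cis a - cis b)"
proof -
  have "\<bar>a - b\<bar> / 2 \<le> sin \<bar>a - b\<bar>" by (rule sin_ge_half) (use assms in auto)
  also have "\<dots> \<le> \<bar>Im (cis (a - b) - 1)\<bar>"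
  proof -
    have "sin \<bar>d\<bar> \<le> \<bar>sin d\<bar>" for d :: real by (auto simp: abs_if)
    then show ?thesis by simp
  qed
  also have "\<dots> \<le> cmod (cis (a - b) - 1)" by (rule abs_Im_le_cmod)
  also have "\<dots> = cmod (cis b) * cmod (cis (a - b) - 1)" by simp
  also have "\<dots> = cmod (cis a - cis b)"
    unfolding norm_mult[symmetric] by (simp add: right_diff_distrib cis_mult)
  finally show ?thesis .
qed

section \<open>Biorthogonal families supported on an arc\<close>

lemma arc_in_open:
  assumes om: "openin (top_of_set torus) \<omega>" and ne: "\<omega> \<noteq> {}"
  obtains a h where "0 \<le> a" "0 < h" "h \<le> 1" "a + h < 2 * pi" "\<And>x. a \<le> x \<Longrightarrow> x < a + h \<Longrightarrow> cis x \<in> \<omega>"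
proof -
  obtain z where z: "z \<in> \<omega>" using ne by auto
  moreover have "\<omega> \<subseteq> torus" using om openin_imp_subset by blast
  ultimately have "cmod z = 1" "z \<noteq> 0" by auto
  then have zz: "z = cis (Arg z)" using cis_Arg[of z] by (auto simp: sgn_eq)
  define a where "a = fold2pi (Arg z)"
  have a: "0 \<le> a" "a < 2 * pi" "a \<in> {x. cis x \<in> \<omega>}" using fold2pi_bounds[of "Arg z"] z zz by (auto simp: a_def)
  then obtain e where e: "0 < e" "\<And>x. \<bar>x - a\<bar> < e \<Longrightarrow> cis x \<in> \<omega>"
    using open_cis_preimage[OF om] unfolding open_dist by (force simp: dist_real_def)
  define h where "h = min (min e (2 * pi - a)) 1 / 2"
  show thesis
  proof (rule that[of a h])
    have h: "h \<le> e / 2" "h \<le> (2 * pi - a) / 2" by (auto simp: h_def)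
    then show "a + h < 2 * pi" using a by argo
    show "cis x \<in> \<omega>" if "a \<le> x" "x < a + h" for x using that a e(1) h by (intro e(2)) (simp add: abs_if)
  qed (use a e in \<open>auto simp: h_def\<close>)
qed

text \<open>Under \<open>|n| e <= 1\<close> the phase stays in \<open>[-1, 1]\<close>, where the
  cosine is at least \<open>1/2\<close>, so the real part cannot cancel.\<close>

lemma integral_ee_interval:
  assumes "0 \<le> a" "0 < e" "a + e \<le> 2 * pi"
  shows "(LINT x|torus_measure. ee n x * indicator {a..<a + e} x) = ee n a * (LINT x:{0..<e}|lborel. ee n x)"
    and "\<bar>real_of_int n\<bar> * e \<le> 1 \<Longrightarrow> e / 2 \<le> cmod (LINT x:{0..<e}|lborel. ee n x)"
proof -
  have "(LINT x|torus_measure. ee n x * indicator {a..<a + e} x) = (LINT x|lborel. indicator {a..<a + e} x *\<^sub>R ee n x)"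
    unfolding integral_torus set_lebesgue_integral_def using assms
    by (intro Bochner_Integration.integral_cong) (auto simp: indicator_def)
  also have "\<dots> = (LINT x|lborel. indicator {a..<a + e} (a + x) *\<^sub>R ee n (a + x))"
    using lborel_integral_real_affine[of 1 "\<lambda>x. indicator {a..<a + e} x *\<^sub>R ee n x" a] by simp
  also have "\<dots> = (LINT x|lborel. ee n a * (indicator {0..<e} x *\<^sub>R ee n x))"
    by (intro Bochner_Integration.integral_cong) (auto simp: indicator_def cis_mult algebra_simps)
  finally show "(LINT x|torus_measure. ee n x * indicator {a..<a + e} x) = ee n a * (LINT x:{0..<e}|lborel. ee n x)"
    by (simp only: set_lebesgue_integral_def integral_mult_right_zero)
  assume n: "\<bar>real_of_int n\<bar> * e \<le> 1"
  have int: "set_integrable lborel {0..<e} (ee n)"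
  proof (rule set_integrable_subset)
    show "set_integrable lborel {0..e} (ee n)"
      unfolding set_integrable_def by (rule borel_integrable_compact) (auto intro!: continuous_intros)
  qed auto
  have intc: "set_integrable lborel {0..<e} (\<lambda>x. cos (of_int n * x))"
  proof (rule set_integrable_subset)
    show "set_integrable lborel {0..e} (\<lambda>x. cos (of_int n * x))"
      unfolding set_integrable_def by (rule borel_integrable_compact) (auto intro!: continuous_intros)
  qed auto
  have "e / 2 = (LINT x:{0..<e}|lborel. 1 / 2)"
    using assms by (simp add: set_lebesgue_integral_def)
  also have "\<dots> \<le> (LINT x:{0..<e}|lborel. cos (of_int n * x))"
  proof (rule set_integral_mono[OF _ intc])
    show "set_integrable lborel {0..<e} (\<lambda>x. 1 / 2 :: real)"
      unfolding set_integrable_def by (intro integrable_scaleR_left integrable_real_indicator) (use assms in auto)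
    fix x assume x: "x \<in> {0..<e}"
    have "\<bar>of_int n * x\<bar> \<le> \<bar>real_of_int n\<bar> * e" using x by (simp add: abs_mult mult_left_mono)
    then show "1 / 2 \<le> cos (of_int n * x)" using n by (intro cos_ge_half) linarith
  qed
  also have "\<dots> = Re (LINT x:{0..<e}|lborel. ee n x)"
    using int by (simp add: set_lebesgue_integral_def set_integrable_def integral_Re[symmetric])
  also have "\<dots> \<le> cmod (LINT x:{0..<e}|lborel. ee n x)" by (rule complex_Re_le_cmod)
  finally show "e / 2 \<le> cmod (LINT x:{0..<e}|lborel. ee n x)" .
qed

text \<open>A family biorthogonal to the exponentials of frequency at most \<open>N\<close>; its
  coefficients at higher frequencies are left free.\<close>

definition dual_family :: "complex set \<Rightarrow> nat \<Rightarrow> real \<Rightarrow> (int \<Rightarrow> real \<Rightarrow> complex) \<Rightarrow> bool" where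
  "dual_family \<omega> N G b \<longleftrightarrow> (\<forall>m. \<bar>m\<bar> \<le> int N \<longrightarrow>
    b m \<in> borel_measurable borel \<and> (\<forall>x. b m x \<noteq> 0 \<longrightarrow> cis x \<in> \<omega>) \<and> (\<forall>x. cmod (b m x) \<le> G) \<and>
    (\<forall>n. \<bar>n\<bar> \<le> int N \<longrightarrow> tcoeff n (b m) / of_real (2 * pi) = (if n = m then 1 else 0)))"

text \<open>Prescribed low Fourier coefficients are realised by a function that is constant on each of
  \<open>2N + 1\<close> equal pieces of an arc; the crude cost \<open>(CN)\<^bsup>4N\<^esup>\<close> suffices.\<close>

lemma static_control:
  assumes om: "openin (top_of_set torus) \<omega>" and ne: "\<omega> \<noteq> {}"
  obtains C where "1 \<le> C" and "\<And>N::nat. 1 \<le> N \<Longrightarrow> \<exists>b. dual_family \<omega> N ((C * real N) ^ (4 * N)) b"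
proof -
  obtain a h where ah: "0 \<le> a" "0 < h" "h \<le> 1" "a + h < 2 * pi" "\<And>x. a \<le> x \<Longrightarrow> x < a + h \<Longrightarrow> cis x \<in> \<omega>"
    using arc_in_open[OF om ne] by blast
  \<comment> \<open>\<open>252 = 12 * 21\<close>: the \<open>12\<close> comes from
    \<open>4 / d <= 12 N / h\<close>, and \<open>21 = 3 * 7\<close> from at most \<open>3 N\<close>
    pieces and the crude bound \<open>7\<close> for \<open>pi\<close>.\<close>
  define C where "C = 252 / h"
  have C1: "1 \<le> C" using ah by (simp add: C_def field_simps)
  show thesis
  proof (rule that[OF C1])
    fix N :: nat assume N: "1 \<le> N"
    \<comment> \<open>The \<open>2 N + 1\<close> frequencies require as many pieces, indexed by
      \<open>0..M\<close>.\<close>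
    define M where "M = 2 * N"
    define d where "d = h / (real M + 1)"
    have d: "0 < d" "d \<le> 1" "(real M + 1) * d = h" using ah N by (auto simp: d_def field_simps)
    define xx where "xx j = a + real j * d" for j
    define Z where "Z j = cis (- xx j)" for j
    have Md: "real j * d + d \<le> h" if "j \<le> M" for j
    proof -
      have "real j * d + d = (real j + 1) * d" by (simp add: algebra_simps)
      also have "\<dots> \<le> (real M + 1) * d" using that d by (intro mult_right_mono) auto
      finally show ?thesis using d by simp
    qed
    have sep: "d / 2 \<le> cmod (Z j - Z k)" if "j \<le> M" "k \<le> M" "j \<noteq> k" for j k
    proof -
      have diff: "\<bar>- xx j - - xx k\<bar> = \<bar>real j - real k\<bar> * d" using d
        by (simp add: xx_def left_diff_distrib[symmetric] abs_mult abs_minus_commute)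
      have "1 \<le> \<bar>real j - real k\<bar>" using that(3) by linarith
      then have "1 * d \<le> \<bar>real j - real k\<bar> * d" using d by (intro mult_right_mono) auto
      moreover have "\<bar>real j - real k\<bar> * d \<le> 1"
      proof -
        have "\<bar>real j - real k\<bar> * d \<le> real M * d" using that d by (intro mult_right_mono) auto
        then show ?thesis using Md[of M] d(1) ah by linarith
      qed
      ultimately show ?thesis
        using cis_dist_lower[of "- xx j" "- xx k"] unfolding Z_def diff by simp
    qed
    have Z1: "cmod (Z j) \<le> 1" for j by (simp add: Z_def)
    obtain l where l0: "\<forall>j i. j \<le> M \<longrightarrow> cmod (l j i) \<le> (2 / (d / 2)) ^ M"
      "\<forall>m i. m \<le> M \<longrightarrow> (\<Sum>j\<le>M. Z j ^ m * l j i) = (if i = m then 1 else 0)"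
      by (rule lagrange_basis[of M "d / 2" Z, OF sep half_gt_zero[OF d(1)] Z1]) blast
    define g where "g n = (LINT x:{0..<d}|lborel. ee n x)" for n
    have nd: "\<bar>real_of_int n\<bar> * d \<le> 1" if "\<bar>n\<bar> \<le> int N" for n
    proof -
      have "\<bar>real_of_int n\<bar> * d \<le> real M * d" using that d N by (intro mult_right_mono) (auto simp: M_def)
      then show ?thesis using Md[of M] d(1) ah by linarith
    qed
    have g: "d / 2 \<le> cmod (g n)" if "\<bar>n\<bar> \<le> int N" for n
      unfolding g_def by (rule integral_ee_interval(2)[of 0]) (use d nd[OF that] pi_ge_two in auto)
    have l: "\<And>j i. j \<le> M \<Longrightarrow> cmod (l j i) \<le> (2 / (d / 2)) ^ M"
      "\<And>m i. m \<le> M \<Longrightarrow> (\<Sum>j\<le>M. Z j ^ m * l j i) = (if i = m then 1 else 0)"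
      using l0 by blast+
    \<comment> \<open>The factor \<open>Z j ^ N\<close> shifts the frequencies \<open>- N..N\<close>
      to the exponents \<open>0..M\<close>; the quotient by \<open>g (- m)\<close> normalises the
      Fourier coefficient of a single piece.\<close>
    define c where "c m j = Z j ^ N * l j (nat (m + int N)) * (of_real (2 * pi) / g (- m))" for m j
    define b where "b m x = (\<Sum>j\<le>M. c m j * indicator {xx j..<xx j + d} x)" for m x
    have c: "cmod (c m j) \<le> (4 / d) ^ M * (4 * pi / d)" if m: "\<bar>m\<bar> \<le> int N" and j: "j \<le> M" for m j
    proof -
      have "cmod (c m j) = cmod (l j (nat (m + int N))) * (2 * pi / cmod (g (- m)))"
        by (simp add: c_def norm_mult norm_divide norm_power Z_def)
      also have "\<dots> \<le> (2 / (d / 2)) ^ M * (2 * pi / (d / 2))"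
        using g[of "- m"] m d by (intro mult_mono l(1) j frac_le) auto
      finally show ?thesis by simp
    qed
    have dle: "4 / d \<le> 12 * real N / h"
    proof -
      have "4 / d = 4 * (real M + 1) / h" using ah d by (simp add: d_def)
      also have "\<dots> \<le> 12 * real N / h" using ah N by (intro divide_right_mono) (auto simp: M_def)
      finally show ?thesis .
    qed
    have bound: "cmod (b m x) \<le> (C * real N) ^ (4 * N)" if m: "\<bar>m\<bar> \<le> int N" for m x
    proof -
      let ?q = "12 * real N / h"
      have q: "1 \<le> ?q" using ah N by (simp add: field_simps)
      have "cmod (b m x) \<le> (\<Sum>j\<le>M. cmod (c m j * indicator {xx j..<xx j + d} x))" unfolding b_def by (rule norm_sum)
      also have "\<dots> \<le> (\<Sum>j\<le>M. (4 / d) ^ M * (4 * pi / d))"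
        by (intro sum_mono) (use c[OF m] d in \<open>auto simp: norm_mult indicator_def\<close>)
      also have "\<dots> = (real M + 1) * ((4 / d) ^ M * (4 / d * pi))" by simp
      also have "\<dots> \<le> (3 * real N) * (?q ^ M * (?q * 7))"
        using d dle N pi_less_4 ah
        by (intro mult_mono power_mono) (auto simp: M_def)
      also have "\<dots> \<le> (3 * ?q) * (?q ^ M * (?q * 7))"
        using N q ah by (intro mult_right_mono) (auto simp: field_simps)
      also have "\<dots> = 21 * ?q ^ (M + 2)" by simp
      also have "\<dots> \<le> 21 ^ (M + 2) * ?q ^ (M + 2)" using self_le_power[of "21::real" "M + 2"] q by (intro mult_right_mono) auto
      also have "\<dots> = (C * real N) ^ (M + 2)" by (simp add: power_mult_distrib[symmetric] C_def)
      also have "\<dots> \<le> (C * real N) ^ (4 * N)"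
      proof (rule power_increasing)
        show "1 \<le> C * real N" using mult_mono[OF C1, of 1 "real N"] N C1 by simp
      qed (use N in \<open>simp add: M_def\<close>)
      finally show ?thesis .
    qed
    show "\<exists>b. dual_family \<omega> N ((C * real N) ^ (4 * N)) b"
      unfolding dual_family_def
    proof (intro exI[of _ b] allI impI conjI)
      fix m :: int assume m: "\<bar>m\<bar> \<le> int N"
      show "b m \<in> borel_measurable borel" unfolding b_def by measurable
      show "cmod (b m x) \<le> (C * real N) ^ (4 * N)" for x by (rule bound[OF m])
      show "cis x \<in> \<omega>" if "b m x \<noteq> 0" for x
      proof -
        obtain j where j: "j \<le> M" "x \<in> {xx j..<xx j + d}"
          using \<open>b m x \<noteq> 0\<close> unfolding b_def by (metis (no_types, lifting) atMost_iff indicator_simps(2) mult_zero_right sum.neutral)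
        have "0 \<le> real j * d" using d by simp
        then show ?thesis using j(2) Md[OF j(1)] \<open>0 \<le> real j * d\<close> unfolding xx_def atLeastLessThan_iff by (intro ah(5)) linarith+
      qed
      fix n :: int assume n: "\<bar>n\<bar> \<le> int N"
      have piece: "tcoeff n (\<lambda>x. indicator {xx j..<xx j + d} x) = ee (- n) (xx j) * g (- n)" if "j \<le> M" for j
        unfolding g_def by (rule integral_ee_interval(1)) (use Md[OF that] d ah in \<open>auto simp: xx_def\<close>)
      have pint: "integrable torus_measure (\<lambda>x. c m j * (ee (- n) x * indicator {xx j..<xx j + d} x))" for j
        by (intro integrable_mult_right finite_measure.integrable_const_bound[OF finite_measure_torus, where B=1] AE_I2 borel_measurable_times)
          (auto simp: norm_mult indicator_def intro!: measurable_restrict_space1 borel_measurable_continuous_onI continuous_intros)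
      have "tcoeff n (b m) = (LINT x|torus_measure. (\<Sum>j\<le>M. c m j * (ee (- n) x * indicator {xx j..<xx j + d} x)))"
        unfolding b_def sum_distrib_left by (intro Bochner_Integration.integral_cong sum.cong refl) (simp only: mult_ac)
      also have "\<dots> = (\<Sum>j\<le>M. c m j * tcoeff n (\<lambda>x. indicator {xx j..<xx j + d} x))"
        by (subst Bochner_Integration.integral_sum[OF pint]) (simp only: integral_mult_right_zero)
      also have "\<dots> = (\<Sum>j\<le>M. (Z j ^ nat (n + int N) * l j (nat (m + int N))) * (of_real (2 * pi) / g (- m) * g (- n)))"
      proof (rule sum.cong[OF refl])
        fix j assume j: "j \<in> {..M}"
        have "Z j ^ N * ee (- n) (xx j) = Z j ^ nat (n + int N)"
          using n by (simp add: Z_def Complex.DeMoivre cis_mult algebra_simps)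
        then have "c m j * (ee (- n) (xx j) * g (- n)) = (Z j ^ nat (n + int N) * l j (nat (m + int N))) * (of_real (2 * pi) / g (- m) * g (- n))"
          by (simp add: c_def algebra_simps)
        then show "c m j * tcoeff n (\<lambda>x. indicator {xx j..<xx j + d} x) =
          (Z j ^ nat (n + int N) * l j (nat (m + int N))) * (of_real (2 * pi) / g (- m) * g (- n))"
          using piece[of j] j by simp
      qed
      also have "\<dots> = (\<Sum>j\<le>M. Z j ^ nat (n + int N) * l j (nat (m + int N))) * (of_real (2 * pi) / g (- m) * g (- n))"
        by (rule sum_distrib_right[symmetric])
      also have "(\<Sum>j\<le>M. Z j ^ nat (n + int N) * l j (nat (m + int N))) = (if n = m then 1 else 0)"
        using m n by (subst l(2)) (auto simp: M_def)
      also have "(if n = m then 1 else 0) * (of_real (2 * pi) / g (- m) * g (- n)) = (if n = m then of_real (2 * pi) else 0)"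
        using g[of "- m"] m d by auto
      finally show "tcoeff n (b m) / of_real (2 * pi) = (if n = m then 1 else 0)" by simp
    qed
  qed
qed

section \<open>Steering a mode through the Kalman condition\<close>

lemma norm_increment_bound:
  fixes f :: "real \<Rightarrow> 'a::real_normed_vector"
  assumes "\<And>s. \<bar>s\<bar> \<le> \<bar>t\<bar> \<Longrightarrow> (f has_vector_derivative f' s) (at s)" "\<And>s. \<bar>s\<bar> \<le> \<bar>t\<bar> \<Longrightarrow> norm (f' s) \<le> B"
  shows "norm (f t - f 0) \<le> B * \<bar>t\<bar>"
proof -
  have "norm (f t - f 0) \<le> B * norm (t - 0)"
  proof (rule differentiable_bound[of "closed_segment 0 t" f "\<lambda>s h. h *\<^sub>R f' s"])
    fix s assume "s \<in> closed_segment 0 t"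
    then have s: "\<bar>s\<bar> \<le> \<bar>t\<bar>" by (auto simp: closed_segment_eq_real_ivl split: if_splits)
    show "(f has_derivative (\<lambda>h. h *\<^sub>R f' s)) (at s within closed_segment 0 t)"
      using assms(1)[OF s] unfolding has_vector_derivative_def by (rule has_derivative_at_withinI)
    show "onorm (\<lambda>h. h *\<^sub>R f' s) \<le> B"
      using assms(2)[OF s] onorm_scaleR_left[OF bounded_linear_ident, of "f' s"] by (simp add: onorm_id)
  qed auto
  then show ?thesis by simp
qed

lemma flow_near_id:
  assumes "norm K \<le> C"
  shows "norm (flow K t v - v) \<le> \<bar>t\<bar> * (C * exp (C * \<bar>t\<bar>)) * norm v"
proof -
  have C: "0 \<le> C" using assms norm_ge_zero order_trans by blast
  have "norm (flow K t v - flow K 0 v) \<le> (C * (exp (C * \<bar>t\<bar>) * norm v)) * \<bar>t\<bar>"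
  proof (rule norm_increment_bound[OF flow_has_derivative])
    fix s assume s: "\<bar>s\<bar> \<le> \<bar>t\<bar>"
    have "norm (- (K *v flow K s v)) \<le> norm K * norm (flow K s v)" by (simp add: norm_matrix_vector_mult)
    also have "\<dots> \<le> C * (exp (C * \<bar>s\<bar>) * norm v)" using C assms by (intro mult_mono flow_norm_bound) auto
    also have "\<dots> \<le> C * (exp (C * \<bar>t\<bar>) * norm v)" using C s
      by (intro mult_left_mono mult_right_mono) (auto intro: mult_left_mono)
    finally show "norm (- (K *v flow K s v)) \<le> C * (exp (C * \<bar>t\<bar>) * norm v)" .
  qed
  then show ?thesis by (simp add: mult_ac)
qed

lemma power_dvd_pderiv:
  fixes p q :: "real poly"
  assumes "q ^ Suc k dvd p"
  shows "q ^ k dvd pderiv p"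
proof -
  obtain r where "p = q ^ Suc k * r" using assms by (auto elim: dvdE)
  then have "pderiv p = q ^ k * (q * pderiv r + smult (of_nat (Suc k)) (pderiv q) * r)"
    by (simp only: pderiv_mult pderiv_power_Suc) (simp add: algebra_simps)
  then show ?thesis by simp
qed

lemma power_dvd_higher_pderiv:
  fixes p q :: "real poly"
  assumes "q ^ (k + j) dvd p"
  shows "q ^ k dvd (pderiv ^^ j) p"
  using assms
proof (induction j arbitrary: k)
  case (Suc j)
  have "q ^ Suc k dvd (pderiv ^^ j) p" by (rule Suc.IH) (use Suc.prems in simp)
  then show ?case by (simp add: power_dvd_pderiv del: power_Suc)
qed simp

text \<open>A multiple of \<open>x^m (1 - x)^m\<close>: each derivative lowers the order of the
  zeros at the end points by at most one.\<close>

lemma bump_polynomial: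
  obtains p :: "real poly" where "\<forall>j<m. poly ((pderiv ^^ j) p) 0 = 0 \<and> poly ((pderiv ^^ j) p) 1 = 0"
    and "\<forall>s\<in>{0..1}. 0 \<le> poly p s" and "(LINT s:{0..1}|lborel. poly p s) = 1"
proof -
  define q where "q = [:0, 1:] ^ m * [:1, -1:: real:] ^ m"
  have cont: "continuous_on {0..1} (poly q)" by (intro continuous_intros)
  have pos: "0 \<le> poly q s" if "s \<in> {0..1}" for s using that by (simp add: q_def poly_power)
  define I where "I = (LINT s:{0..1}|lborel. poly q s)"
  have I: "I = integral {0..1} (poly q)"
    unfolding I_def by (rule set_borel_integral_eq_integral)
      (unfold set_integrable_def, rule borel_integrable_compact[OF _ cont], simp)
  have "I \<ge> 0" unfolding I by (rule integral_nonneg[OF integrable_continuous_real[OF cont]]) (use pos in auto)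
  moreover have "I \<noteq> 0"
  proof
    assume "I = 0"
    then have "\<forall>x\<in>{0..1}. poly q x = 0"
      using integral_eq_0_iff[OF cont] pos unfolding I by auto
    then have "poly q (1/2) = 0" by (auto dest: bspec[of _ _ "1/2"])
    then show False by (simp add: q_def poly_power)
  qed
  ultimately have Ipos: "I > 0" by simp
  define p where "p = smult (1 / I) q"
  have d0: "[:0, 1:] ^ m dvd p" "[:1, -1:] ^ m dvd p"
    unfolding p_def q_def by (auto intro: dvd_smult)
  have z: "poly ((pderiv ^^ j) p) 0 = 0 \<and> poly ((pderiv ^^ j) p) 1 = 0" if j: "j < m" for j
  proof -
    have m: "m = (m - j) + j" "m - j \<noteq> 0" using j by auto
    have "[:0, 1:] ^ (m - j) dvd (pderiv ^^ j) p" "[:1, -1:] ^ (m - j) dvd (pderiv ^^ j) p"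
      using d0 m(1) by (auto intro!: power_dvd_higher_pderiv)
    then obtain r s where "(pderiv ^^ j) p = [:0, 1:] ^ (m - j) * r" "(pderiv ^^ j) p = [:1, -1:] ^ (m - j) * s"
      by (auto elim!: dvdE)
    then have "poly ((pderiv ^^ j) p) 0 = poly ([:0, 1:] ^ (m - j) * r) 0" "poly ((pderiv ^^ j) p) 1 = poly ([:1, -1:] ^ (m - j) * s) 1"
      by simp_all
    then show ?thesis using m(2) by (simp add: poly_power)
  qed
  show thesis
  proof (rule that[of p])
    show "\<forall>s\<in>{0..1}. 0 \<le> poly p s" using pos Ipos by (simp add: p_def)
    show "(LINT s:{0..1}|lborel. poly p s) = 1" using Ipos by (simp add: p_def I_def[symmetric])
  qed (use z in auto)
qed

lemma set_integrable_continuous: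
  fixes f :: "real \<Rightarrow> 'a::euclidean_space"
  assumes "continuous_on {a..b} f"
  shows "set_integrable lborel {a..b} f"
  unfolding set_integrable_def by (rule borel_integrable_compact) (use assms in auto)

lemma flow_back_derivative: "((\<lambda>s. flow K (- s) b) has_vector_derivative K *v flow K (- s) b) (at s)"
proof -
  have "(uminus has_vector_derivative - 1) (at s)" by (auto intro!: derivative_eq_intros)
  from vector_diff_chain_at[OF this flow_has_derivative[of K b "- s"]] show ?thesis by (simp add: comp_def)
qed

lemma continuous_on_flow_comp [continuous_intros]:
  assumes "continuous_on S f" "continuous_on S g"
  shows "continuous_on S (\<lambda>s. flow K (f s) (g s))"
  unfolding flow_def
proof (rule bounded_bilinear.continuous_on[OF bounded_bilinear_matrix_vector _ assms(2)])
  show "continuous_on S (\<lambda>x. mat_exp ((- f x) *\<^sub>R K))"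
    by (rule continuous_on_compose2[OF continuous_on_mat_exp[of K]]) (auto intro!: continuous_intros assms)
qed

text \<open>Repeated integration by parts moves powers of \<open>K\<close> onto the time profile.\<close>

lemma bump_integral_pderiv:
  fixes p :: "real poly"
  assumes z: "\<forall>j<m. poly ((pderiv ^^ j) p) 0 = 0 \<and> poly ((pderiv ^^ j) p) 1 = 0" and tau: "0 < tau" and j: "j \<le> m"
  shows "(LINT s:{0..tau}|lborel. ((1 / tau) ^ Suc j * poly ((pderiv ^^ j) p) (s / tau)) *\<^sub>R flow K (- s) b)
    = (- 1) ^ j *\<^sub>R (LINT s:{0..tau}|lborel. ((1 / tau) * poly p (s / tau)) *\<^sub>R flow K (- s) (matpow K j *v b))"
  using j
proof (induction j arbitrary: b)
  case (Suc j)
  let ?q = "(pderiv ^^ j) p"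
  have q0: "poly ?q 0 = 0" "poly ?q 1 = 0" using z Suc.prems by auto
  define F where "F s = ((1 / tau) ^ Suc j * poly ?q (s / tau)) *\<^sub>R flow K (- s) b" for s
  have c1: "continuous_on {0..tau} (\<lambda>s. ((1 / tau) ^ Suc (Suc j) * poly (pderiv ?q) (s / tau)) *\<^sub>R flow K (- s) b)"
    by (intro continuous_intros) (use tau in auto)
  have c2: "continuous_on {0..tau} (\<lambda>s. ((1 / tau) ^ Suc j * poly ?q (s / tau)) *\<^sub>R flow K (- s) (K *v b))"
    by (intro continuous_intros) (use tau in auto)
  have dF: "(F has_vector_derivative ((1 / tau) ^ Suc (Suc j) * poly (pderiv ?q) (s / tau)) *\<^sub>R flow K (- s) b
      + ((1 / tau) ^ Suc j * poly ?q (s / tau)) *\<^sub>R flow K (- s) (K *v b)) (at s)" for s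
  proof -
    have "((\<lambda>s. (1 / tau) ^ Suc j * poly ?q (s / tau)) has_real_derivative (1 / tau) ^ Suc j * (poly (pderiv ?q) (s / tau) * (1 / tau))) (at s)"
      by (intro DERIV_cmult DERIV_chain2[OF poly_DERIV]) (use tau in \<open>auto intro!: derivative_eq_intros\<close>)
    from has_vector_derivative_scaleR[OF this flow_back_derivative[of K b s]]
    show ?thesis unfolding F_def by (simp add: flow_commute mult_ac add.commute)
  qed
  have "(LINT s:{0..tau}|lborel. ((1 / tau) ^ Suc (Suc j) * poly (pderiv ?q) (s / tau)) *\<^sub>R flow K (- s) b
      + ((1 / tau) ^ Suc j * poly ?q (s / tau)) *\<^sub>R flow K (- s) (K *v b)) = F tau - F 0"
    unfolding set_lebesgue_integral_def
    by (rule integral_FTC_atLeastAtMost[OF less_imp_le[OF tau] has_vector_derivative_at_within[OF dF] continuous_on_add[OF c1 c2]])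
  also have "\<dots> = 0" using tau q0 by (simp add: F_def)
  finally have "(LINT s:{0..tau}|lborel. ((1 / tau) ^ Suc (Suc j) * poly (pderiv ?q) (s / tau)) *\<^sub>R flow K (- s) b)
     = - (LINT s:{0..tau}|lborel. ((1 / tau) ^ Suc j * poly ?q (s / tau)) *\<^sub>R flow K (- s) (K *v b))"
    by (subst (asm) set_integral_add(2)[OF set_integrable_continuous[OF c1] set_integrable_continuous[OF c2]])
      (simp add: add_eq_0_iff2)
  also have "\<dots> = - ((- 1) ^ j *\<^sub>R (LINT s:{0..tau}|lborel. ((1 / tau) * poly p (s / tau)) *\<^sub>R flow K (- s) (matpow K j *v (K *v b))))"
    using Suc.IH[of "K *v b"] Suc.prems by simp
  also have "matpow K j *v (K *v b) = matpow K (Suc j) *v b"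
    by (simp add: matrix_vector_mul_assoc matpow_commute)
  finally show ?case by simp
qed simp

lemma near_identity_solve:
  fixes G :: "complex^'k \<Rightarrow> complex^'k"
  assumes G: "linear G" "\<And>x. norm (G x - x) \<le> norm x / 2"
  obtains x where "G x = y" "norm x \<le> 2 * norm y"
proof -
  have le: "norm x \<le> 2 * norm (G x)" for x
    using G(2)[of x] norm_triangle_ineq2[of x "x - G x"] by (simp add: norm_minus_commute)
  have "inj G"
  proof (rule linear_injective_0[OF G(1), THEN iffD2], intro allI impI)
    fix x assume "G x = 0" then show "x = 0" using le[of x] by simp
  qed
  then have "surj G" using linear_injective_imp_surjective[OF G(1)] by simp
  then obtain x where "y = G x" by (rule surjE)
  then show thesis using that[of x] le[of x] by simp
qed

lemma smult_of_real: "of_real r *s (v::complex^'n) = r *\<^sub>R v"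
  unfolding vec_eq_iff vector_scaleR_component by (simp add: scaleR_conv_of_real)

text \<open>The profile is the alternating sum of the derivatives of a bump, applied to the vectors
  \<open>R j *v x\<close>. Integration by parts turns its moment, pulled back to time 0, into an
  average of \<open>flow K (- s)\<close> applied to \<open>x\<close>, which is close to
  \<open>x\<close> for short times. The constants depend only on \<open>m\<close>,
  \<open>kap\<close> and \<open>rho\<close>, so one cost serves all frequencies; \<open>nu\<close>
  stands for the diffusion.\<close>

lemma kalman_steering:
  fixes m :: nat and kap rho :: real
  assumes kap: "0 \<le> kap" and rho: "0 \<le> rho"
  obtains tau0 C :: real where "0 < tau0" "tau0 \<le> 1" "0 \<le> C"
    and "\<And>(K :: complex^'k^'k) (B :: complex^'n^'k) R nu tau y.
      norm K \<le> kap \<Longrightarrow> (\<And>j. norm (R j) \<le> rho) \<Longrightarrow> (\<And>x. (\<Sum>j<m. matpow K j *v (B *v (R j *v x))) = x) \<Longrightarrow>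
      0 \<le> nu \<Longrightarrow> 0 < tau \<Longrightarrow> tau \<le> tau0 \<Longrightarrow>
      \<exists>v. continuous_on UNIV v \<and> (\<forall>s\<in>{0..tau}. norm (v s) \<le> C * (1 / tau) ^ (m + 1) * norm y) \<and>
        (LINT s:{0..tau}|lborel. flow (mat (of_real nu) + K) (- s) (B *v v s)) = y"
proof -
  obtain p :: "real poly" where p0: "\<forall>j<m. poly ((pderiv ^^ j) p) 0 = 0 \<and> poly ((pderiv ^^ j) p) 1 = 0"
    and pp: "\<forall>s\<in>{0..1}. 0 \<le> poly p s" and pI: "(LINT s:{0..1}|lborel. poly p s) = 1"
    by (rule bump_polynomial[of m]) blast
  have "\<exists>b. \<forall>s\<in>{0..1}. \<bar>poly ((pderiv ^^ j) p) s\<bar> \<le> b" for j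
  proof -
    have "compact (poly ((pderiv ^^ j) p) ` {0..1})" by (intro compact_continuous_image continuous_intros) auto
    then have "bounded (poly ((pderiv ^^ j) p) ` {0..1})" by (rule compact_imp_bounded)
    then show ?thesis unfolding bounded_iff by auto
  qed
  then obtain b where b: "\<And>j s. s \<in> {0..1} \<Longrightarrow> \<bar>poly ((pderiv ^^ j) p) s\<bar> \<le> b j" by metis
  have b0: "0 \<le> b j" for j using b[of 0 j] by auto
  \<comment> \<open>Then \<open>kap * s <= 1/4\<close> for \<open>s <= tau0\<close>, so
    \<open>flow K (- s) x - x\<close> has norm at most \<open>1/4 * 2\<close> times that of
    \<open>x\<close>, and the average \<open>G\<close> is within \<open>1/2\<close> of the
    identity.\<close>
  define tau0 where "tau0 = 1 / (4 * (kap + 1))"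
  have tau0: "0 < tau0" "tau0 \<le> 1" using kap by (auto simp: tau0_def field_simps)
  define C where "C = (\<Sum>j<m. b j * rho) * 2"
  have C: "0 \<le> C" using b0 rho by (simp add: C_def sum_nonneg)
  show thesis
  proof (rule that[OF tau0 C])
    fix K :: "complex^'k^'k" and B :: "complex^'n^'k" and R :: "nat \<Rightarrow> complex^'k^'n" and nu tau :: real and y
    assume K: "norm K \<le> kap" and R: "\<And>j. norm (R j) \<le> rho"
      and kal: "\<And>x. (\<Sum>j<m. matpow K j *v (B *v (R j *v x))) = x"
      and nu: "0 \<le> nu" and tau: "0 < tau" "tau \<le> tau0"
    define psi where "psi j s = (1 / tau) ^ Suc j * poly ((pderiv ^^ j) p) (s / tau)" for j s
    have cpsi: "continuous_on S (psi j)" for S j unfolding psi_def by (intro continuous_intros) (use tau in auto)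
    have psi0: "0 \<le> psi 0 s" if "s \<in> {0..tau}" for s
    proof -
      have "s / tau \<in> {0..1}" using that tau by auto
      then show ?thesis using pp tau by (simp add: psi_def)
    qed
    have psiI: "(LINT s:{0..tau}|lborel. psi 0 s) = 1"
    proof -
      have "(LINT s|lborel. indicator {0..tau} s *\<^sub>R psi 0 s) = \<bar>tau\<bar> *\<^sub>R (LINT s|lborel. indicator {0..tau} (0 + tau * s) *\<^sub>R psi 0 (0 + tau * s))"
        by (rule lborel_integral_real_affine) (use tau in auto)
      also have "(LINT s|lborel. indicator {0..tau} (0 + tau * s) *\<^sub>R psi 0 (0 + tau * s)) = (LINT s|lborel. (1 / tau) * (indicator {0..1} s *\<^sub>R poly p s))"
      proof (rule Bochner_Integration.integral_cong[OF refl])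
        fix s have "tau * s \<in> {0..tau} \<longleftrightarrow> s \<in> {0..1}" using tau by (auto simp: zero_le_mult_iff)
        then show "indicator {0..tau} (0 + tau * s) *\<^sub>R psi 0 (0 + tau * s) = (1 / tau) * (indicator {0..1} s *\<^sub>R poly p s)"
          using tau by (auto simp: psi_def indicator_def)
      qed
      finally show ?thesis using tau pI by (simp add: set_lebesgue_integral_def)
    qed
    define G where "G x = (LINT s:{0..tau}|lborel. psi 0 s *\<^sub>R flow K (- s) x)" for x
    have Gint: "set_integrable lborel {0..tau} (\<lambda>s. psi j s *\<^sub>R flow K (- s) x)" for x j
      by (intro set_integrable_continuous continuous_intros cpsi)
    have Glin: "linear G"
    proof (rule linearI)
      show "G (x1 + x2) = G x1 + G x2" for x1 x2
        unfolding G_def flow_add_right scaleR_add_right by (rule set_integral_add(2)[OF Gint Gint])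
      show "G (r *\<^sub>R x1) = r *\<^sub>R G x1" for r x1
        unfolding G_def flow_scaleR_right scaleR_left_commute[of _ r] by (rule set_integral_scaleR_right)
    qed
    have Gnear: "norm (G x - x) \<le> norm x / 2" for x
    proof -
      have i2: "set_integrable lborel {0..tau} (\<lambda>s. psi 0 s *\<^sub>R x)"
        by (intro set_integrable_continuous continuous_intros cpsi)
      have "x = (LINT s:{0..tau}|lborel. psi 0 s *\<^sub>R x)"
        using psiI set_integrable_continuous[OF cpsi[of "{0..tau}" 0]]
        by (simp add: set_lebesgue_integral_def set_integrable_def)
      then have "G x - x = (LINT s:{0..tau}|lborel. psi 0 s *\<^sub>R (flow K (- s) x - x))"
        unfolding G_def using set_integral_diff(2)[OF Gint[of 0 x] i2] by (simp add: scaleR_diff_right)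
      also have "norm \<dots> \<le> (LINT s:{0..tau}|lborel. norm (psi 0 s *\<^sub>R (flow K (- s) x - x)))"
        by (intro set_integral_norm_bound set_integrable_continuous continuous_intros cpsi)
      also have "\<dots> \<le> (LINT s:{0..tau}|lborel. psi 0 s * (norm x / 2))"
      proof (intro set_integral_mono set_integrable_continuous continuous_intros cpsi)
        fix s assume s: "s \<in> {0..tau}"
        have ks: "kap * \<bar>- s\<bar> \<le> 1 / 4"
        proof -
          have "kap * s \<le> kap * tau0" using s tau kap by (intro mult_left_mono) auto
          also have "\<dots> \<le> 1 / 4" using kap by (simp add: tau0_def field_simps)
          finally show ?thesis using s by simp
        qed
        have "exp (kap * \<bar>- s\<bar>) \<le> exp (1 / 4)" using ks by simp
        also have "\<dots> \<le> 2" using exp_bound[of "1/4::real"] by (simp add: power2_eq_square)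
        finally have e2: "exp (kap * \<bar>- s\<bar>) \<le> 2" .
        have "\<bar>- s\<bar> * (kap * exp (kap * \<bar>- s\<bar>)) = (kap * \<bar>- s\<bar>) * exp (kap * \<bar>- s\<bar>)" by simp
        also have "\<dots> \<le> (1 / 4) * 2" using ks e2 kap by (intro mult_mono) auto
        finally have "\<bar>- s\<bar> * (kap * exp (kap * \<bar>- s\<bar>)) * norm x \<le> 1 / 2 * norm x"
          by (intro mult_right_mono) auto
        then have "norm (flow K (- s) x - x) \<le> norm x / 2" using flow_near_id[OF K, of "- s" x] by simp
        then show "norm (psi 0 s *\<^sub>R (flow K (- s) x - x)) \<le> psi 0 s * (norm x / 2)"
          using psi0[OF s] mult_left_mono[of "norm (flow K (- s) x - x)" "norm x / 2" "psi 0 s"] by simp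
      qed
      also have "\<dots> = norm x / 2" using psiI by simp
      finally show ?thesis .
    qed
    obtain x where x: "G x = y" "norm x \<le> 2 * norm y" using near_identity_solve[OF Glin Gnear] by blast
    \<comment> \<open>The signs undo those of the \<open>j\<close> integrations by parts. The
      \<open>j\<close>-th derivative of the profile costs \<open>tau^-(j + 1)\<close> with
      \<open>j < m\<close>, which the power \<open>m + 1\<close> in the bound covers.\<close>
    define w where "w s = (\<Sum>j<m. ((- 1) ^ j * psi j s) *\<^sub>R (R j *v x))" for s
    have cw: "continuous_on S w" for S unfolding w_def by (intro continuous_intros cpsi)
    have wI: "(LINT s:{0..tau}|lborel. flow K (- s) (B *v w s)) = y"
    proof -
      have "flow K (- s) (B *v w s) = (\<Sum>j<m. (- 1) ^ j *\<^sub>R (psi j s *\<^sub>R flow K (- s) (B *v (R j *v x))))" for s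
        unfolding w_def
        by (simp add: linear_sum[OF bounded_linear.linear[OF bounded_linear_matrix_vector]] linear_sum[OF bounded_linear.linear[OF bounded_linear_flow]]
          linear_scale[OF bounded_linear.linear[OF bounded_linear_matrix_vector]] flow_scaleR_right)
      then have "(LINT s:{0..tau}|lborel. flow K (- s) (B *v w s)) = (\<Sum>j<m. (- 1) ^ j *\<^sub>R (LINT s:{0..tau}|lborel. psi j s *\<^sub>R flow K (- s) (B *v (R j *v x))))"
      proof -
        let ?f = "\<lambda>j s. indicator {0..tau} s *\<^sub>R (psi j s *\<^sub>R flow K (- s) (B *v (R j *v x)))"
        have int: "integrable lborel (\<lambda>s. (- 1) ^ j *\<^sub>R ?f j s)" for j
          using Gint[of j "B *v (R j *v x)"] unfolding set_integrable_def by (rule integrable_scaleR_right)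
        have "(LINT s|lborel. indicator {0..tau} s *\<^sub>R (\<Sum>j<m. (- 1) ^ j *\<^sub>R (psi j s *\<^sub>R flow K (- s) (B *v (R j *v x)))))
          = (LINT s|lborel. (\<Sum>j<m. (- 1) ^ j *\<^sub>R ?f j s))"
          unfolding scaleR_sum_right by (intro Bochner_Integration.integral_cong sum.cong refl) (rule scaleR_left_commute)
        also have "\<dots> = (\<Sum>j<m. LINT s|lborel. (- 1) ^ j *\<^sub>R ?f j s)"
          by (rule Bochner_Integration.integral_sum[OF int])
        also have "\<dots> = (\<Sum>j<m. (- 1) ^ j *\<^sub>R (LINT s|lborel. ?f j s))"
          by (intro sum.cong refl integral_scaleR_right)
        finally show ?thesis
          using \<open>\<And>s. flow K (- s) (B *v w s) = (\<Sum>j<m. (- 1) ^ j *\<^sub>R (psi j s *\<^sub>R flow K (- s) (B *v (R j *v x))))\<close>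
          unfolding set_lebesgue_integral_def by (simp only:)
      qed
      also have "\<dots> = (\<Sum>j<m. LINT s:{0..tau}|lborel. psi 0 s *\<^sub>R flow K (- s) (matpow K j *v (B *v (R j *v x))))"
      proof (rule sum.cong[OF refl])
        fix j assume "j \<in> {..<m}"
        then have "(LINT s:{0..tau}|lborel. psi j s *\<^sub>R flow K (- s) (B *v (R j *v x))) =
          (- 1) ^ j *\<^sub>R (LINT s:{0..tau}|lborel. psi 0 s *\<^sub>R flow K (- s) (matpow K j *v (B *v (R j *v x))))"
          using bump_integral_pderiv[OF p0 tau(1), of j K "B *v (R j *v x)"] by (simp add: psi_def)
        then show "(- 1) ^ j *\<^sub>R (LINT s:{0..tau}|lborel. psi j s *\<^sub>R flow K (- s) (B *v (R j *v x))) =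
          (LINT s:{0..tau}|lborel. psi 0 s *\<^sub>R flow K (- s) (matpow K j *v (B *v (R j *v x))))"
          by (simp flip: power_mult_distrib)
      qed
      also have "\<dots> = (\<Sum>j<m. G (matpow K j *v (B *v (R j *v x))))" by (simp add: G_def)
      also have "\<dots> = G (\<Sum>j<m. matpow K j *v (B *v (R j *v x)))" by (simp add: linear_sum[OF Glin])
      also have "\<dots> = y" by (simp add: kal x)
      finally show ?thesis .
    qed
    have wb: "norm (w s) \<le> C * (1 / tau) ^ (m + 1) * norm y" if s: "s \<in> {0..tau}" for s
    proof -
      have st: "s / tau \<in> {0..1}" using s tau by auto
      have "norm (w s) \<le> (\<Sum>j<m. norm (((- 1) ^ j * psi j s) *\<^sub>R (R j *v x)))" unfolding w_def by (rule norm_sum)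
      also have "\<dots> \<le> (\<Sum>j<m. ((1 / tau) ^ (m + 1) * b j) * (rho * (2 * norm y)))"
      proof (rule sum_mono)
        fix j assume "j \<in> {..<m}"
        then have "(1 / tau) ^ Suc j \<le> (1 / tau) ^ (m + 1)" using tau tau0 by (intro power_increasing) (auto simp: field_simps)
        then have 1: "\<bar>psi j s\<bar> \<le> (1 / tau) ^ (m + 1) * b j"
          unfolding psi_def abs_mult using b[OF st, of j] tau by (intro mult_mono) auto
        have "norm (R j *v x) \<le> norm (R j) * norm x" by (rule norm_matrix_vector_mult)
        also have "\<dots> \<le> rho * (2 * norm y)" using R x(2) rho by (intro mult_mono) auto
        finally have 2: "norm (R j *v x) \<le> rho * (2 * norm y)" .
        have "\<bar>psi j s\<bar> * norm (R j *v x) \<le> ((1 / tau) ^ (m + 1) * b j) * (rho * (2 * norm y))"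
          using 1 2 tau b0[of j] by (intro mult_mono) auto
        then show "norm (((- 1) ^ j * psi j s) *\<^sub>R (R j *v x)) \<le> ((1 / tau) ^ (m + 1) * b j) * (rho * (2 * norm y))"
          by (simp add: abs_mult power_abs)
      qed
      also have "\<dots> = C * (1 / tau) ^ (m + 1) * norm y"
        by (simp add: C_def sum_distrib_left sum_distrib_right mult_ac)
      finally show ?thesis .
    qed
    show "\<exists>v. continuous_on UNIV v \<and> (\<forall>s\<in>{0..tau}. norm (v s) \<le> C * (1 / tau) ^ (m + 1) * norm y) \<and>
        (LINT s:{0..tau}|lborel. flow (mat (of_real nu) + K) (- s) (B *v v s)) = y"
    \<comment> \<open>The factor compensates the growth of the backward flow of
      \<open>mat nu\<close>; since \<open>nu\<close> is nonnegative it does not increase the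
      cost.\<close>
    proof (intro exI[of _ "\<lambda>s. exp (- nu * s) *\<^sub>R w s"] conjI ballI)
      show "continuous_on UNIV (\<lambda>s. exp (- nu * s) *\<^sub>R w s)" by (intro continuous_intros cw)
      show "norm (exp (- nu * s) *\<^sub>R w s) \<le> C * (1 / tau) ^ (m + 1) * norm y" if s: "s \<in> {0..tau}" for s
      proof -
        have "exp (- nu * s) \<le> 1" using s nu by simp
        then have "norm (exp (- nu * s) *\<^sub>R w s) \<le> 1 * norm (w s)"
          using mult_right_mono[of "exp (- nu * s)" 1 "norm (w s)"] by simp
        then show ?thesis using wb[OF s] by simp
      qed
      have "flow (mat (of_real nu) + K) (- s) (B *v (exp (- nu * s) *\<^sub>R w s)) = flow K (- s) (B *v w s)" for s
      proof -
        have "flow (mat (of_real nu) + K) (- s) (B *v (exp (- nu * s) *\<^sub>R w s)) =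
          exp (- of_real nu * of_real (- s)) *s (exp (- nu * s) *\<^sub>R flow K (- s) (B *v w s))"
          unfolding flow_mat_add
          by (simp add: linear_scale[OF bounded_linear.linear[OF bounded_linear_matrix_vector]] flow_scaleR_right)
        also have "\<dots> = (exp (nu * s) * exp (- nu * s)) *\<^sub>R flow K (- s) (B *v w s)"
        proof -
          have "exp (- of_real nu * of_real (- s)) = (of_real (exp (nu * s)) :: complex)"
            by (simp flip: exp_of_real)
          then show ?thesis by (simp add: smult_of_real)
        qed
        finally show ?thesis by (simp flip: exp_add)
      qed
      then show "(LINT s:{0..tau}|lborel. flow (mat (of_real nu) + K) (- s) (B *v (exp (- nu * s) *\<^sub>R w s))) = y"
        using wI by simp
    qed
  qed
qed

section \<open>Null controllability of the parabolic modes\<close>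

lemma bounded_linear_smult_left: "bounded_linear (\<lambda>z::complex. z *s (v::complex^'n))"
proof -
  have "bounded_linear (\<lambda>z::complex. mat z *v v)"
    by (intro bounded_linear_compose[OF bounded_bilinear.bounded_linear_left[OF bounded_bilinear_matrix_vector]]
       linear_conv_bounded_linear[THEN iffD1])
      (auto intro!: linearI simp: mat_def vec_eq_iff)
  then show ?thesis by (simp add: mat_mult_vec)
qed

text \<open>Separation of variables: \<open>b m\<close> carries frequency \<open>m\<close> and
  \<open>v m\<close> its time profile, so biorthogonality leaves exactly \<open>v n\<close> in the
  modes up to \<open>N\<close>. The effect on higher modes is limited only through the norm of the
  control. The constant \<open>3\<close> bounds \<open>sqrt (2 pi tau)\<close>.\<close>

lemma low_mode_control:
  fixes v :: "int \<Rightarrow> real \<Rightarrow> complex^'n"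
  assumes bd: "dual_family \<omega> N G b"
    and v: "\<And>m. continuous_on UNIV (v m)" "\<And>m s. \<bar>m\<bar> \<le> int N \<Longrightarrow> 0 \<le> s \<Longrightarrow> s \<le> tau \<Longrightarrow> norm (v m s) \<le> V m"
    and tau: "0 < tau" "tau \<le> 1"
  obtains u where "\<forall>A. (\<forall>m. \<bar>m\<bar> \<le> int N \<longrightarrow> V m \<le> A) \<longrightarrow> ctl \<omega> t0 (t0 + tau) (3 * (2 * real N + 1) * G * A) u"
    and "\<forall>t n. \<bar>n\<bar> \<le> int N \<longrightarrow> uhat u t n = indicator {t0<..<t0 + tau} t *\<^sub>R v n (t - t0)"
proof -
  note b = bd[unfolded dual_family_def, rule_format]
  define I where "I = {- int N..int N}"
  have I: "m \<in> I \<longleftrightarrow> \<bar>m\<bar> \<le> int N" for m by (auto simp: I_def)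
  have cI: "real (card I) = 2 * real N + 1" by (simp add: I_def)
  define u where "u z = indicator {t0<..<t0 + tau} (fst z) *\<^sub>R (\<Sum>m\<in>I. b m (snd z) *s v m (fst z - t0))" for z :: "real \<times> real"
  have bm: "b m \<in> borel_measurable borel" if "m \<in> I" for m using b I that by auto
  have um: "u \<in> borel_measurable QM"
  proof -
    have "(\<lambda>z. b m (snd z) *s v m (fst z - t0)) \<in> borel_measurable QM" if m: "m \<in> I" for m
    proof (rule borel_measurable_vector_smult)
      have "b m \<in> borel_measurable torus_measure" using bm[OF m] by (intro measurable_restrict_space1) simp
      then show "(\<lambda>z. b m (snd z)) \<in> borel_measurable QM" by (rule measurable_compose[OF measurable_snd])
      have "(\<lambda>t. v m (t - t0)) \<in> borel_measurable lborel"
        by (simp, intro borel_measurable_continuous_onI continuous_on_compose2[OF v(1)[of m]])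
          (auto intro!: continuous_intros)
      then show "(\<lambda>z. v m (fst z - t0)) \<in> borel_measurable QM" by (rule measurable_compose[OF measurable_fst])
    qed
    moreover have "(\<lambda>z. indicator {t0<..<t0 + tau} (fst z) :: real) \<in> borel_measurable QM"
      by (rule measurable_compose[OF measurable_fst]) measurable
    ultimately show ?thesis unfolding u_def by (intro borel_measurable_scaleR borel_measurable_sum) auto
  qed
  have supp: "t0 < t \<and> t < t0 + tau \<and> cis x \<in> \<omega>" if "u (t, x) \<noteq> 0" for t x
  proof -
    have "t \<in> {t0<..<t0 + tau}" using that by (auto simp: u_def indicator_def)
    moreover have "\<exists>m\<in>I. b m x \<noteq> 0"
    proof (rule ccontr)
      assume "\<not> (\<exists>m\<in>I. b m x \<noteq> 0)"
      then have "u (t, x) = 0" by (simp add: u_def)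
      then show False using that by simp
    qed
    ultimately show ?thesis using b I by auto
  qed
  show thesis
  proof (rule that[of u]; intro allI impI)
    fix A assume A: "\<forall>m. \<bar>m\<bar> \<le> int N \<longrightarrow> V m \<le> A"
    have "cmod (b 0 0) \<le> G" using b[of 0] by simp
    then have G0: "0 \<le> G" using norm_ge_zero order_trans by blast
    have A0: "0 \<le> A" using A[rule_format, of 0] v(2)[of 0 0] norm_ge_zero[of "v 0 0"] tau by linarith
    define s where "s = (2 * real N + 1) * G * A"
    have s0: "0 \<le> s" using G0 A0 by (simp add: s_def)
    have ub: "norm (u (t, x)) \<le> s * indicator {t0<..<t0 + tau} t" for t x
    proof (cases "t \<in> {t0<..<t0 + tau}")
      case True
      have "norm (u (t, x)) \<le> (\<Sum>m\<in>I. norm (b m x *s v m (t - t0)))" using True by (simp add: u_def norm_sum)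
      also have "\<dots> \<le> (\<Sum>m\<in>I. G * A)"
      proof (rule sum_mono)
        fix m assume m: "m \<in> I"
        have "norm (v m (t - t0)) \<le> A" using v(2)[of m "t - t0"] A[rule_format, of m] m True I by force
        then show "norm (b m x *s v m (t - t0)) \<le> G * A"
          unfolding norm_vector_smult using b[of m] m I G0 by (intro mult_mono) auto
      qed
      also have "\<dots> = s" by (simp add: s_def cI)
      finally show ?thesis using True by simp
    qed (simp add: u_def)
    interpret tm: sigma_finite_measure torus_measure by (rule sigma_finite_torus)
    have "sqint QM u = (\<integral>\<^sup>+t. (sqint torus_measure (\<lambda>x. u (t, x))) \<partial>lborel)"
      by (rule tm.nn_integral_fst[symmetric]) (use um in measurable)
    also have "\<dots> \<le> (\<integral>\<^sup>+t. (\<integral>\<^sup>+x. ennreal (s\<^sup>2) * indicator {t0<..<t0 + tau} t \<partial>torus_measure) \<partial>lborel)"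
    proof (intro nn_integral_mono)
      fix t x
      show "ennreal ((norm (u (t, x)))\<^sup>2) \<le> ennreal (s\<^sup>2) * indicator {t0<..<t0 + tau} t"
        using ub[of t x] power_mono[OF ub[of t x], of 2] by (cases "t \<in> {t0<..<t0 + tau}") (auto intro: ennreal_leI)
    qed
    also have "\<dots> \<le> (\<integral>\<^sup>+t. (ennreal (s\<^sup>2) * ennreal (2 * pi)) * indicator {t0<..<t0 + tau} t \<partial>lborel)"
    proof (intro nn_integral_mono)
      fix t
      show "(\<integral>\<^sup>+x. ennreal (s\<^sup>2) * indicator {t0<..<t0 + tau} t \<partial>torus_measure) \<le> (ennreal (s\<^sup>2) * ennreal (2 * pi)) * indicator {t0<..<t0 + tau} t"
        using mult_left_mono[OF torus_measure_finite, of "ennreal (s\<^sup>2)"] by (cases "t \<in> {t0<..<t0 + tau}") auto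
    qed
    also have "\<dots> = (ennreal (s\<^sup>2) * ennreal (2 * pi)) * ennreal tau"
      using tau by (subst nn_integral_cmult_indicator) auto
    also have "\<dots> = ennreal (s\<^sup>2 * (2 * pi) * tau)" using tau by (simp add: ennreal_mult)
    also have "\<dots> \<le> ennreal ((3 * s)\<^sup>2)"
    proof (rule ennreal_leI)
      have "s\<^sup>2 * (2 * pi) * tau \<le> s\<^sup>2 * 9 * 1" using tau pi_less_4 by (intro mult_mono) auto
      then show "s\<^sup>2 * (2 * pi) * tau \<le> (3 * s)\<^sup>2" by (simp add: power_mult_distrib)
    qed
    finally have "L2b QM u (3 * s)" using um s0 by (simp add: L2b_def)
    then show "ctl \<omega> t0 (t0 + tau) (3 * (2 * real N + 1) * G * A) u"
      using supp unfolding s_def ctl_def mult.assoc by blast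
  next
    fix t and n :: int assume n: "\<bar>n\<bar> \<le> int N"
    have int: "integrable torus_measure (\<lambda>x. ee (- n) x * b m x)" if m: "m \<in> I" for m
    proof (rule finite_measure.integrable_const_bound[OF finite_measure_torus, where B=G])
      show "AE x in torus_measure. norm (ee (- n) x * b m x) \<le> G" using b[of m] m I by (auto simp: norm_mult)
      show "(\<lambda>x. ee (- n) x * b m x) \<in> borel_measurable torus_measure"
        by (intro borel_measurable_times borel_measurable_ee measurable_restrict_space1) (use bm[OF m] in simp)
    qed
    have "(LINT x|torus_measure. ee (- n) x *s (\<Sum>m\<in>I. b m x *s v m (t - t0))) = (LINT x|torus_measure. (\<Sum>m\<in>I. (ee (- n) x * b m x) *s v m (t - t0)))"
      by (simp add: vec.scale_sum_right)
    also have "\<dots> = (\<Sum>m\<in>I. (LINT x|torus_measure. (ee (- n) x * b m x) *s v m (t - t0)))"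
      by (rule Bochner_Integration.integral_sum) (rule integrable_bounded_linear[OF bounded_linear_smult_left int])
    also have "\<dots> = (\<Sum>m\<in>I. tcoeff n (b m) *s v m (t - t0))"
      by (intro sum.cong refl integral_bounded_linear[OF bounded_linear_smult_left int])
    also have "\<dots> = (\<Sum>m\<in>I. if m = n then (2 * pi) *\<^sub>R v n (t - t0) else 0)"
    proof (rule sum.cong[OF refl])
      fix m assume m: "m \<in> I"
      have "tcoeff n (b m) / of_real (2 * pi) = (if n = m then 1 else 0)" using b[of m] m I n by auto
      then have "tcoeff n (b m) = (if n = m then of_real (2 * pi) else 0)"
        by (auto simp: field_simps split: if_splits)
      then show "tcoeff n (b m) *s v m (t - t0) = (if m = n then (2 * pi) *\<^sub>R v n (t - t0) else 0)"
        using smult_of_real[of "2 * pi" "v n (t - t0)"] by auto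
    qed
    also have "\<dots> = (2 * pi) *\<^sub>R v n (t - t0)" using n I by (simp add: I_def)
    finally have "fourier_coeff (\<lambda>x. \<Sum>m\<in>I. b m x *s v m (t - t0)) n = v n (t - t0)"
      by (simp add: fourier_coeff_def)
    moreover have "uhat u t n = (if t \<in> {t0<..<t0 + tau} then fourier_coeff (\<lambda>x. \<Sum>m\<in>I. b m x *s v m (t - t0)) n else 0)"
      by (simp add: uhat_def u_def) (simp add: fourier_coeff_def)
    ultimately show "uhat u t n = indicator {t0<..<t0 + tau} t *\<^sub>R v n (t - t0)" by simp
  qed
qed

text \<open>Abstract form of the parabolic block for \<open>|n| >= N0\<close>. \<open>B\<close> is
  the input \<open>S\<close> rescaled by \<open>n^2\<close>, and \<open>R\<close> is a right inverse
  of the Kalman map of \<open>Kp\<close> and \<open>B\<close>; its bound does not depend on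
  \<open>n\<close>, which keeps the steering cost under control when \<open>S\<close> itself
  decays.\<close>

locale parabolic_modes =
  fixes \<omega> :: "complex set" and N0 m :: nat and P Kp :: "int \<Rightarrow> complex^'k^'k" and S B :: "int \<Rightarrow> complex^'n^'k"
    and R :: "int \<Rightarrow> nat \<Rightarrow> complex^'k^'n" and kap rho sig :: real
  assumes om: "openin (top_of_set torus) \<omega>" and ne: "\<omega> \<noteq> {}" and N0: "1 \<le> N0"
    and P: "\<And>n. int N0 \<le> \<bar>n\<bar> \<Longrightarrow> P n = mat (of_real ((of_int n)\<^sup>2)) + Kp n"
    and Kp: "\<And>n. int N0 \<le> \<bar>n\<bar> \<Longrightarrow> norm (Kp n) \<le> kap"
    and R: "\<And>n j. int N0 \<le> \<bar>n\<bar> \<Longrightarrow> norm (R n j) \<le> rho"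
    and S: "\<And>n. int N0 \<le> \<bar>n\<bar> \<Longrightarrow> norm (S n) \<le> sig"
    and B: "\<And>n w. int N0 \<le> \<bar>n\<bar> \<Longrightarrow> S n *v ((of_int n)\<^sup>2 *\<^sub>R w) = B n *v w"
    and kalman: "\<And>n x. int N0 \<le> \<bar>n\<bar> \<Longrightarrow> (\<Sum>j<m. matpow (Kp n) j *v (B n *v (R n j *v x))) = x"
begin

lemma nonneg: "0 \<le> kap" "0 \<le> rho" "0 \<le> sig"
  using Kp[of "int N0"] R[of "int N0" 0] S[of "int N0"] norm_ge_zero order_trans by (auto, blast+)

lemma flow_P_decay:
  assumes n: "int N0 \<le> \<bar>n\<bar>" and t: "0 \<le> t"
  shows "norm (flow (P n) t w) \<le> exp (- ((of_int n)\<^sup>2 - kap) * t) * norm w"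
proof (rule flow_growth[OF _ t])
  fix v :: "complex^'k"
  have "P n *v v = (of_int n)\<^sup>2 *\<^sub>R v + Kp n *v v"
    unfolding P[OF n] matrix_vector_mult_add_rdistrib mat_mult_vec smult_of_real ..
  moreover have "\<bar>inner v (Kp n *v v)\<bar> \<le> kap * (norm v)\<^sup>2"
    using inner_matrix_vector_bound[of v "Kp n"] mult_right_mono[OF Kp[OF n], of "(norm v)\<^sup>2"] by simp
  ultimately show "inner v (P n *v v) \<ge> - (- ((of_int n)\<^sup>2 - kap)) * (norm v)\<^sup>2"
    by (simp add: inner_add_right power2_norm_eq_inner[symmetric] algebra_simps)
qed

lemma flow_P_bound:
  assumes n: "int N0 \<le> \<bar>n\<bar>" and t: "0 \<le> t"
  shows "norm (flow (P n) t w) \<le> exp (kap * t) * norm w"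
proof -
  have "- ((of_int n)\<^sup>2 - kap) * t \<le> kap * t" using t by (simp add: algebra_simps)
  then have "exp (- ((of_int n)\<^sup>2 - kap) * t) * norm w \<le> exp (kap * t) * norm w" by (intro mult_right_mono) simp_all
  then show ?thesis using flow_P_decay[OF assms, of w] by simp
qed

text \<open>Moments are pulled back to the starting time \<open>t0\<close>, so they cancel the state
  \<open>y\<close> present there. The control is chosen before its bound: one \<open>u\<close>
  serves every bound of \<open>y\<close>.\<close>

definition low_steer :: "nat \<Rightarrow> real \<Rightarrow> real \<Rightarrow> bool" where
  "low_steer N tau c \<longleftrightarrow> (\<forall>t0 y. \<exists>u. (\<forall>A. l2b y A \<longrightarrow> ctl \<omega> t0 (t0 + tau) (c * A) u) \<and>
    (\<forall>n. int N0 \<le> \<bar>n\<bar> \<longrightarrow> \<bar>n\<bar> \<le> int N \<longrightarrow> mom P S t0 u n = - y n))"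

text \<open>Time profiles from the Kalman steering of each mode are put on a biorthogonal family in
  space. The power \<open>8 N\<close> leaves room, beside the \<open>4 N\<close> of that family, for
  the polynomial factors of both constructions.\<close>

lemma low_mode_steering:
  obtains tau0 C :: real where "0 < tau0" "tau0 \<le> 1" "1 \<le> C"
    and "\<forall>N::nat. 1 \<le> N \<longrightarrow> (\<forall>tau. 0 < tau \<longrightarrow> tau \<le> tau0 \<longrightarrow> low_steer N tau ((C * real N) ^ (8 * N) * (1 / tau) ^ (m + 1)))"
proof -
  obtain tau0 C2 :: real where tau0: "0 < tau0" "tau0 \<le> 1" "0 \<le> C2"
    and K: "\<And>(K :: complex^'k^'k) (B :: complex^'n^'k) R nu tau y.
      norm K \<le> kap \<Longrightarrow> (\<And>j. norm (R j) \<le> rho) \<Longrightarrow> (\<And>x. (\<Sum>j<m. matpow K j *v (B *v (R j *v x))) = x) \<Longrightarrow>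
      0 \<le> nu \<Longrightarrow> 0 < tau \<Longrightarrow> tau \<le> tau0 \<Longrightarrow>
      \<exists>v. continuous_on UNIV v \<and> (\<forall>s\<in>{0..tau}. norm (v s) \<le> C2 * (1 / tau) ^ (m + 1) * norm y) \<and>
        (LINT s:{0..tau}|lborel. flow (mat (of_real nu) + K) (- s) (B *v v s)) = y"
    using kalman_steering[OF nonneg(1,2), of m] by blast
  obtain C1 where C1: "1 \<le> C1" and st: "\<And>N::nat. 1 \<le> N \<Longrightarrow> \<exists>b. dual_family \<omega> N ((C1 * real N) ^ (4 * N)) b"
    using static_control[OF om ne] by blast
  define C where "C = 9 * C1 * (C2 + 1)"
  have CC: "9 \<le> C" "C1 \<le> C" "C2 \<le> C"
  proof -
    define X where "X = C1 * (C2 + 1)"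
    have X: "C2 + 1 \<le> X" "C1 \<le> X"
      using C1 tau0(3) mult_right_mono[of 1 C1 "C2 + 1"] mult_left_mono[of 1 "C2 + 1" C1] by (simp_all add: X_def)
    have C9: "C = 9 * X" by (simp add: C_def X_def)
    show "9 \<le> C" unfolding C9 using X C1 by linarith
    show "C1 \<le> C" unfolding C9 using X C1 by linarith
    show "C2 \<le> C" unfolding C9 using X C1 tau0(3) by linarith
  qed
  show thesis
  proof (rule that[OF tau0(1,2)])
    show "1 \<le> C" using CC by simp
    show "\<forall>N::nat. 1 \<le> N \<longrightarrow> (\<forall>tau. 0 < tau \<longrightarrow> tau \<le> tau0 \<longrightarrow> low_steer N tau ((C * real N) ^ (8 * N) * (1 / tau) ^ (m + 1)))"
      unfolding low_steer_def
    proof (intro allI impI)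
      fix N :: nat and tau t0 :: real and y :: "int \<Rightarrow> complex^'k"
      assume N: "1 \<le> N" and tau: "0 < tau" "tau \<le> tau0"
      define D where "D = C2 * (1 / tau) ^ (m + 1)"
      have D0: "0 \<le> D" using tau0 tau by (simp add: D_def)
      have "\<exists>v. continuous_on UNIV v \<and> (int N0 \<le> \<bar>n\<bar> \<longrightarrow> (\<forall>s\<in>{0..tau}. norm (v s) \<le> D * norm (y n)) \<and>
        (LINT s:{0..tau}|lborel. flow (P n) (- s) (B n *v v s)) = - y n)" for n
      proof (cases "int N0 \<le> \<bar>n\<bar>")
        case True
        from K[OF Kp[OF True] R[OF True] kalman[OF True], of "(of_int n)\<^sup>2" tau "- y n"]
        show ?thesis using tau by (auto simp: P[OF True] D_def)
      next
        case False
        then show ?thesis by (intro exI[of _ "\<lambda>_. 0"]) auto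
      qed
      then have "\<forall>n. \<exists>v. continuous_on UNIV v \<and> (int N0 \<le> \<bar>n\<bar> \<longrightarrow> (\<forall>s\<in>{0..tau}. norm (v s) \<le> D * norm (y n)) \<and>
        (LINT s:{0..tau}|lborel. flow (P n) (- s) (B n *v v s)) = - y n)" ..
      from choice[OF this] obtain w where ww: "\<forall>n. continuous_on UNIV (w n) \<and> (int N0 \<le> \<bar>n\<bar> \<longrightarrow> (\<forall>s\<in>{0..tau}. norm (w n s) \<le> D * norm (y n)) \<and>
        (LINT s:{0..tau}|lborel. flow (P n) (- s) (B n *v w n s)) = - y n)" ..
      have w: "continuous_on UNIV (w n)"
        "int N0 \<le> \<bar>n\<bar> \<Longrightarrow> s \<in> {0..tau} \<Longrightarrow> norm (w n s) \<le> D * norm (y n)"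
        "int N0 \<le> \<bar>n\<bar> \<Longrightarrow> (LINT s:{0..tau}|lborel. flow (P n) (- s) (B n *v w n s)) = - y n" for n s
        using ww by blast+
      \<comment> \<open>The control enters through \<open>S n\<close> and not through
        \<open>B n\<close>, so the profile is multiplied by \<open>n^2\<close>; up to frequency
        \<open>N\<close> this costs at most \<open>N^2\<close>.\<close>
      define v where "v n s = (if int N0 \<le> \<bar>n\<bar> then (of_int n)\<^sup>2 *\<^sub>R w n s else 0)" for n s
      define V where "V n = (real N)\<^sup>2 * (D * norm (y n))" for n
      have cv: "continuous_on UNIV (v n)" for n unfolding v_def by (cases "int N0 \<le> \<bar>n\<bar>") (auto intro!: continuous_intros w)
      have vV: "norm (v n s) \<le> V n" if "\<bar>n\<bar> \<le> int N" "0 \<le> s" "s \<le> tau" for n s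
      proof (cases "int N0 \<le> \<bar>n\<bar>")
        case True
        have "\<bar>real_of_int n\<bar> \<le> real N" using that(1) by linarith
        then have "(of_int n)\<^sup>2 \<le> (real N)\<^sup>2" using power_mono[of "\<bar>real_of_int n\<bar>" "real N" 2] by simp
        then show ?thesis unfolding V_def using True w(2)[OF True, of s] that
          by (simp add: v_def) (intro mult_mono, auto)
      qed (simp add: v_def V_def D0)
      obtain b where b: "dual_family \<omega> N ((C1 * real N) ^ (4 * N)) b"
        using st[OF N] by blast
      have tau1: "tau \<le> 1" using tau tau0 by simp
      obtain u where u1: "\<forall>A. (\<forall>m. \<bar>m\<bar> \<le> int N \<longrightarrow> V m \<le> A) \<longrightarrow> ctl \<omega> t0 (t0 + tau) (3 * (2 * real N + 1) * (C1 * real N) ^ (4 * N) * A) u"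
        and u2: "\<forall>t n. \<bar>n\<bar> \<le> int N \<longrightarrow> uhat u t n = indicator {t0<..<t0 + tau} t *\<^sub>R v n (t - t0)"
        by (rule low_mode_control[where b=b and v=v and V=V and ?t0.0=t0, OF b cv vV tau(1) tau1]) blast
      show "\<exists>u. (\<forall>A. l2b y A \<longrightarrow> ctl \<omega> t0 (t0 + tau) ((C * real N) ^ (8 * N) * (1 / tau) ^ (m + 1) * A) u) \<and>
        (\<forall>n. int N0 \<le> \<bar>n\<bar> \<longrightarrow> \<bar>n\<bar> \<le> int N \<longrightarrow> mom P S t0 u n = - y n)"
      proof (intro exI[of _ u] conjI allI impI)
        fix A assume yA: "l2b y A"
        have A0: "0 \<le> A" using l2b_nonneg[OF yA] .
        have "V n \<le> (real N)\<^sup>2 * (D * A)" for n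
          unfolding V_def using l2b_component[OF yA, of n] D0 by (intro mult_left_mono) auto
        then have "ctl \<omega> t0 (t0 + tau) (3 * (2 * real N + 1) * (C1 * real N) ^ (4 * N) * ((real N)\<^sup>2 * (D * A))) u"
          using u1 by blast
        moreover have "3 * (2 * real N + 1) * (C1 * real N) ^ (4 * N) * ((real N)\<^sup>2 * (D * A)) \<le> (C * real N) ^ (8 * N) * (1 / tau) ^ (m + 1) * A"
        proof -
          have CN: "1 \<le> C * real N" using mult_mono[of 1 C 1 "real N"] N CC by simp
          have "3 * (2 * real N + 1) * (C1 * real N) ^ (4 * N) * ((real N)\<^sup>2 * C2) \<le> (C * real N) * (C * real N) ^ (4 * N) * ((C * real N)\<^sup>2 * (C * real N))"
          proof -
            have "3 * (2 * real N + 1) \<le> 9 * real N" using N by simp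
            also have "\<dots> \<le> C * real N" using CC(1) by (rule mult_right_mono) simp
            finally have h1: "3 * (2 * real N + 1) \<le> C * real N" .
            have h2: "C1 * real N \<le> C * real N" using CC by (intro mult_right_mono) auto
            have h3: "real N \<le> C * real N" using mult_right_mono[of 1 C "real N"] CC by simp
            have h4: "C2 \<le> C * real N"
            proof -
              have "C * 1 \<le> C * real N" using CC N by (intro mult_left_mono) auto
              then show ?thesis using CC(3) by linarith
            qed
            have h2': "(C1 * real N) ^ (4 * N) \<le> (C * real N) ^ (4 * N)" using h2 C1 by (intro power_mono) auto
            have h3': "(real N)\<^sup>2 \<le> (C * real N)\<^sup>2" using h3 by (intro power_mono) auto
            show ?thesis
              by (rule mult_mono[OF mult_mono[OF h1 h2'] mult_mono[OF h3' h4]]) (use C1 CC tau0 CN in auto)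
          qed
          also have "\<dots> = (C * real N) ^ (4 * N + 4)" by (simp add: power_add power2_eq_square power4_eq_xxxx mult_ac)
          also have "\<dots> \<le> (C * real N) ^ (8 * N)" using N CN by (intro power_increasing) auto
          finally have "3 * (2 * real N + 1) * (C1 * real N) ^ (4 * N) * ((real N)\<^sup>2 * C2) * ((1 / tau) ^ (m + 1) * A) \<le> (C * real N) ^ (8 * N) * ((1 / tau) ^ (m + 1) * A)"
            using tau A0 by (intro mult_right_mono) auto
          then show ?thesis by (simp add: D_def mult_ac)
        qed
        ultimately show "ctl \<omega> t0 (t0 + tau) ((C * real N) ^ (8 * N) * (1 / tau) ^ (m + 1) * A) u"
          by (rule ctl_mono[OF _ order_refl order_refl])
      next
        fix n assume n: "int N0 \<le> \<bar>n\<bar>" "\<bar>n\<bar> \<le> int N"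
        have "mom P S t0 u n = (LINT t|lborel. indicator {t0<..<t0 + tau} t *\<^sub>R flow (P n) (t0 - t) (B n *v w n (t - t0)))"
          unfolding mom_def using n
          by (simp add: u2 linear_scale[OF bounded_linear.linear[OF bounded_linear_matrix_vector]] flow_scaleR_right v_def)
            (simp add: B[OF n(1), symmetric] linear_scale[OF bounded_linear.linear[OF bounded_linear_matrix_vector]] flow_scaleR_right)
        also have "\<dots> = (LINT s|lborel. indicator {0<..<tau} s *\<^sub>R flow (P n) (- s) (B n *v w n s))"
          using lborel_integral_real_affine[of 1 "\<lambda>t. indicator {t0<..<t0 + tau} t *\<^sub>R flow (P n) (t0 - t) (B n *v w n (t - t0))" t0]
          by (simp add: indicator_def)
        also have "\<dots> = (LINT s:{0..tau}|lborel. flow (P n) (- s) (B n *v w n s))"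
          unfolding set_lebesgue_integral_def
          by (rule integral_discrete_difference[where X="{0, tau}"]) (auto simp: indicator_def)
        finally show "mom P S t0 u n = - y n" using w(3)[OF n(1)] by simp
      qed
    qed
  qed
qed

end

text \<open>The cost of controlling the modes \<open>|n| \<le> (k+1)\<^sup>4\<close> in time \<open>d/((k+1)(k+2))\<close> is beaten by
  the dissipation of the other modes in the same time.\<close>

lemma cost_summable:
  fixes C d sig kap :: real and m :: nat
  assumes C: "1 \<le> C" and d: "0 < d" "d \<le> 1" and sig: "0 \<le> sig" and kap: "0 \<le> kap"
  defines "N \<equiv> \<lambda>k. (k + 1) ^ 4" and "tau \<equiv> \<lambda>k. d / (real (k + 1) * real (k + 2))"
  defines "G \<equiv> \<lambda>k. (C * real (N k)) ^ (8 * N k) * (1 / tau k) ^ (m + 1)"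
  defines "r \<equiv> \<lambda>k. exp (2 * kap - (real (N k))\<^sup>2 * tau k) * (1 + sig * G k)"
  shows "summable (\<lambda>k. G k * (\<Prod>i<k. r i))" and "\<And>k. 1 \<le> G k"
proof -
  have CN: "1 \<le> C * real (N k)" for k
    using mult_mono[OF C, of 1 "real (N k)"] C by (simp add: N_def)
  have it: "1 / tau k = (real k + 1) * (real k + 2) / d" for k by (simp add: tau_def add.commute)
  have it1: "1 \<le> 1 / tau k" for k
  proof -
    have "1 * 1 \<le> (real k + 1) * (real k + 2)" by (intro mult_mono) auto
    then have "1 * d \<le> (real k + 1) * (real k + 2)" using d by linarith
    then show ?thesis unfolding it using d by (simp only: pos_le_divide_eq)
  qed
  show G1: "1 \<le> G k" for k
  proof -
    have "1 * 1 \<le> (C * real (N k)) ^ (8 * N k) * (1 / tau k) ^ (m + 1)"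
      using CN[of k] it1[of k] by (intro mult_mono one_le_power) auto
    then show ?thesis by (simp add: G_def)
  qed
  have Gp: "G k = (C * (real k + 1) ^ 4) powr (8 * (real k + 1) ^ 4) * ((real k + 1) * (real k + 2) / d) powr (real m + 1)" for k
  proof -
    have "x powr (8 * (real k + 1) ^ 4) = x ^ (8 * N k)" "x powr (real m + 1) = x ^ (m + 1)" if "0 < x" for x
      using powr_realpow[OF that, of "8 * N k"] powr_realpow[OF that, of "m + 1"] by (simp_all add: N_def add.commute)
    moreover have "0 < C * (real k + 1) ^ 4" "0 < (real k + 1) * (real k + 2) / d" using C d by simp_all
    ultimately show ?thesis by (simp add: G_def it N_def add.commute)
  qed
  have Nt: "(real (N k))\<^sup>2 * tau k = (real k + 1) ^ 8 * (d / ((real k + 1) * (real k + 2)))" for k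
    by (simp add: N_def tau_def add.commute flip: power_mult)
  define h where "h k = (1 + sig) * (G (Suc k) * (exp (2 * kap - (real (N k))\<^sup>2 * tau k) * G k))" for k
  have hr: "G (Suc k) * r k \<le> h k" for k
  proof -
    have "1 + sig * G k \<le> (1 + sig) * G k" using G1[of k] by (simp add: algebra_simps)
    then have "r k \<le> exp (2 * kap - (real (N k))\<^sup>2 * tau k) * ((1 + sig) * G k)" unfolding r_def by (intro mult_left_mono) auto
    then have "G (Suc k) * r k \<le> G (Suc k) * (exp (2 * kap - (real (N k))\<^sup>2 * tau k) * ((1 + sig) * G k))"
      using G1[of "Suc k"] by (intro mult_left_mono) auto
    then show ?thesis by (simp add: h_def mult_ac)
  qed
  \<comment> \<open>With \<open>N\<close> equal to \<open>(k + 1)^4\<close> the exponent of the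
    dissipation is of order \<open>d k^6\<close>, while the logarithm of the cost is only of order
    \<open>k^4 log k\<close>; fixed powers of \<open>1 / tau\<close> are negligible.\<close>
  have "(\<lambda>k. G (Suc k) * (exp (2 * kap - (real (N k))\<^sup>2 * tau k) * G k)) \<longlonglongrightarrow> 0"
    unfolding Gp Nt of_nat_Suc using C d by real_asymp
  then have "h \<longlonglongrightarrow> 0" unfolding h_def by (rule tendsto_mult_right_zero)
  then have "\<forall>\<^sub>F k in sequentially. h k < 1 / 2" by (rule order_tendstoD) simp
  then obtain k0 where k0: "\<And>k. k \<ge> k0 \<Longrightarrow> h k < 1 / 2" by (auto simp: eventually_sequentially)
  have rpos: "0 \<le> r k" for k using sig G1[of k] by (auto simp: r_def intro!: mult_nonneg_nonneg add_nonneg_nonneg)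
  show "summable (\<lambda>k. G k * (\<Prod>i<k. r i))"
  proof (rule summable_ratio_test[of "1/2" k0])
    fix k assume k: "k0 \<le> k"
    have pr: "0 \<le> (\<Prod>i<k. r i)" by (intro prod_nonneg) (simp add: rpos)
    have "G (Suc k) * (\<Prod>i<Suc k. r i) = (G (Suc k) * r k) * (\<Prod>i<k. r i)" by simp
    also have "\<dots> \<le> 1 / 2 * (\<Prod>i<k. r i)" using hr[of k] k0[OF k] pr by (intro mult_right_mono) auto
    also have "\<dots> \<le> 1 / 2 * (G k * (\<Prod>i<k. r i))" using G1[of k] pr mult_right_mono[of 1 "G k" "\<Prod>i<k. r i"] by simp
    finally show "norm (G (Suc k) * (\<Prod>i<Suc k. r i)) \<le> 1 / 2 * norm (G k * (\<Prod>i<k. r i))"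
      using G1[of k] G1[of "Suc k"] pr rpos[of k] by (simp add: abs_mult)
  qed simp
qed

context parabolic_modes
begin

text \<open>In round \<open>k\<close> the modes up to \<open>N k\<close> are cancelled during
  \<open>tau k\<close>; then the system rests for another \<open>tau k\<close>, so that what the
  control stirred up in higher modes decays. The rounds accumulate at \<open>b\<close>. The factor
  \<open>r k\<close> bounds the change of the state and \<open>G k\<close> the cost, and
  \<open>cost_summable\<close> makes the total control finite.\<close>

theorem parabolic_null_control:
  assumes ab: "a < b"
  shows "\<exists>C\<ge>0. \<forall>q A. l2b q A \<longrightarrow> (\<forall>n. \<bar>n\<bar> < int N0 \<longrightarrow> q n = 0) \<longrightarrow>
    (\<exists>u. ctl \<omega> a b (C * A) u \<and> (\<forall>n. int N0 \<le> \<bar>n\<bar> \<longrightarrow> mom P S b u n = - flow (P n) (b - a) (q n)))"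
proof -
  obtain tau0 C1 :: real where tau0: "0 < tau0" "tau0 \<le> 1" "1 \<le> C1"
    and step: "\<forall>N::nat. 1 \<le> N \<longrightarrow> (\<forall>tau. 0 < tau \<longrightarrow> tau \<le> tau0 \<longrightarrow> low_steer N tau ((C1 * real N) ^ (8 * N) * (1 / tau) ^ (m + 1)))"
    by (rule low_mode_steering) blast
  \<comment> \<open>\<open>d <= tau0\<close> admits the low steering in every round, and
    \<open>2 d <= b - a\<close> places the first round after \<open>a\<close>.\<close>
  define d where "d = min tau0 ((b - a) / 2)"
  have d: "0 < d" "d \<le> tau0" "d \<le> 1" "a \<le> b - 2 * d" using tau0 ab by (auto simp: d_def min_def field_simps)
  define N where "N k = (k + 1) ^ 4" for k :: nat
  define tau where "tau k = d / (real (k + 1) * real (k + 2))" for k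
  define G where "G k = (C1 * real (N k)) ^ (8 * N k) * (1 / tau k) ^ (m + 1)" for k
  define r where "r k = exp (2 * kap - (real (N k))\<^sup>2 * tau k) * (1 + sig * G k)" for k
  \<comment> \<open>Consecutive times differ by \<open>2 * tau k\<close>, because
    \<open>1/(k + 1) - 1/(k + 2) = 1/((k + 1) (k + 2))\<close>.\<close>
  define t where "t k = b - 2 * d / real (k + 1)" for k
  have sumG: "summable (\<lambda>k. G k * (\<Prod>i<k. r i))"
    unfolding G_def r_def N_def tau_def
    by (rule cost_summable(1)[of C1 d sig kap m, OF tau0(3) d(1,3) nonneg(3,1)])
  have G1: "1 \<le> G k" for k
    unfolding G_def r_def N_def tau_def
    by (rule cost_summable(2)[where C=C1 and d=d and sig=sig and kap=kap and m=m, OF tau0(3) d(1,3) nonneg(3,1)])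
  have r0: "0 \<le> r k" for k unfolding r_def using nonneg G1[of k] by (intro mult_nonneg_nonneg add_nonneg_nonneg) auto
  have tau_pos: "0 < tau k" for k using d by (simp add: tau_def)
  have tau_le: "tau k \<le> d" for k
  proof -
    have "1 * 1 \<le> real (k + 1) * real (k + 2)" by (intro mult_mono) auto
    then have "d / (real (k + 1) * real (k + 2)) \<le> d / 1" using d by (intro divide_left_mono) auto
    then show ?thesis by (simp add: tau_def)
  qed
  have t_Suc: "t (Suc k) = t k + 2 * tau k" for k
    unfolding t_def tau_def by (simp add: divide_simps) (simp add: algebra_simps)
  have t_a: "a \<le> t k" for k
  proof -
    have "2 * d / real (k + 1) \<le> 2 * d / 1" using d by (intro divide_left_mono) auto
    then show ?thesis using d by (simp add: t_def)
  qed
  have t_b: "t k + tau k \<le> b" for k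
  proof -
    have "t (Suc k) \<le> b" using d by (simp add: t_def)
    then show ?thesis using tau_pos[of k] by (simp add: t_Suc)
  qed
  define good where "good k y u \<longleftrightarrow> (\<forall>A. l2b y A \<longrightarrow> ctl \<omega> (t k) (t k + tau k) (G k * A) u) \<and>
      (\<forall>n. int N0 \<le> \<bar>n\<bar> \<longrightarrow> \<bar>n\<bar> \<le> int (N k) \<longrightarrow> mom P S (t k) u n = - y n)" for k y u
  define U where "U k y = (SOME u. good k y u)" for k y
  have "good k y (U k y)" for k y
  proof -
    have "1 \<le> N k" unfolding N_def by (rule one_le_power) simp
    moreover have "tau k \<le> tau0" using tau_le[of k] d(2) by linarith
    ultimately have "\<exists>u. good k y u"
      using step tau_pos[of k] unfolding good_def G_def low_steer_def by blast
    then show ?thesis unfolding U_def by (rule someI_ex)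
  qed
  then have U: "l2b y A \<Longrightarrow> ctl \<omega> (t k) (t k + tau k) (G k * A) (U k y)"
    "int N0 \<le> \<bar>n\<bar> \<Longrightarrow> \<bar>n\<bar> \<le> int (N k) \<Longrightarrow> mom P S (t k) (U k y) n = - y n" for k y A n
    unfolding good_def by blast+
  \<comment> \<open>State after control and rest, obtained by adding the pulled-back moment first
    and flowing over the whole round afterwards. Modes below \<open>N0\<close>, for which no decay
    is assumed, are set to zero.\<close>
  define nxt where "nxt k y n = (if int N0 \<le> \<bar>n\<bar> then flow (P n) (2 * tau k) (y n + mom P S (t k) (U k y) n) else 0)" for k y n
  have nxt_bound: "l2b (nxt k y) (r k * A)" if y: "l2b y A" for k y A
  proof -
    let ?I = "{n. int N0 \<le> \<bar>n\<bar> \<and> int (N k) < \<bar>n\<bar>}"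
    let ?e = "exp (2 * kap - (real (N k))\<^sup>2 * tau k)"
    have u: "ctl \<omega> (t k) (t k + tau k) (G k * A) (U k y)" by (rule U(1)[OF y])
    have A: "0 \<le> A" using l2b_nonneg[OF y] .
    have tk1: "tau k \<le> 1" using tau_le[of k] d by simp
    have decay: "norm (flow (P n) s w) \<le> ?e * norm w" if n: "n \<in> ?I" and s: "tau k \<le> s" "s \<le> 2 * tau k" for n s w
    proof -
      have "real (N k) \<le> \<bar>real_of_int n\<bar>" using n by auto
      then have n2: "(real (N k))\<^sup>2 \<le> (of_int n)\<^sup>2" using power_mono[of "real (N k)" "\<bar>real_of_int n\<bar>" 2] by simp
      have "(real (N k))\<^sup>2 * tau k \<le> (of_int n)\<^sup>2 * s" using n2 s tau_pos[of k] by (intro mult_mono) auto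
      moreover have "kap * s \<le> kap * 2" using s tk1 nonneg by (intro mult_left_mono) auto
      ultimately have "- ((of_int n)\<^sup>2 - kap) * s \<le> 2 * kap - (real (N k))\<^sup>2 * tau k" by (simp add: algebra_simps)
      then have "exp (- ((of_int n)\<^sup>2 - kap) * s) * norm w \<le> ?e * norm w" by (intro mult_right_mono) simp_all
      moreover have "norm (flow (P n) s w) \<le> exp (- ((of_int n)\<^sup>2 - kap) * s) * norm w"
        by (rule flow_P_decay) (use n s tau_pos[of k] in auto)
      ultimately show ?thesis by linarith
    qed
    have 1: "l2b (\<lambda>n. if n \<in> ?I then flow (P n) (2 * tau k) (y n) else 0) (?e * A)"
      by (rule l2b_le[OF y]) (use decay tau_pos[of k] in auto)
    have 2: "l2b (\<lambda>n. if n \<in> ?I then mom P S (t k + 2 * tau k) (U k y) n else 0) ((?e * sig) * sqrt (t k + tau k - t k) * (G k * A))"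
    proof (rule mom_bound[OF u])
      fix n s w assume n: "n \<in> ?I" and s: "t k < s" "s < t k + tau k"
      have "norm (flow (P n) (t k + 2 * tau k - s) (S n *v w)) \<le> ?e * norm (S n *v w)"
        by (rule decay[OF n]) (use s in auto)
      also have "norm (S n *v w) \<le> sig * norm w"
        using norm_matrix_vector_mult[of "S n" w] mult_right_mono[OF S, of n "norm w"] n by auto
      finally show "norm (flow (P n) (t k + 2 * tau k - s) (S n *v w)) \<le> ?e * sig * norm w"
        by (simp add: mult.assoc)
    qed (use tau_pos[of k] nonneg in auto)
    have eq: "nxt k y = (\<lambda>n. (if n \<in> ?I then flow (P n) (2 * tau k) (y n) else 0) + (if n \<in> ?I then mom P S (t k + 2 * tau k) (U k y) n else 0))"
    proof
      fix n
      have "mom P S (t k + 2 * tau k) (U k y) n = flow (P n) (2 * tau k) (mom P S (t k) (U k y) n)"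
        using mom_time[OF u, of P S "t k + 2 * tau k" n "t k"] tau_pos[of k] by simp
      then show "nxt k y n = (if n \<in> ?I then flow (P n) (2 * tau k) (y n) else 0) + (if n \<in> ?I then mom P S (t k + 2 * tau k) (U k y) n else 0)"
        using U(2)[of n k y] by (auto simp: nxt_def flow_add_right flow_minus_right)
    qed
    have "sqrt (t k + tau k - t k) \<le> 1" using tk1 by simp
    then have "(?e * sig) * sqrt (t k + tau k - t k) * (G k * A) \<le> (?e * sig) * 1 * (G k * A)"
      using nonneg A G1[of k] by (intro mult_right_mono mult_left_mono) auto
    then have "?e * A + (?e * sig) * sqrt (t k + tau k - t k) * (G k * A) \<le> r k * A"
      by (simp add: r_def algebra_simps)
    then show ?thesis unfolding eq using l2b_mono[OF l2b_add[OF 1 2]] by blast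
  qed
  define C where "C = exp (kap * (b - a)) * (\<Sum>k. G k * (\<Prod>i<k. r i))"
  have C0: "0 \<le> C" unfolding C_def using G1 r0 less_imp_le
    by (intro mult_nonneg_nonneg suminf_nonneg[OF sumG] prod_nonneg) (auto intro: order_trans[OF zero_le_one])
  show ?thesis
  proof (intro exI[of _ C] conjI C0 allI impI)
    fix q :: "int \<Rightarrow> complex^'k" and A
    assume q: "l2b q A" and "\<forall>n. \<bar>n\<bar> < int N0 \<longrightarrow> q n = 0"
    \<comment> \<open>States at the beginning of the rounds; before round 0 the system evolves
      freely from \<open>a\<close> to \<open>t 0\<close>.\<close>
    define Y where "Y = rec_nat (\<lambda>n. if int N0 \<le> \<bar>n\<bar> then flow (P n) (t 0 - a) (q n) else 0) (\<lambda>k y. nxt k y)"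
    have Y0: "Y 0 n = (if int N0 \<le> \<bar>n\<bar> then flow (P n) (t 0 - a) (q n) else 0)" for n by (simp add: Y_def)
    have YS: "Y (Suc k) = nxt k (Y k)" for k by (simp add: Y_def)
    define A0 where "A0 = exp (kap * (b - a)) * A"
    have YB: "l2b (Y k) ((\<Prod>i<k. r i) * A0)" for k
    proof (induction k)
      case 0
      have "l2b (Y 0) (exp (kap * (b - a)) * A)"
      proof (rule l2b_le[OF q])
        fix n
        have "exp (kap * (t 0 - a)) \<le> exp (kap * (b - a))" using nonneg d by (auto simp: t_def intro!: mult_left_mono)
        then have "exp (kap * (t 0 - a)) * norm (q n) \<le> exp (kap * (b - a)) * norm (q n)" by (intro mult_right_mono) auto
        then show "norm (Y 0 n) \<le> exp (kap * (b - a)) * norm (q n)"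
          using flow_P_bound[of n "t 0 - a" "q n"] t_a[of 0] by (auto simp: Y0)
      qed simp
      then show ?case by (simp add: A0_def)
    next
      case (Suc k)
      show ?case using nxt_bound[OF Suc, of k] by (simp add: YS mult_ac)
    qed
    define u where "u k = U k (Y k)" for k
    have uc: "ctl \<omega> a b ((G k * (\<Prod>i<k. r i)) * A0) (u k)" for k
      using ctl_mono[OF U(1)[OF YB[of k], of k] t_a[of k] t_b[of k]] by (simp add: u_def mult.assoc)
    have sB: "summable (\<lambda>k. (G k * (\<Prod>i<k. r i)) * A0)" by (rule summable_mult2[OF sumG])
    obtain v where v: "ctl \<omega> a b (\<Sum>k. (G k * (\<Prod>i<k. r i)) * A0) v"
      and vt: "\<forall>m. ctl \<omega> a b (\<Sum>k. (G (k + m) * (\<Prod>i<k + m. r i)) * A0) (\<lambda>z. v z - (\<Sum>k<m. u k z))"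
      by (rule ctl_series[OF uc sB]) blast
    have vm: "(\<lambda>k. mom P S b (u k) n) sums mom P S b v n" for n
      by (rule mom_series[OF uc sB less_imp_le[OF ab] v vt])
    show "\<exists>u. ctl \<omega> a b (C * A) u \<and> (\<forall>n. int N0 \<le> \<bar>n\<bar> \<longrightarrow> mom P S b u n = - flow (P n) (b - a) (q n))"
    proof (intro exI[of _ v] conjI allI impI)
      have "(\<Sum>k. (G k * (\<Prod>i<k. r i)) * A0) = C * A"
        using suminf_mult2[OF sumG, of A0] by (simp add: C_def A0_def mult_ac)
      then show "ctl \<omega> a b (C * A) v" using v by simp
      fix n assume n: "int N0 \<le> \<bar>n\<bar>"
      \<comment> \<open>Telescoping: the moments of the first \<open>k\<close> rounds equal the
        state still left, transported to \<open>b\<close>, minus the free evolution. It remains to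
        see that the first term vanishes in the limit.\<close>
      have part: "(\<Sum>i<k. mom P S b (u i) n) = flow (P n) (b - t k) (Y k n) - flow (P n) (b - a) (q n)" for k
      proof (induction k)
        case 0
        have "flow (P n) (b - t 0) (flow (P n) (t 0 - a) (q n)) = flow (P n) (b - a) (q n)"
          using flow_add_time[of "P n" "b - t 0" "t 0 - a" "q n"] by simp
        then show ?case using n by (simp add: Y0)
      next
        case (Suc k)
        have "flow (P n) (b - t (Suc k)) (Y (Suc k) n) = flow (P n) (b - t k) (Y k n + mom P S (t k) (u k) n)"
          using flow_add_time[of "P n" "b - t (Suc k)" "2 * tau k"] n by (simp add: YS nxt_def t_Suc u_def)
        moreover have "mom P S b (u k) n = flow (P n) (b - t k) (mom P S (t k) (u k) n)"
          by (rule mom_time[OF uc less_imp_le[OF ab]])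
        ultimately show ?case using Suc by (simp add: flow_add_right)
      qed
      have "(\<lambda>k. flow (P n) (b - t k) (Y k n)) \<longlonglongrightarrow> 0"
      proof (rule Lim_null_comparison)
        have "norm (flow (P n) (b - t k) (Y k n)) \<le> exp (kap * (b - a)) * ((G k * (\<Prod>i<k. r i)) * A0)" for k
        proof -
          have b: "0 \<le> b - t k" "b - t k \<le> b - a" using t_b[of k] tau_pos[of k] t_a[of k] by linarith+
          have "norm (flow (P n) (b - t k) (Y k n)) \<le> exp (kap * (b - t k)) * norm (Y k n)" by (rule flow_P_bound[OF n b(1)])
          also have "\<dots> \<le> exp (kap * (b - a)) * ((\<Prod>i<k. r i) * A0)"
            using b nonneg l2b_component[OF YB] by (intro mult_mono) (auto intro: mult_left_mono)
          also have "\<dots> \<le> exp (kap * (b - a)) * ((G k * (\<Prod>i<k. r i)) * A0)"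
          proof (intro mult_left_mono)
            have "0 \<le> (\<Prod>i<k. r i) * A0" using l2b_nonneg[OF YB] .
            from mult_right_mono[OF G1[of k] this] show "(\<Prod>i<k. r i) * A0 \<le> (G k * (\<Prod>i<k. r i)) * A0" by (simp add: mult_ac)
          qed simp
          finally show ?thesis .
        qed
        then show "\<forall>\<^sub>F k in sequentially. norm (flow (P n) (b - t k) (Y k n)) \<le> exp (kap * (b - a)) * ((G k * (\<Prod>i<k. r i)) * A0)"
          by simp
        show "(\<lambda>k. exp (kap * (b - a)) * ((G k * (\<Prod>i<k. r i)) * A0)) \<longlonglongrightarrow> 0"
          by (rule tendsto_mult_right_zero[OF summable_LIMSEQ_zero[OF sB]])
      qed
      then have "(\<lambda>k. \<Sum>i<k. mom P S b (u i) n) \<longlonglongrightarrow> 0 - flow (P n) (b - a) (q n)"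
        unfolding part by (intro tendsto_intros)
      moreover have "(\<lambda>k. \<Sum>i<k. mom P S b (u i) n) \<longlonglongrightarrow> mom P S b v n"
        using vm by (simp add: sums_def)
      ultimately show "mom P S b v n = - flow (P n) (b - a) (q n)"
        using LIMSEQ_unique by fastforce
    qed
  qed
qed

end

section \<open>Decoupling of the high frequencies\<close>

lemma mv_scaleR: "(A::complex^'m^'n) *v (r *\<^sub>R x) = r *\<^sub>R (A *v x)"
  by (rule linear_scale[OF bounded_linear.linear[OF bounded_linear_matrix_vector]])

text \<open>A contraction with factor \<open>1/2\<close> on the unit ball. The image of that ball
  already lies in the ball of radius \<open>e\<close>, so the fixed point inherits the size of the
  coefficients.\<close>

lemma riccati:
  fixes C0 :: "complex^'p^'q" and A1 :: "complex^'p^'p" and A2 :: "complex^'q^'q" and A3 :: "complex^'q^'p"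
  assumes e: "norm C0 + norm A1 + norm A2 + norm A3 \<le> e" "e \<le> 1 / 4"
  obtains S where "norm S \<le> e" "S = C0 + S ** A1 + A2 ** S + S ** A3 ** S"
proof -
  interpret mm: bounded_bilinear "\<lambda>(A::complex^'p^'q) (B::complex^'p^'p). A ** B" by (rule bounded_bilinear_matrix_matrix)
  interpret m2: bounded_bilinear "\<lambda>(A::complex^'q^'q) (B::complex^'p^'q). A ** B" by (rule bounded_bilinear_matrix_matrix)
  interpret m3: bounded_bilinear "\<lambda>(A::complex^'p^'q) (B::complex^'q^'p). A ** B" by (rule bounded_bilinear_matrix_matrix)
  define F where "F S = C0 + S ** A1 + A2 ** S + S ** A3 ** S" for S :: "complex^'p^'q"
  have Fb: "norm (F S) \<le> e" if S: "norm S \<le> 1" for S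
  proof -
    have "norm (S ** A1) \<le> 1 * norm A1"
      using S by (intro order_trans[OF norm_matrix_matrix_mult] mult_right_mono) auto
    moreover have "norm (A2 ** S) \<le> norm A2 * 1"
      using S by (intro order_trans[OF norm_matrix_matrix_mult] mult_left_mono) auto
    moreover have "norm (S ** A3 ** S) \<le> (1 * norm A3) * 1"
      using S by (intro order_trans[OF norm_matrix_matrix_mult] mult_mono order_trans[OF norm_matrix_matrix_mult] mult_right_mono) auto
    moreover have "norm (F S) \<le> norm C0 + norm (S ** A1) + norm (A2 ** S) + norm (S ** A3 ** S)"
      unfolding F_def by (intro order_trans[OF norm_triangle_ineq] add_mono order_refl)
    ultimately show ?thesis using e by simp
  qed
  have Fc: "dist (F S) (F T) \<le> 1 / 2 * dist S T" if S: "norm S \<le> 1" and T: "norm T \<le> 1" for S T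
  proof -
    have "F S - F T = (S - T) ** A1 + A2 ** (S - T) + ((S - T) ** A3 ** S + T ** A3 ** (S - T))"
      unfolding F_def by (simp add: mm.diff_left m2.diff_right m3.diff_left m2.diff_left)
    also have "norm \<dots> \<le> norm ((S - T) ** A1) + norm (A2 ** (S - T)) + (norm ((S - T) ** A3 ** S) + norm (T ** A3 ** (S - T)))"
      by (intro order_trans[OF norm_triangle_ineq] add_mono order_refl)
    also have "\<dots> \<le> norm (S - T) * norm A1 + norm A2 * norm (S - T) + ((norm (S - T) * norm A3) * 1 + (1 * norm A3) * norm (S - T))"
    proof (intro add_mono norm_matrix_matrix_mult)
      show "norm ((S - T) ** A3 ** S) \<le> (norm (S - T) * norm A3) * 1"
        using S by (intro order_trans[OF norm_matrix_matrix_mult] mult_mono norm_matrix_matrix_mult) auto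
      have "norm (T ** A3) \<le> 1 * norm A3"
        using T by (intro order_trans[OF norm_matrix_matrix_mult] mult_right_mono) auto
      then show "norm (T ** A3 ** (S - T)) \<le> (1 * norm A3) * norm (S - T)"
        by (intro order_trans[OF norm_matrix_matrix_mult[of "T ** A3" "S - T"]] mult_right_mono) auto
    qed
    also have "\<dots> = (norm A1 + norm A2 + 2 * norm A3) * norm (S - T)" by (simp add: algebra_simps)
    also have "\<dots> \<le> 1 / 2 * norm (S - T)"
      using e norm_ge_zero[of C0] norm_ge_zero[of A1] norm_ge_zero[of A2] norm_ge_zero[of "S - T"] by (intro mult_right_mono) linarith+
    finally show ?thesis by (simp add: dist_norm)
  qed
  have "\<exists>!S\<in>cball 0 1. F S = S"
  proof (rule Banach_fix[of _ "1/2"])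
    show "complete (cball (0::complex^'p^'q) 1)" by (simp add: complete_eq_closed)
    show "F ` cball 0 1 \<subseteq> cball 0 1" using Fb e by (force simp: dist_norm)
    show "dist (F x) (F y) \<le> 1 / 2 * dist x y" if "x \<in> cball 0 1" "y \<in> cball 0 1" for x y
      using Fc[of x y] that by (simp add: dist_norm)
  qed auto
  then obtain S where "norm S \<le> 1" "F S = S" by (auto simp: dist_norm)
  then show thesis using Fb[of S] by (intro that[of S]) (auto simp: F_def)
qed

text \<open>The diagonal part is skew-adjoint and drops out of the energy, so the growth does not
  depend on \<open>d\<close>, that is, on the frequency.\<close>

lemma skew_flow_bound:
  assumes "norm D \<le> c"
  shows "norm (flow (diagm (\<lambda>i. \<i> * of_real (d i)) + D) t v) \<le> exp (c * \<bar>t\<bar>) * norm v"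
proof -
  have skew: "inner v (diagm (\<lambda>i. \<i> * of_real (d i)) *v v) = 0" for v and d :: "'a \<Rightarrow> real"
    by (simp add: inner_vec_def inner_complex_def algebra_simps)
  have *: "norm (flow (diagm (\<lambda>i. \<i> * of_real (d i)) + D) t v) \<le> exp (c * t) * norm v"
    if "0 \<le> t" "norm D \<le> c" for t v D and d :: "'a \<Rightarrow> real"
  proof (rule flow_growth[OF _ that(1)])
    fix v
    have "\<bar>inner v (D *v v)\<bar> \<le> c * (norm v)\<^sup>2"
      using inner_matrix_vector_bound[of v D] mult_right_mono[OF that(2), of "(norm v)\<^sup>2"] by simp
    then show "inner v ((diagm (\<lambda>i. \<i> * of_real (d i)) + D) *v v) \<ge> - c * (norm v)\<^sup>2"
      by (simp add: matrix_vector_mult_add_rdistrib inner_add_right skew)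
  qed
  show ?thesis
  proof (cases "0 \<le> t")
    case True
    then show ?thesis using *[OF True assms, of d v] by simp
  next
    case False
    have neg: "- (diagm (\<lambda>i. \<i> * of_real (d i)) + D) = diagm (\<lambda>i. \<i> * of_real (- d i)) + (- D)"
      unfolding vec_eq_iff by (auto simp: diagm_def)
    have "flow A t v = flow (- A) (- t) v" for A by (simp add: flow_def)
    from this[of "diagm (\<lambda>i. \<i> * of_real (d i)) + D", unfolded neg]
    have "flow (diagm (\<lambda>i. \<i> * of_real (d i)) + D) t v = flow (diagm (\<lambda>i. \<i> * of_real (- d i)) + (- D)) (- t) v" .
    then show ?thesis using *[of "- t" "- D" "\<lambda>i. - d i" v] False assms by simp
  qed
qed

text \<open>The coupling between different speeds is removed up to \<open>O(1/n)\<close> by the change of variables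
  \<open>I + X/n\<close>, where \<open>X\<close> solves a commutator equation with the transport part.\<close>

lemma hyperbolic_perturbation:
  fixes mu :: "'n::finite \<Rightarrow> real" and K :: "complex^'n^'n"
  assumes C: "0 \<le> C" and T: "0 \<le> T"
  defines "D \<equiv> (\<chi> i j. if mu i = mu j then K $ i $ j else 0)"
  obtains C' where "0 \<le> C'" and "\<forall>n (E :: complex^'n^'n) t v. n \<noteq> (0::int) \<longrightarrow> norm E \<le> C / \<bar>of_int n\<bar> \<longrightarrow> 0 \<le> t \<longrightarrow> t \<le> T \<longrightarrow>
    norm (flow (diagm (\<lambda>i. \<i> * of_int n * mu i) + K + E) t v - flow (diagm (\<lambda>i. \<i> * of_int n * mu i) + D) t v)
      \<le> C' / \<bar>of_int n\<bar> * norm v"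
proof -
  \<comment> \<open>Entries between different speeds are divided by
    \<open>\<i> (mu i - mu j)\<close>; then the commutator of \<open>X / n\<close> with the
    transport part cancels \<open>K - D\<close>.\<close>
  define X where "X = (\<chi> i j. if mu i = mu j then 0 else K $ i $ j / (\<i> * of_real (mu i - mu j)))"
  define k where "k = norm K + C + norm D"
  let ?x = "exp (k * T)"
  have k0: "0 \<le> k" using C by (simp add: k_def)
  define CF where "CF = C + norm X * (norm K + C) + norm D * norm X"
  have CF0: "0 \<le> CF" using C by (simp add: CF_def)
  define C' where "C' = ?x * (T * (?x * (CF * ?x))) + 2 * norm X * ?x"
  have C'0: "0 \<le> C'" using T CF0 by (simp add: C'_def)
  show thesis
  proof (rule that[OF C'0], intro allI impI)
    fix n :: int and E :: "complex^'n^'n" and t and v :: "complex^'n"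
    assume n: "n \<noteq> 0" and E: "norm E \<le> C / \<bar>of_int n\<bar>" and t: "0 \<le> t" "t \<le> T"
    define r where "r = 1 / real_of_int n"
    have n1: "1 \<le> \<bar>real_of_int n\<bar>" using n by linarith
    have r: "\<bar>r\<bar> \<le> 1" "\<bar>r\<bar> = 1 / \<bar>of_int n\<bar>" using n1 by (auto simp: r_def field_simps)
    have EC: "norm E \<le> C" using E C n1 by (smt (verit, best) divide_left_mono div_by_1 mult_pos_pos)
    let ?d = "diagm (\<lambda>i. \<i> * of_int n * mu i)"
    define H where "H = ?d + K + E"
    define G where "G = ?d + D"
    have dd: "?d = diagm (\<lambda>i. \<i> * of_real (of_int n * mu i))" by (simp add: mult.assoc)
    have Gb: "norm (flow G s w) \<le> ?x * norm w" if "\<bar>s\<bar> \<le> T" for s w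
    proof -
      have "norm (flow G s w) \<le> exp (norm D * \<bar>s\<bar>) * norm w" unfolding G_def dd by (rule skew_flow_bound) simp
      also have "\<dots> \<le> ?x * norm w" using that C k0 by (intro mult_right_mono) (auto simp: k_def intro!: mult_mono)
      finally show ?thesis .
    qed
    have Hb: "norm (flow H s w) \<le> ?x * norm w" if "\<bar>s\<bar> \<le> T" for s w
    proof -
      have "norm (K + E) \<le> norm K + C" using EC norm_triangle_ineq[of K E] by linarith
      then have "norm (flow H s w) \<le> exp ((norm K + C) * \<bar>s\<bar>) * norm w" unfolding H_def dd add.assoc by (rule skew_flow_bound)
      also have "\<dots> \<le> ?x * norm w" using that C k0 by (intro mult_right_mono) (auto simp: k_def intro!: mult_mono)
      finally show ?thesis .
    qed
    define R where "R w = w + r *\<^sub>R (X *v w)" for w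
    have R: "bounded_linear R" unfolding R_def
      by (intro bounded_linear_add bounded_linear_ident bounded_linear_scaleR_right[THEN bounded_linear_compose] bounded_linear_matrix_vector)
    \<comment> \<open>Defect of the intertwining relation between \<open>H\<close> and
      \<open>G\<close> under \<open>R\<close>. After the cancellation by \<open>X\<close>, each
      remaining term carries a factor \<open>1 / n\<close> or \<open>E\<close>.\<close>
    define F where "F w = R (H *v w) - G *v R w" for w
    have Feq: "F w = E *v w + r *\<^sub>R (X *v ((K + E) *v w)) - r *\<^sub>R (D *v (X *v w))" for w
    proof -
      have com: "r *\<^sub>R (X *v (?d *v w)) - r *\<^sub>R (?d *v (X *v w)) = - ((K - D) *v w)"
      proof (rule vec_eq_iff[THEN iffD2], rule allI)
        fix i
        have "(r *\<^sub>R (X *v (?d *v w)) - r *\<^sub>R (?d *v (X *v w))) $ i =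
          (\<Sum>j\<in>UNIV. r *\<^sub>R (X $ i $ j * (\<i> * of_int n * mu j * w $ j)) - r *\<^sub>R (\<i> * of_int n * mu i * (X $ i $ j * w $ j)))"
        proof -
          have Xx: "(X *v x) $ i = (\<Sum>j\<in>UNIV. X $ i $ j * x $ j)" for x by (simp add: matrix_vector_mult_def)
          show ?thesis by (simp only: vector_minus_component vector_scaleR_component diagm_mult Xx sum_distrib_left scaleR_sum_right sum_subtractf)
        qed
        also have "\<dots> = (\<Sum>j\<in>UNIV. - ((K $ i $ j - D $ i $ j) * w $ j))"
        proof (rule sum.cong[OF refl])
          fix j
          show "r *\<^sub>R (X $ i $ j * (\<i> * of_int n * mu j * w $ j)) - r *\<^sub>R (\<i> * of_int n * mu i * (X $ i $ j * w $ j)) = - ((K $ i $ j - D $ i $ j) * w $ j)"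
          proof (cases "mu i = mu j")
            case False
            then have ne: "complex_of_real (mu i) - of_real (mu j) \<noteq> 0" by (simp flip: of_real_diff)
            have "r *\<^sub>R (X $ i $ j * (\<i> * of_int n * mu j * w $ j)) - r *\<^sub>R (\<i> * of_int n * mu i * (X $ i $ j * w $ j))
              = - (of_real r * of_int n) * (X $ i $ j * (\<i> * (of_real (mu i) - of_real (mu j)))) * w $ j"
              by (simp add: scaleR_conv_of_real algebra_simps)
            also have "X $ i $ j * (\<i> * (of_real (mu i) - of_real (mu j))) = K $ i $ j" using False ne by (simp add: X_def)
            also have "of_real r * complex_of_int n = 1" using n by (simp add: r_def)
            finally show ?thesis using False by (simp add: D_def)
          qed (simp add: X_def D_def)
        qed
        also have "\<dots> = (- ((K - D) *v w)) $ i" by (simp add: matrix_vector_mult_def sum_negf)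
        finally show "(r *\<^sub>R (X *v (?d *v w)) - r *\<^sub>R (?d *v (X *v w))) $ i = (- ((K - D) *v w)) $ i" .
      qed
      have "F w = (r *\<^sub>R (X *v (?d *v w)) - r *\<^sub>R (?d *v (X *v w))) + ((K - D) *v w) + (E *v w + r *\<^sub>R (X *v ((K + E) *v w)) - r *\<^sub>R (D *v (X *v w)))"
        unfolding F_def R_def H_def G_def
        by (simp add: matrix_vector_mult_add_rdistrib matrix_vector_right_distrib matrix_vector_mult_diff_rdistrib
            mv_scaleR scaleR_add_right)
      then show ?thesis unfolding com by simp
    qed
    have Fb: "norm (F w) \<le> \<bar>r\<bar> * CF * norm w" for w
    proof -
      have "norm (E *v w) \<le> \<bar>r\<bar> * C * norm w"
        using norm_matrix_vector_mult[of E w] mult_right_mono[OF E, of "norm w"] r(2) by simp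
      moreover have "norm (X *v ((K + E) *v w)) \<le> norm X * ((norm K + C) * norm w)"
      proof -
        have "norm ((K + E) *v w) \<le> (norm K + C) * norm w"
          using norm_matrix_vector_mult[of "K + E" w] EC norm_triangle_ineq[of K E]
          by (elim order_trans) (intro mult_right_mono, auto)
        then show ?thesis using norm_matrix_vector_mult[of X "(K + E) *v w"] by (elim order_trans) (intro mult_left_mono, auto)
      qed
      then have "norm (r *\<^sub>R (X *v ((K + E) *v w))) \<le> \<bar>r\<bar> * (norm X * ((norm K + C) * norm w))" by (simp add: mult_left_mono)
      moreover have "norm (D *v (X *v w)) \<le> norm D * (norm X * norm w)"
        using norm_matrix_vector_mult[of D "X *v w"] norm_matrix_vector_mult[of X w] by (elim order_trans) (intro mult_left_mono, auto)
      then have "norm (r *\<^sub>R (D *v (X *v w))) \<le> \<bar>r\<bar> * (norm D * (norm X * norm w))" by (simp add: mult_left_mono)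
      moreover have "norm (F w) \<le> norm (E *v w) + norm (r *\<^sub>R (X *v ((K + E) *v w))) + norm (r *\<^sub>R (D *v (X *v w)))"
        unfolding Feq by (intro order_trans[OF norm_triangle_ineq4] add_mono norm_triangle_ineq order_refl)
      ultimately show ?thesis by (simp add: CF_def algebra_simps)
    qed
    \<comment> \<open>Variation of constants: pulled back by the flow of \<open>G\<close>, the
      transformed solution is driven by the small defect \<open>F\<close> alone.\<close>
    define z where "z s = flow (- G) s (R (flow H s v))" for s
    have Gm: "flow (- G) s w = flow G (- s) w" for s w by (simp add: flow_def)
    have dz: "(z has_vector_derivative - flow (- G) s (F (flow H s v))) (at s)" for s
    proof -
      have "((\<lambda>s. R (flow H s v)) has_vector_derivative R (- (H *v flow H s v))) (at s)"
        by (rule bounded_linear.has_vector_derivative[OF R flow_has_derivative])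
      from flow_has_derivative_comp[OF this, of "- G"]
      have "(z has_vector_derivative - ((- G) *v flow (- G) s (R (flow H s v))) + flow (- G) s (R (- (H *v flow H s v)))) (at s)"
        unfolding z_def .
      moreover have "- ((- G) *v flow (- G) s w) = flow (- G) s (G *v w)" for w
        by (simp only: flow_commute) (simp add: bounded_bilinear.minus_left[OF bounded_bilinear_matrix_vector] flow_minus_right)
      ultimately show ?thesis
        by (simp add: F_def flow_diff_right flow_minus_right linear_neg[OF bounded_linear.linear[OF R]])
    qed
    have "norm (z t - z 0) \<le> (?x * (\<bar>r\<bar> * CF * (?x * norm v))) * \<bar>t\<bar>"
    proof (rule norm_increment_bound[OF dz])
      fix s assume "\<bar>s\<bar> \<le> \<bar>t\<bar>"
      then have sT: "\<bar>s\<bar> \<le> T" using t by auto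
      have "norm (- flow (- G) s (F (flow H s v))) \<le> ?x * norm (F (flow H s v))"
        unfolding Gm norm_minus_cancel by (rule Gb) (use sT in simp)
      also have "\<dots> \<le> ?x * (\<bar>r\<bar> * CF * (?x * norm v))"
        using CF0 by (intro mult_left_mono order_trans[OF Fb] Hb sT) auto
      finally show "norm (- flow (- G) s (F (flow H s v))) \<le> ?x * (\<bar>r\<bar> * CF * (?x * norm v))" .
    qed
    also have "\<dots> \<le> (?x * (\<bar>r\<bar> * CF * (?x * norm v))) * T"
      using t CF0 by (intro mult_left_mono) auto
    finally have zb: "norm (z t - z 0) \<le> (?x * (\<bar>r\<bar> * CF * (?x * norm v))) * T" .
    have tT: "\<bar>t\<bar> \<le> T" using t by simp
    have zz: "flow G t (z t - z 0) = R (flow H t v) - flow G t (R v)"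
      unfolding z_def flow_diff_right Gm using flow_inverse[of G "- t" "R (flow H t v)"] by simp
    have "flow H t v - flow G t v = flow G t (z t - z 0) - r *\<^sub>R (X *v flow H t v) + r *\<^sub>R flow G t (X *v v)"
      unfolding zz R_def by (simp add: flow_add_right flow_scaleR_right)
    also have "norm \<dots> \<le> norm (flow G t (z t - z 0)) + norm (r *\<^sub>R (X *v flow H t v)) + norm (r *\<^sub>R flow G t (X *v v))"
      by (intro order_trans[OF norm_triangle_ineq] add_mono norm_triangle_ineq4 order_refl)
    also have "\<dots> \<le> ?x * ((?x * (\<bar>r\<bar> * CF * (?x * norm v))) * T)
        + \<bar>r\<bar> * (norm X * (?x * norm v)) + \<bar>r\<bar> * (?x * (norm X * norm v))"
    proof (intro add_mono)
      show "norm (flow G t (z t - z 0)) \<le> ?x * ((?x * (\<bar>r\<bar> * CF * (?x * norm v))) * T)"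
        by (intro order_trans[OF Gb[OF tT]] mult_left_mono zb) auto
      show "norm (r *\<^sub>R (X *v flow H t v)) \<le> \<bar>r\<bar> * (norm X * (?x * norm v))"
        unfolding norm_scaleR by (intro mult_left_mono order_trans[OF norm_matrix_vector_mult] Hb tT) auto
      show "norm (r *\<^sub>R flow G t (X *v v)) \<le> \<bar>r\<bar> * (?x * (norm X * norm v))"
        unfolding norm_scaleR by (intro mult_left_mono order_trans[OF Gb[OF tT]] norm_matrix_vector_mult) auto
    qed
    also have "\<dots> = C' / \<bar>of_int n\<bar> * norm v" using r(2) by (simp add: C'_def algebra_simps add_divide_distrib)
    finally show "norm (flow (?d + K + E) t v - flow (?d + D) t v) \<le> C' / \<bar>of_int n\<bar> * norm v"
      by (simp only: H_def G_def)
  qed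
qed

section \<open>Block vectors and stability of the Kalman inverse\<close>

definition join :: "complex^'a::finite \<Rightarrow> complex^'b::finite \<Rightarrow> complex^('a + 'b)" where
  "join x y = (\<chi> i. case i of Inl a \<Rightarrow> x $ a | Inr b \<Rightarrow> y $ b)"

definition part1 :: "complex^('a::finite + 'b::finite) \<Rightarrow> complex^'a" where "part1 c = (\<chi> a. c $ Inl a)"

definition part2 :: "complex^('a::finite + 'b::finite) \<Rightarrow> complex^'b" where "part2 c = (\<chi> b. c $ Inr b)"

lemma join_simps [simp]: "part1 (join x y) = x" "part2 (join x y) = y" "join (part1 c) (part2 c) = c"
  "join x y $ Inl a = x $ a" "join x y $ Inr b = y $ b"
  by (auto simp: join_def part1_def part2_def vec_eq_iff split: sum.splits)

lemma sum_UNIV_sum: "(\<Sum>i\<in>UNIV. f i) = (\<Sum>a\<in>UNIV. f (Inl a)) + (\<Sum>b\<in>UNIV. f (Inr b))"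
  for f :: "'a::finite + 'b::finite \<Rightarrow> 'c::comm_monoid_add"
  by (simp add: UNIV_Plus_UNIV[symmetric] sum.Plus del: UNIV_Plus_UNIV)

lemma block_matrix_mult:
  "block_matrix M11 M12 M21 M22 *v c = join (M11 *v part1 c + M12 *v part2 c) (M21 *v part1 c + M22 *v part2 c)"
  by (auto simp: vec_eq_iff matrix_vector_mult_def block_matrix_def join_def part1_def part2_def sum_UNIV_sum split: sum.splits)

lemma bounded_linear_parts [simp, intro]:
  "bounded_linear (part1 :: complex^('a::finite + 'b::finite) \<Rightarrow> complex^'a)"
  "bounded_linear (part2 :: complex^('a::finite + 'b::finite) \<Rightarrow> complex^'b)"
  by (auto intro!: linear_conv_bounded_linear[THEN iffD1] linearI simp: part1_def part2_def vec_eq_iff)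

lemma norm_join_sq: "(norm (join x y))\<^sup>2 = (norm x)\<^sup>2 + (norm y)\<^sup>2"
  unfolding norm_vec_def L2_set_def by (simp add: sum_nonneg sum_UNIV_sum)

lemma norm_parts_le: "norm (part1 c) \<le> norm c" "norm (part2 c) \<le> norm c"
proof -
  have "(norm c)\<^sup>2 = (norm (part1 c))\<^sup>2 + (norm (part2 c))\<^sup>2"
    using norm_join_sq[of "part1 c" "part2 c"] by simp
  then have "(norm (part1 c))\<^sup>2 \<le> (norm c)\<^sup>2" "(norm (part2 c))\<^sup>2 \<le> (norm c)\<^sup>2" by auto
  then show "norm (part1 c) \<le> norm c" "norm (part2 c) \<le> norm c" by (auto intro: power2_le_imp_le)
qed

lemma norm_join_le: "norm (join x y) \<le> norm x + norm y"
proof (rule power2_le_imp_le)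
  show "(norm (join x y))\<^sup>2 \<le> (norm x + norm y)\<^sup>2" unfolding norm_join_sq by (simp add: power2_sum)
qed simp

lemma norm_mat: "norm (mat c ** (A::complex^'m^'n)) = cmod c * norm A"
proof -
  have row: "(mat c ** A) $ i = c *s (A $ i)" for i
    by (auto simp: vec_eq_iff matrix_matrix_mult_def mat_def if_distrib[where f="\<lambda>a. a * b" for b] cong: if_cong)
  show ?thesis
    by (simp add: norm_vec_eq[of "mat c ** A"] norm_vec_eq[of A] row norm_vector_smult L2_set_right_distrib)
qed

lemma norm_diagm_le: "norm (diagm d) \<le> (\<Sum>i\<in>UNIV. cmod (d i))" for d :: "'n::finite \<Rightarrow> complex"
proof -
  have row: "diagm d $ i = axis i (d i)" for i by (auto simp: diagm_def axis_def vec_eq_iff)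
  have "norm (diagm d) = L2_set (\<lambda>i. cmod (d i)) UNIV"
    by (simp add: norm_vec_eq[of "diagm d"] row norm_axis_eq)
  also have "\<dots> \<le> (\<Sum>i\<in>UNIV. cmod (d i))" by (rule L2_set_le_sum) simp
  finally show ?thesis .
qed

lemma norm_le_columns: "norm (A::complex^'m^'n) \<le> (\<Sum>j\<in>UNIV. norm (A *v axis j 1))"
proof -
  have col: "transpose A $ j = A *v axis j 1" for j
    by (auto simp: matrix_vector_mult_def axis_def transpose_def vec_eq_iff if_distrib[where f="\<lambda>a. b * a" for b] cong: if_cong)
  have "norm A = L2_set (\<lambda>j. norm (transpose A $ j)) UNIV"
    unfolding norm_transpose_matrix[of A, symmetric] by (rule norm_vec_eq)
  also have "\<dots> \<le> (\<Sum>j\<in>UNIV. norm (transpose A $ j))" by (rule L2_set_le_sum) simp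
  finally show ?thesis by (simp only: col)
qed

lemma near_identity_inverse:
  fixes W :: "complex^'k^'k"
  assumes "\<And>x. norm (W *v x - x) \<le> norm x / 2"
  obtains V where "\<And>x. W *v (V *v x) = x" "norm V \<le> 2 * real CARD('k)"
proof -
  have le: "norm x \<le> 2 * norm (W *v x)" for x
    using assms[of x] norm_triangle_ineq2[of x "x - W *v x"] by (simp add: norm_minus_commute)
  have "inj ((*v) W)"
  proof (rule injI)
    fix x y assume "W *v x = W *v y"
    then have "W *v (x - y) = 0" by (simp add: matrix_vector_mult_diff_distrib)
    then show "x = y" using le[of "x - y"] by simp
  qed
  then obtain V where "V ** W = mat 1" using matrix_left_invertible_injective[of W] by blast
  then have WV: "W ** V = mat 1" using matrix_left_right_inverse by blast
  have "norm V \<le> (\<Sum>j\<in>UNIV. norm (V *v axis j 1))" by (rule norm_le_columns)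
  also have "\<dots> \<le> (\<Sum>j\<in>(UNIV::'k set). 2)"
  proof (rule sum_mono)
    fix j
    have "norm (V *v axis j 1) \<le> 2 * norm (W *v (V *v axis j 1))" by (rule le)
    then show "norm (V *v axis j 1) \<le> 2" by (simp add: matrix_vector_mul_assoc WV norm_axis_eq)
  qed
  finally have "norm V \<le> 2 * real CARD('k)" by simp
  then show thesis using that[of V] by (simp add: matrix_vector_mul_assoc WV)
qed

lemma continuous_on_matpow: "continuous_on UNIV (\<lambda>K::complex^'n^'n. matpow K j)"
proof (induction j)
  case (Suc j)
  show ?case unfolding matpow.simps
    by (intro bounded_bilinear.continuous_on[OF bounded_bilinear_matrix_matrix] continuous_on_id Suc)
qed (simp add: continuous_on_const)

text \<open>The Kalman map composed with the fixed \<open>R\<close> depends continuously on the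
  matrices and is the identity at \<open>(K, B)\<close>, so it stays invertible nearby; composing
  \<open>R\<close> with the inverse gives right inverses with a common bound.\<close>

lemma kalman_perturbation:
  fixes K :: "complex^'k^'k" and B :: "complex^'n^'k" and R :: "nat \<Rightarrow> complex^'k^'n"
  assumes "\<And>x. (\<Sum>j<m. matpow K j *v (B *v (R j *v x))) = x"
  obtains e rho where "0 < e" "\<forall>K' B'. norm (K' - K) < e \<longrightarrow> norm (B' - B) < e \<longrightarrow>
    (\<exists>R'. (\<forall>j. norm (R' j) \<le> rho) \<and> (\<forall>x. (\<Sum>j<m. matpow K' j *v (B' *v (R' j *v x))) = x))"
proof -
  define W where "W z = (\<Sum>j<m. matpow (fst z) j ** (snd z ** R j))" for z :: "(complex^'k^'k) \<times> (complex^'n^'k)"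
  have Wv: "W z *v x = (\<Sum>j<m. matpow (fst z) j *v (snd z *v (R j *v x)))" for z x
    unfolding W_def
    by (simp add: linear_sum[OF bounded_linear.linear[OF bounded_bilinear.bounded_linear_left[OF bounded_bilinear_matrix_vector]]] matrix_vector_mul_assoc matrix_mul_assoc)
  have WI: "W (K, B) = mat 1"
    unfolding matrix_eq using assms by (simp add: Wv)
  have "continuous_on UNIV W" unfolding W_def
    by (intro continuous_on_sum bounded_bilinear.continuous_on[OF bounded_bilinear_matrix_matrix]
      continuous_on_compose2[OF continuous_on_matpow] continuous_intros) auto
  then have "isCont W (K, B)" by (simp add: continuous_on_eq_continuous_at)
  then obtain e where e: "0 < e" "\<And>z. dist z (K, B) < e \<Longrightarrow> dist (W z) (W (K, B)) < 1 / 2"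
    unfolding continuous_at_eps_delta by (metis half_gt_zero zero_less_one)
  define rho where "rho = (\<Sum>j<m. norm (R j)) * (2 * real CARD('k))"
  show thesis
  proof (rule that[of "e / 2" rho], goal_cases)
    case 1 then show ?case using e by simp
  next
    case 2
    show ?case
    proof (intro allI impI)
      fix K' B' assume K': "norm (K' - K) < e / 2" and B': "norm (B' - B) < e / 2"
      have "dist (K', B') (K, B) \<le> dist K' K + dist B' B"
        unfolding dist_Pair_Pair by (intro sqrt_sum_squares_le_sum) auto
      also have "\<dots> < e" using K' B' by (simp add: dist_norm)
      finally have "norm (W (K', B') - mat 1) < 1 / 2" using e(2)[of "(K', B')"] by (simp add: WI dist_norm)
      then have "norm (W (K', B') *v x - x) \<le> norm x / 2" for x
        using norm_matrix_vector_mult[of "W (K', B') - mat 1" x] mult_right_mono[of "norm (W (K', B') - mat 1)" "1/2" "norm x"]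
        by (simp add: matrix_vector_mult_diff_rdistrib)
      then obtain V where V: "\<And>x. W (K', B') *v (V *v x) = x" "norm V \<le> 2 * real CARD('k)"
        using near_identity_inverse by blast
      show "\<exists>R'. (\<forall>j. norm (R' j) \<le> rho) \<and> (\<forall>x. (\<Sum>j<m. matpow K' j *v (B' *v (R' j *v x))) = x)"
      \<comment> \<open>Indices from \<open>m\<close> on do not enter the sum; the value 0 there
        makes the bound valid for every \<open>j\<close>.\<close>
      proof (intro exI[of _ "\<lambda>j. if j < m then R j ** V else 0"] conjI allI)
        fix j
        show "norm (if j < m then R j ** V else 0) \<le> rho"
        proof (cases "j < m")
          case True
          have "norm (R j ** V) \<le> norm (R j) * norm V" by (rule norm_matrix_matrix_mult)
          also have "\<dots> \<le> rho" unfolding rho_def using True V(2)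
            by (intro mult_mono member_le_sum) (auto intro: sum_nonneg)
          finally show ?thesis using True by simp
        qed (simp add: rho_def sum_nonneg)
        fix x
        show "(\<Sum>j<m. matpow K' j *v (B' *v ((if j < m then R j ** V else 0) *v x))) = x"
          using V(1)[of x] unfolding Wv by (simp flip: matrix_vector_mul_assoc cong: sum.cong_simp)
      qed
    qed
  qed
qed

text \<open>The system in the eigenbasis of \<open>A'\<close>, with speeds \<open>mu\<close>. The
  Kalman condition is kept in the form of a right inverse \<open>R0\<close>, the form in which it
  survives perturbation.\<close>

locale hp_system =
  fixes mu :: "'d1::finite \<Rightarrow> real" and K11 :: "complex^'d1^'d1" and A12 K12 :: "complex^'d2::finite^'d1"
    and K21 :: "complex^'d1^'d2" and K22 :: "complex^'d2^'d2" and \<omega> :: "complex set"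
    and mm :: nat and R0 :: "nat \<Rightarrow> complex^'d2^'d1"
  assumes mu: "\<And>i. mu i \<noteq> 0"
    and om: "openin (top_of_set torus) \<omega>" and ne: "\<omega> \<noteq> {}"
    and R0: "\<And>x. (\<Sum>j<mm. matpow K22 j *v (K21 *v (R0 j *v x))) = x"
begin

definition Dn :: "int \<Rightarrow> complex^'d1^'d1" where "Dn n = diagm (\<lambda>i. \<i> * of_int n * mu i)"
definition M12 :: "int \<Rightarrow> complex^'d2^'d1" where "M12 n = mat (\<i> * of_int n) ** A12 + K12"
definition Mn :: "int \<Rightarrow> complex^('d1 + 'd2)^('d1 + 'd2)" where
  "Mn n = block_matrix (Dn n + K11) (M12 n) K21 (mat (of_real ((of_int n)\<^sup>2)) + K22)"
definition emb :: "complex^'d1^('d1 + 'd2)" where "emb = (\<chi> i j. case i of Inl a \<Rightarrow> if a = j then 1 else 0 | Inr b \<Rightarrow> 0)"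

lemma emb_mult: "emb *v w = join w 0"
  by (auto simp: emb_def join_def vec_eq_iff matrix_vector_mult_def if_distrib[where f="\<lambda>a. a * b" for b] split: sum.splits cong: if_cong)

lemma Mn_mult: "Mn n *v c = join ((Dn n + K11) *v part1 c + M12 n *v part2 c) (K21 *v part1 c + (of_int n)\<^sup>2 *\<^sub>R part2 c + K22 *v part2 c)"
  unfolding Mn_def block_matrix_mult matrix_vector_mult_add_rdistrib[of "mat _"] mat_mult_vec smult_of_real
  by (simp add: add.assoc)

text \<open>The summand 1 ensures \<open>kk >= 1\<close>, so that bounds with different powers of
  \<open>kk\<close> can be merged.\<close>

definition kk :: real where
  "kk = (\<Sum>i\<in>UNIV. \<bar>mu i\<bar>) + norm K11 + norm A12 + norm K12 + norm K21 + norm K22 + 1"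

lemma kk: "1 \<le> kk" by (simp add: kk_def sum_nonneg)

lemma M_bounds:
  assumes "n \<noteq> 0"
  shows "norm (Dn n + K11) \<le> kk * \<bar>of_int n\<bar>" "norm (M12 n) \<le> kk * \<bar>of_int n\<bar>" "norm K21 \<le> kk * \<bar>of_int n\<bar>" "norm K22 \<le> kk * \<bar>of_int n\<bar>"
    "norm (Dn n + K11) + norm (M12 n) + norm K21 + norm K22 \<le> kk * \<bar>of_int n\<bar>"
proof -
  let ?n = "\<bar>real_of_int n\<bar>"
  have n1: "1 \<le> ?n" using assms by linarith
  have up: "x \<le> x * ?n" if "0 \<le> x" for x using mult_left_mono[OF n1 that] by simp
  have d: "norm (Dn n) \<le> (\<Sum>i\<in>UNIV. \<bar>mu i\<bar>) * ?n"
    unfolding Dn_def by (rule order_trans[OF norm_diagm_le]) (simp add: norm_mult sum_distrib_left[symmetric] mult.commute)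
  have a: "norm (mat (\<i> * of_int n) ** A12) = norm A12 * ?n" by (simp add: norm_mat norm_mult)
  have "norm (Dn n + K11) + norm (M12 n) + norm K21 + norm K22 \<le>
    (\<Sum>i\<in>UNIV. \<bar>mu i\<bar>) * ?n + norm K11 * ?n + (norm A12 * ?n + norm K12 * ?n) + norm K21 * ?n + norm K22 * ?n"
    unfolding M12_def
    by (intro add_mono order_trans[OF norm_triangle_ineq] d up) (use a in auto)
  also have "\<dots> \<le> kk * ?n" by (simp add: kk_def algebra_simps)
  finally show *: "norm (Dn n + K11) + norm (M12 n) + norm K21 + norm K22 \<le> kk * ?n" .
  show "norm (Dn n + K11) \<le> kk * ?n" "norm (M12 n) \<le> kk * ?n" "norm K21 \<le> kk * ?n" "norm K22 \<le> kk * ?n"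
    using * norm_ge_zero[of "Dn n + K11"] norm_ge_zero[of "M12 n"] norm_ge_zero[of K21] norm_ge_zero[of K22] by linarith+
qed

text \<open>With the unknowns \<open>c1 + Q c2\<close> and \<open>S c1 + c2\<close> the symbol
  becomes block diagonal, and the input column becomes \<open>(I, S)\<close>. That
  \<open>n^2 S\<close> is close to \<open>K21\<close> means that the control reaches the parabolic
  block essentially through \<open>K21 / n^2\<close>.\<close>

definition dec :: "real \<Rightarrow> int \<Rightarrow> complex^'d2^'d1 \<Rightarrow> complex^'d1^'d2 \<Rightarrow> bool" where
  "dec C n Q S \<longleftrightarrow> norm Q \<le> C / \<bar>of_int n\<bar> \<and> norm S \<le> C / \<bar>of_int n\<bar> \<and> norm Q \<le> 1 / 2 \<and> norm S \<le> 1 / 2 \<and>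
    norm (S ** M12 n) \<le> C / \<bar>of_int n\<bar> \<and> norm ((of_int n)\<^sup>2 *\<^sub>R S - K21) \<le> C / \<bar>of_int n\<bar> \<and>
    (\<forall>c. part1 (Mn n *v c) + Q *v part2 (Mn n *v c) = (Dn n + K11 + Q ** K21) *v (part1 c + Q *v part2 c)) \<and>
    (\<forall>c. S *v part1 (Mn n *v c) + part2 (Mn n *v c) = (mat (of_real ((of_int n)\<^sup>2)) + (K22 + S ** M12 n)) *v (S *v part1 c + part2 c))"

text \<open>Both changes of unknowns solve a Riccati equation whose coefficients are small because the
  diffusion is of higher order than the transport.\<close>

lemma decoupling:
  assumes n: "4 * kk \<le> \<bar>of_int n\<bar>"
  shows "\<exists>Q S. dec (4 * kk ^ 3) n Q S"
proof -
  let ?n = "\<bar>real_of_int n\<bar>"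
  \<comment> \<open>Dividing by \<open>n^2\<close>, the size of the diffusion, brings both equations
    into fixed-point form with coefficients of total size \<open>kk / n\<close>.\<close>
  define r where "r = 1 / ?n\<^sup>2"
  have n4: "4 \<le> ?n" using n kk by linarith
  have n0: "n \<noteq> 0" using n4 by auto
  have "0 < 1 / x\<^sup>2 \<and> 1 / x\<^sup>2 * x = 1 / x \<and> 1 / x\<^sup>2 * x\<^sup>2 = 1" if "4 \<le> x" for x :: real
    using that by (simp add: power2_eq_square)
  from this[OF n4] have r0: "0 < r" "r * ?n = 1 / ?n" "r * (of_int n)\<^sup>2 = 1" unfolding r_def power2_abs by blast+
  define e where "e = kk / ?n"
  have e: "e \<le> 1 / 4" "0 < e" "r * (kk * ?n) = e" using n n4 kk r0 by (auto simp: e_def field_simps)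
  note b = M_bounds[OF n0]
  have q1: "norm (- (r *\<^sub>R M12 n)) + norm (- (r *\<^sub>R K22)) + norm (r *\<^sub>R (Dn n + K11)) + norm (r *\<^sub>R K21) \<le> e"
    using mult_left_mono[OF b(5), of r] r0(1) e(3) unfolding norm_minus_cancel norm_scaleR by (simp add: distrib_left)
  obtain Q where Q: "norm Q \<le> e" "Q = - (r *\<^sub>R M12 n) + Q ** - (r *\<^sub>R K22) + (r *\<^sub>R (Dn n + K11)) ** Q + Q ** (r *\<^sub>R K21) ** Q"
    by (rule riccati[OF q1 e(1)])
  have s1: "norm (r *\<^sub>R K21) + norm (r *\<^sub>R (Dn n + K11)) + norm (- (r *\<^sub>R K22)) + norm (- (r *\<^sub>R M12 n)) \<le> e"
    using q1 by simp
  obtain S where S: "norm S \<le> e" "S = r *\<^sub>R K21 + S ** (r *\<^sub>R (Dn n + K11)) + (- (r *\<^sub>R K22)) ** S + S ** (- (r *\<^sub>R M12 n)) ** S"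
    by (rule riccati[OF s1 e(1)])
  have mvs: "(a *\<^sub>R A) *v x = a *\<^sub>R (A *v x)" for a and A :: "complex^'m^'n" and x
    by (rule bounded_bilinear.scaleR_left[OF bounded_bilinear_matrix_vector])
  have mvn: "(- A) *v x = - (A *v x)" "A *v (- x) = - (A *v x)" for A :: "complex^'m^'n" and x
    by (rule bounded_bilinear.minus_left[OF bounded_bilinear_matrix_vector], rule bounded_bilinear.minus_right[OF bounded_bilinear_matrix_vector])
  have scale: "(of_int n)\<^sup>2 *\<^sub>R (r *\<^sub>R x) = x" for x :: "'v::real_vector" using r0(3) by (simp add: mult.commute)
  have Qv: "(of_int n)\<^sup>2 *\<^sub>R (Q *v x) = - (M12 n *v x) - Q *v (K22 *v x) + (Dn n + K11) *v (Q *v x) + Q *v (K21 *v (Q *v x))" for x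
  proof -
    have "Q *v x = r *\<^sub>R (- (M12 n *v x) - Q *v (K22 *v x) + (Dn n + K11) *v (Q *v x) + Q *v (K21 *v (Q *v x)))"
      by (subst Q(2)) (simp only: matrix_vector_mult_add_rdistrib matrix_vector_mul_assoc[symmetric] mvs mvn mv_scaleR scaleR_add_right scaleR_diff_right scaleR_minus_right diff_conv_add_uminus)
    then show ?thesis using scale by metis
  qed
  have Sv: "(of_int n)\<^sup>2 *\<^sub>R (S *v x) = K21 *v x + S *v ((Dn n + K11) *v x) - K22 *v (S *v x) - S *v (M12 n *v (S *v x))" for x
  proof -
    have "S *v x = r *\<^sub>R (K21 *v x + S *v ((Dn n + K11) *v x) - K22 *v (S *v x) - S *v (M12 n *v (S *v x)))"
      by (subst S(2)) (simp add: matrix_vector_mult_add_rdistrib matrix_vector_mul_assoc[symmetric] mvs mvn mv_scaleR matrix_vector_right_distrib scaleR_add_right scaleR_diff_right)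
    then show ?thesis using scale by metis
  qed
  have Sm: "(of_int n)\<^sup>2 *\<^sub>R S = K21 + (S ** (Dn n + K11) - K22 ** S - S ** M12 n ** S)"
    unfolding matrix_eq using Sv
    by (simp add: mvs matrix_vector_mult_add_rdistrib matrix_vector_mult_diff_rdistrib matrix_vector_mul_assoc[symmetric] algebra_simps)
  have rest: "norm (S ** A) \<le> s * (kk * ?n)" if "norm A \<le> kk * ?n" "norm S \<le> s" "0 \<le> s" for A :: "complex^'m^'d1" and s
    using that by (intro order_trans[OF norm_matrix_matrix_mult] mult_mono) auto
  have rem: "norm (S ** (Dn n + K11) - K22 ** S - S ** M12 n ** S) \<le> s * (kk * ?n)" if "norm S \<le> s" "s \<le> 1" "0 \<le> s" for s
  proof -
    have 1: "norm (S ** (Dn n + K11)) \<le> s * norm (Dn n + K11)"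
      using that by (intro order_trans[OF norm_matrix_matrix_mult] mult_right_mono) auto
    have 2: "norm (K22 ** S) \<le> s * norm K22"
      using that mult_left_mono[of "norm S" s "norm K22"] norm_matrix_matrix_mult[of K22 S] by (simp add: mult.commute)
    have "norm (S ** M12 n) \<le> s * norm (M12 n)"
      using that by (intro order_trans[OF norm_matrix_matrix_mult] mult_right_mono) auto
    then have 3: "norm (S ** M12 n ** S) \<le> (s * norm (M12 n)) * 1"
      using that by (intro order_trans[OF norm_matrix_matrix_mult[of "S ** M12 n" S]] mult_mono) auto
    have "norm (S ** (Dn n + K11) - K22 ** S - S ** M12 n ** S) \<le> norm (S ** (Dn n + K11)) + norm (K22 ** S) + norm (S ** M12 n ** S)"
      by (intro order_trans[OF norm_triangle_ineq4] add_mono norm_triangle_ineq4 order_refl)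
    also have "\<dots> \<le> s * (norm (Dn n + K11) + norm (M12 n) + norm K21 + norm K22)"
      using 1 2 3 mult_nonneg_nonneg[OF that(3) norm_ge_zero[of K21]] by (simp add: distrib_left)
    also have "\<dots> \<le> s * (kk * ?n)" using b(5) that by (intro mult_left_mono)
    finally show ?thesis .
  qed
  \<comment> \<open>The fixed point only gives \<open>S\<close> of order \<open>1/n\<close>.
    Inserted once into its own equation, whose constant term \<open>K21\<close> is bounded, this
    improves to \<open>1/n^2\<close>, the order needed for \<open>S ** M12 n\<close> and for
    \<open>n^2 S - K21\<close>.\<close>
  define s where "s = r * (kk + e * (kk * ?n))"
  have S2: "norm S \<le> s"
  proof -
    have "S = r *\<^sub>R ((of_int n)\<^sup>2 *\<^sub>R S)" using r0(3) by simp
    then have "norm S = r * norm ((of_int n)\<^sup>2 *\<^sub>R S)" using r0(1) by (metis norm_scaleR abs_of_pos)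
    also have "\<dots> \<le> r * (kk + e * (kk * ?n))"
    proof (intro mult_left_mono)
      have "norm K21 \<le> kk" by (simp add: kk_def sum_nonneg)
      then show "norm ((of_int n)\<^sup>2 *\<^sub>R S) \<le> kk + e * (kk * ?n)"
        unfolding Sm using rem[OF S(1)] e by (intro order_trans[OF norm_triangle_ineq] add_mono) auto
    qed (use r0 in auto)
    finally show ?thesis by (simp add: s_def)
  qed
  have kk3: "kk \<le> kk ^ 3" "kk ^ 2 \<le> kk ^ 3" using kk self_le_power[of kk 3] power_increasing[of 2 3 kk] by auto
  have s_n: "s * (kk * ?n) \<le> 2 * kk ^ 3 / ?n"
  proof -
    have "s * (kk * ?n) = (kk + kk * kk) * kk * (r * ?n)" using n4 by (simp add: s_def e_def)
    also have "\<dots> \<le> (kk ^ 2 + kk ^ 2) * kk * (r * ?n)"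
      using kk r0 self_le_power[of kk 2] by (intro mult_right_mono add_mono) (auto simp: power2_eq_square)
    also have "\<dots> = 2 * kk ^ 3 / ?n" using r0(2) by (simp add: power3_eq_cube power2_eq_square)
    finally show ?thesis .
  qed
  have s0: "0 \<le> s" using S2 norm_ge_zero order_trans by blast
  have dec: "dec (4 * kk ^ 3) n Q S"
    unfolding dec_def
  proof (intro conjI allI)
    have "kk / ?n \<le> 4 * kk ^ 3 / ?n" using kk3 kk n4 by (intro divide_right_mono) auto
    then show "norm Q \<le> 4 * kk ^ 3 / ?n" "norm S \<le> 4 * kk ^ 3 / ?n" using Q(1) S(1) by (auto simp: e_def)
    show "norm Q \<le> 1 / 2" "norm S \<le> 1 / 2" using Q(1) S(1) e by auto
    have "2 * kk ^ 3 / ?n \<le> 4 * kk ^ 3 / ?n" using kk n4 by (intro divide_right_mono) auto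
    then have s4: "s * (kk * ?n) \<le> 4 * kk ^ 3 / ?n" using s_n by simp
    then show "norm (S ** M12 n) \<le> 4 * kk ^ 3 / ?n" using rest[OF b(2) S2 s0] by simp
    show "norm ((of_int n)\<^sup>2 *\<^sub>R S - K21) \<le> 4 * kk ^ 3 / ?n"
    proof -
      have "norm S \<le> min s 1" using S2 S(1) e by simp
      from rem[OF this] have "norm (S ** (Dn n + K11) - K22 ** S - S ** M12 n ** S) \<le> min s 1 * (kk * ?n)" using s0 by simp
      also have "\<dots> \<le> s * (kk * ?n)" using kk by (intro mult_right_mono) auto
      finally show ?thesis unfolding Sm using s4 by simp
    qed
    fix c
    show "part1 (Mn n *v c) + Q *v part2 (Mn n *v c) = (Dn n + K11 + Q ** K21) *v (part1 c + Q *v part2 c)"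
      using Qv[of "part2 c"]
      by (simp add: Mn_mult matrix_vector_right_distrib mv_scaleR matrix_vector_mult_add_rdistrib[of "Dn n + K11" "Q ** K21"]
        matrix_vector_mul_assoc[symmetric])
    show "S *v part1 (Mn n *v c) + part2 (Mn n *v c) = (mat (of_real ((of_int n)\<^sup>2)) + (K22 + S ** M12 n)) *v (S *v part1 c + part2 c)"
      using Sv[of "part1 c"]
      by (simp add: Mn_mult matrix_vector_right_distrib mv_scaleR matrix_vector_mult_add_rdistrib[of "mat _"] matrix_vector_mult_add_rdistrib[of K22]
        mat_mult_vec smult_of_real[of "(of_int n)\<^sup>2", simplified] smult_of_real scaleR_add_right matrix_vector_mul_assoc[symmetric])
  qed
  then show ?thesis by blast
qed

end

section \<open>Control of the high frequencies\<close>

locale hp_time = hp_system mu K11 A12 K12 K21 K22 \<omega> mm R0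
  for mu :: "'d1::finite \<Rightarrow> real" and K11 :: "complex^'d1^'d1" and A12 K12 :: "complex^'d2::finite^'d1"
    and K21 :: "complex^'d1^'d2" and K22 :: "complex^'d2^'d2" and \<omega> mm R0 +
  fixes T0 T :: real
  assumes T0: "0 \<le> T0" "T0 < T" and gap: "\<And>i. max_gap \<omega> < ennreal (\<bar>mu i\<bar> * T0)"
begin

definition C1 :: real where "C1 = 4 * kk ^ 3 * (1 + kk)"

lemma C1: "4 * kk ^ 3 \<le> C1" "4 * kk ^ 3 * norm K21 \<le> C1" "0 \<le> C1"
proof -
  have k3: "0 \<le> 4 * kk ^ 3" using kk by simp
  have "norm K21 \<le> 1 + kk" by (simp add: kk_def sum_nonneg)
  then show "4 * kk ^ 3 * norm K21 \<le> C1" unfolding C1_def using k3 by (intro mult_left_mono)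
  show "4 * kk ^ 3 \<le> C1" "0 \<le> C1" unfolding C1_def using k3 kk mult_left_mono[of 1 "1 + kk" "4 * kk ^ 3"] by auto
qed

definition QQ :: "int \<Rightarrow> complex^'d2^'d1" where "QQ n = fst (SOME z. dec (4 * kk ^ 3) n (fst z) (snd z))"
definition SS :: "int \<Rightarrow> complex^'d1^'d2" where "SS n = snd (SOME z. dec (4 * kk ^ 3) n (fst z) (snd z))"

lemma dec_QS: "4 * kk \<le> \<bar>of_int n\<bar> \<Longrightarrow> dec (4 * kk ^ 3) n (QQ n) (SS n)"
  unfolding QQ_def SS_def by (rule someI_ex) (use decoupling[of n] in auto)

definition HH :: "int \<Rightarrow> complex^'d1^'d1" where "HH n = Dn n + K11 + QQ n ** K21"
definition Kp :: "int \<Rightarrow> complex^'d2^'d2" where "Kp n = K22 + SS n ** M12 n"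
definition PP :: "int \<Rightarrow> complex^'d2^'d2" where "PP n = mat (of_real ((of_int n)\<^sup>2)) + Kp n"

definition y1 :: "int \<Rightarrow> complex^('d1 + 'd2) \<Rightarrow> complex^'d1" where "y1 n c = part1 c + QQ n *v part2 c"
definition y2 :: "int \<Rightarrow> complex^('d1 + 'd2) \<Rightarrow> complex^'d2" where "y2 n c = SS n *v part1 c + part2 c"

lemma bounded_linear_y: "bounded_linear (y1 n)" "bounded_linear (y2 n)"
  unfolding y1_def[abs_def] y2_def[abs_def]
  by (intro bounded_linear_add bounded_linear_parts bounded_linear_compose[OF bounded_linear_matrix_vector])+

lemma y_emb: "y1 n (emb *v w) = mat 1 *v w" "y2 n (emb *v w) = SS n *v w"
  by (simp_all add: y1_def y2_def emb_mult)

lemma y_Mn: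
  assumes "4 * kk \<le> \<bar>of_int n\<bar>"
  shows "y1 n (Mn n *v c) = HH n *v y1 n c" "y2 n (Mn n *v c) = PP n *v y2 n c"
  using dec_QS[OF assms] unfolding dec_def y1_def y2_def HH_def PP_def Kp_def by (auto simp: add.assoc)

text \<open>Both off-diagonal matrices have norm at most \<open>1/2\<close>, so the change of
  unknowns is injective, and a state that vanishes in the new unknowns vanishes.\<close>

lemma y_zero:
  assumes n: "4 * kk \<le> \<bar>of_int n\<bar>" and "y1 n c = 0" "y2 n c = 0"
  shows "c = 0"
proof -
  have b: "norm (QQ n) \<le> 1 / 2" "norm (SS n) \<le> 1 / 2" using dec_QS[OF n] by (auto simp: dec_def)
  have p2: "part2 c = - (SS n *v part1 c)" using assms(3)[unfolded y2_def add_eq_0_iff] .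
  have p1: "part1 c = - (QQ n *v part2 c)" using assms(2)[unfolded y1_def add_eq_0_iff2] .
  have "norm (part1 c) \<le> 1 / 2 * norm (part2 c)"
    using norm_matrix_vector_mult[of "QQ n" "part2 c"] mult_right_mono[OF b(1) norm_ge_zero[of "part2 c"]] arg_cong[OF p1, of norm] unfolding norm_minus_cancel by linarith
  moreover have "norm (part2 c) \<le> 1 / 2 * norm (part1 c)"
    using norm_matrix_vector_mult[of "SS n" "part1 c"] mult_right_mono[OF b(2) norm_ge_zero[of "part1 c"]] arg_cong[OF p2, of norm] unfolding norm_minus_cancel by linarith
  ultimately have "norm (part1 c) = 0" "norm (part2 c) = 0"
    using norm_ge_zero[of "part1 c"] norm_ge_zero[of "part2 c"] by linarith+
  then have "join (part1 c) (part2 c) = 0" by (simp add: join_def vec_eq_iff split: sum.splits)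
  then show ?thesis by simp
qed

lemma norm_y_le:
  assumes n: "4 * kk \<le> \<bar>of_int n\<bar>"
  shows "norm (y1 n c) \<le> 2 * norm c" "norm (y2 n c) \<le> 2 * norm c"
proof -
  have b: "norm (QQ n) \<le> 1 / 2" "norm (SS n) \<le> 1 / 2" using dec_QS[OF n] by (auto simp: dec_def)
  have "norm (QQ n *v part2 c) \<le> 1 * norm c" "norm (SS n *v part1 c) \<le> 1 * norm c"
    using b norm_parts_le[of c]
      order_trans[OF norm_matrix_vector_mult mult_mono[of "norm (QQ n)" 1 "norm (part2 c)" "norm c"]]
      order_trans[OF norm_matrix_vector_mult mult_mono[of "norm (SS n)" 1 "norm (part1 c)" "norm c"]] by simp_all
  then show "norm (y1 n c) \<le> 2 * norm c" "norm (y2 n c) \<le> 2 * norm c"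
    using norm_triangle_ineq[of "part1 c" "QQ n *v part2 c"] norm_triangle_ineq[of "SS n *v part1 c" "part2 c"] norm_parts_le[of c]
    by (auto simp: y1_def y2_def)
qed

lemma mom_y:
  assumes n: "4 * kk \<le> \<bar>of_int n\<bar>" and u: "ctl \<omega> 0 T A u"
  shows "y1 n (flow (Mn n) T g + mom Mn (\<lambda>_. emb) T u n) = flow (HH n) T (y1 n g) + mom HH (\<lambda>_. mat 1) T u n"
    and "y2 n (flow (Mn n) T g + mom Mn (\<lambda>_. emb) T u n) = flow (PP n) T (y2 n g) + mom PP SS T u n"
proof -
  have T: "0 \<le> T" using T0 by simp
  show "y1 n (flow (Mn n) T g + mom Mn (\<lambda>_. emb) T u n) = flow (HH n) T (y1 n g) + mom HH (\<lambda>_. mat 1) T u n"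
    using flow_intertwine[OF bounded_linear_y(1)[of n] y_Mn(1)[OF n]] mom_intertwine[OF u T bounded_linear_y(1)[of n], where G=Mn and P=HH and S="\<lambda>_. emb" and S'="\<lambda>_. mat 1" and n=n, OF y_Mn(1)[OF n] y_emb(1)]
    by (simp add: linear_add[OF bounded_linear.linear[OF bounded_linear_y(1)]])
  show "y2 n (flow (Mn n) T g + mom Mn (\<lambda>_. emb) T u n) = flow (PP n) T (y2 n g) + mom PP SS T u n"
    using flow_intertwine[OF bounded_linear_y(2)[of n] y_Mn(2)[OF n]] mom_intertwine[OF u T bounded_linear_y(2)[of n], where G=Mn and P=PP and S="\<lambda>_. emb" and S'=SS and n=n, OF y_Mn(2)[OF n] y_emb(2)]
    by (simp add: linear_add[OF bounded_linear.linear[OF bounded_linear_y(2)]])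
qed

lemma QK21_small:
  assumes "4 * kk \<le> \<bar>of_int n\<bar>"
  shows "norm (QQ n ** K21) \<le> C1 / \<bar>of_int n\<bar>"
proof -
  have "norm (QQ n) \<le> 4 * kk ^ 3 / \<bar>of_int n\<bar>" using dec_QS[OF assms] by (simp add: dec_def)
  then have "norm (QQ n ** K21) \<le> 4 * kk ^ 3 / \<bar>of_int n\<bar> * norm K21"
    by (intro order_trans[OF norm_matrix_matrix_mult] mult_right_mono) auto
  also have "\<dots> = (4 * kk ^ 3 * norm K21) / \<bar>of_int n\<bar>" by simp
  also have "\<dots> \<le> C1 / \<bar>of_int n\<bar>" using C1(2) by (intro divide_right_mono) auto
  finally show ?thesis .
qed

lemma flow_H_bound:
  assumes n: "4 * kk \<le> \<bar>of_int n\<bar>" and t: "0 \<le> t" "t \<le> T"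
  shows "norm (flow (HH n) t w) \<le> exp ((norm K11 + C1) * T) * norm w"
proof -
  have n1: "1 \<le> \<bar>real_of_int n\<bar>" using n kk by linarith
  have "norm (QQ n ** K21) \<le> C1 / 1"
    using QK21_small[OF n] C1(3) n1 by (elim order_trans) (intro divide_left_mono, auto)
  then have "norm (K11 + QQ n ** K21) \<le> norm K11 + C1" using norm_triangle_ineq[of K11 "QQ n ** K21"] by simp
  then have "norm (flow (diagm (\<lambda>i. \<i> * of_real (of_int n * mu i)) + (K11 + QQ n ** K21)) t w) \<le> exp ((norm K11 + C1) * \<bar>t\<bar>) * norm w"
    by (rule skew_flow_bound)
  also have "\<dots> \<le> exp ((norm K11 + C1) * T) * norm w" using t C1(3) by (intro mult_right_mono) (auto intro!: mult_left_mono)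
  finally show ?thesis by (simp add: HH_def Dn_def mult.assoc add.assoc)
qed

text \<open>For large \<open>n\<close> the pair \<open>(Kp n, n^2 S n)\<close> is close to
  \<open>(K22, K21)\<close>, so the perturbed Kalman inverses exist with one bound;
  \<open>N0\<close> is a threshold for this and for the splitting.\<close>

lemma parabolic_family:
  obtains N0 :: nat and R rho where "4 * kk \<le> real N0" "parabolic_modes \<omega> N0 mm PP Kp SS (\<lambda>n. (of_int n)\<^sup>2 *\<^sub>R SS n) R (norm K22 + C1) rho 1"
proof -
  obtain e rho where e: "0 < e" and ex: "\<forall>K' B'. norm (K' - K22) < e \<longrightarrow> norm (B' - K21) < e \<longrightarrow>
    (\<exists>R'. (\<forall>j. norm (R' j) \<le> rho) \<and> (\<forall>x. (\<Sum>j<mm. matpow K' j *v (B' *v (R' j *v x))) = x))"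
    by (rule kalman_perturbation[OF R0]) blast
  obtain N0 :: nat where N0: "4 * kk + (4 * kk ^ 3) / e + 1 < real N0" using reals_Archimedean2 by blast
  have kp: "0 \<le> 4 * kk ^ 3 / e" using kk e by simp
  have big: "4 * kk \<le> \<bar>of_int n\<bar>" "4 * kk ^ 3 / \<bar>of_int n\<bar> < e" if n: "int N0 \<le> \<bar>n\<bar>" for n
  proof -
    have nr: "real N0 \<le> \<bar>of_int n\<bar>" using n by linarith
    show "4 * kk \<le> \<bar>of_int n\<bar>" using nr N0 kp by linarith
    have "4 * kk ^ 3 / e < \<bar>of_int n\<bar>" using nr N0 kk by linarith
    then have "4 * kk ^ 3 < e * \<bar>of_int n\<bar>" using e by (simp add: pos_divide_less_eq mult.commute)
    moreover have "0 < \<bar>real_of_int n\<bar>" using nr N0 kp kk by linarith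
    ultimately show "4 * kk ^ 3 / \<bar>of_int n\<bar> < e" by (subst pos_divide_less_eq) auto
  qed
  define good where "good n R' \<longleftrightarrow> (\<forall>j. norm (R' j) \<le> rho) \<and> (\<forall>x. (\<Sum>j<mm. matpow (Kp n) j *v (((of_int n)\<^sup>2 *\<^sub>R SS n) *v (R' j *v x))) = x)" for n R'
  define R where "R n = (SOME R'. good n R')" for n
  have good: "good n (R n)" if n: "int N0 \<le> \<bar>n\<bar>" for n
  proof -
    have d: "norm (SS n ** M12 n) \<le> 4 * kk ^ 3 / \<bar>of_int n\<bar>" "norm ((of_int n)\<^sup>2 *\<^sub>R SS n - K21) \<le> 4 * kk ^ 3 / \<bar>of_int n\<bar>"
      using dec_QS[OF big(1)[OF n]] by (auto simp: dec_def)
    have "norm (Kp n - K22) < e" using d(1) big(2)[OF n] by (simp add: Kp_def)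
    moreover have "norm ((of_int n)\<^sup>2 *\<^sub>R SS n - K21) < e" using d(2) big(2)[OF n] by linarith
    ultimately have "\<exists>R'. good n R'" using ex unfolding good_def by blast
    then show ?thesis unfolding R_def by (rule someI_ex)
  qed
  show thesis
  proof (rule that[of N0 R rho])
    show "4 * kk \<le> real N0" using N0 kp by linarith
    show "parabolic_modes \<omega> N0 mm PP Kp SS (\<lambda>n. (of_int n)\<^sup>2 *\<^sub>R SS n) R (norm K22 + C1) rho 1"
    proof
      show "1 \<le> N0" using N0 kp kk by (cases N0) auto
      fix n assume n: "int N0 \<le> \<bar>n\<bar>"
      show "PP n = mat (of_real ((of_int n)\<^sup>2)) + Kp n" by (simp add: PP_def)
      have n1: "1 \<le> \<bar>real_of_int n\<bar>" using big(1)[OF n] kk by linarith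
      have "norm (SS n ** M12 n) \<le> 4 * kk ^ 3 / \<bar>of_int n\<bar>" using dec_QS[OF big(1)[OF n]] by (simp add: dec_def)
      also have "\<dots> \<le> 4 * kk ^ 3 / 1" using n1 kk by (intro divide_left_mono) auto
      also have "\<dots> \<le> C1" using C1(1) by simp
      finally show "norm (Kp n) \<le> norm K22 + C1" unfolding Kp_def using norm_triangle_ineq[of K22 "SS n ** M12 n"] by linarith
      show "norm (SS n) \<le> 1" using dec_QS[OF big(1)[OF n]] by (simp add: dec_def)
      show "norm (R n j) \<le> rho" for j using good[OF n] by (simp add: good_def)
      show "SS n *v ((of_int n)\<^sup>2 *\<^sub>R w) = ((of_int n)\<^sup>2 *\<^sub>R SS n) *v w" for w
        by (simp add: mv_scaleR bounded_bilinear.scaleR_left[OF bounded_bilinear_matrix_vector])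
      show "(\<Sum>j<mm. matpow (Kp n) j *v (((of_int n)\<^sup>2 *\<^sub>R SS n) *v (R n j *v x))) = x" for x
        using good[OF n] unfolding good_def by blast
    qed (rule om ne)+
  qed
qed

text \<open>\<open>q\<close> plays the role of the parabolic state at time \<open>T2\<close>; only
  modes above \<open>N\<close> may be present in it.\<close>

definition par_ctl :: "nat \<Rightarrow> real \<Rightarrow> real \<Rightarrow> bool" where
  "par_ctl N Cp T2 \<longleftrightarrow> (\<forall>q A. l2b q A \<longrightarrow> (\<forall>n. \<bar>n\<bar> \<le> int N \<longrightarrow> q n = 0) \<longrightarrow>
      (\<exists>u. ctl \<omega> 0 T (Cp * A) u \<and> (\<forall>n. int N < \<bar>n\<bar> \<longrightarrow> mom PP SS T u n = - flow (PP n) (T - T2) (q n))))"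

text \<open>\<open>r\<close> is a hyperbolic residual at the final time. The control leaves the
  parabolic block undisturbed at that time, so that infinitely many corrections can be
  superposed.\<close>

definition halves :: "nat \<Rightarrow> real \<Rightarrow> bool" where
  "halves N C \<longleftrightarrow> (\<forall>r A. l2b r A \<longrightarrow> (\<exists>u. ctl \<omega> 0 T (C * A) u \<and> (\<forall>n. int N < \<bar>n\<bar> \<longrightarrow> mom PP SS T u n = 0) \<and>
      l2b (\<lambda>n. if int N < \<bar>n\<bar> then mom HH (\<lambda>_. mat 1) T u n + r n else 0) (A / 2)))"

text \<open>The transport control corrects the hyperbolic residual, the parabolic control removes what this leaves
  in the parabolic part. The new residual is of order \<open>1/N\<close>.\<close>

lemma residual_halving:
  obtains N :: nat and C Cp T2 kap :: real where "4 * kk \<le> real N" "0 \<le> C" "0 \<le> Cp" "0 \<le> T2" "T2 < T" "0 \<le> kap"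
    and "\<forall>n t w. int N < \<bar>n\<bar> \<longrightarrow> 0 \<le> t \<longrightarrow> t \<le> T \<longrightarrow> norm (flow (PP n) t w) \<le> exp (kap * T) * norm w"
    and "par_ctl N Cp T2"
    and "halves N C"
proof -
  obtain N0 R rho where N0: "4 * kk \<le> real N0" and pm: "parabolic_modes \<omega> N0 mm PP Kp SS (\<lambda>n. (of_int n)\<^sup>2 *\<^sub>R SS n) R (norm K22 + C1) rho 1"
    by (rule parabolic_family)
  define kap where "kap = norm K22 + C1"
  interpret pm: parabolic_modes \<omega> N0 mm PP Kp SS "\<lambda>n. (of_int n)\<^sup>2 *\<^sub>R SS n" R kap rho 1
    using pm unfolding kap_def .
  have big: "4 * kk \<le> \<bar>of_int n\<bar>" if "int N0 \<le> \<bar>n\<bar>" for n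
  proof -
    have "real N0 \<le> \<bar>of_int n\<bar>" using that by linarith
    then show ?thesis using N0 by linarith
  qed
  have kap: "0 \<le> kap" using C1(3) by (simp add: kap_def)
  have T: "0 < T" using T0 by simp
  \<comment> \<open>Transport controls use \<open>(0, T0)\<close> and parabolic ones
    \<open>(T2, T)\<close>; the pause of length \<open>d\<close> lets the parabolic response to the
    former decay.\<close>
  define T2 where "T2 = (T0 + T) / 2"
  define d where "d = T2 - T0"
  have T2: "T0 < T2" "T2 < T" "0 < d" "0 \<le> T2" using T0 by (auto simp: T2_def d_def)
  obtain Cp where Cp: "0 \<le> Cp" "\<forall>q A. l2b q A \<longrightarrow> (\<forall>n. \<bar>n\<bar> < int N0 \<longrightarrow> q n = 0) \<longrightarrow>
    (\<exists>u. ctl \<omega> T2 T (Cp * A) u \<and> (\<forall>n. int N0 \<le> \<bar>n\<bar> \<longrightarrow> mom PP SS T u n = - flow (PP n) (T - T2) (q n)))"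
    using pm.parabolic_null_control[OF T2(2)] by blast
  define D where "D = (\<chi> i j. if mu i = mu j then K11 $ i $ j else 0)"
  have Dz: "D $ i $ j = 0" if "mu i \<noteq> mu j" for i j using that by (simp add: D_def)
  obtain Ch where Ch: "0 \<le> Ch" "\<And>(a :: int \<Rightarrow> complex^'d1) A. l2b a A \<Longrightarrow>
    (\<exists>v. ctl \<omega> 0 T0 (Ch * A) v \<and> (\<forall>n. mom (\<lambda>n. Dn n + D) (\<lambda>n. mat 1) T v n = a n))"
    using transport_control_commuting[of \<omega> mu T0 D T, OF om ne mu T0(1) gap Dz] unfolding Dn_def by blast
  obtain Cx where Cx: "0 \<le> Cx" and hp: "\<forall>n (E :: complex^'d1^'d1) t v. n \<noteq> (0::int) \<longrightarrow> norm E \<le> C1 / \<bar>of_int n\<bar> \<longrightarrow> 0 \<le> t \<longrightarrow> t \<le> T \<longrightarrow>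
    norm (flow (diagm (\<lambda>i. \<i> * of_int n * mu i) + K11 + E) t v - flow (diagm (\<lambda>i. \<i> * of_int n * mu i) + D) t v)
      \<le> Cx / \<bar>of_int n\<bar> * norm v"
    unfolding D_def by (rule hyperbolic_perturbation[OF C1(3) less_imp_le[OF T], of mu K11]) blast
  define eH where "eH = exp ((norm K11 + C1) * T)"
  \<comment> \<open>\<open>a1\<close> measures the error of replacing \<open>HH\<close> by
    \<open>Dn + D\<close>, and \<open>a2\<close> the effect of the parabolic correction on the
    hyperbolic block, which the pause damps. \<open>N\<close> is chosen so large that both together
    stay below \<open>1/2\<close>.\<close>
  define a1 where "a1 = Cx * sqrt T0 * Ch"
  define a2 where "a2 = eH * sqrt (T - T2) * Cp * sqrt T0 * Ch * exp (kap * T)"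
  have lim: "(\<lambda>N::nat. a1 / real N + a2 * exp (- (real N)\<^sup>2 * d)) \<longlonglongrightarrow> 0"
    using T2(3) by real_asymp
  then have "\<forall>\<^sub>F N in sequentially. a1 / real N + a2 * exp (- (real N)\<^sup>2 * d) < 1 / 2" by (rule order_tendstoD) simp
  moreover have "\<forall>\<^sub>F N in sequentially. max N0 1 \<le> N" by (rule eventually_ge_at_top)
  ultimately have "\<forall>\<^sub>F N in sequentially. a1 / real N + a2 * exp (- (real N)\<^sup>2 * d) < 1 / 2 \<and> max N0 1 \<le> N" by (rule eventually_conj)
  then obtain N where N: "a1 / real N + a2 * exp (- (real N)\<^sup>2 * d) < 1 / 2" "N0 \<le> N" "1 \<le> N"
    by (auto simp: eventually_sequentially)
  have dec: "norm (flow (PP n) t w) \<le> exp (kap * T) * exp (- (real N)\<^sup>2 * s) * norm w"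
    if n: "int N < \<bar>n\<bar>" and t: "s \<le> t" "t \<le> T" "0 \<le> s" for n t s w
  proof -
    have "real N \<le> \<bar>real_of_int n\<bar>" using n by linarith
    then have "(real N)\<^sup>2 \<le> (of_int n)\<^sup>2" using power_mono[of "real N" "\<bar>real_of_int n\<bar>" 2] by simp
    then have "(real N)\<^sup>2 * s \<le> (of_int n)\<^sup>2 * t" using t by (intro mult_mono) auto
    moreover have "kap * t \<le> kap * T" using t kap by (intro mult_left_mono) auto
    ultimately have "- ((of_int n)\<^sup>2 - kap) * t \<le> kap * T + (- (real N)\<^sup>2 * s)" by (simp add: algebra_simps)
    then have "exp (- ((of_int n)\<^sup>2 - kap) * t) * norm w \<le> exp (kap * T + (- (real N)\<^sup>2 * s)) * norm w" by (intro mult_right_mono) simp_all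
    moreover have "norm (flow (PP n) t w) \<le> exp (- ((of_int n)\<^sup>2 - kap) * t) * norm w"
      by (rule pm.flow_P_decay) (use n t N in auto)
    ultimately have "norm (flow (PP n) t w) \<le> exp (kap * T + (- (real N)\<^sup>2 * s)) * norm w" by linarith
    then show ?thesis by (simp only: exp_add)
  qed
  have parab: "\<exists>u. ctl \<omega> T2 T (Cp * A) u \<and> (\<forall>n. int N < \<bar>n\<bar> \<longrightarrow> mom PP SS T u n = - flow (PP n) (T - T2) (q n))"
    if q: "l2b q A" "\<forall>n. \<bar>n\<bar> \<le> int N \<longrightarrow> q n = 0" for q A
  proof -
    have "\<forall>n. \<bar>n\<bar> < int N0 \<longrightarrow> q n = 0" using q(2) N(2) by auto
    then obtain u where "ctl \<omega> T2 T (Cp * A) u" "\<forall>n. int N0 \<le> \<bar>n\<bar> \<longrightarrow> mom PP SS T u n = - flow (PP n) (T - T2) (q n)"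
      using Cp(2) q(1) by blast
    then show ?thesis using N(2) by (intro exI[of _ u]) auto
  qed
  define Cs where "Cs = Ch + Cp * (exp (kap * T) * exp (- (real N)\<^sup>2 * d) * sqrt T0 * Ch)"
  have Cs: "0 \<le> Cs" using Ch Cp T0 by (simp add: Cs_def)
  show thesis
  proof (rule that[OF _ Cs Cp(1) T2(4,2) kap]; (unfold par_ctl_def halves_def)?; (intro allI impI)?)
    show "4 * kk \<le> real N" using N0 N(2) by simp
  next
    fix n t w assume "int N < \<bar>n\<bar>" "0 \<le> t" "t \<le> T"
    then show "norm (flow (PP n) t w) \<le> exp (kap * T) * norm w" using dec[of n 0 t w] by simp
  next
    fix q :: "int \<Rightarrow> complex^'d2" and A assume "l2b q A" "\<forall>n. \<bar>n\<bar> \<le> int N \<longrightarrow> q n = 0"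
    from parab[OF this] obtain u where "ctl \<omega> T2 T (Cp * A) u" "\<forall>n. int N < \<bar>n\<bar> \<longrightarrow> mom PP SS T u n = - flow (PP n) (T - T2) (q n)"
      by blast
    then show "\<exists>u. ctl \<omega> 0 T (Cp * A) u \<and> (\<forall>n. int N < \<bar>n\<bar> \<longrightarrow> mom PP SS T u n = - flow (PP n) (T - T2) (q n))"
      using T2 by (intro exI[of _ u]) (auto intro: ctl_mono)
  next
    fix r :: "int \<Rightarrow> complex^'d1" and A assume r: "l2b r A"
    have A: "0 \<le> A" using l2b_nonneg[OF r] .
    obtain uh where uh: "ctl \<omega> 0 T0 (Ch * A) uh" "\<And>n. mom (\<lambda>n. Dn n + D) (\<lambda>n. mat 1) T uh n = - r n"
      using Ch(2)[OF l2b_minus[OF r]] by blast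
    define e where "e = exp (kap * T) * exp (- (real N)\<^sup>2 * d)"
    have e0: "0 \<le> e" by (simp add: e_def)
    \<comment> \<open>Parabolic response to the transport control, taken at the end of the pause and
      hence already small.\<close>
    define q where "q n = (if n \<in> {n. int N < \<bar>n\<bar>} then mom PP SS T2 uh n else 0)" for n
    have q: "l2b q (e * sqrt (T0 - 0) * (Ch * A))"
      unfolding q_def
    proof (rule mom_bound[OF uh(1) T0(1) e0])
      fix n t w assume n: "n \<in> {n. int N < \<bar>n\<bar>}" and t: "0 < t" "t < T0"
      have "norm (flow (PP n) (T2 - t) (SS n *v w)) \<le> e * norm (SS n *v w)"
        unfolding e_def by (rule dec) (use n t T2 T0 in \<open>auto simp: d_def\<close>)
      also have "\<dots> \<le> e * (1 * norm w)"
        using pm.S[of n] n N(2) e0 by (intro mult_left_mono order_trans[OF norm_matrix_vector_mult] mult_right_mono) auto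
      finally show "norm (flow (PP n) (T2 - t) (SS n *v w)) \<le> e * norm w" by simp
    qed
    obtain up where up: "ctl \<omega> T2 T (Cp * (e * sqrt (T0 - 0) * (Ch * A))) up"
      "\<And>n. int N < \<bar>n\<bar> \<Longrightarrow> mom PP SS T up n = - flow (PP n) (T - T2) (q n)"
      using parab[OF q] by (auto simp: q_def)
    have uh': "ctl \<omega> 0 T (Ch * A) uh" using T0 by (intro ctl_mono[OF uh(1)]) auto
    have up': "ctl \<omega> 0 T (Cp * (e * sqrt (T0 - 0) * (Ch * A))) up" using T2 by (intro ctl_mono[OF up(1)]) auto
    let ?u = "\<lambda>z. uh z + up z"
    have u: "ctl \<omega> 0 T (Cs * A) ?u"
      using ctl_add[OF uh' up'] by (simp add: Cs_def e_def algebra_simps)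
    show "\<exists>u. ctl \<omega> 0 T (Cs * A) u \<and> (\<forall>n. int N < \<bar>n\<bar> \<longrightarrow> mom PP SS T u n = 0) \<and>
      l2b (\<lambda>n. if int N < \<bar>n\<bar> then mom HH (\<lambda>_. mat 1) T u n + r n else 0) (A / 2)"
    proof (intro exI[of _ ?u] conjI u allI impI)
      fix n assume n: "int N < \<bar>n\<bar>"
      have "mom PP SS T uh n = flow (PP n) (T - T2) (mom PP SS T2 uh n)" by (rule mom_time[OF uh(1) T0(1)])
      then show "mom PP SS T ?u n = 0"
        using up(2)[OF n] n by (simp add: mom_add[OF uh' up' less_imp_le[OF T]] q_def)
    next
      \<comment> \<open>Difference between the true hyperbolic response and the model response for
        which the transport control is exact.\<close>
      define g where "g n t = (if int N < \<bar>n\<bar> then flow (HH n) (T - t) (mat 1 *v uhat uh t n) - flow (Dn n + D) (T - t) (mat 1 *v uhat uh t n) else 0)" for n t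
      have l1: "l2b (\<lambda>n. LINT t|lborel. g n t) (Cx / real N * sqrt (T0 - 0) * (Ch * A))"
      proof (rule kernel_bound(2)[OF ctlD(1)[OF uh(1)] T0(1)])
        show "0 \<le> Cx / real N" using Cx by simp
        fix n
        have "(\<lambda>t. flow M (T - t) (mat 1 *v uhat uh t n)) \<in> borel_measurable lborel" for M :: "complex^'d1^'d1"
          by (intro borel_measurable_flow borel_measurable_matrix_vector uhat_measurable ctlD(2)[OF uh(1)]) simp
        then show "g n \<in> borel_measurable lborel" unfolding g_def by (cases "int N < \<bar>n\<bar>") auto
        show "norm (g n t) \<le> Cx / real N * norm (uhat uh t n)" if t: "0 < t" "t < T0" for t
        proof (cases "int N < \<bar>n\<bar>")
          case True
          have n4: "4 * kk \<le> \<bar>of_int n\<bar>" by (rule big) (use True N(2) in auto)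
          have "norm (g n t) \<le> Cx / \<bar>of_int n\<bar> * norm (uhat uh t n)"
            using hp[rule_format, of n "QQ n ** K21" "T - t" "uhat uh t n"] QK21_small[OF n4] True t T0 N
            by (simp add: g_def HH_def Dn_def)
          also have "\<dots> \<le> Cx / real N * norm (uhat uh t n)"
            using True N Cx by (intro mult_right_mono divide_left_mono) auto
          finally show ?thesis .
        qed (simp add: g_def Cx)
        show "g n t = 0" if "\<not> (0 < t \<and> t < T0)" for t
          using ctlD(4)[OF uh(1) that] by (simp add: g_def uhat_eq_0)
      qed
      have l2: "l2b (\<lambda>n. if n \<in> {n. int N < \<bar>n\<bar>} then mom HH (\<lambda>_. mat 1) T up n else 0) (eH * sqrt (T - T2) * (Cp * (e * sqrt (T0 - 0) * (Ch * A))))"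
      proof (rule mom_bound[OF up(1) less_imp_le[OF T2(2)]])
        show "0 \<le> eH" by (simp add: eH_def)
        fix n t w assume n: "n \<in> {n. int N < \<bar>n\<bar>}" and t: "T2 < t" "t < T"
        show "norm (flow (HH n) (T - t) (mat 1 *v w)) \<le> eH * norm w"
          unfolding eH_def matrix_vector_mul_lid by (rule flow_H_bound) (use n t T2 T0 N big in auto)
      qed
      have eq: "(\<lambda>n. if int N < \<bar>n\<bar> then mom HH (\<lambda>_. mat 1) T ?u n + r n else 0) =
        (\<lambda>n. (LINT t|lborel. g n t) + (if n \<in> {n. int N < \<bar>n\<bar>} then mom HH (\<lambda>_. mat 1) T up n else 0))"
      proof
        fix n
        have "(LINT t|lborel. g n t) = (if int N < \<bar>n\<bar> then mom HH (\<lambda>_. mat 1) T uh n - mom (\<lambda>n. Dn n + D) (\<lambda>n. mat 1) T uh n else 0)"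
          unfolding g_def mom_def
          using Bochner_Integration.integral_diff[OF mom_integrand[OF uh(1) T0(1), of HH n T "\<lambda>_. mat 1"] mom_integrand[OF uh(1) T0(1), of "\<lambda>n. Dn n + D" n T "\<lambda>_. mat 1"]]
          by simp
        then show "(if int N < \<bar>n\<bar> then mom HH (\<lambda>_. mat 1) T ?u n + r n else 0) =
          (LINT t|lborel. g n t) + (if n \<in> {n. int N < \<bar>n\<bar>} then mom HH (\<lambda>_. mat 1) T up n else 0)"
          by (simp add: mom_add[OF uh' up' less_imp_le[OF T]] uh(2))
      qed
      have "Cx / real N * sqrt (T0 - 0) * (Ch * A) + eH * sqrt (T - T2) * (Cp * (e * sqrt (T0 - 0) * (Ch * A)))
        = (a1 / real N + a2 * exp (- (real N)\<^sup>2 * d)) * A"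
        by (simp add: a1_def a2_def e_def algebra_simps)
      also have "\<dots> \<le> 1 / 2 * A" using N(1) A by (intro mult_right_mono) auto
      finally show "l2b (\<lambda>n. if int N < \<bar>n\<bar> then mom HH (\<lambda>_. mat 1) T ?u n + r n else 0) (A / 2)"
        unfolding eq using l2b_mono[OF l2b_add[OF l1 l2]] by simp
    qed
  qed
qed

text \<open>A parabolic control cancels the free parabolic part; the hyperbolic residual, including
  the effect of that control, is then removed by halving corrections, which leave the parabolic
  block alone. The bound on the remaining low modes is linear in the data, and this later makes the
  functional built from them continuous.\<close>

theorem control_up_to_low_modes:
  obtains N :: nat and B :: real where "0 \<le> B"
    and "\<forall>g G. l2b g G \<longrightarrow> (\<exists>u A. ctl \<omega> 0 T A u \<and>
      (\<forall>n. int N < \<bar>n\<bar> \<longrightarrow> flow (Mn n) T (g n) + mom Mn (\<lambda>_. emb) T u n = 0) \<and>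
      (\<forall>n. norm (flow (Mn n) T (g n) + mom Mn (\<lambda>_. emb) T u n) \<le> B * G))"
proof -
  obtain N C Cp T2 kap where N0: "4 * kk \<le> real N" and C: "0 \<le> C" "0 \<le> Cp" and T2: "0 \<le> T2" "T2 < T" and kap: "0 \<le> kap"
    and Pb: "\<forall>n t w. int N < \<bar>n\<bar> \<longrightarrow> 0 \<le> t \<longrightarrow> t \<le> T \<longrightarrow> norm (flow (PP n) t w) \<le> exp (kap * T) * norm w"
    and par: "par_ctl N Cp T2"
    and hyp: "halves N C"
    by (rule residual_halving)
  have T: "0 < T" using T0 by simp
  have big: "4 * kk \<le> \<bar>of_int n\<bar>" if "int N < \<bar>n\<bar>" for n
  proof -
    have "real N \<le> \<bar>of_int n\<bar>" using that by linarith
    then show ?thesis using N0 by linarith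
  qed
  \<comment> \<open>The halving step is iterated on its own residual. The costs form a geometric
    series, so the corrections sum to a control of norm at most \<open>2 C A\<close>.\<close>
  have kill: "\<exists>v. ctl \<omega> 0 T (2 * C * A) v \<and> (\<forall>n. int N < \<bar>n\<bar> \<longrightarrow> mom PP SS T v n = 0 \<and> mom HH (\<lambda>_. mat 1) T v n = - r n)"
    if r: "l2b r A" for r :: "int \<Rightarrow> complex^'d1" and A
  proof -
    define good where "good u s a \<longleftrightarrow> ctl \<omega> 0 T (C * a) u \<and> (\<forall>n. int N < \<bar>n\<bar> \<longrightarrow> mom PP SS T u n = 0) \<and>
      l2b (\<lambda>n. if int N < \<bar>n\<bar> then mom HH (\<lambda>_. mat 1) T u n + s n else 0) (a / 2)" for u s a
    define uu where "uu s a = (SOME u. good u s a)" for s a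
    have uu: "good (uu s a) s a" if "l2b s a" for s a
    proof -
      have "\<exists>u. good u s a" using hyp that unfolding good_def halves_def by blast
      then show ?thesis unfolding uu_def by (rule someI_ex)
    qed
    define rr where "rr = rec_nat r (\<lambda>k s. (\<lambda>n. if int N < \<bar>n\<bar> then mom HH (\<lambda>_. mat 1) T (uu s (A / 2 ^ k)) n + s n else 0))"
    have rr0: "rr 0 = r" and rrS: "rr (Suc k) = (\<lambda>n. if int N < \<bar>n\<bar> then mom HH (\<lambda>_. mat 1) T (uu (rr k) (A / 2 ^ k)) n + rr k n else 0)" for k
      unfolding rr_def by simp_all
    have rb: "l2b (rr k) (A / 2 ^ k)" for k
    proof (induction k)
      case 0 then show ?case using r by (simp add: rr0)
    next
      case (Suc k)
      show ?case using uu[OF Suc] unfolding good_def rrS by (simp add: mult.commute)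
    qed
    define w where "w k = uu (rr k) (A / 2 ^ k)" for k
    have w: "ctl \<omega> 0 T (C * (A / 2 ^ k)) (w k)" "int N < \<bar>n\<bar> \<Longrightarrow> mom PP SS T (w k) n = 0" for k n
      using uu[OF rb[of k]] by (auto simp: good_def w_def)
    have sB: "(\<lambda>k. C * (A / 2 ^ k)) sums (C * (A * 2))"
      using sums_mult[OF sums_mult[OF geometric_sums[of "1 / 2 :: real"]], of C A] by (simp add: power_divide)
    note sm = sums_summable[OF sB]
    obtain v where v: "ctl \<omega> 0 T (\<Sum>k. C * (A / 2 ^ k)) v" "\<forall>m. ctl \<omega> 0 T (\<Sum>k. C * (A / 2 ^ (k + m))) (\<lambda>z. v z - (\<Sum>k<m. w k z))"
      by (rule ctl_series[OF w(1) sm])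
    note ms = mom_series[OF w(1) sm less_imp_le[OF T] v]
    show ?thesis
    proof (intro exI[of _ v] conjI allI impI)
      show "ctl \<omega> 0 T (2 * C * A) v" using v(1) sums_unique[OF sB] by (simp add: mult_ac)
      fix n assume n: "int N < \<bar>n\<bar>"
      show "mom PP SS T v n = 0" using sums_unique2[OF ms[of PP SS T n]] w(2)[OF n] sums_zero by simp
      have lim: "(\<lambda>k. rr k n) \<longlonglongrightarrow> 0"
      proof (rule Lim_null_comparison)
        show "\<forall>\<^sub>F k in sequentially. norm (rr k n) \<le> A / 2 ^ k" using l2b_component[OF rb] by simp
        show "(\<lambda>k. A / 2 ^ k) \<longlonglongrightarrow> 0" by real_asymp
      qed
      have "(\<lambda>k. mom HH (\<lambda>_. mat 1) T (w k) n) = (\<lambda>k. rr (Suc k) n - rr k n)" using n by (simp add: rrS w_def)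
      then show "mom HH (\<lambda>_. mat 1) T v n = - r n"
        using telescope_sums[OF lim] ms[of HH "\<lambda>_. mat 1" T n] sums_unique2 by (fastforce simp: rr0)
    qed
  qed
  define e where "e = exp (kap * T)"
  define eH where "eH = exp ((norm K11 + C1) * T)"
  define eM where "eM = exp ((\<Sum>n\<in>{- int N..int N}. norm (Mn n)) * T)"
  define Cr where "Cr = eH * 2 + eH * sqrt (T - 0) * (Cp * (e * 2))"
  define Cu where "Cu = Cp * (e * 2) + 2 * C * Cr"
  define B where "B = eM + eM * norm (emb :: complex^'d1^('d1+'d2)) * sqrt (T - 0) * Cu"
  have nn: "0 \<le> e" "0 \<le> eH" "0 \<le> eM" by (simp_all add: e_def eH_def eM_def)
  have Cr: "0 \<le> Cr" using nn C T by (simp add: Cr_def)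
  then have Cu: "0 \<le> Cu" using nn C by (simp add: Cu_def)
  have eM: "norm (flow (Mn n) t w) \<le> eM * norm w" if n: "n \<in> {- int N..int N}" and t: "0 \<le> t" "t \<le> T" for n t w
  proof -
    have s: "norm (Mn n) \<le> (\<Sum>n\<in>{- int N..int N}. norm (Mn n))" using n by (intro member_le_sum) auto
    have "norm (flow (Mn n) t w) \<le> exp ((\<Sum>n\<in>{- int N..int N}. norm (Mn n)) * \<bar>t\<bar>) * norm w" by (rule flow_norm_bound[OF s])
    also have "\<dots> \<le> eM * norm w" unfolding eM_def using t by (intro mult_right_mono) (auto intro!: mult_left_mono sum_nonneg)
    finally show ?thesis .
  qed
  show thesis
  proof (rule that[of B N]; (intro allI impI)?)
    show "0 \<le> B" using nn Cu T by (simp add: B_def)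
    fix g :: "int \<Rightarrow> complex^('d1 + 'd2)" and G assume g: "l2b g G"
    have G: "0 \<le> G" using l2b_nonneg[OF g] .
    define q where "q n = (if int N < \<bar>n\<bar> then flow (PP n) T2 (y2 n (g n)) else 0)" for n
    have q: "l2b q (e * 2 * G)"
    proof (rule l2b_le[OF g])
      fix n
      show "norm (q n) \<le> e * 2 * norm (g n)"
      proof (cases "int N < \<bar>n\<bar>")
        case True
        have "norm (q n) \<le> e * norm (y2 n (g n))" using Pb True T2 by (simp add: q_def e_def)
        also have "\<dots> \<le> e * (2 * norm (g n))" using norm_y_le(2)[OF big[OF True]] nn by (intro mult_left_mono) auto
        finally show ?thesis by simp
      qed (simp add: q_def nn)
    qed (use nn in auto)
    have "\<forall>n. \<bar>n\<bar> \<le> int N \<longrightarrow> q n = 0" by (simp add: q_def)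
    then obtain u0 where u0: "ctl \<omega> 0 T (Cp * (e * 2 * G)) u0" "\<forall>n. int N < \<bar>n\<bar> \<longrightarrow> mom PP SS T u0 n = - flow (PP n) (T - T2) (q n)"
      using par q unfolding par_ctl_def by blast
    \<comment> \<open>Hyperbolic part of the free evolution together with the hyperbolic response to
      \<open>u0\<close>.\<close>
    define r where "r n = (if int N < \<bar>n\<bar> then flow (HH n) T (y1 n (g n)) else 0) + (if n \<in> {n. int N < \<bar>n\<bar>} then mom HH (\<lambda>_. mat 1) T u0 n else 0)" for n
    have "l2b (\<lambda>n. if int N < \<bar>n\<bar> then flow (HH n) T (y1 n (g n)) else 0) (eH * 2 * G)"
    proof (rule l2b_le[OF g])
      fix n
      show "norm (if int N < \<bar>n\<bar> then flow (HH n) T (y1 n (g n)) else 0) \<le> eH * 2 * norm (g n)"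
      proof (cases "int N < \<bar>n\<bar>")
        case True
        have "norm (flow (HH n) T (y1 n (g n))) \<le> eH * norm (y1 n (g n))" unfolding eH_def using flow_H_bound[OF big[OF True]] T by simp
        also have "\<dots> \<le> eH * (2 * norm (g n))" using norm_y_le(1)[OF big[OF True]] nn by (intro mult_left_mono) auto
        finally show ?thesis using True by simp
      qed (simp add: nn)
    qed (use nn in auto)
    moreover have "l2b (\<lambda>n. if n \<in> {n. int N < \<bar>n\<bar>} then mom HH (\<lambda>_. mat 1) T u0 n else 0) (eH * sqrt (T - 0) * (Cp * (e * 2 * G)))"
    proof (rule mom_bound[OF u0(1) less_imp_le[OF T] nn(2)])
      fix n t w assume n: "n \<in> {n. int N < \<bar>n\<bar>}" and t: "0 < t" "t < T"
      show "norm (flow (HH n) (T - t) (mat 1 *v w)) \<le> eH * norm w"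
        unfolding eH_def matrix_vector_mul_lid by (rule flow_H_bound) (use n t big in auto)
    qed
    ultimately have "l2b r (eH * 2 * G + eH * sqrt (T - 0) * (Cp * (e * 2 * G)))"
      unfolding r_def[abs_def] by (rule l2b_add)
    then have r: "l2b r (Cr * G)" by (simp add: Cr_def algebra_simps)
    obtain v where v: "ctl \<omega> 0 T (2 * C * (Cr * G)) v" "\<forall>n. int N < \<bar>n\<bar> \<longrightarrow> mom PP SS T v n = 0 \<and> mom HH (\<lambda>_. mat 1) T v n = - r n"
      using kill[OF r] by blast
    define u where "u = (\<lambda>z. u0 z + v z)"
    have u: "ctl \<omega> 0 T (Cu * G) u" using ctl_add[OF u0(1) v(1)] by (simp add: u_def Cu_def algebra_simps)
    have z: "flow (Mn n) T (g n) + mom Mn (\<lambda>_. emb) T u n = 0" if n: "int N < \<bar>n\<bar>" for n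
    proof (rule y_zero[OF big[OF n]])
      note ma = mom_add[OF u0(1) v(1) less_imp_le[OF T], folded u_def]
      show "y1 n (flow (Mn n) T (g n) + mom Mn (\<lambda>_. emb) T u n) = 0"
        using n v(2) unfolding mom_y(1)[OF big[OF n] u] ma[of HH] by (simp add: r_def)
      show "y2 n (flow (Mn n) T (g n) + mom Mn (\<lambda>_. emb) T u n) = 0"
        using n v(2) u0(2) flow_add_time[of "PP n" "T - T2" T2 "y2 n (g n)"] unfolding mom_y(2)[OF big[OF n] u] ma[of PP] by (simp add: q_def)
    qed
    show "\<exists>u A. ctl \<omega> 0 T A u \<and>
      (\<forall>n. int N < \<bar>n\<bar> \<longrightarrow> flow (Mn n) T (g n) + mom Mn (\<lambda>_. emb) T u n = 0) \<and>
      (\<forall>n. norm (flow (Mn n) T (g n) + mom Mn (\<lambda>_. emb) T u n) \<le> B * G)"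
    proof (intro exI conjI allI impI, rule u, erule z)
      fix n
      show "norm (flow (Mn n) T (g n) + mom Mn (\<lambda>_. emb) T u n) \<le> B * G"
      proof (cases "int N < \<bar>n\<bar>")
        case True
        then show ?thesis using z nn Cu T G by (simp add: B_def)
      next
        case False
        then have n: "n \<in> {- int N..int N}" by auto
        have 1: "norm (flow (Mn n) T (g n)) \<le> eM * G"
          using eM[OF n, of T "g n"] T mult_left_mono[OF l2b_component[OF g, of n] nn(3)] by linarith
        have k0: "0 \<le> eM * norm (emb :: complex^'d1^('d1+'d2))" using nn by simp
        have "l2b (\<lambda>n. if n \<in> {- int N..int N} then mom Mn (\<lambda>_. emb) T u n else 0) (eM * norm (emb :: complex^'d1^('d1+'d2)) * sqrt (T - 0) * (Cu * G))"
        proof (rule mom_bound[OF u less_imp_le[OF T] k0])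
          fix n t w assume n: "n \<in> {- int N..int N}" and t: "0 < t" "t < T"
          have "norm (flow (Mn n) (T - t) (emb *v w)) \<le> eM * norm ((emb :: complex^'d1^('d1+'d2)) *v w)" by (rule eM[OF n]) (use t in auto)
          also have "\<dots> \<le> eM * (norm (emb :: complex^'d1^('d1+'d2)) * norm w)" by (intro mult_left_mono norm_matrix_vector_mult nn)
          finally show "norm (flow (Mn n) (T - t) (emb *v w)) \<le> eM * norm (emb :: complex^'d1^('d1+'d2)) * norm w" by (simp add: mult_ac)
        qed
        from l2b_component[OF this, of n] have "norm (mom Mn (\<lambda>_. emb) T u n) \<le> eM * norm (emb :: complex^'d1^('d1+'d2)) * sqrt (T - 0) * (Cu * G)" using n by simp
        with 1 show ?thesis using norm_triangle_ineq[of "flow (Mn n) T (g n)" "mom Mn (\<lambda>_. emb) T u n"] by (simp add: B_def algebra_simps)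
      qed
    qed
  qed
qed

end

section \<open>Unique continuation for the low frequencies\<close>

text \<open>Take a nonzero polynomial of least degree annihilating \<open>v\<close> and split off a
  root: the cofactor applied to \<open>v\<close> is an eigenvector. The scaling is abstract so that
  vectors and frequency sequences are covered alike.\<close>

lemma eigenvector_exists:
  fixes scale :: "complex \<Rightarrow> 'b::ab_group_add \<Rightarrow> 'b" and f :: "'b \<Rightarrow> 'b"
  assumes vs: "vector_space scale" and W: "module.subspace scale W" and B: "finite B" "W \<subseteq> module.span scale B"
    and add: "\<And>x y. f (x + y) = f x + f y" and scl: "\<And>c x. f (scale c x) = scale c (f x)"
    and inv: "\<And>x. x \<in> W \<Longrightarrow> f x \<in> W" and v: "v \<in> W" "v \<noteq> 0"
  shows "\<exists>l w. w \<in> W \<and> w \<noteq> 0 \<and> f w = scale l w"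
proof -
  interpret vector_space scale by fact
  have z: "f 0 = 0" using scl[of 0 0] by simp
  have fsum: "f (sum g I) = (\<Sum>i\<in>I. f (g i))" for g and I :: "nat set"
    by (induction I rule: infinite_finite_induct) (simp_all add: z add)
  have it: "(f ^^ k) v \<in> W" for k by (induction k) (auto intro: inv v)
  define act where "act p = (\<Sum>k\<le>degree p. scale (coeff p k) ((f ^^ k) v))" for p
  have act: "act p = (\<Sum>k\<le>m. scale (coeff p k) ((f ^^ k) v))" if "degree p \<le> m" for p m
    unfolding act_def using that by (intro sum.mono_neutral_left) (auto simp: coeff_eq_0)
  have actW: "act p \<in> W" for p unfolding act_def by (intro subspace_sum W subspace_scale it)
  have "\<exists>p. p \<noteq> 0 \<and> act p = 0"
  \<comment> \<open>Linear dependence is a property of sets, so coinciding iterates are treated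
    apart; they give the polynomial \<open>x^i - x^j\<close> at once.\<close>
  proof (cases "inj_on (\<lambda>k. (f ^^ k) v) {..card B}")
    case True
    have "card ((\<lambda>k. (f ^^ k) v) ` {..card B}) = Suc (card B)" using card_image[OF True] by simp
    then have "dependent ((\<lambda>k. (f ^^ k) v) ` {..card B})"
      using independent_span_bound[OF B(1), of "(\<lambda>k. (f ^^ k) v) ` {..card B}"] it B(2) by fastforce
    then obtain u where u: "\<exists>x\<in>(\<lambda>k. (f ^^ k) v) ` {..card B}. u x \<noteq> 0" "(\<Sum>x\<in>(\<lambda>k. (f ^^ k) v) ` {..card B}. scale (u x) x) = 0"
      using dependent_finite[of "(\<lambda>k. (f ^^ k) v) ` {..card B}"] by blast
    define p where "p = (\<Sum>k\<le>card B. monom (u ((f ^^ k) v)) k)"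
    have co: "coeff p k = (if k \<le> card B then u ((f ^^ k) v) else 0)" for k
      by (simp add: p_def coeff_sum)
    have "degree p \<le> card B" by (rule degree_le) (simp add: co)
    then have "act p = 0" using u(2) by (simp add: act co sum.reindex[OF True] o_def)
    moreover obtain k where "k \<le> card B" "u ((f ^^ k) v) \<noteq> 0" using u(1) by blast
    then have "p \<noteq> 0" using co[of k] by auto
    ultimately show ?thesis by blast
  next
    case False
    then obtain i j where ij: "(f ^^ i) v = (f ^^ j) v" "i \<noteq> j" unfolding inj_on_def by blast
    define p where "p = monom 1 i - monom (1 :: complex) j"
    have co: "coeff p k = (if k = i then 1 else 0) - (if k = j then 1 else 0)" for k by (simp add: p_def coeff_monom)
    have "degree p \<le> i + j" by (rule degree_le) (simp add: co)
    then have "act p = (\<Sum>k\<le>i + j. scale (if k = i then 1 else 0) ((f ^^ k) v)) - (\<Sum>k\<le>i + j. scale (if k = j then 1 else 0) ((f ^^ k) v))"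
      unfolding sum_subtractf[symmetric] by (simp add: act co scale_left_diff_distrib)
    also have "\<dots> = 0" using ij(1) by (simp add: if_distrib[where f="\<lambda>c. scale c x" for x] cong: if_cong)
    finally have "act p = 0" .
    moreover have "coeff p i \<noteq> 0" using ij(2) by (simp add: co)
    then have "p \<noteq> 0" by auto
    ultimately show ?thesis by blast
  qed
  then obtain p where p: "p \<noteq> 0" "act p = 0" and mn: "\<And>q. q \<noteq> 0 \<Longrightarrow> degree q < degree p \<Longrightarrow> act q \<noteq> 0"
    using exists_least_lemma[of "\<lambda>d. \<exists>p. degree p = d \<and> p \<noteq> 0 \<and> act p = 0"]
      ex_has_least_nat[of "\<lambda>p. p \<noteq> 0 \<and> act p = 0" _ degree] by (metis not_le)
  have "degree p \<noteq> 0"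
  proof
    assume "degree p = 0"
    then have "scale (coeff p 0) v = 0" using p(2) by (simp add: act_def)
    then show False using v(2) p(1) \<open>degree p = 0\<close> by (metis leading_coeff_0_iff scale_eq_0_iff)
  qed
  then have "\<not> constant (poly p)" by (simp add: constant_degree)
  then obtain l where "poly p l = 0" using fundamental_theorem_of_algebra by blast
  then obtain q where q: "p = [:- l, 1:] * q" unfolding poly_eq_0_iff_dvd by (elim dvdE)
  have q0: "q \<noteq> 0" using p(1) q by auto
  have dq: "degree p = Suc (degree q)" using q0 unfolding q by (subst degree_mult_eq) auto
  have co: "coeff p k = (case k of 0 \<Rightarrow> 0 | Suc j \<Rightarrow> coeff q j) - l * coeff q k" for k
    unfolding q by (simp add: coeff_pCons split: nat.split)
  have "act p = (\<Sum>k\<le>Suc (degree q). scale (case k of 0 \<Rightarrow> 0 | Suc j \<Rightarrow> coeff q j) ((f ^^ k) v)) - (\<Sum>k\<le>Suc (degree q). scale (l * coeff q k) ((f ^^ k) v))"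
    unfolding sum_subtractf[symmetric] using act[of p "Suc (degree q)"] dq by (simp add: co scale_left_diff_distrib)
  also have "(\<Sum>k\<le>Suc (degree q). scale (case k of 0 \<Rightarrow> 0 | Suc j \<Rightarrow> coeff q j) ((f ^^ k) v)) = f (act q)"
    unfolding sum.atMost_Suc_shift by (simp add: act_def fsum scl)
  also have "(\<Sum>k\<le>Suc (degree q). scale (l * coeff q k) ((f ^^ k) v)) = scale l (act q)"
    by (simp only: act[of q "Suc (degree q)", OF le_SucI[OF order_refl]] scale_sum_right scale_scale)
  finally have "f (act q) = scale l (act q)" using p(2) by simp
  moreover have "act q \<noteq> 0" using mn[OF q0] dq by simp
  ultimately show ?thesis using actW by blast
qed

text \<open>Among all independent sets contained in some \<open>E t\<close>, one of greatest
  cardinality spans every later \<open>E t\<close>, since otherwise it could be enlarged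
  there.\<close>

lemma increasing_subspaces_stabilize:
  fixes scale :: "complex \<Rightarrow> 'b::ab_group_add \<Rightarrow> 'b" and E :: "real \<Rightarrow> 'b set"
  assumes vs: "vector_space scale" and W: "\<And>t. a \<le> t \<Longrightarrow> t < b \<Longrightarrow> module.subspace scale (E t)"
    and B: "finite B" "\<And>t. a \<le> t \<Longrightarrow> t < b \<Longrightarrow> E t \<subseteq> module.span scale B"
    and mono: "\<And>s t. a \<le> s \<Longrightarrow> s \<le> t \<Longrightarrow> t < b \<Longrightarrow> E s \<subseteq> E t" and ab: "a < b"
  shows "\<exists>t0. a \<le> t0 \<and> t0 < b \<and> (\<forall>t. t0 \<le> t \<longrightarrow> t < b \<longrightarrow> E t = E t0)"
proof -
  interpret vector_space scale by fact
  define Q where "Q k \<longleftrightarrow> (\<exists>t S. a \<le> t \<and> t < b \<and> independent S \<and> S \<subseteq> E t \<and> card S = k)" for k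
  have bd: "finite S \<and> card S \<le> card B" if "a \<le> t" "t < b" "independent S" "S \<subseteq> E t" for S t
    using independent_span_bound[OF B(1) that(3)] that B(2)[of t] by blast
  have "Q 0" unfolding Q_def using ab by (intro exI[of _ a] exI[of _ "{}"]) (auto simp: independent_empty)
  moreover have "\<forall>k. Q k \<longrightarrow> k \<le> card B" unfolding Q_def using bd by blast
  ultimately obtain k where k: "Q k" "\<forall>k'. Q k' \<longrightarrow> k' \<le> k" using Nat.ex_has_greatest_nat[of Q 0 "card B"] by blast
  obtain t0 S where S: "a \<le> t0" "t0 < b" "independent S" "S \<subseteq> E t0" "card S = k" using k(1) unfolding Q_def by blast
  have "E t \<subseteq> E t0" if t: "t0 \<le> t" "t < b" for t
  proof
    fix x assume x: "x \<in> E t"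
    have "x \<in> span S"
    proof (rule ccontr)
      assume n: "x \<notin> span S"
      have "independent (insert x S)" by (rule independent_insertI[OF n S(3)])
      moreover have "insert x S \<subseteq> E t" using x S(4) mono[OF S(1) t] by blast
      moreover have "card (insert x S) = Suc k" using S n bd[OF S(1-4)] span_base[of x S] by (subst card_insert_disjoint) auto
      ultimately have "Q (Suc k)" unfolding Q_def using S(1) t by (metis order_trans)
      then show False using k(2) by fastforce
    qed
    then show "x \<in> E t0" using span_minimal[OF S(4) W[OF S(1,2)]] by blast
  qed
  then show ?thesis using S(1,2) mono[OF S(1)] by (intro exI[of _ t0]) blast
qed

text \<open>A basis of \<open>E\<close> together with \<open>v\<close> is independent; the values 0
  on the basis and 1 at \<open>v\<close> extend linearly.\<close>

lemma separating_functional: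
  fixes scale :: "complex \<Rightarrow> 'b::ab_group_add \<Rightarrow> 'b"
  assumes vs: "vector_space scale" and E: "module.subspace scale E" and v: "v \<notin> E"
  obtains ph where "\<And>x y. ph (x + y) = ph x + ph y" "\<And>c x. ph (scale c x) = c * ph x" "\<And>e. e \<in> E \<Longrightarrow> ph e = 0" "ph v = 1"
proof -
  interpret V: vector_space scale by fact
  interpret C: vector_space "(*) :: complex \<Rightarrow> complex \<Rightarrow> complex" by standard (simp_all add: algebra_simps)
  interpret vector_space_pair scale "(*) :: complex \<Rightarrow> complex \<Rightarrow> complex" ..
  obtain b where b: "b \<subseteq> E" "V.independent b" "E \<subseteq> V.span b" by (rule V.maximal_independent_subset)
  have sp: "V.span b = E" using b V.span_minimal[OF b(1) E(1)] by blast
  have "V.independent (insert v b)" using V.independent_insertI[OF _ b(2)] v sp by blast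
  then obtain ph where ph: "Vector_Spaces.linear scale (*) ph" "\<forall>x\<in>insert v b. ph x = (if x = v then 1 else 0)"
    using linear_independent_extend[of "insert v b" "\<lambda>x. if x = v then 1 else 0"] by blast
  have phadd: "ph (x + y) = ph x + ph y" and phs: "ph (scale c x) = c * ph x" for x y c
    using ph(1) unfolding Vector_Spaces.linear_iff by blast+
  have ph0: "ph 0 = 0" using phs[of 0 0] unfolding V.scale_zero_left by simp
  have phE: "ph e = 0" if "e \<in> E" for e
  proof -
    have "e \<in> V.span b" using that sp by simp
    then show ?thesis
    proof (induction rule: V.span_induct_alt)
      case base show ?case by (rule ph0)
    next
      case (step c x y)
      then have "ph x = 0" using ph(2) v b(1) by auto
      then show ?case using step(2) by (simp only: phadd phs mult_zero_right add_0_left)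
    qed
  qed
  show thesis by (rule that[of ph]) (use phadd phs phE ph(2) in auto)
qed

section \<open>Sequences of modes and linear functionals on them\<close>

definition sscale :: "complex \<Rightarrow> (int \<Rightarrow> complex^'n) \<Rightarrow> int \<Rightarrow> complex^'n" where
  "sscale c g = (\<lambda>n. c *s g n)"

lemma vector_space_sscale: "vector_space sscale"
  by standard (auto simp: sscale_def fun_eq_iff vector_add_ldistrib vector_sadd_rdistrib)

definition sgl :: "int \<Rightarrow> complex^'n \<Rightarrow> int \<Rightarrow> complex^'n" where
  "sgl n v = (\<lambda>m. if m = n then v else 0)"

definition VN :: "nat \<Rightarrow> (int \<Rightarrow> complex^'n) set" where
  "VN N = {g. \<forall>n. int N < \<bar>n\<bar> \<longrightarrow> g n = 0}"

text \<open>Bilinear pairing without conjugation: functionals stay complex linear, and the dual of a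
  matrix is its transpose.\<close>

definition pr :: "complex^'n \<Rightarrow> complex^'n \<Rightarrow> complex" where
  "pr a v = (\<Sum>i\<in>UNIV. a $ i * v $ i)"

lemma pr_simps [simp]: "pr a (v + w) = pr a v + pr a w" "pr (a + b) v = pr a v + pr b v" "pr a (c *s v) = c * pr a v"
  "pr (c *s a) v = c * pr a v" "pr a 0 = 0" "pr 0 v = 0" "pr a (- v) = - pr a v" "pr a (v - w) = pr a v - pr a w"
  by (simp_all add: pr_def algebra_simps sum.distrib sum_distrib_left sum_negf sum_subtractf)

lemma pr_axis [simp]: "pr a (axis i 1) = a $ i"
  by (simp add: pr_def axis_def if_distrib[where f="\<lambda>x. y * x" for y] cong: if_cong)

lemma pr_transpose: "pr (transpose M *v a) v = pr a (M *v v)"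
  unfolding pr_def matrix_vector_mult_def transpose_def
  by (simp add: sum_distrib_left sum_distrib_right) (subst sum.swap, simp add: mult_ac)

lemma pr_eqI: "(\<And>v. pr a v = pr b v) \<Longrightarrow> a = b"
  by (metis pr_axis vec_eq_iff)

lemma norm_pr_le: "norm (pr a v) \<le> norm a * norm v"
  unfolding pr_def by (rule norm_inner_row)

lemma bounded_linear_pr [simp, intro]: "bounded_linear (pr a)"
proof (rule bounded_linear_intro[where K="norm a"])
  show "pr a (r *\<^sub>R x) = r *\<^sub>R pr a x" for r x
    by (simp add: pr_def scaleR_sum_right)
  show "norm (pr a x) \<le> norm x * norm a" for x using norm_pr_le[of a x] by (simp add: mult.commute)
qed simp

lemma pr_join: "pr p (join x y) = pr (part1 p) x + pr (part2 p) y"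
  by (simp add: pr_def sum_UNIV_sum part1_def part2_def)

lemma fun_sum_apply: "(sum f I) x = (\<Sum>i\<in>I. f i x)"
  for f :: "'i \<Rightarrow> 'a \<Rightarrow> 'b::comm_monoid_add"
  by (induction I rule: infinite_finite_induct) simp_all

lemma VN_expansion:
  fixes e :: "int \<Rightarrow> complex^'n"
  assumes e: "e \<in> VN N"
  shows "e = (\<Sum>n\<in>{- int N..int N}. \<Sum>i\<in>UNIV. sscale (e n $ i) (sgl n (axis i 1)))"
proof
  fix m
  have "(\<Sum>n\<in>{- int N..int N}. \<Sum>i\<in>UNIV. sscale (e n $ i) (sgl n (axis i 1))) m
    = (\<Sum>n\<in>{- int N..int N}. if n = m then (\<Sum>i\<in>UNIV. e m $ i *s axis i 1) else 0)"
    unfolding fun_sum_apply by (intro sum.cong) (auto simp: fun_sum_apply sscale_def sgl_def)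
  also have "\<dots> = e m" using e by (auto simp: VN_def basis_expansion)
  finally show "e m = (\<Sum>n\<in>{- int N..int N}. \<Sum>i\<in>UNIV. sscale (e n $ i) (sgl n (axis i 1))) m" by simp
qed

lemma VN_spanned: "\<exists>B :: (int \<Rightarrow> complex^'n) set. finite B \<and> VN N \<subseteq> module.span sscale B"
proof -
  interpret vector_space "sscale :: complex \<Rightarrow> (int \<Rightarrow> complex^'n) \<Rightarrow> _" by (rule vector_space_sscale)
  let ?B = "(\<lambda>(n, i). sgl n (axis i 1 :: complex^'n)) ` ({- int N..int N} \<times> UNIV)"
  have "g \<in> span ?B" if g: "g \<in> VN N" for g :: "int \<Rightarrow> complex^'n"
  proof -
    have "(\<Sum>n\<in>{- int N..int N}. \<Sum>i\<in>UNIV. sscale (g n $ i) (sgl n (axis i 1))) \<in> span ?B"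
      by (intro span_sum span_scale span_base) auto
    then show ?thesis using VN_expansion[OF g] by simp
  qed
  then show ?thesis by (intro exI[of _ ?B]) auto
qed

lemma subspace_VN: "module.subspace sscale (VN N)"
proof -
  interpret vector_space sscale by (rule vector_space_sscale)
  show ?thesis by (rule subspaceI) (auto simp: VN_def sscale_def)
qed

lemma derivative_unique_right:
  fixes h k :: "real \<Rightarrow> 'a::real_normed_vector"
  assumes "(h has_vector_derivative d) (at 0)" "(k has_vector_derivative e) (at 0)"
    and "0 < \<delta>" "\<And>s. 0 \<le> s \<Longrightarrow> s < \<delta> \<Longrightarrow> h s = k s"
  shows "d = e"
proof (rule vector_derivative_unique_within_closed_interval[of 0 "\<delta> / 2" 0 h])
  show "(h has_vector_derivative d) (at 0 within cbox 0 (\<delta> / 2))"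
    using assms(1) by (rule has_vector_derivative_at_within)
  show "(h has_vector_derivative e) (at 0 within cbox 0 (\<delta> / 2))"
    using has_vector_derivative_at_within[OF assms(2), of "cbox 0 (\<delta> / 2)"]
    by (rule has_vector_derivative_transform[rotated 2]) (use assms in auto)
qed (use assms in auto)

text \<open>The annihilator of \<open>E\<close> is invariant under the transposed generator, hence contains an
  eigenvector of it.\<close>

lemma annihilating_eigenfunctional:
  fixes E :: "(int \<Rightarrow> complex^'n) set" and M :: "int \<Rightarrow> complex^'n^'n"
  assumes E: "module.subspace sscale E" "E \<subseteq> VN N" "E \<noteq> VN N" and d: "0 < \<delta>"
    and inv: "\<And>e s. e \<in> E \<Longrightarrow> 0 \<le> s \<Longrightarrow> s < \<delta> \<Longrightarrow> (\<lambda>n. flow (M n) s (e n)) \<in> E"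
  obtains p l where "p \<in> VN N" "p \<noteq> 0" "\<forall>e\<in>E. (\<Sum>n\<in>{- int N..int N}. pr (p n) (e n)) = 0"
    "\<forall>n. transpose (M n) *v p n = l *s p n"
proof -
  interpret V: vector_space "sscale :: complex \<Rightarrow> (int \<Rightarrow> complex^'n) \<Rightarrow> _" by (rule vector_space_sscale)
  define BB where "BB p e = (\<Sum>n\<in>{- int N..int N}. pr (p n) (e n))" for p e :: "int \<Rightarrow> complex^'n"
  define W where "W = {p \<in> VN N. \<forall>e\<in>E. BB p e = 0}"
  obtain v where v: "v \<in> VN N" "v \<notin> E" using E(2,3) by blast
  obtain ph where phadd: "\<And>x y. ph (x + y) = ph x + ph y" and phs: "\<And>c x. ph (sscale c x) = c * ph x"
    and phE: "\<And>e. e \<in> E \<Longrightarrow> ph e = 0" and phv: "ph v = 1"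
    using separating_functional[OF vector_space_sscale E(1) v(2)] by blast
  have ph0: "ph 0 = 0" using phs[of 0 0] unfolding V.scale_zero_left by simp
  \<comment> \<open>Coordinates of the separating functional \<open>ph\<close>, which represent it
    through the pairing on the low modes.\<close>
  define p0 where "p0 n = (if \<bar>n\<bar> \<le> int N then (\<chi> i. ph (sgl n (axis i 1))) else 0)" for n
  have p0: "BB p0 e = ph e" if e: "e \<in> VN N" for e
  proof -
    have phsum: "ph (sum g I) = (\<Sum>i\<in>I. ph (g i))" for g :: "'i \<Rightarrow> _" and I
      by (induction I rule: infinite_finite_induct) (use ph0 in \<open>simp_all only: sum.infinite sum.empty sum.insert phadd not_False_eq_True\<close>)
    have "ph e = ph (\<Sum>n\<in>{- int N..int N}. \<Sum>i\<in>UNIV. sscale (e n $ i) (sgl n (axis i 1)))"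
      using VN_expansion[OF e] by (rule arg_cong)
    also have "\<dots> = (\<Sum>n\<in>{- int N..int N}. \<Sum>i\<in>UNIV. e n $ i * ph (sgl n (axis i 1)))"
      by (simp only: phsum phs)
    also have "\<dots> = BB p0 e" unfolding BB_def pr_def by (intro sum.cong) (auto simp: p0_def mult.commute)
    finally show ?thesis by simp
  qed
  have p0W: "p0 \<in> W" unfolding W_def using p0 phE E(2) by (auto simp: VN_def p0_def)
  have p00: "p0 \<noteq> 0" using p0[OF v(1)] phv by (auto simp: BB_def)
  have WS: "V.subspace W"
    using subspace_VN[of N] by (intro V.subspaceI) (auto simp: W_def BB_def VN_def sscale_def sum.distrib sum_distrib_left[symmetric])
  obtain B :: "(int \<Rightarrow> complex^'n) set" where B: "finite B" "VN N \<subseteq> V.span B" using VN_spanned by blast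
  \<comment> \<open>For \<open>p\<close> in \<open>W\<close> the pairing with
    \<open>flow (M n) s (e n)\<close> vanishes for small \<open>s >= 0\<close>; its derivative at
    zero moves the generator onto \<open>p\<close>.\<close>
  have WM: "(\<lambda>n. transpose (M n) *v p n) \<in> W" if p: "p \<in> W" for p
  proof -
    have "BB (\<lambda>n. transpose (M n) *v p n) e = 0" if e: "e \<in> E" for e
    proof -
      have "((\<lambda>s. BB p (\<lambda>n. flow (M n) s (e n))) has_vector_derivative (\<Sum>n\<in>{- int N..int N}. pr (p n) (- (M n *v flow (M n) 0 (e n))))) (at 0)"
        unfolding BB_def by (intro has_vector_derivative_sum bounded_linear.has_vector_derivative[OF bounded_linear_pr] flow_has_derivative)
      then have "(\<Sum>n\<in>{- int N..int N}. pr (p n) (- (M n *v flow (M n) 0 (e n)))) = 0"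
      proof (rule derivative_unique_right[OF _ _ d])
        show "((\<lambda>_. 0) has_vector_derivative 0) (at (0::real))" by simp
        show "BB p (\<lambda>n. flow (M n) s (e n)) = 0" if "0 \<le> s" "s < \<delta>" for s
          using p inv[OF e that] by (auto simp: W_def)
      qed
      then have "(\<Sum>n\<in>{- int N..int N}. pr (p n) (M n *v e n)) = 0" by (simp add: sum_negf)
      then show ?thesis by (simp only: BB_def pr_transpose)
    qed
    moreover have "(\<lambda>n. transpose (M n) *v p n) \<in> VN N" using p by (auto simp: W_def VN_def)
    ultimately show ?thesis by (auto simp: W_def)
  qed
  have WB: "W \<subseteq> V.span B" using B(2) by (auto simp: W_def)
  have "\<exists>l w. w \<in> W \<and> w \<noteq> 0 \<and> (\<lambda>n. transpose (M n) *v w n) = sscale l w"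
  proof (rule eigenvector_exists[OF vector_space_sscale WS B(1) WB _ _ WM p0W p00])
    show "(\<lambda>n. transpose (M n) *v (x + y) n) = (\<lambda>n. transpose (M n) *v x n) + (\<lambda>n. transpose (M n) *v y n)" for x y
      by (rule ext) (simp only: plus_fun_apply matrix_vector_right_distrib)
    show "(\<lambda>n. transpose (M n) *v sscale c x n) = sscale c (\<lambda>n. transpose (M n) *v x n)" for c x
      by (rule ext) (simp only: sscale_def vector_scalar_commute)
  qed
  then obtain l w where w: "w \<in> W" "w \<noteq> 0" "(\<lambda>n. transpose (M n) *v w n) = sscale l w" by blast
  show thesis
  proof (rule that[of w l])
    show "\<forall>n. transpose (M n) *v w n = l *s w n" using fun_cong[OF w(3)] by (simp only: sscale_def) blast
  qed (use w in \<open>auto simp: W_def BB_def\<close>)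
qed

lemma inner_join: "inner v w = inner (part1 v) (part1 w) + inner (part2 v) (part2 (w :: complex^('a::finite + 'b::finite)))"
  by (simp add: inner_vec_def part1_def part2_def sum_UNIV_sum)

lemma parts_zero:
  assumes "part1 p = 0" "part2 p = 0"
  shows "p = 0"
proof -
  have "p = join (part1 p) (part2 p)" by simp
  also have "\<dots> = 0" unfolding assms by (simp add: join_def vec_eq_iff split: sum.splits)
  finally show ?thesis .
qed

text \<open>The functional is viewed as a map into vectors with one component, where it intertwines
  \<open>M\<close> with the scalar \<open>l\<close>.\<close>

lemma pr_flow:
  assumes "\<And>v. pr p (M *v v) = l * pr p v"
  shows "pr p (flow M t v) = exp (- l * of_real t) * pr p v"
proof -
  define R where "R v = ((\<chi> i. pr p v) :: complex^1)" for v
  have "bounded_linear R"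
  proof (rule linear_conv_bounded_linear[THEN iffD1], rule linearI)
    fix r x show "R (r *\<^sub>R x) = r *\<^sub>R R x"
      by (simp add: R_def vec_eq_iff linear_scale[OF bounded_linear.linear[OF bounded_linear_pr]])
  qed (simp add: R_def vec_eq_iff)
  moreover have "R (M *v v) = mat l *v R v" for v using assms by (simp add: R_def vec_eq_iff mat_mult_vec)
  ultimately have "R (flow M t v) = flow (mat l) t (R v)" by (rule flow_intertwine)
  then show ?thesis by (simp add: R_def vec_eq_iff flow_mat)
qed

lemma l2b_VN:
  assumes "g \<in> VN N"
  shows "\<exists>G. l2b g G"
proof -
  have nz: "n \<in> {- int N..int N}" if "g n \<noteq> 0" for n
    using assms that unfolding VN_def by (cases "int N < \<bar>n\<bar>") auto
  have "(\<Sum>n\<in>F. (norm (g n))\<^sup>2) \<le> (L2_set (\<lambda>n. norm (g n)) {- int N..int N})\<^sup>2" if F: "finite F" for F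
  proof -
    have "(\<Sum>n\<in>F. (norm (g n))\<^sup>2) = (\<Sum>n\<in>F \<inter> {- int N..int N}. (norm (g n))\<^sup>2)"
      using F nz by (intro sum.mono_neutral_right) auto
    also have "\<dots> \<le> (\<Sum>n\<in>{- int N..int N}. (norm (g n))\<^sup>2)" by (intro sum_mono2) auto
    also have "\<dots> = (L2_set (\<lambda>n. norm (g n)) {- int N..int N})\<^sup>2" by (simp add: L2_set_def sum_nonneg)
    finally show ?thesis .
  qed
  then show ?thesis by (intro exI[of _ "L2_set (\<lambda>n. norm (g n)) {- int N..int N}"]) (simp add: l2b_iff_sum L2_set_nonneg)
qed

section \<open>Uniform bounds and reachable states\<close>

context hp_system
begin

definition Cg :: real where "Cg = (norm A12)\<^sup>2 + norm K11 + norm K12 + norm K21 + norm K22"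

text \<open>The coupling \<open>\<i> n A12\<close> is of order \<open>n\<close>, yet
  \<open>|n| |A12| |x| |y| <= |A12|^2 |x|^2 + n^2 |y|^2\<close> lets the diffusion absorb it, and
  the transport part is skew. So on bounded time intervals the semigroup is bounded uniformly in the
  frequency.\<close>

lemma flow_Mn_bound:
  assumes t: "0 \<le> t"
  shows "norm (flow (Mn n) t v) \<le> exp (Cg * t) * norm v"
proof (rule flow_growth[OF _ t])
  fix v :: "complex^('d1 + 'd2)"
  let ?x = "part1 v" and ?y = "part2 v" and ?n = "\<bar>real_of_int n\<bar>"
  have nv: "(norm v)\<^sup>2 = (norm ?x)\<^sup>2 + (norm ?y)\<^sup>2" using norm_join_sq[of ?x ?y] by simp
  have b: "- (norm M * (norm v)\<^sup>2) \<le> inner x (M *v y)" if "norm x \<le> norm v" "norm y \<le> norm v" for M :: "complex^'j^'k" and x y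
  proof -
    have "\<bar>inner x (M *v y)\<bar> \<le> norm x * norm (M *v y)" by (rule Cauchy_Schwarz_ineq2)
    also have "\<dots> \<le> norm v * (norm M * norm v)"
      using that norm_matrix_vector_mult[of M y] mult_left_mono[OF that(2), of "norm M"] by (intro mult_mono) auto
    finally show ?thesis by (simp add: power2_eq_square mult_ac)
  qed
  have xy: "x * y \<le> x\<^sup>2 + y\<^sup>2" if "0 \<le> x" "0 \<le> y" for x y :: real
    using sum_squares_bound[of x y] mult_nonneg_nonneg[OF that] by linarith
  have d: "inner ?x (Dn n *v ?x) = 0"
    by (simp add: Dn_def inner_vec_def inner_complex_def algebra_simps)
  have "\<bar>inner ?x ((mat (\<i> * of_int n) ** A12) *v ?y)\<bar> \<le> norm ?x * (?n * norm A12 * norm ?y)"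
  proof -
    have "norm (mat (\<i> * of_int n) ** A12) = ?n * norm A12" by (simp add: norm_mat norm_mult)
    then show ?thesis
      using order_trans[OF Cauchy_Schwarz_ineq2 mult_left_mono[OF norm_matrix_vector_mult norm_ge_zero], of ?x "mat (\<i> * of_int n) ** A12" ?y] by simp
  qed
  also have "\<dots> = (norm A12 * norm ?x) * (?n * norm ?y)" by simp
  also have "\<dots> \<le> (norm A12 * norm ?x)\<^sup>2 + (?n * norm ?y)\<^sup>2"
    by (rule xy) simp_all
  also have "\<dots> \<le> (norm A12)\<^sup>2 * (norm v)\<^sup>2 + (of_int n)\<^sup>2 * (norm ?y)\<^sup>2"
    unfolding power_mult_distrib power2_abs nv by (simp add: algebra_simps)
  finally have a: "- ((norm A12)\<^sup>2 * (norm v)\<^sup>2 + (of_int n)\<^sup>2 * (norm ?y)\<^sup>2) \<le> inner ?x ((mat (\<i> * of_int n) ** A12) *v ?y)" by linarith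
  have "inner v (Mn n *v v) = inner ?x (Dn n *v ?x) + inner ?x (K11 *v ?x) + inner ?x ((mat (\<i> * of_int n) ** A12) *v ?y)
    + inner ?x (K12 *v ?y) + inner ?y (K21 *v ?x) + (of_int n)\<^sup>2 * (norm ?y)\<^sup>2 + inner ?y (K22 *v ?y)"
    unfolding Mn_mult inner_join[of v] M12_def
    by (simp add: matrix_vector_mult_add_rdistrib inner_add_right power2_norm_eq_inner)
  then show "- Cg * (norm v)\<^sup>2 \<le> inner v (Mn n *v v)"
    using a d b[of ?x ?x K11] b[of ?x ?y K12] b[of ?y ?x K21] b[of ?y ?y K22] norm_parts_le[of v]
    unfolding Cg_def by (simp add: algebra_simps)
qed

lemma Cg_nonneg: "0 \<le> Cg" by (simp add: Cg_def)

definition Sg :: "real \<Rightarrow> (int \<Rightarrow> complex^('d1 + 'd2)) \<Rightarrow> int \<Rightarrow> complex^('d1 + 'd2)" where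
  "Sg t g = (\<lambda>n. flow (Mn n) t (g n))"

text \<open>States reachable from zero at time \<open>t\<close>, recorded as sequences of all modes,
  with any finite bound on the control.\<close>

definition Rch :: "real \<Rightarrow> (int \<Rightarrow> complex^('d1 + 'd2)) set" where
  "Rch t = {c. \<exists>u A. ctl \<omega> 0 t A u \<and> c = mom Mn (\<lambda>_. emb) t u}"

lemma Sg_simps: "Sg t (g + h) = Sg t g + Sg t h" "Sg t (g - h) = Sg t g - Sg t h" "Sg t (sscale c g) = sscale c (Sg t g)"
  "Sg s (Sg t g) = Sg (s + t) g" "Sg t (sgl n v) = sgl n (flow (Mn n) t v)" "Sg 0 g = g"
  by (auto simp: Sg_def fun_eq_iff flow_add_right flow_diff_right sscale_def flow_smult_right flow_add_time sgl_def)

lemma Sg_VN: "g \<in> VN N \<Longrightarrow> Sg t g \<in> VN N"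
  by (simp add: VN_def Sg_def)

lemma Sg_l2b: "0 \<le> t \<Longrightarrow> l2b g G \<Longrightarrow> l2b (Sg t g) (exp (Cg * t) * G)"
  by (rule l2b_le) (auto simp: Sg_def flow_Mn_bound)

lemma subspace_Rch:
  assumes t: "0 \<le> t"
  shows "module.subspace sscale (Rch t)"
proof -
  interpret vector_space "sscale :: complex \<Rightarrow> (int \<Rightarrow> complex^('d1 + 'd2)) \<Rightarrow> _" by (rule vector_space_sscale)
  show ?thesis
  proof (rule subspaceI)
    show "0 \<in> Rch t" unfolding Rch_def
    proof (rule CollectI, intro exI conjI)
      show "ctl \<omega> 0 t 0 (\<lambda>_. 0)" by (rule ctl_zero) simp
      show "0 = mom Mn (\<lambda>_. emb) t (\<lambda>_. 0)" by (rule ext) (simp only: mom_zero zero_fun_apply)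
    qed
    fix x y assume "x \<in> Rch t" "y \<in> Rch t"
    then obtain u A v B where u: "ctl \<omega> 0 t A u" "x = mom Mn (\<lambda>_. emb) t u" and v: "ctl \<omega> 0 t B v" "y = mom Mn (\<lambda>_. emb) t v"
      unfolding Rch_def by blast
    have "x + y = mom Mn (\<lambda>_. emb) t (\<lambda>z. u z + v z)"
      by (rule ext) (simp only: mom_add[OF u(1) v(1) t] u(2) v(2) plus_fun_apply)
    then show "x + y \<in> Rch t" using ctl_add[OF u(1) v(1)] unfolding Rch_def by blast
  next
    fix c x assume "x \<in> Rch t"
    then obtain u A where u: "ctl \<omega> 0 t A u" "x = mom Mn (\<lambda>_. emb) t u" unfolding Rch_def by blast
    let ?u = "\<lambda>z. mat c *v u z"
    have cu: "ctl \<omega> 0 t (cmod c * A) ?u"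
      using ctl_matrix[OF u(1), of "\<lambda>_. mat c" "cmod c"] by (simp add: mat_mult_vec norm_vector_smult)
    have "sscale c x n = mom Mn (\<lambda>_. emb) t ?u n" for n
    proof -
      have "c *s x n = (LINT \<tau>|lborel. c *s flow (Mn n) (t - \<tau>) (emb *v uhat u \<tau> n))"
        unfolding u(2) mom_def by (rule integral_bounded_linear[OF bounded_linear_vector_smult mom_integrand[OF u(1) t], symmetric])
      also have "\<dots> = mom Mn (\<lambda>_. emb) t ?u n" unfolding mom_def
      proof (rule integral_cong_AE)
        show "AE \<tau> in lborel. c *s flow (Mn n) (t - \<tau>) (emb *v uhat u \<tau> n) = flow (Mn n) (t - \<tau>) (emb *v uhat ?u \<tau> n)"
          using uhat_matrix_AE[OF ctlD(1)[OF u(1)], of "\<lambda>_. mat c" n]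
          by eventually_elim (simp only: mat_mult_vec vector_scalar_commute flow_smult_right)
        show "(\<lambda>\<tau>. flow (Mn n) (t - \<tau>) (emb *v uhat ?u \<tau> n)) \<in> borel_measurable lborel"
          using mom_integrand[OF cu t] by (rule borel_measurable_integrable)
        have "(\<lambda>\<tau>. flow (Mn n) (t - \<tau>) (emb *v uhat u \<tau> n)) \<in> borel_measurable lborel"
          using mom_integrand[OF u(1) t] by (rule borel_measurable_integrable)
        then show "(\<lambda>\<tau>. c *s flow (Mn n) (t - \<tau>) (emb *v uhat u \<tau> n)) \<in> borel_measurable lborel"
          by (intro borel_measurable_vector_smult) simp_all
      qed
      finally show ?thesis by (simp add: sscale_def)
    qed
    then have "sscale c x = mom Mn (\<lambda>_. emb) t ?u" by (rule ext)
    then show "sscale c x \<in> Rch t" using cu unfolding Rch_def by blast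
  qed
qed

text \<open>Stay at rest for the time \<open>t - s\<close>, then apply the control.\<close>

lemma Rch_mono:
  assumes "0 \<le> s" "s \<le> t"
  shows "Rch s \<subseteq> Rch t"
proof
  fix x assume "x \<in> Rch s"
  then obtain u A where u: "ctl \<omega> 0 s A u" "x = mom Mn (\<lambda>_. emb) s u" unfolding Rch_def by blast
  have "ctl \<omega> 0 t A (\<lambda>z. u (fst z - (t - s), snd z))"
    using ctl_mono[OF ctl_shift(1)[OF u(1), of "t - s"], of 0 t A] assms by simp
  moreover have "x = mom Mn (\<lambda>_. emb) t (\<lambda>z. u (fst z - (t - s), snd z))"
    using ctl_shift(2)[OF u(1), of Mn "\<lambda>_. emb" s "t - s"] u(2) by (simp add: fun_eq_iff)
  ultimately show "x \<in> Rch t" unfolding Rch_def by blast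
qed

text \<open>Apply the control, then let the system evolve freely.\<close>

lemma Sg_Rch:
  assumes "0 \<le> s" "0 \<le> t" "x \<in> Rch t"
  shows "Sg s x \<in> Rch (t + s)"
proof -
  obtain u A where u: "ctl \<omega> 0 t A u" "x = mom Mn (\<lambda>_. emb) t u" using assms(3) unfolding Rch_def by blast
  have "Sg s x = mom Mn (\<lambda>_. emb) (t + s) u"
    using mom_time[OF u(1) assms(2), of Mn "\<lambda>_. emb" "t + s" _ t] u(2) by (simp add: Sg_def fun_eq_iff)
  then show ?thesis using ctl_mono[OF u(1), of 0 "t + s" A] assms unfolding Rch_def by auto
qed

lemma Rch_l2b:
  assumes t: "0 \<le> t" and "x \<in> Rch t"
  shows "\<exists>G. l2b x G"
proof -
  obtain u A where u: "ctl \<omega> 0 t A u" "x = mom Mn (\<lambda>_. emb) t u" using assms(2) unfolding Rch_def by blast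
  let ?e = "emb :: complex^'d1^('d1 + 'd2)"
  have k: "0 \<le> exp (Cg * t) * norm ?e" by simp
  have "l2b (\<lambda>n. if n \<in> UNIV then mom Mn (\<lambda>_. emb) t u n else 0) (exp (Cg * t) * norm ?e * sqrt (t - 0) * A)"
  proof (rule mom_bound[OF u(1) t k])
    fix n s w assume s: "0 < s" "s < t"
    have "norm (flow (Mn n) (t - s) (?e *v w)) \<le> exp (Cg * (t - s)) * norm (?e *v w)" using s by (intro flow_Mn_bound) auto
    also have "\<dots> \<le> exp (Cg * t) * (norm ?e * norm w)"
      using s Cg_nonneg by (intro mult_mono norm_matrix_vector_mult) (auto intro: mult_left_mono)
    finally show "norm (flow (Mn n) (t - s) (?e *v w)) \<le> exp (Cg * t) * norm ?e * norm w" by simp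
  qed
  then show ?thesis using u(2) by auto
qed

text \<open>A fixed \<open>l\<close> cannot match the growing diagonal of a high mode. Dividing the
  component equations by \<open>n mu i\<close> and by \<open>n^2\<close> bounds the norm of
  \<open>P n\<close>, taken as the sum over the two parts, by itself times
  \<open>Cm L / |n|\<close>, which is impossible for large \<open>|n|\<close> unless
  \<open>P n = 0\<close>.\<close>

lemma common_eigenvalue_high_modes:
  assumes "\<And>n v. pr (P n) (Mn n *v v) = l * pr (P n) v"
  obtains N :: nat where "\<forall>n. int N < \<bar>n\<bar> \<longrightarrow> P n = 0"
proof -
  define L where "L = cmod l + kk"
  define Cm where "Cm = (\<Sum>i\<in>UNIV. 1 / \<bar>mu i\<bar>) + real CARD('d2)"
  obtain N :: nat where N: "Cm * L + 1 < real N" using reals_Archimedean2 by blast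
  have L: "0 \<le> L" using kk by (simp add: L_def)
  have Cm: "0 \<le> Cm" by (simp add: Cm_def sum_nonneg)
  have "P n = 0" if n: "int N < \<bar>n\<bar>" for n
  proof -
    define a where "a = part1 (P n)"
    define b where "b = part2 (P n)"
    define s where "s = norm a + norm b"
    let ?n = "\<bar>real_of_int n\<bar>"
    have nN: "real N \<le> ?n" using n by linarith
    have CL: "0 \<le> Cm * L" using Cm L by simp
    have n1: "1 \<le> ?n" "Cm * L < ?n" using nN N CL by linarith+
    have Pv: "pr (P n) v = pr a (part1 v) + pr b (part2 v)" for v
      using pr_join[of "P n" "part1 v" "part2 v"] by (simp add: a_def b_def)
    have kn: "norm (pr c (M *v axis i 1)) \<le> norm M * norm c" for M :: "complex^'j::finite^'k::finite" and c i
    proof -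
      have "norm (pr c (M *v axis i 1)) \<le> norm c * norm (M *v axis i 1)" by (rule norm_pr_le)
      also have "\<dots> \<le> norm c * (norm M * norm (axis i (1::complex)))" by (intro mult_left_mono norm_matrix_vector_mult) simp
      finally show ?thesis by (simp add: mult.commute norm_axis_eq)
    qed
    have n0: "n \<noteq> 0" using n by auto
    note Mb = M_bounds[OF n0]
    have k: "norm K11 \<le> kk" "norm K21 \<le> kk" "norm K22 \<le> kk" "norm A12 + norm K12 \<le> kk"
      using sum_nonneg[of UNIV "\<lambda>i. \<bar>mu i\<bar>"] norm_ge_zero[of K11] norm_ge_zero[of K12] norm_ge_zero[of K21] norm_ge_zero[of K22] norm_ge_zero[of A12]
      unfolding kk_def by (simp_all only: abs_ge_zero, linarith+)
    have ai: "cmod (a $ i) \<le> 1 / \<bar>mu i\<bar> * (L * s / ?n)" for i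
    proof -
      have "pr a ((Dn n + K11) *v axis i 1) + pr b (K21 *v axis i 1) = l * a $ i"
        using assms[of n "join (axis i 1) 0"] by (simp add: Mn_mult Pv)
      moreover have "Dn n *v axis i 1 = (\<i> * of_int n * of_real (mu i)) *s axis i 1"
        by (simp add: Dn_def vec_eq_iff axis_def)
      ultimately have "(\<i> * of_int n * of_real (mu i)) * a $ i = l * a $ i - pr a (K11 *v axis i 1) - pr b (K21 *v axis i 1)"
        by (simp add: matrix_vector_mult_add_rdistrib algebra_simps)
      then have "?n * \<bar>mu i\<bar> * cmod (a $ i) = cmod (l * a $ i - pr a (K11 *v axis i 1) - pr b (K21 *v axis i 1))"
        by (simp add: norm_mult flip: \<open>_ = l * a $ i - _ - _\<close>)
      also have "\<dots> \<le> cmod l * norm a + norm K11 * norm a + norm K21 * norm b"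
        using norm_triangle_ineq4[of "l * a $ i - pr a (K11 *v axis i 1)" "pr b (K21 *v axis i 1)"]
          norm_triangle_ineq4[of "l * a $ i" "pr a (K11 *v axis i 1)"] kn[of a K11 i] kn[of b K21 i]
          mult_left_mono[OF Finite_Cartesian_Product.norm_nth_le[of a i], of "cmod l"] by (simp add: norm_mult)
      also have "\<dots> \<le> cmod l * norm a + kk * norm a + kk * norm b"
        using k by (intro add_mono mult_right_mono) auto
      also have "\<dots> \<le> L * s" by (simp add: L_def s_def algebra_simps)
      finally show ?thesis using mu[of i] n1 by (simp add: field_simps)
    qed
    have bj: "cmod (b $ j) \<le> L * s / ?n" for j
    proof -
      have "pr a (M12 n *v axis j 1) + (pr b ((of_int n)\<^sup>2 *\<^sub>R axis j 1) + pr b (K22 *v axis j 1)) = l * b $ j"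
        using assms[of n "join 0 (axis j 1)"] by (simp add: Mn_mult Pv)
      moreover have "pr b ((of_int n)\<^sup>2 *\<^sub>R axis j 1) = of_real ((of_int n)\<^sup>2) * b $ j"
        unfolding smult_of_real[symmetric] by simp
      ultimately have "of_real ((of_int n)\<^sup>2) * b $ j = l * b $ j - pr a (M12 n *v axis j 1) - pr b (K22 *v axis j 1)"
        by (simp add: algebra_simps)
      then have "?n * ?n * cmod (b $ j) = cmod (l * b $ j - pr a (M12 n *v axis j 1) - pr b (K22 *v axis j 1))"
        by (simp add: norm_mult power2_eq_square flip: \<open>_ = l * b $ j - _ - _\<close>)
      also have "\<dots> \<le> cmod l * norm b + norm (M12 n) * norm a + norm K22 * norm b"
        using norm_triangle_ineq4[of "l * b $ j - pr a (M12 n *v axis j 1)" "pr b (K22 *v axis j 1)"]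
          norm_triangle_ineq4[of "l * b $ j" "pr a (M12 n *v axis j 1)"] kn[of a "M12 n" j] kn[of b K22 j]
          mult_left_mono[OF Finite_Cartesian_Product.norm_nth_le[of b j], of "cmod l"] by (simp add: norm_mult)
      also have "\<dots> \<le> cmod l * norm b * ?n + kk * ?n * norm a + kk * ?n * norm b"
        using Mb(2,4) mult_left_mono[OF n1(1), of "cmod l * norm b"] by (intro add_mono mult_right_mono) auto
      also have "\<dots> \<le> ?n * (L * s)" by (simp add: L_def s_def algebra_simps)
      finally have "?n * (?n * cmod (b $ j)) \<le> ?n * (L * s)" unfolding mult.assoc .
      then have "?n * cmod (b $ j) \<le> L * s" by (rule mult_left_le_imp_le) (use n1 in linarith)
      then show ?thesis using n1 by (simp add: field_simps)
    qed
    have "norm a \<le> (\<Sum>i\<in>UNIV. cmod (a $ i))" unfolding norm_vec_def by (rule L2_set_le_sum) simp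
    also have "\<dots> \<le> (\<Sum>i\<in>UNIV. 1 / \<bar>mu i\<bar> * (L * s / ?n))" by (intro sum_mono ai)
    finally have na: "norm a \<le> (\<Sum>i\<in>UNIV. 1 / \<bar>mu i\<bar>) * (L * s / ?n)" by (simp only: sum_distrib_right)
    have "norm b \<le> (\<Sum>i\<in>UNIV. cmod (b $ i))" unfolding norm_vec_def by (rule L2_set_le_sum) simp
    also have "\<dots> \<le> (\<Sum>i\<in>(UNIV::'d2 set). L * s / ?n)" by (intro sum_mono bj)
    finally have nb: "norm b \<le> real CARD('d2) * (L * s / ?n)" by simp
    have "s \<le> Cm * (L * s / ?n)" unfolding Cm_def distrib_right using add_mono[OF na nb] by (simp only: s_def)
    then have "?n * s \<le> (Cm * L) * s" using n1 by (simp add: field_simps)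
    moreover have "0 \<le> s" by (simp add: s_def)
    ultimately have "s = 0" using mult_strict_right_mono[OF n1(2), of s] by (cases "0 < s") auto
    then have "a = 0" "b = 0" unfolding s_def by (smt (verit) norm_ge_zero norm_eq_zero)+
    then show ?thesis unfolding a_def b_def by (rule parts_zero)
  qed
  then show thesis using that by blast
qed

text \<open>Hautus test: a functional without hyperbolic part annihilates \<open>K21\<close> and is
  a left eigenvector of \<open>K22\<close>, hence annihilates every \<open>K22^j K21\<close>; by the
  right inverse \<open>R0\<close> these ranges fill the whole space.\<close>

lemma kalman_dual:
  assumes e: "\<And>v. pr p (Mn n *v v) = l * pr p v" and a: "part1 p = 0"
  shows "p = 0"
proof -
  define b where "b = part2 p"
  have Pv: "pr p v = pr b (part2 v)" for v
    using pr_join[of p "part1 v" "part2 v"] a by (simp add: b_def)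
  have K21: "pr b (K21 *v x) = 0" for x using e[of "join x 0"] by (simp add: Mn_mult Pv)
  have K22: "pr b (K22 *v y) = (l - of_real ((of_int n)\<^sup>2)) * pr b y" for y
  proof -
    have "pr b ((of_int n)\<^sup>2 *\<^sub>R y) = of_real ((of_int n)\<^sup>2) * pr b y" unfolding smult_of_real[symmetric] by simp
    then show ?thesis using e[of "join 0 y"] by (simp add: Mn_mult Pv algebra_simps)
  qed
  have pw: "pr b (matpow K22 j *v y) = (l - of_real ((of_int n)\<^sup>2)) ^ j * pr b y" for j y
    by (induction j) (simp_all add: matrix_vector_mul_assoc[symmetric] K22 mult.assoc)
  have "pr b x = 0" for x
  proof -
    have "pr b (\<Sum>j<m. f j) = (\<Sum>j<m. pr b (f j))" for f and m :: nat by (induction m) simp_all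
    then have "pr b (\<Sum>j<mm. matpow K22 j *v (K21 *v (R0 j *v x))) = 0" by (simp add: pw K21)
    then show ?thesis by (simp add: R0)
  qed
  then have "b = 0" by (intro pr_eqI) simp
  then show ?thesis using a unfolding b_def by (intro parts_zero)
qed

end

section \<open>Control of all modes\<close>

locale hp_control = hp_system mu K11 A12 K12 K21 K22 \<omega> mm R0
  for mu :: "'d1::finite \<Rightarrow> real" and K11 :: "complex^'d1^'d1" and A12 K12 :: "complex^'d2::finite^'d1"
    and K21 :: "complex^'d1^'d2" and K22 :: "complex^'d2^'d2" and \<omega> mm R0 +
  fixes T0 :: real
  assumes T0: "0 \<le> T0" and gap: "\<And>i. max_gap \<omega> < ennreal (\<bar>mu i\<bar> * T0)"
begin

text \<open>Free evolution up to \<open>t - T1\<close>, then control during the last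
  \<open>T1\<close>. The threshold \<open>N\<close> therefore does not depend on \<open>t\<close>,
  and the remainders at all times lie in one space of finite dimension.\<close>

lemma steer_to_low_modes:
  assumes T: "T0 < T1"
  obtains N B where "\<forall>t g G. T1 \<le> t \<longrightarrow> l2b g G \<longrightarrow>
    (\<exists>e\<in>VN N. Sg t g - e \<in> Rch t \<and> (\<forall>n. norm (e n) \<le> B * (exp (Cg * (t - T1)) * G)))"
proof -
  interpret hp_time mu K11 A12 K12 K21 K22 \<omega> mm R0 T0 T1
    by unfold_locales (use T0 T gap in auto)
  obtain N B where "0 \<le> B" and NB: "\<forall>g G. l2b g G \<longrightarrow> (\<exists>u A. ctl \<omega> 0 T1 A u \<and>
      (\<forall>n. int N < \<bar>n\<bar> \<longrightarrow> flow (Mn n) T1 (g n) + mom Mn (\<lambda>_. emb) T1 u n = 0) \<and>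
      (\<forall>n. norm (flow (Mn n) T1 (g n) + mom Mn (\<lambda>_. emb) T1 u n) \<le> B * G))"
    by (rule control_up_to_low_modes)
  show thesis
  proof (rule that[of N B], intro allI impI)
    fix t G and g :: "int \<Rightarrow> complex^('d1 + 'd2)" assume t: "T1 \<le> t" and g: "l2b g G"
    have "l2b (Sg (t - T1) g) (exp (Cg * (t - T1)) * G)" using t g by (intro Sg_l2b) auto
    then obtain u A where u: "ctl \<omega> 0 T1 A u"
      and z: "\<forall>n. int N < \<bar>n\<bar> \<longrightarrow> flow (Mn n) T1 (Sg (t - T1) g n) + mom Mn (\<lambda>_. emb) T1 u n = 0"
      and b: "\<forall>n. norm (flow (Mn n) T1 (Sg (t - T1) g n) + mom Mn (\<lambda>_. emb) T1 u n) \<le> B * (exp (Cg * (t - T1)) * G)"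
      using NB by blast
    define e where "e n = flow (Mn n) T1 (Sg (t - T1) g n) + mom Mn (\<lambda>_. emb) T1 u n" for n
    have Sgt: "flow (Mn n) T1 (Sg (t - T1) g n) = Sg t g n" for n
      using flow_add_time[of "Mn n" T1 "t - T1" "g n"] by (simp add: Sg_def)
    have "mom Mn (\<lambda>_. emb) T1 (\<lambda>z. - u z) \<in> Rch T1" unfolding Rch_def using ctl_minus[OF u] by blast
    moreover have "Sg t g - e = mom Mn (\<lambda>_. emb) T1 (\<lambda>z. - u z)"
      by (rule ext) (simp only: minus_apply e_def Sgt mom_minus diff_add_eq_diff_diff_swap, simp)
    ultimately have "Sg t g - e \<in> Rch t" using Rch_mono[of T1 t] T T0 t by auto
    moreover have "e \<in> VN N" using z by (simp add: VN_def e_def)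
    ultimately show "\<exists>e\<in>VN N. Sg t g - e \<in> Rch t \<and> (\<forall>n. norm (e n) \<le> B * (exp (Cg * (t - T1)) * G))"
      using b by (intro bexI[of _ e]) (auto simp: e_def)
  qed
qed

text \<open>The reachable part of the low modes stabilizes on some interval \<open>[t0, T)\<close>. If it is not everything,
  a functional annihilating it, transported to the initial data, is a common eigenvector of all transposed
  symbols that vanishes on reachable states, and the Kalman condition kills it.\<close>

lemma low_modes_reachable:
  assumes T: "T0 < T1" "T1 < T"
    and steer: "\<forall>t g G. T1 \<le> t \<longrightarrow> l2b g G \<longrightarrow>
      (\<exists>e\<in>VN N. Sg t g - e \<in> Rch t \<and> (\<forall>n. norm (e n) \<le> B * (exp (Cg * (t - T1)) * G)))"
  shows "\<exists>t0. T1 \<le> t0 \<and> t0 < T \<and> VN N \<subseteq> Rch t0"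
proof -
  interpret V: vector_space "sscale :: complex \<Rightarrow> (int \<Rightarrow> complex^('d1 + 'd2)) \<Rightarrow> _" by (rule vector_space_sscale)
  define E where "E t = Rch t \<inter> VN N" for t
  have Es: "V.subspace (E t)" if "T1 \<le> t" for t
    unfolding E_def using that T T0 by (intro V.subspace_inter subspace_Rch subspace_VN) auto
  obtain BB :: "(int \<Rightarrow> complex^('d1 + 'd2)) set" where BB: "finite BB" "VN N \<subseteq> V.span BB" using VN_spanned by blast
  have "\<exists>t0. T1 \<le> t0 \<and> t0 < T \<and> (\<forall>t. t0 \<le> t \<longrightarrow> t < T \<longrightarrow> E t = E t0)"
  proof (rule increasing_subspaces_stabilize[OF vector_space_sscale _ BB(1)])
    show "V.subspace (E t)" if "T1 \<le> t" "t < T" for t using Es that by simp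
    show "E t \<subseteq> V.span BB" for t using BB(2) by (auto simp: E_def)
    show "E s \<subseteq> E t" if "T1 \<le> s" "s \<le> t" "t < T" for s t
      using Rch_mono[of s t] that T T0 by (auto simp: E_def)
  qed (use T in auto)
  then obtain t0 where t0: "T1 \<le> t0" "t0 < T" and st: "\<And>t. t0 \<le> t \<Longrightarrow> t < T \<Longrightarrow> E t = E t0" by blast
  have t00: "0 \<le> t0" using t0 T T0 by simp
  define \<delta> where "\<delta> = T - t0"
  have d: "0 < \<delta>" using t0 by (simp add: \<delta>_def)
  have "E t0 = VN N"
  proof (rule ccontr)
    assume neE: "E t0 \<noteq> VN N"
    \<comment> \<open>Evolution by \<open>s\<close> leads into \<open>E (t0 + s)\<close>, and
      stationarity on \<open>[t0, T)\<close> identifies this with \<open>E t0\<close>; growth in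
      time has become invariance under the semigroup.\<close>
    have SgE: "Sg s e \<in> E t0" if "e \<in> E t0" "0 \<le> s" "s < \<delta>" for e s
    proof -
      have "Sg s e \<in> E (t0 + s)" using that Sg_Rch[of s t0 e] Sg_VN[of e N s] t00 by (auto simp: E_def)
      then show ?thesis using st[of "t0 + s"] that by (simp add: \<delta>_def)
    qed
    obtain p l where p: "p \<in> VN N" "p \<noteq> 0" "\<forall>e\<in>E t0. (\<Sum>n\<in>{- int N..int N}. pr (p n) (e n)) = 0"
      "\<forall>n. transpose (Mn n) *v p n = l *s p n"
    proof (rule annihilating_eigenfunctional[OF Es[OF t0(1)] _ neE d])
      show "E t0 \<subseteq> VN N" by (auto simp: E_def)
      show "(\<lambda>n. flow (Mn n) s (e n)) \<in> E t0" if "e \<in> E t0" "0 \<le> s" "s < \<delta>" for e s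
        using SgE[OF that] by (simp add: Sg_def)
    qed blast
    have pM: "pr (p n) (Mn n *v v) = l * pr (p n) v" for n v
      using pr_transpose[of "Mn n" "p n" v] p(4) by simp
    define ph where "ph e = (\<Sum>n\<in>{- int N..int N}. pr (p n) (e n))" for e
    have ph_lin: "ph (x + y) = ph x + ph y" "ph (x - y) = ph x - ph y" "ph (sscale c x) = c * ph x" for x y c
      by (simp_all add: ph_def sum.distrib sum_subtractf sscale_def sum_distrib_left)
    have phS: "ph (Sg s e) = exp (- l * of_real s) * ph e" for s e
      unfolding ph_def Sg_def pr_flow[OF pM] by (simp only: sum_distrib_left)
    have phE: "ph e = 0" if "e \<in> E t0" for e using p(3) that by (simp add: ph_def)
    define good where "good g e \<longleftrightarrow> e \<in> VN N \<and> Sg t0 g - e \<in> Rch t0" for g e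
    \<comment> \<open>Extends the functional from low modes to all data: steer to the low modes and
      evaluate \<open>ph\<close> on the remainder. Two remainders differ by an element of
      \<open>E t0\<close>, where \<open>ph\<close> vanishes, so the choice does not matter.\<close>
    define ps where "ps g = ph (SOME e. good g e)" for g
    note R0s = subspace_Rch[OF t00] and VNs = subspace_VN[of N, where 'a = "'d1 + 'd2"]
    have ps_eq: "ps g = ph e" if "good g e" for g e
    proof -
      have g: "good g (SOME e. good g e)" (is "good g ?e") using that by (rule someI[where P="good g"])
      have "(Sg t0 g - ?e) - (Sg t0 g - e) \<in> Rch t0" "e - ?e \<in> VN N"
        by (rule V.subspace_diff[OF R0s]; use g that in \<open>simp add: good_def\<close>)
          (rule V.subspace_diff[OF VNs]; use g that in \<open>simp add: good_def\<close>)
      then have "e - ?e \<in> E t0" by (simp add: E_def)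
      then have "ph (e - ?e) = 0" by (rule phE)
      then show ?thesis by (simp only: ps_def ph_lin(2) right_minus_eq)
    qed
    define B1 where "B1 = B * exp (Cg * (t0 - T1))"
    have good_ex: "\<exists>e. good g e \<and> (\<forall>n. norm (e n) \<le> B1 * G)" if "l2b g G" for g G
      using steer[rule_format, OF t0(1) that] by (auto simp: good_def B1_def mult.assoc)
    define Kb where "Kb = (\<Sum>n\<in>{- int N..int N}. norm (p n)) * B1"
    \<comment> \<open>The linear bound on remainders enters here: \<open>ps\<close> is continuous,
      hence determined by its values on finitely supported sequences.\<close>
    have ps_bound: "cmod (ps g) \<le> Kb * G" if g: "l2b g G" for g G
    proof -
      obtain e where e: "good g e" "\<forall>n. norm (e n) \<le> B1 * G" using good_ex[OF g] by blast
      have "cmod (ph e) \<le> (\<Sum>n\<in>{- int N..int N}. norm (p n) * (B1 * G))"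
        unfolding ph_def by (intro sum_norm_le order_trans[OF norm_pr_le] mult_left_mono) (use e in auto)
      then show ?thesis using ps_eq[OF e(1)] by (simp add: Kb_def sum_distrib_right mult.assoc)
    qed
    have ps_add: "ps (g + h) = ps g + ps h" if gh: "l2b g G" "l2b h H" for g h G H
    proof -
      obtain e where e: "good g e" using good_ex[OF gh(1)] by blast
      obtain f where f: "good h f" using good_ex[OF gh(2)] by blast
      have "(Sg t0 g - e) + (Sg t0 h - f) \<in> Rch t0" "e + f \<in> VN N"
        by (rule V.subspace_add[OF R0s]; use e f in \<open>simp add: good_def\<close>)
          (rule V.subspace_add[OF VNs]; use e f in \<open>simp add: good_def\<close>)
      then have "good (g + h) (e + f)" by (simp add: good_def Sg_simps(1) add_diff_add)
      then show ?thesis by (simp only: ps_eq[OF e] ps_eq[OF f] ps_eq ph_lin(1))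
    qed
    have ps_scale: "ps (sscale c g) = c * ps g" if g: "l2b g G" for c g G
    proof -
      obtain e where e: "good g e" using good_ex[OF g] by blast
      have "sscale c (Sg t0 g - e) \<in> Rch t0" "sscale c e \<in> VN N"
        by (rule V.subspace_scale[OF R0s]; use e in \<open>simp add: good_def\<close>)
          (rule V.subspace_scale[OF VNs]; use e in \<open>simp add: good_def\<close>)
      then have "good (sscale c g) (sscale c e)" by (simp add: good_def Sg_simps(3) V.scale_right_diff_distrib)
      then show ?thesis by (simp only: ps_eq[OF e] ps_eq ph_lin(3))
    qed
    \<comment> \<open>Both remainders are compared at time \<open>t0 + s\<close>, which is still
      before \<open>T\<close>, so that \<open>E\<close> is the same space.\<close>
    have ps_S: "ps (Sg s g) = exp (- l * of_real s) * ps g" if g: "l2b g G" and s: "0 \<le> s" "s < \<delta>" for s g G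
    proof -
      obtain e where e: "good g e" using good_ex[OF g] by blast
      obtain f where f: "good (Sg s g) f" using good_ex[OF Sg_l2b[OF s(1) g]] by blast
      have "Sg s (Sg t0 g - e) \<in> Rch (t0 + s)" using e Sg_Rch[OF s(1) t00] unfolding good_def by blast
      moreover have "Sg t0 (Sg s g) - f \<in> Rch (t0 + s)" using f Rch_mono[of t0 "t0 + s"] t00 s(1) unfolding good_def by auto
      ultimately have "(Sg t0 (Sg s g) - f) - Sg s (Sg t0 g - e) \<in> Rch (t0 + s)"
        using V.subspace_diff[OF subspace_Rch[of "t0 + s"]] t00 s(1) by auto
      moreover have "(Sg t0 (Sg s g) - f) - Sg s (Sg t0 g - e) = Sg s e - f"
        by (simp add: Sg_simps add.commute)
      moreover have "Sg s e - f \<in> VN N" by (rule V.subspace_diff[OF VNs]) (use e f Sg_VN in \<open>simp_all add: good_def\<close>)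
      ultimately have "Sg s e - f \<in> E t0" using st[of "t0 + s"] s by (auto simp: E_def \<delta>_def)
      then have "ph (Sg s e - f) = 0" by (rule phE)
      then show ?thesis by (simp only: ps_eq[OF e] ps_eq[OF f] ph_lin(2) phS right_minus_eq)
    qed
    \<comment> \<open>A state reachable within time \<open>s\<close> has a remainder reachable at
      \<open>t0 + s\<close>, hence an element of \<open>E t0\<close>.\<close>
    have ps_R: "ps c = 0" if c: "c \<in> Rch s" and s: "0 \<le> s" "s < \<delta>" for c s
    proof -
      obtain G where "l2b c G" using Rch_l2b[OF s(1) c] by blast
      then obtain e where e: "good c e" using good_ex by blast
      have 1: "Sg t0 c \<in> Rch (t0 + s)" using Sg_Rch[OF t00 s(1) c] by (simp add: add.commute)
      have 2: "Sg t0 c - e \<in> Rch (t0 + s)" using e Rch_mono[of t0 "t0 + s"] t00 s(1) unfolding good_def by auto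
      have 3: "0 \<le> t0 + s" using t00 s(1) by simp
      have "Sg t0 c - (Sg t0 c - e) \<in> Rch (t0 + s)" by (rule V.subspace_diff[OF subspace_Rch[OF 3] 1 2])
      moreover have "Sg t0 c - (Sg t0 c - e) = e" by (rule ext) simp
      ultimately have "e \<in> E (t0 + s)" using e by (simp add: E_def good_def)
      then show ?thesis using st[of "t0 + s"] s phE ps_eq[OF e] by (simp add: \<delta>_def)
    qed
    define P where "P n = (\<chi> i. ps (sgl n (axis i 1)))" for n
    have sgl_l2b: "\<exists>G. l2b (sgl n v) G" for n and v :: "complex^('d1 + 'd2)"
      by (rule l2b_VN[of _ "nat \<bar>n\<bar>"]) (auto simp: VN_def sgl_def)
    have ps_sum: "ps (\<Sum>i\<in>I. g i) = (\<Sum>i\<in>I. ps (g i)) \<and> (\<exists>G. l2b (\<Sum>i\<in>I. g i) G)" if "finite I" "\<And>i. i \<in> I \<Longrightarrow> \<exists>G. l2b (g i) G" for I :: "'i set" and g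
      using that
    proof (induction I)
      case empty
      have z: "l2b (0 :: int \<Rightarrow> complex^('d1 + 'd2)) 0" by (simp add: l2b_def L2_set_def)
      have "ps (sscale 0 0) = 0" using ps_scale[OF z, of 0] by simp
      then have "ps 0 = 0" by (simp only: V.scale_zero_left)
      then show ?case using z by (simp only: sum.empty) blast
    next
      case (insert i I)
      obtain G H where G: "l2b (g i) G" and H: "l2b (sum g I) H" using insert by blast
      show ?case using insert ps_add[OF G H] l2b_add[OF G H] by (auto simp: plus_fun_def)
    qed
    have ps_VN: "ps g = (\<Sum>n\<in>{- int m..int m}. pr (P n) (g n))" if g: "g \<in> VN m" for g m
    proof -
      have sc: "\<exists>G. l2b (sscale c (sgl n (v :: complex^('d1 + 'd2)))) G" for c n v
        by (rule l2b_VN[of _ "nat \<bar>n\<bar>"]) (auto simp: VN_def sgl_def sscale_def)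
      have "ps g = ps (\<Sum>n\<in>{- int m..int m}. \<Sum>i\<in>UNIV. sscale (g n $ i) (sgl n (axis i 1)))"
        using VN_expansion[OF g] by (rule arg_cong)
      also have "\<dots> = (\<Sum>n\<in>{- int m..int m}. ps (\<Sum>i\<in>UNIV. sscale (g n $ i) (sgl n (axis i 1))))"
        by (rule ps_sum[THEN conjunct1]) (simp, rule ps_sum[THEN conjunct2], simp, rule sc)
      also have "\<dots> = (\<Sum>n\<in>{- int m..int m}. \<Sum>i\<in>UNIV. ps (sscale (g n $ i) (sgl n (axis i 1))))"
        by (intro sum.cong refl ps_sum[THEN conjunct1] sc) simp
      also have "\<dots> = (\<Sum>n\<in>{- int m..int m}. \<Sum>i\<in>UNIV. g n $ i * ps (sgl n (axis i 1)))"
        by (intro sum.cong refl) (use sgl_l2b ps_scale in blast)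
      finally show ?thesis by (simp add: pr_def P_def mult.commute)
    qed
    have ps_sgl: "ps (sgl n v) = pr (P n) v" for n v
    proof -
      have "ps (sgl n v) = (\<Sum>k\<in>{- int (nat \<bar>n\<bar>)..int (nat \<bar>n\<bar>)}. pr (P k) (sgl n v k))"
        by (rule ps_VN) (auto simp: VN_def sgl_def)
      also have "\<dots> = (\<Sum>k\<in>{- int (nat \<bar>n\<bar>)..int (nat \<bar>n\<bar>)}. if k = n then pr (P n) v else 0)"
        by (intro sum.cong) (auto simp: sgl_def)
      also have "\<dots> = pr (P n) v" by (subst sum.delta) auto
      finally show ?thesis .
    qed
    \<comment> \<open>The semigroup identity for \<open>ps\<close>, tested on a single mode and
      differentiated at zero, gives the same eigenvalue \<open>l\<close> for every
      frequency.\<close>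
    have PM: "pr (P n) (Mn n *v v) = l * pr (P n) v" for n v
    proof -
      have "((\<lambda>s. pr (P n) (flow (Mn n) s v)) has_vector_derivative pr (P n) (- (Mn n *v flow (Mn n) 0 v))) (at 0)"
        by (intro bounded_linear.has_vector_derivative[OF bounded_linear_pr] flow_has_derivative)
      moreover have "((\<lambda>s. pr (P n) (exp (- l * of_real s) *s v)) has_vector_derivative pr (P n) (- l *s (exp (- l * of_real 0) *s v))) (at 0)"
        by (intro bounded_linear.has_vector_derivative[OF bounded_linear_pr] has_vector_derivative_exp_smult)
      ultimately have "pr (P n) (- (Mn n *v flow (Mn n) 0 v)) = pr (P n) (- l *s (exp (- l * of_real 0) *s v))"
      proof (rule derivative_unique_right[OF _ _ d])
        fix s assume s: "0 \<le> s" "s < \<delta>"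
        obtain G where "l2b (sgl n v) G" using sgl_l2b by blast
        from ps_S[OF this s] show "pr (P n) (flow (Mn n) s v) = pr (P n) (exp (- l * of_real s) *s v)"
          by (simp add: Sg_simps(5) ps_sgl)
      qed
      then show ?thesis by simp
    qed
    obtain N' :: nat where N': "\<forall>n. int N' < \<bar>n\<bar> \<longrightarrow> P n = 0" by (rule common_eigenvalue_high_modes[OF PM])
    \<comment> \<open>Truncation: the tail is small in norm and \<open>ps\<close> is continuous,
      while on the finitely many other modes \<open>P\<close> represents \<open>ps\<close> and
      contributes nothing beyond \<open>N'\<close>.\<close>
    have ps_exp: "ps g = (\<Sum>n\<in>{- int N'..int N'}. pr (P n) (g n))" if g: "l2b g G" for g G
    proof -
      have "cmod (ps g - (\<Sum>n\<in>{- int N'..int N'}. pr (P n) (g n))) \<le> Kb * e" if e: "0 < e" for e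
      proof -
        obtain m :: nat where m: "l2b (\<lambda>n. if \<bar>n\<bar> \<le> int m then 0 else g n) e" by (rule l2b_tail[OF g e])
        define M where "M = max m N'"
        define g1 where "g1 n = (if \<bar>n\<bar> \<le> int M then g n else 0)" for n
        define g2 where "g2 n = (if \<bar>n\<bar> \<le> int M then 0 else g n)" for n
        have "l2b g2 (1 * e)" by (rule l2b_le[OF m]) (auto simp: g2_def M_def)
        then have g2: "l2b g2 e" by simp
        have V1: "g1 \<in> VN M" by (auto simp: VN_def g1_def)
        obtain G1 where g1: "l2b g1 G1" using l2b_VN[OF V1] by blast
        have gg: "g = g1 + g2" by (rule ext) (simp add: g1_def g2_def)
        have "ps g1 = (\<Sum>n\<in>{- int M..int M}. pr (P n) (g1 n))" by (rule ps_VN[OF V1])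
        also have "\<dots> = (\<Sum>n\<in>{- int N'..int N'}. pr (P n) (g1 n))"
        proof (rule sum.mono_neutral_right)
          show "\<forall>i\<in>{- int M..int M} - {- int N'..int N'}. pr (P i) (g1 i) = 0"
          proof
            fix i assume "i \<in> {- int M..int M} - {- int N'..int N'}"
            then have "int N' < \<bar>i\<bar>" by auto
            then show "pr (P i) (g1 i) = 0" using N' by simp
          qed
        qed (auto simp: M_def)
        also have "\<dots> = (\<Sum>n\<in>{- int N'..int N'}. pr (P n) (g n))" by (intro sum.cong) (auto simp: g1_def M_def)
        finally have "ps g - (\<Sum>n\<in>{- int N'..int N'}. pr (P n) (g n)) = ps g2"
          using ps_add[OF g1 g2] gg by simp
        then show ?thesis using ps_bound[OF g2] by simp
      qed
      then have "cmod (ps g - (\<Sum>n\<in>{- int N'..int N'}. pr (P n) (g n))) \<le> 0 + e" if "0 < e" for e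
        using that by (cases "Kb \<le> 0") (meson less_eq_real_def mult_nonpos_nonneg order_trans le_add_same_cancel1,
          smt (verit) divide_pos_pos nonzero_mult_div_cancel_left times_divide_eq_right)
      then have "cmod (ps g - (\<Sum>n\<in>{- int N'..int N'}. pr (P n) (g n))) \<le> 0" by (rule field_le_epsilon)
      then show ?thesis by simp
    qed
    \<comment> \<open>The test control has, among the frequencies up to \<open>N1\<close>, only the
      profile \<open>exp (- l t) w\<close> in mode \<open>m\<close>. On the state it reaches,
      \<open>ps\<close> equals \<open>s exp (- l s)\<close> times the pairing of \<open>P m\<close>
      with the input \<open>w\<close>, because the two exponentials combine to a constant; so this
      pairing vanishes.\<close>
    have P1: "part1 (P m) = 0" if m: "\<bar>m\<bar> \<le> int N'" for m
    proof (rule pr_eqI)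
      fix w :: "complex^'d1"
      \<comment> \<open>Vanishing on reachable states requires \<open>s < \<delta>\<close>, and the
        construction of the control \<open>s <= 1\<close>.\<close>
      define s where "s = min (\<delta> / 2) 1"
      have s: "0 < s" "s \<le> 1" "s < \<delta>" "0 \<le> s" using d by (auto simp: s_def)
      define v where "v n \<tau> = (if n = m then exp (- l * of_real \<tau>) *s w else 0)" for n :: int and \<tau> :: real
      define N1 where "N1 = max 1 N'"
      obtain G b where b: "dual_family \<omega> N1 G b" using static_control[OF om ne] by (metis N1_def max.cobounded1)
      have ec: "continuous_on S (\<lambda>t. exp (- l * of_real t) *s w)" for S :: "real set"
        using has_vector_derivative_exp_smult[of "- l" w] by (meson continuous_at_imp_continuous_on has_vector_derivative_continuous)
      have vc: "continuous_on UNIV (v n)" for n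
        unfolding v_def[abs_def] using ec[of UNIV] by (cases "n = m") simp_all
      obtain Vb where Vb: "\<And>\<tau>. 0 \<le> \<tau> \<Longrightarrow> \<tau> \<le> s \<Longrightarrow> norm (exp (- l * of_real \<tau>) *s w) \<le> Vb"
        using compact_imp_bounded[OF compact_continuous_image[OF ec compact_Icc[of 0 s]]] unfolding bounded_iff by force
      have Vb0: "0 \<le> Vb" using Vb[of 0] s norm_ge_zero order_trans by blast
      have vb: "norm (v n \<tau>) \<le> Vb" if "0 \<le> \<tau>" "\<tau> \<le> s" for n \<tau>
        using Vb[OF that] Vb0 by (simp add: v_def)
      obtain u where u: "\<forall>A. (\<forall>m. \<bar>m\<bar> \<le> int N1 \<longrightarrow> Vb \<le> A) \<longrightarrow> ctl \<omega> 0 (0 + s) (3 * (2 * real N1 + 1) * G * A) u"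
        "\<forall>t n. \<bar>n\<bar> \<le> int N1 \<longrightarrow> uhat u t n = indicator {0<..<0 + s} t *\<^sub>R v n (t - 0)"
        by (rule low_mode_control[where N=N1 and V="\<lambda>_. Vb" and ?t0.0=0 and tau=s and b=b and v=v and G="G", OF b vc vb s(1,2)])
      define c where "c = mom Mn (\<lambda>_. emb) s u"
      obtain A where cu: "ctl \<omega> 0 s A u" using u(1) by auto
      have cR: "c \<in> Rch s" using cu unfolding Rch_def c_def by blast
      obtain G where cG: "l2b c G" using Rch_l2b[OF s(4) cR] by blast
      define K where "K n = (if n = m then exp (- l * of_real s) * pr (P m) (emb *v w) else 0)" for n
      have "pr (P n) (c n) = of_real s * K n" if n: "n \<in> {- int N'..int N'}" for n
      proof -
        have "pr (P n) (c n) = (LINT t|lborel. pr (P n) (flow (Mn n) (s - t) (emb *v uhat u t n)))"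
          unfolding c_def mom_def by (rule integral_bounded_linear[OF bounded_linear_pr mom_integrand[OF cu s(4)], symmetric])
        also have "\<dots> = (LINT t|lborel. indicator {0<..<s} t *\<^sub>R K n)"
        proof (rule Bochner_Integration.integral_cong[OF refl])
          fix t
          have uh: "uhat u t n = indicator {0<..<s} t *\<^sub>R v n t" using u(2) n by (auto simp: N1_def)
          have ex: "exp (- l * of_real (s - t)) * exp (- l * of_real t) = exp (- l * of_real s)"
            unfolding exp_add[symmetric] by (simp add: algebra_simps)
          show "pr (P n) (flow (Mn n) (s - t) (emb *v uhat u t n)) = indicator {0<..<s} t *\<^sub>R K n"
          proof (cases "t \<in> {0<..<s}")
            case True
            then show ?thesis unfolding pr_flow[OF PM] uh
              using ex by (simp add: v_def K_def vector_scalar_commute mult.assoc[symmetric] del: of_real_diff)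
          qed (simp add: uh)
        qed
        also have "\<dots> = of_real s * K n" using s by (simp add: scaleR_conv_of_real)
        finally show ?thesis .
      qed
      then have "(\<Sum>n\<in>{- int N'..int N'}. of_real s * K n) = 0"
        using ps_R[OF cR s(4,3)] ps_exp[OF cG] by simp
      then have "of_real s * (exp (- l * of_real s) * pr (P m) (emb *v w)) = 0"
        using m by (auto simp: K_def if_distrib[where f="\<lambda>x. y * x" for y] abs_le_iff split: if_splits cong: if_cong)
      then have "pr (P m) (join w 0) = 0" using s by (simp add: emb_mult)
      then show "pr (part1 (P m)) w = pr 0 w" by (simp add: pr_join)
    qed
    have "P n = 0" for n
    proof (cases "int N' < \<bar>n\<bar>")
      case False
      then show ?thesis using kalman_dual[OF PM P1] by simp
    qed (use N' in blast)
    then have ps0: "ps g = 0" if "g \<in> VN N" for g using ps_VN[OF that] by simp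
    \<comment> \<open>The flow is invertible on finitely many modes, so every low state is, exactly,
      the remainder of some low datum.\<close>
    have ph0: "ph e = 0" if e: "e \<in> VN N" for e
    proof -
      have "good (Sg (- t0) e) e" using e V.subspace_0[OF R0s] by (simp add: good_def Sg_simps)
      then show ?thesis using ps_eq ps0[OF Sg_VN[OF e]] by metis
    qed
    have "p n = 0" for n
    proof (cases "int N < \<bar>n\<bar>")
      case True
      then show ?thesis using p(1) by (simp add: VN_def)
    next
      case False
      have "pr (p n) v = pr 0 v" for v
      proof -
        have "ph (sgl n v) = (\<Sum>k\<in>{- int N..int N}. if k = n then pr (p n) v else 0)"
          unfolding ph_def by (intro sum.cong) (auto simp: sgl_def)
        also have "\<dots> = pr (p n) v" using False by auto
        finally show ?thesis using ph0[of "sgl n v"] False by (auto simp: VN_def sgl_def)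
      qed
      then show ?thesis by (rule pr_eqI)
    qed
    then show False using p(2) by (simp add: fun_eq_iff)
  qed
  then show ?thesis using t0 by (auto simp: E_def)
qed

text \<open>Up to a low-mode remainder the free evolution is reachable at \<open>t0\<close>, and the
  remainder is reachable as well. Letting the system evolve to \<open>T\<close> and reversing the
  sign of the control cancels the free evolution.\<close>

theorem null_control:
  assumes T: "T0 < T" and g: "l2b g G"
  obtains u A where "ctl \<omega> 0 T A u" "\<forall>n. flow (Mn n) T (g n) + mom Mn (\<lambda>_. emb) T u n = 0"
proof -
  define T1 where "T1 = (T0 + T) / 2"
  have T1: "T0 < T1" "T1 < T" using T by (auto simp: T1_def)
  obtain N B where st: "\<forall>t g G. T1 \<le> t \<longrightarrow> l2b g G \<longrightarrow>
    (\<exists>e\<in>VN N. Sg t g - e \<in> Rch t \<and> (\<forall>n. norm (e n) \<le> B * (exp (Cg * (t - T1)) * G)))"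
    by (rule steer_to_low_modes[OF T1(1)])
  obtain t0 where t0: "T1 \<le> t0" "t0 < T" "VN N \<subseteq> Rch t0" using low_modes_reachable[OF T1 st] by blast
  have t00: "0 \<le> t0" using t0 T1 T0 by simp
  interpret V: vector_space "sscale :: complex \<Rightarrow> (int \<Rightarrow> complex^('d1 + 'd2)) \<Rightarrow> _" by (rule vector_space_sscale)
  obtain e where e: "e \<in> VN N" "Sg t0 g - e \<in> Rch t0" using st[rule_format, OF t0(1) g] by blast
  then have "(Sg t0 g - e) + e \<in> Rch t0" using V.subspace_add[OF subspace_Rch[OF t00]] t0(3) by blast
  then have "Sg t0 g \<in> Rch t0" by simp
  then have "Sg (T - t0) (Sg t0 g) \<in> Rch (t0 + (T - t0))" using t00 t0(2) by (intro Sg_Rch) auto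
  then obtain u A where u: "ctl \<omega> 0 T A u" "Sg T g = mom Mn (\<lambda>_. emb) T u" by (auto simp: Sg_simps Rch_def)
  show thesis
  proof (rule that[OF ctl_minus[OF u(1)]], rule allI)
    fix n show "flow (Mn n) T (g n) + mom Mn (\<lambda>_. emb) T (\<lambda>z. - u z) n = 0"
      using fun_cong[OF u(2), of n] unfolding mom_minus by (simp add: Sg_def)
  qed
qed

end

section \<open>Necessity of the Kalman condition\<close>

text \<open>The Kalman span is the range of a linear map in the coefficient vectors; preimages of
  the basis vectors, taken as columns, form the right inverse matrices.\<close>

lemma kalman_right_inverse:
  fixes K22 :: "real^'d2^'d2" and K21 :: "real^'d1^'d2"
  assumes "kalman_condition K22 K21"
  obtains R :: "nat \<Rightarrow> complex^'d2^'d1" where "\<And>x. (\<Sum>j<CARD('d2). matpow (cmat K22) j *v (cmat K21 *v (R j *v x))) = x"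
proof -
  define L where "L r = (\<Sum>j<CARD('d2). matpow (cmat K22) j *v (cmat K21 *v r j))" for r :: "nat \<Rightarrow> complex^'d1"
  let ?S = "{matpow (cmat K22) j *v (cmat K21 *v X1) | j X1. j \<le> CARD('d2) - 1}"
  have "vec.span ?S \<subseteq> range L"
  proof (rule vec.span_minimal)
    show "?S \<subseteq> range L"
    proof
      fix y assume "y \<in> ?S"
      then obtain j X where y: "y = matpow (cmat K22) j *v (cmat K21 *v X)" "j \<le> CARD('d2) - 1" by blast
      have "0 < CARD('d2)" by simp
      then have j: "j < CARD('d2)" using y(2) by linarith
      have "L (\<lambda>k. if k = j then X else 0) = (\<Sum>k<CARD('d2). if k = j then y else 0)"
        unfolding L_def y(1) by (intro sum.cong) auto
      also have "\<dots> = y" using j by simp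
      finally show "y \<in> range L" by (metis rangeI)
    qed
    show "vec.subspace (range L)"
    proof (rule vec.subspaceI)
      have "L (\<lambda>_. 0) = 0" by (simp add: L_def)
      then show "0 \<in> range L" by (metis rangeI)
      fix x y assume "x \<in> range L" "y \<in> range L"
      then obtain r s where "x = L r" "y = L s" by blast
      then have "x + y = L (\<lambda>j. r j + s j)" by (simp add: L_def matrix_vector_right_distrib sum.distrib)
      then show "x + y \<in> range L" by blast
    next
      fix c x assume "x \<in> range L"
      then obtain r where "x = L r" by blast
      then have "c *s x = L (\<lambda>j. c *s r j)" by (simp add: L_def vec.scale_sum_right vector_scalar_commute)
      then show "c *s x \<in> range L" by blast
    qed
  qed
  then have "\<forall>y. \<exists>r. y = L r" using assms unfolding kalman_condition_def by (metis UNIV_I rangeE subset_antisym subset_UNIV)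
  then obtain r where r: "\<And>y. y = L (r y)" by metis
  define R where "R j = (\<chi> a i. r (axis i 1) j $ a)" for j
  have R: "R j *v x = (\<Sum>i\<in>UNIV. x $ i *s r (axis i 1) j)" for j x
    by (simp add: R_def vec_eq_iff matrix_vector_mult_def mult.commute)
  have mvs: "M *v (\<Sum>i\<in>UNIV. x $ i *s f i) = (\<Sum>i\<in>UNIV. x $ i *s (M *v f i))" for M :: "complex^'j^'k" and x :: "complex^'d2" and f
    by (simp add: linear_sum[OF bounded_linear.linear[OF bounded_linear_matrix_vector]] vector_scalar_commute)
  have "(\<Sum>j<CARD('d2). matpow (cmat K22) j *v (cmat K21 *v (R j *v x))) = x" for x
  proof -
    have "(\<Sum>j<CARD('d2). matpow (cmat K22) j *v (cmat K21 *v (R j *v x)))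
      = (\<Sum>j<CARD('d2). \<Sum>i\<in>UNIV. x $ i *s (matpow (cmat K22) j *v (cmat K21 *v r (axis i 1) j)))"
      unfolding R mvs ..
    also have "\<dots> = (\<Sum>i\<in>UNIV. x $ i *s L (r (axis i 1)))"
      unfolding L_def vec.scale_sum_right by (rule sum.swap)
    also have "\<dots> = x" unfolding r[symmetric] by (rule basis_expansion)
    finally show ?thesis .
  qed
  then show thesis by (rule that)
qed

text \<open>The annihilators \<open>A k\<close> decrease, hence two consecutive ones coincide before the dimension is exhausted;
  such an annihilator is invariant under the transpose of \<open>K22\<close>.\<close>

lemma not_kalman_eigenvector:
  fixes K22 :: "real^'d2^'d2" and K21 :: "real^'d1^'d2"
  assumes "\<not> kalman_condition K22 K21"
  obtains b l where "b \<noteq> 0" "\<And>v. pr b (cmat K22 *v v) = l * pr b v" "\<And>x. pr b (cmat K21 *v x) = 0"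
proof -
  define A where "A k = {b :: complex^'d2. \<forall>j<k. \<forall>x. pr b (matpow (cmat K22) j *v (cmat K21 *v x)) = 0}" for k
  let ?d = "CARD('d2)"
  let ?S = "{matpow (cmat K22) j *v (cmat K21 *v X1) | j X1. j \<le> ?d - 1}"
  have sub: "vec.subspace (A k)" for k by (rule vec.subspaceI) (auto simp: A_def)
  have dec: "A (Suc k) \<subseteq> A k" for k by (auto simp: A_def)
  have decm: "A m \<subseteq> A k" if "k \<le> m" for k m using that by (auto simp: A_def)
  obtain v where v: "v \<notin> vec.span ?S" using assms unfolding kalman_condition_def by blast
  obtain ph :: "complex^'d2 \<Rightarrow> complex" where pha: "\<And>x y. ph (x + y) = ph x + ph y" and phs: "\<And>c x. ph (c *s x) = c * ph x"
    and phS: "\<And>e. e \<in> vec.span ?S \<Longrightarrow> ph e = 0" and phv: "ph v = 1"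
    using separating_functional[OF vec.vector_space_axioms vec.subspace_span v] by blast
  define b0 where "b0 = (\<chi> i. ph (axis i 1))"
  have phsum: "ph (sum g I) = (\<Sum>i\<in>I. ph (g i))" for g :: "'d2 \<Rightarrow> _" and I
    by (induction I rule: infinite_finite_induct) (use phs[of 0 0] in \<open>simp_all add: pha\<close>)
  have b0: "pr b0 x = ph x" for x
    using phsum[of "\<lambda>i. x $ i *s axis i 1" UNIV] unfolding basis_expansion phs pr_def b0_def vec_lambda_beta
    by (simp only: mult.commute)
  have b0A: "b0 \<in> A ?d" unfolding A_def mem_Collect_eq b0
  proof (intro allI impI)
    fix j x assume "j < ?d"
    then have "matpow (cmat K22) j *v (cmat K21 *v x) \<in> ?S" by (intro CollectI exI[of _ j] exI[of _ x]) auto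
    then show "ph (matpow (cmat K22) j *v (cmat K21 *v x)) = 0" by (intro phS vec.span_base)
  qed
  have b0n: "b0 \<noteq> 0" using b0[of v] phv by auto
  \<comment> \<open>Each strict inclusion costs a dimension, so \<open>CARD('d2)\<close> of them
    would leave only zero, contradicting the nonzero \<open>b0\<close>.\<close>
  have "(\<exists>j<k. A (Suc j) = A j) \<or> vec.dim (A k) + k \<le> ?d" for k
  proof (induction k)
    case 0
    show ?case using vec.dim_subset_UNIV[of "A 0"] by (simp add: vec.dimension_def card_cart_basis)
  next
    case (Suc k)
    show ?case
    proof (cases "\<exists>j<Suc k. A (Suc j) = A j")
      case False
      then have "A (Suc k) \<subset> A k" using dec[of k] by auto
      then have "vec.dim (A (Suc k)) < vec.dim (A k)"
        by (intro vec.dim_psubset) (simp add: vec.span_eq_iff[THEN iffD2, OF sub])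
      then show ?thesis using Suc False by (auto simp: less_Suc_eq)
    qed blast
  qed
  from this[of ?d] obtain k where k: "k < ?d" "A (Suc k) = A k"
    using b0A b0n by (auto simp: vec.dim_eq_0)
  have "\<exists>l w. w \<in> A k \<and> w \<noteq> 0 \<and> transpose (cmat K22) *v w = l *s w"
  proof (rule eigenvector_exists[OF vec.vector_space_axioms sub])
    show "finite (cart_basis :: (complex^'d2) set)" by (rule finite_cart_basis)
    show "A k \<subseteq> vec.span cart_basis" by simp
    show "transpose (cmat K22) *v (x + y) = transpose (cmat K22) *v x + transpose (cmat K22) *v y" for x y
      by (rule matrix_vector_right_distrib)
    show "transpose (cmat K22) *v (c *s x) = c *s (transpose (cmat K22) *v x)" for c x
      by (rule vector_scalar_commute)
    show "b0 \<in> A k" using b0A decm[of k ?d] k(1) by auto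
    show "transpose (cmat K22) *v x \<in> A k" if "x \<in> A k" for x
    proof -
      have "pr x (matpow (cmat K22) (Suc j) *v (cmat K21 *v y)) = 0" if "j < k" for j y
      proof -
        have "x \<in> A (Suc k)" using \<open>x \<in> A k\<close> k(2) by simp
        then show ?thesis unfolding A_def mem_Collect_eq using that by blast
      qed
      then show ?thesis unfolding A_def mem_Collect_eq pr_transpose by (simp add: matrix_vector_mul_assoc matrix_mul_assoc)
    qed
  qed (rule b0n)
  then obtain l w where w: "w \<in> A k" "w \<noteq> 0" "transpose (cmat K22) *v w = l *s w" by blast
  show thesis
  proof (rule that[OF w(2)])
    show "pr w (cmat K22 *v v) = l * pr w v" for v
      using pr_transpose[of "cmat K22" w v] unfolding w(3) by simp
    have "w \<in> A (Suc k)" using w(1) k(2) by simp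
    then have "pr w (matpow (cmat K22) 0 *v (cmat K21 *v x)) = 0" for x unfolding A_def by blast
    then show "pr w (cmat K21 *v x) = 0" for x by simp
  qed
qed

abbreviation sys_symbol where
  "sys_symbol A' A12 K11 K12 K21 K22 \<equiv> symbol diffusion_matrix (transport_matrix A' A12) (block_matrix K11 K12 K21 K22)"

lemma symbol_block:
  "sys_symbol A' A12 K11 K12 K21 K22 n = block_matrix (mat (\<i> * of_int n) ** cmat A' + cmat K11)
    (mat (\<i> * of_int n) ** cmat A12 + cmat K12) (cmat K21) (mat (of_real ((of_int n)\<^sup>2)) + cmat K22)"
proof -
  have m: "(mat c ** M) $ i $ j = c * M $ i $ j" for c and M :: "complex^'x^'y" and i j
    by (simp add: matrix_matrix_mult_def mat_def if_distrib[where f="\<lambda>a. a * b" for b] cong: if_cong)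
  show ?thesis
    unfolding vec_eq_iff
    by (auto simp: symbol_def diffusion_matrix_def transport_matrix_def block_matrix_def m split: sum.splits)
      (simp_all add: mat_def)
qed

lemma symbol_mult:
  "sys_symbol A' A12 K11 K12 K21 K22 n *v c =
    join ((\<i> * of_int n) *s (cmat A' *v part1 c) + cmat K11 *v part1 c + (\<i> * of_int n) *s (cmat A12 *v part2 c) + cmat K12 *v part2 c)
      (cmat K21 *v part1 c + of_real ((of_int n)\<^sup>2) *s part2 c + cmat K22 *v part2 c)"
  unfolding symbol_block block_matrix_mult matrix_vector_mult_add_rdistrib matrix_vector_mul_assoc[symmetric] mat_mult_vec
  by (simp add: add.assoc)

lemma semigroup_multiplier_flow: "semigroup_multiplier B A K t n *v v = flow (symbol B A K n) t v"
  by (simp add: semigroup_multiplier_def flow_def)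

lemma null_controllable_imp_kalman:
  fixes A' K11 :: "real^'d1^'d1" and K22 :: "real^'d2^'d2"
  assumes nc: "null_controllable A' A12 K11 K12 K21 K22 \<omega> T" and T: "0 \<le> T"
  shows "kalman_condition K22 K21"
proof (rule ccontr)
  assume "\<not> kalman_condition K22 K21"
  then obtain b l where b: "b \<noteq> 0" "\<And>v. pr b (cmat K22 *v v) = l * pr b v" "\<And>x. pr b (cmat K21 *v x) = 0"
    by (rule not_kalman_eigenvector) blast
  let ?M = "sys_symbol A' A12 K11 K12 K21 K22 0"
  \<comment> \<open>At \<open>n = 0\<close> transport and diffusion drop out, and the row
    \<open>(0, b)\<close> meets only \<open>K21\<close> and \<open>K22\<close>; so it is a left
    eigenvector of the whole symbol.\<close>
  define p :: "complex^('d1 + 'd2)" where "p = join 0 b"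
  have pv: "pr p v = pr b (part2 v)" for v using pr_join[of p "part1 v" "part2 v"] by (simp add: p_def)
  have pM: "pr p (?M *v v) = l * pr p v" for v
    unfolding symbol_mult pv by (simp add: b)
  \<comment> \<open>The conjugate of \<open>b\<close>, so that the bilinear pairing gives
    \<open>|b|^2\<close>.\<close>
  define v :: "complex^('d1 + 'd2)" where "v = join 0 (\<chi> i. cnj (b $ i))"
  have pn: "pr p v \<noteq> 0"
  proof -
    have "pr p v = of_real (\<Sum>i\<in>UNIV. (cmod (b $ i))\<^sup>2)"
      unfolding pv by (simp add: v_def pr_def complex_norm_square del: of_real_power)
    moreover have "(\<Sum>i\<in>UNIV. (cmod (b $ i))\<^sup>2) \<noteq> 0" using b(1) by (simp add: sum_nonneg_eq_0_iff vec_eq_iff)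
    ultimately show ?thesis by (simp only: of_real_eq_0_iff) blast
  qed
  define f0 where "f0 = trig {0} (\<lambda>_. v)"
  have "f0 \<in> L2 torus_measure" unfolding f0_def L2_iff_L2b by (rule L2b_trig_ex)
  then obtain u f where ms: "mild_solution diffusion_matrix (transport_matrix A' A12) (block_matrix K11 K12 K21 K22) \<omega> T f0 u f"
    and z: "AE x in torus_measure. f T x = 0"
    using nc unfolding null_controllable_def by blast
  have "AE x in torus_measure. cis (- (of_int 0 * x)) *s f T x = 0" using z by eventually_elim simp
  then have "fourier_coeff (f T) 0 = 0" unfolding fourier_coeff_def by (subst integral_eq_zero_AE) auto
  then have e: "0 = flow ?M T v + (LINT \<tau>:{0..T}|lborel. flow ?M (T - \<tau>) (fourier_coeff (control_term \<omega> u \<tau>) 0))"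
    using ms T fourier_coeff_trig[of "{0}" "\<lambda>_. v" 0] unfolding mild_solution_def by (auto simp: semigroup_multiplier_flow f0_def)
  have pc: "pr p (fourier_coeff (control_term \<omega> u \<tau>) 0) = 0" for \<tau>
  proof -
    let ?F = "\<lambda>x. cis (- (of_int 0 * x)) *s control_term \<omega> u \<tau> x :: complex^('d1 + 'd2)"
    have "fourier_coeff (control_term \<omega> u \<tau> :: real \<Rightarrow> complex^('d1 + 'd2)) 0 $ Inr j = 0" for j
    proof (cases "integrable torus_measure ?F")
      case True
      have "(LINT x|torus_measure. ?F x) $ Inr j = (LINT x|torus_measure. ?F x $ Inr j)"
        by (rule integral_bounded_linear[OF bounded_linear_vec_nth True, symmetric])
      then show ?thesis unfolding fourier_coeff_def by (simp add: control_term_def)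
    next
      \<comment> \<open>A non-integrable function has integral 0 by convention, which agrees with
        the claim.\<close>
      case False
      then show ?thesis unfolding fourier_coeff_def not_integrable_integral_eq[OF False] by simp
    qed
    then have "part2 (fourier_coeff (control_term \<omega> u \<tau> :: real \<Rightarrow> complex^('d1 + 'd2)) 0) = 0" by (simp add: part2_def vec_eq_iff)
    then show ?thesis by (simp add: pv)
  qed
  have "pr p (LINT \<tau>:{0..T}|lborel. flow ?M (T - \<tau>) (fourier_coeff (control_term \<omega> u \<tau>) 0)) = 0"
    (is "pr p (LINT \<tau>:_|_. ?g \<tau>) = 0")
  proof (cases "set_integrable lborel {0..T} ?g")
    case True
    have "pr p (LINT \<tau>:{0..T}|lborel. ?g \<tau>) = (LINT \<tau>|lborel. pr p (indicator {0..T} \<tau> *\<^sub>R ?g \<tau>))"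
      unfolding set_lebesgue_integral_def
      by (rule integral_bounded_linear[OF bounded_linear_pr True[unfolded set_integrable_def], symmetric])
    also have "\<dots> = (LINT \<tau>|(lborel :: real measure). 0)"
      by (rule Bochner_Integration.integral_cong[OF refl]) (simp add: linear_scale[OF bounded_linear.linear[OF bounded_linear_pr]] pr_flow[OF pM] pc)
    finally show ?thesis by simp
  next
    case False
    then show ?thesis unfolding set_lebesgue_integral_def set_integrable_def by (simp add: not_integrable_integral_eq)
  qed
  then have "pr p 0 = exp (- l * of_real T) * pr p v"
    unfolding e pr_simps(1) by (simp add: pr_flow[OF pM])
  then show False using pn by simp
qed

section \<open>Mild solutions\<close>

lemma l2b_finite_support:
  assumes "\<And>n. int m < \<bar>n\<bar> \<Longrightarrow> x n = 0"
  shows "l2b x (\<Sum>n\<in>{- int m..int m}. norm (x n))"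
  unfolding l2b_def
proof (intro allI impI)
  fix F :: "int set" assume F: "finite F"
  have "L2_set (\<lambda>n. norm (x n)) F \<le> (\<Sum>n\<in>F. norm (x n))" by (rule L2_set_le_sum) simp
  also have "\<dots> = (\<Sum>n\<in>F \<inter> {- int m..int m}. norm (x n))"
  proof (rule sum.mono_neutral_right)
    show "\<forall>n\<in>F - F \<inter> {- int m..int m}. norm (x n) = 0"
    proof
      fix n assume "n \<in> F - F \<inter> {- int m..int m}"
      then have "int m < \<bar>n\<bar>" by auto
      then show "norm (x n) = 0" using assms by simp
    qed
  qed (use F in auto)
  also have "\<dots> \<le> (\<Sum>n\<in>{- int m..int m}. norm (x n))" by (intro sum_mono2) auto
  finally show "L2_set (\<lambda>n. norm (x n)) F \<le> (\<Sum>n\<in>{- int m..int m}. norm (x n))" .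
qed

text \<open>The bound \<open>a n\<close> on the \<open>n\<close>-th coefficient is uniform in time, so that continuity in \<open>L\<^sup>2\<close> reduces to
  continuity of each coefficient.\<close>

lemma duhamel_path:
  fixes G :: "int \<Rightarrow> complex^'k^'k"
  assumes U: "ctl \<omega> 0 T A U" and T: "0 \<le> T" and g: "l2b g Gb"
    and bd: "\<And>n t v. 0 \<le> t \<Longrightarrow> t \<le> T \<Longrightarrow> norm (flow (G n) t v) \<le> Cb * norm v" and Cb: "0 \<le> Cb"
    and c: "\<And>t n. c t n = flow (G n) t (g n) + (LINT \<tau>:{0..t}|lborel. flow (G n) (t - \<tau>) (uhat U \<tau> n))"
  obtains a :: "int \<Rightarrow> real" and Ab where "l2b a Ab" "\<And>t n. t \<in> {0..T} \<Longrightarrow> norm (c t n) \<le> norm (a n)"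
    "\<And>n. continuous_on {0..T} (\<lambda>t. c t n)"
proof -
  define h where "h n = (LINT \<tau>|lborel. norm (uhat U \<tau> n))" for n
  have kb: "integrable lborel (\<lambda>\<tau>. norm (uhat U \<tau> n))" "l2b h (1 * sqrt (T - 0) * A)" for n
    unfolding h_def
    by (rule kernel_bound[OF ctlD(1)[OF U] T, of 1 "\<lambda>n t. norm (uhat U t n)"]; use uhat_measurable[OF ctlD(2)[OF U]] ctlD(4)[OF U] in \<open>auto intro!: uhat_eq_0\<close>)+
  define a where "a n = Cb * norm (g n) + Cb * h n" for n
  have "l2b (\<lambda>n. Cb * norm (g n)) (Cb * Gb)" by (rule l2b_le[OF g]) (use Cb in \<open>auto simp: abs_mult\<close>)
  moreover have "l2b (\<lambda>n. Cb * h n) (Cb * (1 * sqrt (T - 0) * A))" by (rule l2b_le[OF kb(2)]) (use Cb in \<open>auto simp: abs_mult\<close>)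
  ultimately have a: "l2b a (Cb * Gb + Cb * (1 * sqrt (T - 0) * A))" unfolding a_def[abs_def] by (rule l2b_add)
  have int: "integrable lborel (\<lambda>\<tau>. flow (G n) (t - \<tau>) (uhat U \<tau> n))" for t n
    using mom_integrand[OF U T, of G n t "\<lambda>_. mat 1"] by simp
  have bound: "norm (c t n) \<le> norm (a n)" if t: "t \<in> {0..T}" for t n
  proof -
    have "norm (LINT \<tau>:{0..t}|lborel. flow (G n) (t - \<tau>) (uhat U \<tau> n)) \<le> (LINT \<tau>|lborel. Cb * norm (uhat U \<tau> n))"
      unfolding set_lebesgue_integral_def
    proof (rule Bochner_Integration.integral_norm_bound_integral)
      show "integrable lborel (\<lambda>\<tau>. indicator {0..t} \<tau> *\<^sub>R flow (G n) (t - \<tau>) (uhat U \<tau> n))"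
        by (intro integrable_mult_indicator int) simp
      show "integrable lborel (\<lambda>\<tau>. Cb * norm (uhat U \<tau> n))" using kb(1) by simp
      show "norm (indicator {0..t} \<tau> *\<^sub>R flow (G n) (t - \<tau>) (uhat U \<tau> n)) \<le> Cb * norm (uhat U \<tau> n)" for \<tau>
        using bd[of "t - \<tau>" n "uhat U \<tau> n"] t Cb by (auto simp: indicator_def)
    qed
    then have "norm (c t n) \<le> a n"
      unfolding c a_def h_def using bd[of t n "g n"] t by (intro norm_triangle_le) auto
    then show ?thesis by simp
  qed
  have "continuous_on {0..T} (\<lambda>t. c t n)" for n
  proof -
    let ?q = "\<lambda>\<tau>. flow (G n) (0 - \<tau>) (uhat U \<tau> n)"
    have si: "set_integrable lborel {0..t} ?q" for t
      unfolding set_integrable_def by (intro integrable_mult_indicator int) simp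
    \<comment> \<open>Pulling the flow out leaves an indefinite integral with an integrand that does
      not depend on \<open>t\<close>, from which continuity follows.\<close>
    have eq: "(LINT \<tau>:{0..t}|lborel. flow (G n) (t - \<tau>) (uhat U \<tau> n)) = flow (G n) t (integral {0..t} ?q)" for t
    proof -
      have "flow (G n) t (LINT \<tau>:{0..t}|lborel. ?q \<tau>) = (LINT \<tau>|lborel. flow (G n) t (indicator {0..t} \<tau> *\<^sub>R ?q \<tau>))"
        unfolding set_lebesgue_integral_def
        by (rule integral_bounded_linear[OF bounded_linear_flow si[unfolded set_integrable_def], symmetric])
      also have "\<dots> = (LINT \<tau>:{0..t}|lborel. flow (G n) (t - \<tau>) (uhat U \<tau> n))"
        unfolding set_lebesgue_integral_def
        by (rule Bochner_Integration.integral_cong[OF refl]) (simp add: flow_scaleR_right flow_add_time[symmetric])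
      finally show ?thesis unfolding set_borel_integral_eq_integral(2)[OF si] by simp
    qed
    show ?thesis unfolding c eq
      by (intro continuous_on_add continuous_on_flow continuous_on_flow_comp continuous_on_id
        indefinite_integral_continuous_1 set_borel_integral_eq_integral(1)[OF si])
  qed
  then show thesis using that[OF a bound] by blast
qed

text \<open>Riesz-Fischer realises each \<open>c t\<close>, and a Parseval bound for differences
  transfers smallness from coefficients to functions. The common majorant \<open>a\<close> makes the
  high frequencies small uniformly in \<open>t\<close>; the finitely many others are
  continuous.\<close>

lemma continuous_path_realization:
  fixes c :: "real \<Rightarrow> int \<Rightarrow> complex^'k" and a :: "int \<Rightarrow> real"
  assumes a: "l2b a Ab" and dom: "\<And>t n. t \<in> S \<Longrightarrow> norm (c t n) \<le> norm (a n)"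
    and cont: "\<And>n. continuous_on S (\<lambda>t. c t n)"
  obtains f where "\<And>t. t \<in> S \<Longrightarrow> f t \<in> L2 torus_measure" "\<And>t n. t \<in> S \<Longrightarrow> fourier_coeff (f t) n = c t n"
    "L2_continuous_on S f" "\<And>t. t \<in> S \<Longrightarrow> (\<And>n. c t n = 0) \<Longrightarrow> AE x in torus_measure. f t x = 0"
proof -
  define good where "good t h \<longleftrightarrow> L2b torus_measure h (sqrt (2 * pi) * Ab) \<and> (\<forall>n. fourier_coeff h n = c t n) \<and>
    (\<forall>e>0. \<exists>m0. \<forall>m\<ge>m0. L2b torus_measure (\<lambda>x. h x - trig {-int m..int m} (c t) x) e)" for t and h :: "real \<Rightarrow> complex^'k"
  define f where "f t = (SOME h. good t h)" for t
  have good: "good t (f t)" if t: "t \<in> S" for t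
  proof -
    have "l2b (c t) (1 * Ab)" by (rule l2b_le[OF a]) (use dom t in auto)
    then have "l2b (c t) Ab" by simp
    then obtain h where "good t h" unfolding good_def by (rule riesz_fischer) blast
    then show ?thesis unfolding f_def by (rule someI[where P="good t"])
  qed
  \<comment> \<open>Both functions are limits of their symmetric partial sums, and the difference of
    two partial sums is a trigonometric polynomial whose norm is known from its
    coefficients.\<close>
  have parseval: "L2b torus_measure (\<lambda>x. f s x - f t x) (sqrt (2 * pi) * B)"
    if s: "s \<in> S" and t: "t \<in> S" and B: "l2b (\<lambda>n. c s n - c t n) B" for s t B
  proof (rule L2b_epsilon)
    fix e :: real assume e: "0 < e"
    then have e2: "0 < e / 2" by simp
    obtain m1 where m1: "\<forall>m\<ge>m1. L2b torus_measure (\<lambda>x. f s x - trig {-int m..int m} (c s) x) (e / 2)"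
      using good[OF s] e2 unfolding good_def by blast
    obtain m2 where m2: "\<forall>m\<ge>m2. L2b torus_measure (\<lambda>x. f t x - trig {-int m..int m} (c t) x) (e / 2)"
      using good[OF t] e2 unfolding good_def by blast
    define I where "I = {- int (max m1 m2)..int (max m1 m2)}"
    have "L2b torus_measure (\<lambda>x. f s x - trig I (c s) x) (e / 2)" "L2b torus_measure (\<lambda>x. f t x - trig I (c t) x) (e / 2)"
      unfolding I_def using m1[rule_format, of "max m1 m2"] m2[rule_format, of "max m1 m2"] by simp_all
    note L = L2b_diff[OF this]
    have "L2b torus_measure (trig I (\<lambda>n. c s n - c t n)) (sqrt (2 * pi) * B)"
      by (rule L2b_trig) (use l2bD[OF B] in \<open>auto simp: I_def\<close>)
    from L2b_add[OF L this] show "L2b torus_measure (\<lambda>x. f s x - f t x) (sqrt (2 * pi) * B + e)"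
      by (simp add: trig_diff[symmetric] algebra_simps)
  qed (use l2b_nonneg[OF B] in simp)
  show thesis
  proof (rule that[of f])
    show "f t \<in> L2 torus_measure" if "t \<in> S" for t using good[OF that] unfolding good_def L2_iff_L2b by blast
    show "fourier_coeff (f t) n = c t n" if "t \<in> S" for t n using good[OF that] unfolding good_def by blast
    show "AE x in torus_measure. f t x = 0" if t: "t \<in> S" and z: "\<And>n. c t n = 0" for t
    proof -
      have "L2b torus_measure (f t) 0"
      proof (rule L2b_epsilon)
        fix e :: real assume "0 < e"
        then obtain m0 where "\<forall>m\<ge>m0. L2b torus_measure (\<lambda>x. f t x - trig {-int m..int m} (c t) x) e"
          using good[OF t] unfolding good_def by blast
        then have "L2b torus_measure (\<lambda>x. f t x - trig {-int m0..int m0} (c t) x) e" by simp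
        then show "L2b torus_measure (f t) (0 + e)" by (simp add: trig_def z)
      qed simp
      from L2bD(2,3)[OF this] have m: "f t \<in> borel_measurable torus_measure" and "sqint torus_measure (f t) = 0" by simp_all
      then have "AE x in torus_measure. ennreal ((norm (f t x))\<^sup>2) = 0"
        by (subst (asm) nn_integral_0_iff_AE) auto
      then show ?thesis by eventually_elim simp
    qed
    show "L2_continuous_on S f"
      unfolding L2_continuous_on_def
    proof (rule ballI, rule tendstoI)
      fix t e :: real assume t: "t \<in> S" and e: "0 < e"
      \<comment> \<open>Distance \<open>d\<close> between the coefficient sequences corresponds to
        the squared norm \<open>2 pi d^2 = e / 2\<close> of the functions.\<close>
      define d where "d = sqrt (e / 2) / sqrt (2 * pi)"
      have d: "0 < d" "(sqrt (2 * pi) * d)\<^sup>2 < e" using e by (simp_all add: d_def)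
      obtain m :: nat where m: "l2b (\<lambda>n. if \<bar>n\<bar> \<le> int m then 0 else a n) (d / 4)"
        using l2b_tail[OF a, of "d / 4"] d(1) by auto
      have "((\<lambda>s. \<Sum>n\<in>{- int m..int m}. norm (c s n - c t n)) \<longlongrightarrow> (\<Sum>n\<in>{- int m..int m}. norm (c t n - c t n))) (at t within S)"
        using cont t by (intro tendsto_sum tendsto_norm tendsto_diff tendsto_const) (auto simp: continuous_on_def)
      then have "((\<lambda>s. \<Sum>n\<in>{- int m..int m}. norm (c s n - c t n)) \<longlongrightarrow> 0) (at t within S)" by simp
      then have "\<forall>\<^sub>F s in at t within S. (\<Sum>n\<in>{- int m..int m}. norm (c s n - c t n)) < d / 2"
        by (rule order_tendstoD) (use d in simp)
      moreover have "\<forall>\<^sub>F s in at t within S. s \<in> S" by (simp add: eventually_at_filter)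
      ultimately show "\<forall>\<^sub>F s in at t within S. dist (LINT x|torus_measure. (norm (f s x - f t x))\<^sup>2) 0 < e"
      proof eventually_elim
        case (elim s)
        define lo where "lo n = (if int m < \<bar>n\<bar> then 0 else c s n - c t n)" for n
        define hi where "hi n = (if int m < \<bar>n\<bar> then c s n - c t n else 0)" for n
        have "l2b lo (\<Sum>n\<in>{- int m..int m}. norm (lo n))" by (rule l2b_finite_support) (simp add: lo_def)
        moreover have "(\<Sum>n\<in>{- int m..int m}. norm (lo n)) = (\<Sum>n\<in>{- int m..int m}. norm (c s n - c t n))"
          by (intro sum.cong) (auto simp: lo_def)
        ultimately have lo: "l2b lo (d / 2)" using l2b_mono[of lo] elim(1) by simp
        have "l2b hi (2 * (d / 4))"
        proof (rule l2b_le[OF m])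
          fix n
          have "norm (c s n - c t n) \<le> 2 * norm (a n)"
            using norm_triangle_ineq4[of "c s n" "c t n"] dom[OF elim(2), of n] dom[OF t, of n] by linarith
          then show "norm (hi n) \<le> 2 * norm (if \<bar>n\<bar> \<le> int m then 0 else a n)" by (simp add: hi_def)
        qed simp
        from l2b_add[OF lo this] have "l2b (\<lambda>n. lo n + hi n) d" by simp
        moreover have "(\<lambda>n. lo n + hi n) = (\<lambda>n. c s n - c t n)" by (auto simp: lo_def hi_def)
        ultimately have "L2b torus_measure (\<lambda>x. f s x - f t x) (sqrt (2 * pi) * d)" using parseval[OF elim(2) t] by simp
        from L2b_integral_le[OF this] d(2) show ?case by (simp add: integral_nonneg_AE)
      qed
    qed
  qed
qed

lemma control_in_L2:
  assumes u: "ctl \<omega> a b A u"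
  shows "u \<in> L2 (restrict_space lborel {a<..<b} \<Otimes>\<^sub>M torus_measure)"
proof -
  interpret sigma_finite_measure torus_measure by (rule sigma_finite_torus)
  let ?M = "restrict_space lborel {a<..<b} \<Otimes>\<^sub>M torus_measure"
  have um [measurable]: "u \<in> borel_measurable QM" using ctlD(2)[OF u] .
  have "(\<lambda>z. z) \<in> measurable ?M QM"
  proof -
    have "(\<lambda>z. (fst z, snd z)) \<in> measurable ?M QM"
    proof (rule measurable_Pair[OF measurable_compose[OF measurable_fst] measurable_snd])
      show "(\<lambda>t. t) \<in> measurable (restrict_space lborel {a<..<b}) lborel" by (rule measurable_restrict_space1) simp
    qed
    then show ?thesis by simp
  qed
  from measurable_compose[OF this um] have m [measurable]: "u \<in> borel_measurable ?M" .
  have "sqint ?M u = (\<integral>\<^sup>+t. (sqint torus_measure (\<lambda>x. u (t, x))) \<partial>restrict_space lborel {a<..<b})"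
    by (rule nn_integral_fst[symmetric]) measurable
  also have "\<dots> = (\<integral>\<^sup>+t. (sqint torus_measure (\<lambda>x. u (t, x))) * indicator {a<..<b} t \<partial>lborel)"
    by (rule nn_integral_restrict_space) simp
  also have "\<dots> \<le> (\<integral>\<^sup>+t. (sqint torus_measure (\<lambda>x. u (t, x))) \<partial>lborel)"
    by (intro nn_integral_mono) (auto simp: indicator_def)
  also have "\<dots> = sqint QM u"
    by (rule nn_integral_fst) measurable
  also have "\<dots> \<le> ennreal (A\<^sup>2)" using L2bD(3)[OF ctlD(1)[OF u]] .
  finally have "L2b ?M u A" using m ctlD(3)[OF u] by (simp add: L2b_def)
  then show ?thesis unfolding L2_iff_L2b by blast
qed

section \<open>Return to the original unknowns\<close>

lemma matrix_inv_vector: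
  assumes "invertible (P :: complex^'n^'n)"
  shows "P *v (matrix_inv P *v x) = x" "matrix_inv P *v (P *v x) = x"
proof -
  have "P ** matrix_inv P = mat 1 \<and> matrix_inv P ** P = mat 1"
    using assms unfolding invertible_def matrix_inv_def by (rule someI_ex)
  then show "P *v (matrix_inv P *v x) = x" "matrix_inv P *v (P *v x) = x" by (simp_all add: matrix_vector_mul_assoc)
qed

lemma diagonal_spectrum:
  fixes P D :: "complex^'n^'n"
  assumes P: "invertible P" and D: "\<And>i j. i \<noteq> j \<Longrightarrow> D $ i $ j = 0"
  shows "spectrum (P ** D ** matrix_inv P) = range (\<lambda>i. D $ i $ i)"
proof -
  have Dv: "(D *v w) $ i = D $ i $ i * w $ i" for w i
  proof -
    have "(D *v w) $ i = (\<Sum>j\<in>UNIV. if j = i then D $ i $ i * w $ i else 0)"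
      unfolding matrix_vector_mult_def vec_lambda_beta by (intro sum.cong) (auto simp: D)
    then show ?thesis by simp
  qed
  have Av: "P ** D ** matrix_inv P *v v = P *v (D *v (matrix_inv P *v v))" for v by (simp only: matrix_vector_mul_assoc matrix_mul_assoc)
  show ?thesis
  proof (intro set_eqI iffI)
    fix l assume "l \<in> spectrum (P ** D ** matrix_inv P)"
    then obtain v where v: "v \<noteq> 0" "P *v (D *v (matrix_inv P *v v)) = l *s v" unfolding spectrum_def Av by blast
    define w where "w = matrix_inv P *v v"
    have "w \<noteq> 0" using v(1) matrix_inv_vector(1)[OF P, of v] by (auto simp: w_def)
    then obtain i where i: "w $ i \<noteq> 0" by (auto simp: vec_eq_iff)
    have "D *v w = l *s w"
      using arg_cong[OF v(2), of "\<lambda>z. matrix_inv P *v z"] by (simp add: matrix_inv_vector(2)[OF P] w_def vector_scalar_commute)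
    then have "D $ i $ i * w $ i = l * w $ i" using Dv[of w i] by auto
    then show "l \<in> range (\<lambda>i. D $ i $ i)" using i by auto
  next
    fix l assume "l \<in> range (\<lambda>i. D $ i $ i)"
    then obtain i where l: "l = D $ i $ i" by blast
    define v where "v = P *v axis i 1"
    have iv: "matrix_inv P *v v = axis i 1" by (simp add: v_def matrix_inv_vector(2)[OF P])
    then have "v \<noteq> 0" by auto
    have "D *v axis i 1 = l *s axis i 1" by (simp add: vec_eq_iff Dv l axis_def)
    then have "P *v (D *v (matrix_inv P *v v)) = l *s v" unfolding iv by (simp add: v_def vector_scalar_commute)
    then show "l \<in> spectrum (P ** D ** matrix_inv P)" unfolding spectrum_def Av using \<open>v \<noteq> 0\<close> by blast
  qed
qed

text \<open>The eigenvector basis \<open>P\<close> of \<open>A'\<close> changes only the hyperbolic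
  unknowns and does not depend on the frequency, so the system keeps its form and the support in
  \<omega> is preserved; control and state are carried back by \<open>P\<close>.\<close>

theorem kalman_imp_null_controllable:
  fixes A' K11 :: "real^'d1^'d1" and A12 K12 :: "real^'d2^'d1" and K21 :: "real^'d1^'d2" and K22 :: "real^'d2^'d2"
  assumes diag: "diagonalizable (cmat A')" and sp: "spectrum (cmat A') \<subseteq> \<real>"
    and om: "openin (top_of_set torus) \<omega>" and ne: "\<omega> \<noteq> {}"
    and kal: "kalman_condition K22 K21"
    and fin: "critical_time A' \<omega> < \<infinity>" and T: "critical_time A' \<omega> < ennreal T"
  shows "null_controllable A' A12 K11 K12 K21 K22 \<omega> T"
proof -
  obtain P D :: "complex^'d1^'d1" where P: "invertible P" and D: "\<forall>i j. i \<noteq> j \<longrightarrow> D $ i $ j = 0" and A': "cmat A' = P ** D ** matrix_inv P"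
    using diag unfolding diagonalizable_def by blast
  define Pi where "Pi = matrix_inv P"
  have PPi: "P *v (Pi *v x) = x" and PiP: "Pi *v (P *v x) = x" for x
    unfolding Pi_def by (rule matrix_inv_vector[OF P])+
  have spec: "spectrum (cmat A') = range (\<lambda>i. D $ i $ i)"
    unfolding A' by (rule diagonal_spectrum[OF P]) (use D in blast)
  define mu where "mu i = Re (D $ i $ i)" for i
  have Dmu: "D $ i $ i = of_real (mu i)" for i
  proof -
    have "D $ i $ i \<in> \<real>" using sp spec by blast
    then show ?thesis by (simp add: mu_def)
  qed
  have ms: "0 < min_speed A'" using fin unfolding critical_time_def by (auto split: if_splits)
  have ms_le: "min_speed A' \<le> \<bar>mu i\<bar>" for i
  proof -
    have "cmod (D $ i $ i) \<in> cmod ` spectrum (cmat A')" unfolding spec by blast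
    then have "min_speed A' \<le> cmod (D $ i $ i)" unfolding min_speed_def spec by (intro Min_le) auto
    then show ?thesis by (simp add: Dmu)
  qed
  \<comment> \<open>A time strictly between the critical one and \<open>T\<close> provides the
    margin used by the parabolic controls.\<close>
  obtain r where r: "critical_time A' \<omega> < r" "r < ennreal T" using dense[OF T] by blast
  define T0 where "T0 = enn2real r"
  have "r < top" using r(2) by (rule less_trans) simp
  then have rT: "r = ennreal T0" by (simp add: T0_def)
  have T0: "0 \<le> T0" "T0 < T" using r(2) unfolding rT by (auto simp: T0_def ennreal_less_iff)
  have gap: "max_gap \<omega> < ennreal (\<bar>mu i\<bar> * T0)" for i
  proof -
    have "max_gap \<omega> / ennreal (min_speed A') < ennreal T0" using r(1) ms unfolding rT critical_time_def by simp
    then have "max_gap \<omega> < ennreal T0 * ennreal (min_speed A')" using ms by (subst (asm) divide_less_ennreal) auto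
    also have "\<dots> = ennreal (min_speed A' * T0)" using ms T0 by (simp add: ennreal_mult[symmetric] mult.commute)
    also have "\<dots> \<le> ennreal (\<bar>mu i\<bar> * T0)" using ms_le T0 by (intro ennreal_leI mult_right_mono) auto
    finally show ?thesis .
  qed
  obtain R where R: "\<And>x. (\<Sum>j<CARD('d2). matpow (cmat K22) j *v (cmat K21 *v (R j *v x))) = x"
    by (rule kalman_right_inverse[OF kal]) blast
  interpret hp: hp_control mu "Pi ** (cmat K11 ** P)" "Pi ** cmat A12" "Pi ** cmat K12" "cmat K21 ** P" "cmat K22" \<omega> "CARD('d2)" "\<lambda>j. Pi ** R j" T0
  proof
    show "mu i \<noteq> 0" for i using ms_le[of i] ms by auto
    show "(\<Sum>j<CARD('d2). matpow (cmat K22) j *v (cmat K21 ** P *v (Pi ** R j *v x))) = x" for x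
      unfolding matrix_vector_mul_assoc[symmetric] PPi by (rule R)
  qed (fact om ne T0(1) gap)+
  define sym where "sym = sys_symbol A' A12 K11 K12 K21 K22"
  define Q :: "complex^('d1 + 'd2) \<Rightarrow> complex^('d1 + 'd2)" where "Q c = join (P *v part1 c) (part2 c)" for c
  define Qi :: "complex^('d1 + 'd2) \<Rightarrow> complex^('d1 + 'd2)" where "Qi c = join (Pi *v part1 c) (part2 c)" for c
  have QQi: "Q (Qi c) = c" for c by (simp add: Q_def Qi_def PPi)
  have bl: "bounded_linear (\<lambda>c. join (M *v part1 c) (part2 c) :: complex^('d1 + 'd2))" for M :: "complex^'d1^'d1"
  proof (rule linear_conv_bounded_linear[THEN iffD1], rule linearI)
    fix x y :: "complex^('d1 + 'd2)" and s :: real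
    have p: "part1 (x + y) = part1 x + part1 y" "part2 (x + y) = part2 x + part2 y" "part1 (s *\<^sub>R x) = s *\<^sub>R part1 x" "part2 (s *\<^sub>R x) = s *\<^sub>R part2 x"
      by (simp_all add: part1_def part2_def vec_eq_iff)
    show "join (M *v part1 (x + y)) (part2 (x + y)) = join (M *v part1 x) (part2 x) + join (M *v part1 y) (part2 y)"
      unfolding p by (auto simp: join_def vec_eq_iff matrix_vector_right_distrib split: sum.splits)
    show "join (M *v part1 (s *\<^sub>R x)) (part2 (s *\<^sub>R x)) = s *\<^sub>R join (M *v part1 x) (part2 x)"
      unfolding p mv_scaleR by (auto simp: join_def vec_eq_iff split: sum.splits)
  qed
  have blQ: "bounded_linear Q" unfolding Q_def[abs_def] by (rule bl)
  have nb: "norm (join (M *v part1 c) (part2 c)) \<le> (norm M + 1) * norm c" for M :: "complex^'d1^'d1" and c :: "complex^('d1 + 'd2)"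
    using norm_join_le[of "M *v part1 c" "part2 c"] norm_matrix_vector_mult[of M "part1 c"] norm_parts_le[of c]
      mult_left_mono[OF norm_parts_le(1)[of c], of "norm M"] by (simp add: distrib_right)
  have symQ: "Q (hp.Mn n *v c) = sym n *v Q c" for n c
  proof -
    have Dn: "hp.Dn n *v x = (\<i> * of_int n) *s (D *v x)" for x
    proof (rule vec_eq_iff[THEN iffD2], rule allI)
      fix i
      have "(D *v x) $ i = (\<Sum>j\<in>UNIV. if j = i then D $ i $ i * x $ i else 0)"
        unfolding matrix_vector_mult_def vec_lambda_beta by (intro sum.cong) (use D in auto)
      then show "(hp.Dn n *v x) $ i = ((\<i> * of_int n) *s (D *v x)) $ i" by (simp add: hp.Dn_def Dmu)
    qed
    have AP: "cmat A' *v (P *v x) = P *v (D *v x)" for x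
      unfolding A' Pi_def[symmetric] by (simp only: matrix_vector_mul_assoc[symmetric] PiP)
    show ?thesis
      unfolding sym_def symbol_mult hp.Mn_mult Q_def join_simps hp.M12_def AP
      by (simp add: matrix_vector_mult_add_rdistrib Dn matrix_vector_mul_assoc[symmetric] mat_mult_vec matrix_vector_right_distrib
          vector_scalar_commute PPi smult_of_real add.assoc del: of_real_power flip: smult_of_real)
  qed
  have flowQ: "flow (sym n) t (Q v) = Q (flow (hp.Mn n) t v)" for n t v
    by (rule flow_intertwine[OF blQ symQ, symmetric])
  define Cb where "Cb = (norm P + 1) * (exp (hp.Cg * T) * (norm Pi + 1))"
  have Cb: "0 \<le> Cb" by (simp add: Cb_def)
  have bd: "norm (flow (sym n) t v) \<le> Cb * norm v" if t: "0 \<le> t" "t \<le> T" for n t v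
  proof -
    have "norm (flow (sym n) t v) = norm (Q (flow (hp.Mn n) t (Qi v)))" using flowQ[of n t "Qi v"] by (simp add: QQi)
    also have "\<dots> \<le> (norm P + 1) * norm (flow (hp.Mn n) t (Qi v))" unfolding Q_def by (rule nb)
    also have "\<dots> \<le> (norm P + 1) * (exp (hp.Cg * T) * norm (Qi v))"
    proof (rule mult_left_mono)
      have "exp (hp.Cg * t) * norm (Qi v) \<le> exp (hp.Cg * T) * norm (Qi v)"
        using t hp.Cg_nonneg by (simp add: mult_left_mono mult_right_mono)
      then show "norm (flow (hp.Mn n) t (Qi v)) \<le> exp (hp.Cg * T) * norm (Qi v)"
        using hp.flow_Mn_bound[OF t(1), of n "Qi v"] by linarith
    qed simp
    also have "\<dots> \<le> (norm P + 1) * (exp (hp.Cg * T) * ((norm Pi + 1) * norm v))"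
      unfolding Qi_def by (intro mult_left_mono nb) auto
    finally show ?thesis by (simp add: Cb_def mult.assoc)
  qed
  show ?thesis
    unfolding null_controllable_def
  proof
    fix f0 :: "real \<Rightarrow> complex^('d1 + 'd2)" assume "f0 \<in> L2 torus_measure"
    then obtain af where "L2b torus_measure f0 af" unfolding L2_iff_L2b by blast
    then have g0: "l2b (fourier_coeff f0) (af / sqrt (2 * pi))" by (rule bessel)
    have "l2b (\<lambda>n. Qi (fourier_coeff f0 n)) ((norm Pi + 1) * (af / sqrt (2 * pi)))"
      by (rule l2b_le[OF g0]) (auto simp: Qi_def nb)
    then obtain ut A where ut: "ctl \<omega> 0 T A ut"
      and z: "\<forall>n. flow (hp.Mn n) T (Qi (fourier_coeff f0 n)) + mom hp.Mn (\<lambda>_. hp.emb) T ut n = 0"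
      by (rule hp.null_control[OF T0(2)])
    have T': "0 \<le> T" using T0 by simp
    define u where "u = (\<lambda>z. P *v ut z)"
    have u: "ctl \<omega> 0 T (norm P * A) u"
      unfolding u_def by (rule ctl_matrix[OF ut]) (auto simp: norm_matrix_vector_mult)
    \<comment> \<open>The control as a forcing of the full system in the original unknowns. The
      cutoff in \<open>control_term\<close> changes nothing, because the support already lies in
      \<omega>.\<close>
    define U where "U = (\<lambda>z. (hp.emb ** P) *v ut z)"
    have U: "ctl \<omega> 0 T (norm (hp.emb ** P) * A) U"
      unfolding U_def by (rule ctl_matrix[OF ut]) (auto simp: norm_matrix_vector_mult)
    have ct: "fourier_coeff (control_term \<omega> u \<tau>) n = uhat U \<tau> n" for \<tau> n
    proof -
      have "control_term \<omega> u \<tau> x = U (\<tau>, x)" for x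
        using ctlD(5)[OF u, of x \<tau>]
        by (auto simp: control_term_def U_def u_def hp.emb_mult join_def vec_eq_iff matrix_vector_mul_assoc[symmetric] split: sum.splits)
      then have "control_term \<omega> u \<tau> = (\<lambda>x. U (\<tau>, x))" by (rule ext)
      then show ?thesis by (simp add: uhat_def)
    qed
    define c where "c t n = flow (sym n) t (fourier_coeff f0 n) + (LINT \<tau>:{0..t}|lborel. flow (sym n) (t - \<tau>) (uhat U \<tau> n))" for t n
    obtain a :: "int \<Rightarrow> real" and Ab where a: "l2b a Ab" "\<And>t n. t \<in> {0..T} \<Longrightarrow> norm (c t n) \<le> norm (a n)"
      "\<And>n. continuous_on {0..T} (\<lambda>t. c t n)"
      by (rule duhamel_path[OF U T' g0 bd Cb c_def]) blast+
    obtain f where f: "\<And>t. t \<in> {0..T} \<Longrightarrow> f t \<in> L2 torus_measure" "\<And>t n. t \<in> {0..T} \<Longrightarrow> fourier_coeff (f t) n = c t n"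
      "L2_continuous_on {0..T} f" "\<And>t. t \<in> {0..T} \<Longrightarrow> (\<And>n. c t n = 0) \<Longrightarrow> AE x in torus_measure. f t x = 0"
      by (rule continuous_path_realization[OF a]) blast+
    have cT: "c T n = 0" for n
    proof -
      have "(LINT \<tau>:{0..T}|lborel. flow (sym n) (T - \<tau>) (uhat U \<tau> n)) = mom sym (\<lambda>_. hp.emb ** P) T ut n"
        unfolding mom_def set_lebesgue_integral_def
      proof (rule integral_cong_AE)
        show "(\<lambda>\<tau>. indicator {0..T} \<tau> *\<^sub>R flow (sym n) (T - \<tau>) (uhat U \<tau> n)) \<in> borel_measurable lborel"
          using borel_measurable_flow[OF uhat_measurable[OF ctlD(2)[OF U]]] by (intro borel_measurable_scaleR) auto
        show "(\<lambda>\<tau>. flow (sym n) (T - \<tau>) (hp.emb ** P *v uhat ut \<tau> n)) \<in> borel_measurable lborel"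
          using mom_integrand[OF ut T'] by (rule borel_measurable_integrable)
        show "AE \<tau> in lborel. indicator {0..T} \<tau> *\<^sub>R flow (sym n) (T - \<tau>) (uhat U \<tau> n) = flow (sym n) (T - \<tau>) (hp.emb ** P *v uhat ut \<tau> n)"
          using uhat_matrix_AE[OF ctlD(1)[OF ut], of "\<lambda>_. hp.emb ** P" n]
        proof eventually_elim
          case (elim \<tau>)
          have "uhat ut \<tau> n = 0" if "\<tau> \<notin> {0..T}" using that ctlD(4)[OF ut, of \<tau>] by (intro uhat_eq_0) auto
          then show ?case using elim by (cases "\<tau> \<in> {0..T}") (simp_all add: U_def)
        qed
      qed
      also have "\<dots> = Q (mom hp.Mn (\<lambda>_. hp.emb) T ut n)"
      proof (rule mom_intertwine[OF ut T' blQ, where G=hp.Mn and P=sym and S="\<lambda>_. hp.emb" and S'="\<lambda>_. hp.emb ** P", symmetric])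
        show "Q (hp.Mn n *v v) = sym n *v Q v" for v by (rule symQ)
        show "Q (hp.emb *v w) = hp.emb ** P *v w" for w by (simp add: Q_def hp.emb_mult matrix_vector_mul_assoc[symmetric])
      qed
      finally have "c T n = Q (flow (hp.Mn n) T (Qi (fourier_coeff f0 n))) + Q (mom hp.Mn (\<lambda>_. hp.emb) T ut n)"
        unfolding c_def flowQ[symmetric] QQi by simp
      also have "\<dots> = Q (flow (hp.Mn n) T (Qi (fourier_coeff f0 n)) + mom hp.Mn (\<lambda>_. hp.emb) T ut n)"
        by (rule linear_add[OF bounded_linear.linear[OF blQ], symmetric])
      also have "\<dots> = 0" using z linear_0[OF bounded_linear.linear[OF blQ]] by simp
      finally show ?thesis .
    qed
    show "\<exists>u\<in>L2 (restrict_space lborel {0<..<T} \<Otimes>\<^sub>M torus_measure).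
      (AE (t, x) in restrict_space lborel {0<..<T} \<Otimes>\<^sub>M torus_measure. cis x \<notin> \<omega> \<longrightarrow> u (t, x) = 0) \<and>
      (\<exists>f. mild_solution diffusion_matrix (transport_matrix A' A12) (block_matrix K11 K12 K21 K22) \<omega> T f0 u f \<and>
        (AE x in torus_measure. f T x = 0))"
    proof (intro bexI[of _ u] conjI exI[of _ f])
      show "u \<in> L2 (restrict_space lborel {0<..<T} \<Otimes>\<^sub>M torus_measure)" by (rule control_in_L2[OF u])
      show "AE (t, x) in restrict_space lborel {0<..<T} \<Otimes>\<^sub>M torus_measure. cis x \<notin> \<omega> \<longrightarrow> u (t, x) = 0"
        using ctlD(5)[OF u] by (intro AE_I2) auto
      show "mild_solution diffusion_matrix (transport_matrix A' A12) (block_matrix K11 K12 K21 K22) \<omega> T f0 u f"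
        unfolding mild_solution_def semigroup_multiplier_flow ct
        using f(1-3) by (auto simp: c_def sym_def)
      show "AE x in torus_measure. f T x = 0" using f(4)[of T] T' cT by simp
    qed
  qed
qed

theorem theorem33:
  fixes A' K11 :: "real^'d1^'d1"
    and A12 K12 :: "real^'d2^'d1"
    and K21 :: "real^'d1^'d2"
    and K22 :: "real^'d2^'d2"
    and \<omega> :: "complex set"
  assumes "diagonalizable (cmat A')"
    and "spectrum (cmat A') \<subseteq> \<real>"
    and "openin (top_of_set torus) \<omega>" and "\<omega> \<noteq> {}"
    and "critical_time A' \<omega> < \<infinity>"
  shows "(\<forall>T::real. ennreal T > critical_time A' \<omega> \<longrightarrow>
            null_controllable A' A12 K11 K12 K21 K22 \<omega> T)
         \<longleftrightarrow> kalman_condition K22 K21"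
proof
  assume nc: "\<forall>T::real. ennreal T > critical_time A' \<omega> \<longrightarrow> null_controllable A' A12 K11 K12 K21 K22 \<omega> T"
  \<comment> \<open>One admissible time suffices for necessity, and finiteness of the critical time
    provides it.\<close>
  define T where "T = enn2real (critical_time A' \<omega>) + 1"
  have "critical_time A' \<omega> = ennreal (enn2real (critical_time A' \<omega>))" using assms(5) by simp
  also have "\<dots> < ennreal T" by (simp add: T_def ennreal_less_iff)
  finally have "null_controllable A' A12 K11 K12 K21 K22 \<omega> T" using nc by blast
  then show "kalman_condition K22 K21" by (rule null_controllable_imp_kalman) (simp add: T_def)
next
  assume "kalman_condition K22 K21"
  then show "\<forall>T::real. ennreal T > critical_time A' \<omega> \<longrightarrow> null_controllable A' A12 K11 K12 K21 K22 \<omega> T"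
    using kalman_imp_null_controllable[OF assms(1-4)] assms(5) by blast
qed

end
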